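(* Assume $J(x-y)=L^{-d}\,V\!\left(\tfrac{n}{L}|x-y|\right)$ with $V:\mathbb{R}^+\to\mathbb{R}$ of class $\mathcal{C}^1$ and $V(r)=0$ for $|r|\ge 1$. Let $\epsilon = C\beta\,\frac{q}{L}\,\|\nabla V\|_\infty$, where $C$ is some constant. Then there exists a constant $\delta_0>0$ such that, if $$\delta = Q\,\epsilon<\delta_0 ,$$ the exact coarse-grained Hamiltonian $\bar H_M(\eta)$ can be expanded into a convergent series $$\bar H_M(\eta)=\sum_{p=0}^{\infty}\bar H_M^{(p)}(\eta),$$ where each term $\bar H^{(p)}_M(\eta)$ is a sum of finite-range translation-invariant many-body potentials. The first few terms are $\bar H_M^{(0)}(\eta)=\mathbb{E}[H_N\,|\,\eta]$ and the functions $\bar H_M^{(1)},\bar H_M^{(2)}$ given explicitly in the context. The following error bounds hold uniformly in $\eta$ and $N$: $$\frac{\beta}{N}\Big(\bar H_M(\eta)-\big(\bar H_M^{(0)}(\eta)+\dots+\bar H_M^{(p)}(\eta)\big)\Big)=O(\epsilon^{p+1}).$$ If one defines the Gibbs measures $$\bar\mu^{(p)}_{M,\beta}(d\eta)=\frac{1}{\bar Z_M^{(p)}}\,e^{-\beta\left(\bar H_M^{(0)}(\eta)+\dots+\bar H_M^{(p)}(\eta)\right)}\,\bar P_M(d\eta)$$ (with $\bar Z_M^{(p)}$ the normalizing constant), then the following bounds for the relative entropy per unit volume hold: $$\frac1N\,\mathcal{R}\big(\bar\mu^{(0)}_{M,\beta}\,|\,\mu_{N,\beta}\circ \mathbf{F}^{-1}\big)=O(\epsilon^2),\qquad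 \frac1N\,\mathcal{R}\big(\bar\mu^{(p)}_{M,\beta}\,|\,\mu_{N,\beta}\circ \mathbf{F}^{-1}\big)=O(\epsilon^{p+1}),\quad p=2,3,\dots$$
   Context: **Microscopic model.** $\mathbb{T}_d=[0,1)^d$ is the torus with periodic boundary conditions, $\Lambda_N=(\frac1n\mathbb{Z})^d\cap\mathbb{T}_d$, $N=n^d$, and $\mathcal{S}_N=\{+1,-1\}^{\Lambda_N}$. The Hamiltonian is $$H_N(\sigma)=-\tfrac12\sum_{x\in\Lambda_N}\sum_{y\ne x}J(x-y)\sigma(x)\sigma(y)+\sum_{x\in\Lambda_N}h(x)\sigma(x),$$ where $J$ is the two-body potential, $h$ is an external field, and $L$ is the interaction range (in lattice units). The prior $P_N$ on $\mathcal{S}_N$ is the product measure under which each $\sigma(x)=\pm1$ with probability $\frac12$. With $\beta$ the inverse temperature, the Gibbs measure is $\mu_{N,\beta}(d\sigma)=Z_N^{-1}e^{-\beta H_N(\sigma)}P_N(d\sigma)$. **Coarse graining.** Let $n=mq$, $M=m^d$, $Q=q^d$, so $N=MQ$. $\mathbb{T}_d$ is partitioned into the $M$ cells $C_k=\prod_{i=1}^d[\frac{k_i}{m},\frac{k_i+1}{m})$, $0\le k_i\le m-1$; each contains $Q$ points of $\Lambda_N$. The set of cells is identified with the coarse lattice $\bar\Lambda_M=(\frac1m\mathbb{Z})^d\cap\mathbb{T}_d$. The map $\mathbf{F}:\mathcal{S}_N\to\bar{\mathcal{S}}_M=\{-Q,-Q+2,\dots,Q\}^{\bar\Lambda_M}$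 is $\mathbf{F}(\sigma)=\eta$, $\eta(k)=\sum_{x\in C_k}\sigma(x)$ (here and below sums over $x\in C_k$ run over the lattice points $x\in C_k\cap\Lambda_N$). $\bar P_M=P_N\circ\mathbf{F}^{-1}$, and $\mathbb{E}[f|\eta]$ is the conditional expectation of $f(\sigma)$ under $P_N$ given $\mathbf{F}(\sigma)=\eta$. The exact coarse-grained Hamiltonian $\bar H_M$ is defined by $e^{-\beta\bar H_M(\eta)}=\mathbb{E}[e^{-\beta H_N}|\eta]$. A sum of many-body potentials is a function of the form $\sum_{X\subset\bar\Lambda_M}\mathcal{J}(X,\{\eta(k)\}_{k\in X})$. **Relative entropy.** $\mathcal{R}(\pi_1|\pi_2)=\sum_{s}\pi_1(s)\log\frac{\pi_1(s)}{\pi_2(s)}$. **Explicit first terms.** Fix a total order (e.g. lexicographic) on $\bar\Lambda_M$. Put $$\bar J(k,l)=\tfrac{1}{Q^2}\sum_{x\in C_k,\,y\in C_l}J(x-y)\ (k\ne l),\qquad \bar J(k,k)=\tfrac{1}{Q(Q-1)}\sum_{x,y\in C_k,\,x\ne y}J(x-y).$$ Let $$j^1_{kl}=\sum_{x\in C_k,\,y\in C_l}(J(x-y)-\bar J(k,l))^2,\quad j^2_{kl}=\sum_{x\in C_k,\;y,y'\in C_l}(J(x-y)-\bar J(k,l))(J(x-y')-\bar J(k,l)),$$ $$j^2_{k_1k_2k_3}=\sum_{x\in C_{k_1},\,y\in C_{k_2},\,z\in C_{k_3}}(J(x-y)-\bar J(k_1,k_2))(J(y-z)-\bar J(k_2,k_3)),$$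 where, whenever the two points in a factor $J(\cdot-\cdot)$ range over the same cell, they are required to be distinct. Let $\alpha(k)=\frac{\eta(k)+Q}{2}$ be the number of $+1$ spins in $C_k$, and for $i=1,2,3,4$ let $E_i(\alpha)$ be the conditional expectation of the product of the spins at $i$ distinct sites of a cell given that exactly $\alpha$ of its $Q$ spins are $+1$; i.e., with $\omega=Q-\alpha$, $$E_1(\alpha)=\frac{2\alpha-Q}{Q},\qquad E_2(\alpha)=\frac{\alpha(\alpha-1)-2\alpha\omega+\omega(\omega-1)}{Q(Q-1)},$$ $$E_3(\alpha)=\frac{\alpha(\alpha-1)(\alpha-2)-3\alpha(\alpha-1)\omega+3\alpha(\omega-1)\omega-(\omega-2)(\omega-1)\omega}{Q(Q-1)(Q-2)},$$ $$\begin{aligned}E_4(\alpha)={}&\frac{\alpha(\alpha-1)(\alpha-2)(\alpha-3)-4\alpha(\alpha-1)(\alpha-2)\omega}{Q(Q-1)(Q-2)(Q-3)}\\&+\frac{6\alpha(\alpha-1)(\omega-1)\omega-4\alpha(\omega-2)(\omega-1)\omega+\omega(\omega-1)(\omega-2)(\omega-3)}{Q(Q-1)(Q-2)(Q-3)}.\end{aligned}$$ Writing $E_i(k)$ for $E_i(\alpha(k))$, $$\begin{aligned}-\bar H_M^{(1)}(\eta)={}&\frac{\beta}{8}\sum_k\Big(4j^2_{kk}[-E_4(k)+E_2(k)]+2j^1_{kk}[E_4(k)+1-2E_2(k)]\Big)\\&+\frac{\beta}{2}\sum_{k<l}\Big(j^1_{kl}[E_2(k)E_2(l)-E_2(l)-E_2(k)+1]+j^2_{kl}[-2E_2(k)E_2(l)+E_2(k)+E_2(l)]\Big)\\&+\frac{\beta}{2}\sum_{k}\sum_{l\ne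 k}j^2_{kkl}[-E_3(k)E_1(l)+2E_1(k)E_1(l)-E_3(l)E_1(k)],\end{aligned}$$ $$\begin{aligned}\bar H_M^{(2)}(\eta)=\beta\sum_{k_1}\sum_{k_2>k_1}\sum_{k_3>k_2}\Big(&j^2_{k_1k_2k_3}[-E_1(k_1)E_2(k_2)E_1(k_3)+E_1(k_1)E_1(k_3)]\\&+j^2_{k_2k_3k_1}[-E_1(k_2)E_2(k_3)E_1(k_1)+E_1(k_2)E_1(k_1)]\\&+j^2_{k_3k_1k_2}[-E_1(k_3)E_2(k_1)E_1(k_2)+E_1(k_3)E_1(k_2)]\Big).\end{aligned}$$
   Formalization: The external field h is assumed constant on each cell, and translation invariance of the p=0 term is claimed only for constant h (both fail otherwise, e.g. V=0); the formula for H^(2) carries the opposite overall sign, since with the printed sign the p=2 error bound fails. *)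

theory Defs
  imports "HOL-Probability.Probability"
begin

section \<open>Microscopic model\<close>

definition torus_lattice :: "nat \<Rightarrow> (real ^ 'd::finite) set" where
  "torus_lattice n = {x. \<forall>i. \<exists>j<n. x $ i = real j / real n}"

text \<open>Periodic distance of a displacement \<open>v\<close>: the Euclidean norm of its shortest representative
  modulo the integer lattice.\<close>
definition torus_norm :: "real ^ 'd::finite \<Rightarrow> real" where
  "torus_norm v = infdist v {z. \<forall>i. z $ i \<in> \<int>}"

definition kac_potential :: "nat \<Rightarrow> real \<Rightarrow> (real \<Rightarrow> real) \<Rightarrow> real ^ 'd::finite \<Rightarrow> real" where
  "kac_potential n L V v = V (real n / L * torus_norm v) / L ^ CARD('d)"

definition hamiltonian ::
  "nat \<Rightarrow> (real ^ 'd::finite \<Rightarrow> real) \<Rightarrow> (real ^ 'd \<Rightarrow> real) \<Rightarrow> (real ^ 'd \<Rightarrow> real) \<Rightarrow> real" where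
  "hamiltonian n J h \<sigma> =
     - (1/2) * (\<Sum>x\<in>torus_lattice n. \<Sum>y\<in>torus_lattice n - {x}. J (x - y) * \<sigma> x * \<sigma> y)
     + (\<Sum>x\<in>torus_lattice n. h x * \<sigma> x)"

text \<open>Spin configurations are extensional functions on the lattice: the law below is concentrated on
  \<open>torus_lattice n \<rightarrow>\<^sub>E {1, -1}\<close>.\<close>
definition prior :: "nat \<Rightarrow> (real ^ 'd::finite \<Rightarrow> real) pmf" where
  "prior n = Pi_pmf (torus_lattice n) undefined (\<lambda>_. pmf_of_set {1, -1})"

definition gibbs :: "'s pmf \<Rightarrow> real \<Rightarrow> ('s \<Rightarrow> real) \<Rightarrow> 's pmf" where
  "gibbs P \<beta> H =
     embed_pmf (\<lambda>s. exp (- \<beta> * H s) * pmf P s / measure_pmf.expectation P (\<lambda>s. exp (- \<beta> * H s)))"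

text \<open>For finite state spaces the normalised weights do form a probability mass function, so
  \<open>gibbs\<close> is what it should be.\<close>
lemma pmf_gibbs:
  assumes fin: "finite (set_pmf P)"
  shows "pmf (gibbs P \<beta> H) s =
           exp (- \<beta> * H s) * pmf P s / measure_pmf.expectation P (\<lambda>s. exp (- \<beta> * H s))"
proof -
  let ?Z = "measure_pmf.expectation P (\<lambda>s. exp (- \<beta> * H s))"
  let ?f = "\<lambda>s. exp (- \<beta> * H s) * pmf P s / ?Z"
  have Z: "?Z = (\<Sum>s\<in>set_pmf P. exp (- \<beta> * H s) * pmf P s)"
    by (rule integral_measure_pmf_real) (use fin in auto)
  have Zpos: "?Z > 0"
    unfolding Z using fin set_pmf_not_empty by (intro sum_pos) (auto intro!: mult_pos_pos simp: pmf_positive)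
  have nn: "?f s \<ge> 0" for s
    using Zpos by (simp add: divide_nonneg_pos)
  have "(\<integral>\<^sup>+s. ennreal (?f s) \<partial>count_space UNIV) = (\<integral>\<^sup>+s. ennreal (?f s) \<partial>count_space (set_pmf P))"
    by (rule nn_integral_count_space_eq) (auto simp: set_pmf_iff)
  also have "\<dots> = (\<Sum>s\<in>set_pmf P. ennreal (?f s))"
    using fin by (rule nn_integral_count_space_finite)
  also have "\<dots> = ennreal (\<Sum>s\<in>set_pmf P. ?f s)"
    by (rule sum_ennreal) (use nn in auto)
  also have "(\<Sum>s\<in>set_pmf P. ?f s) = 1"
    using Z Zpos by (simp flip: sum_divide_distrib)
  finally show ?thesis
    unfolding gibbs_def by (subst pmf_embed_pmf) (use nn in auto)
qed

definition rel_entropy :: "'s pmf \<Rightarrow> 's pmf \<Rightarrow> real" where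
  "rel_entropy \<pi>1 \<pi>2 = (\<Sum>s\<in>set_pmf \<pi>1. pmf \<pi>1 s * ln (pmf \<pi>1 s / pmf \<pi>2 s))"


section \<open>Coarse graining\<close>

text \<open>Throughout, the microscopic lattice is \<open>torus_lattice (m * q)\<close>, and a cell is named by its
  lower corner, a point of the coarse lattice \<open>torus_lattice m\<close>.\<close>

definition cell :: "nat \<Rightarrow> nat \<Rightarrow> real ^ 'd::finite \<Rightarrow> (real ^ 'd) set" where
  "cell m q k = {x \<in> torus_lattice (m * q). \<forall>i. k $ i \<le> x $ i \<and> x $ i < k $ i + 1 / real m}"

definition coarse_configs :: "nat \<Rightarrow> nat \<Rightarrow> (real ^ 'd::finite \<Rightarrow> real) set" where
  "coarse_configs m q =
     torus_lattice m \<rightarrow>\<^sub>E {2 * real j - real (q ^ CARD('d)) | j. j \<le> q ^ CARD('d)}"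

definition block_spin :: "nat \<Rightarrow> nat \<Rightarrow> (real ^ 'd::finite \<Rightarrow> real) \<Rightarrow> real ^ 'd \<Rightarrow> real" where
  "block_spin m q \<sigma> = (\<lambda>k\<in>torus_lattice m. \<Sum>x\<in>cell m q k. \<sigma> x)"

definition coarse_prior :: "nat \<Rightarrow> nat \<Rightarrow> (real ^ 'd::finite \<Rightarrow> real) pmf" where
  "coarse_prior m q = map_pmf (block_spin m q) (prior (m * q))"

definition cond_expect ::
  "nat \<Rightarrow> nat \<Rightarrow> ((real ^ 'd::finite \<Rightarrow> real) \<Rightarrow> real) \<Rightarrow> (real ^ 'd \<Rightarrow> real) \<Rightarrow> real" where
  "cond_expect m q f \<eta> =
     measure_pmf.expectation (cond_pmf (prior (m * q)) {\<sigma>. block_spin m q \<sigma> = \<eta>}) f"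

text \<open>The solution of \<open>exp (- \<beta> * H\<eta>) = cond_expect m q (\<lambda>\<sigma>. exp (- \<beta> * H \<sigma>)) \<eta>\<close>.\<close>
definition coarse_hamiltonian ::
  "nat \<Rightarrow> nat \<Rightarrow> real \<Rightarrow> ((real ^ 'd::finite \<Rightarrow> real) \<Rightarrow> real) \<Rightarrow> (real ^ 'd \<Rightarrow> real) \<Rightarrow> real" where
  "coarse_hamiltonian m q \<beta> H \<eta> = - ln (cond_expect m q (\<lambda>\<sigma>. exp (- \<beta> * H \<sigma>)) \<eta>) / \<beta>"


section \<open>Many-body potentials on the coarse lattice\<close>

text \<open>A family of potentials is a function \<open>\<Phi> X \<xi>\<close> of a set of cells and of a configuration on these cells;
  it is always evaluated at \<open>\<xi> = restrict \<eta> X\<close>, so \<open>\<Phi> X\<close> sees only the values \<open>\<eta> k\<close> with \<open>k \<in> X\<close>.\<close>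
type_synonym 'd potential = "(real ^ 'd) set \<Rightarrow> (real ^ 'd \<Rightarrow> real) \<Rightarrow> real"

definition potential_sum :: "nat \<Rightarrow> 'd::finite potential \<Rightarrow> (real ^ 'd \<Rightarrow> real) \<Rightarrow> real" where
  "potential_sum m \<Phi> \<eta> = (\<Sum>X\<in>Pow (torus_lattice m). \<Phi> X (restrict \<eta> X))"

definition finite_range :: "nat \<Rightarrow> nat \<Rightarrow> real \<Rightarrow> 'd::finite potential \<Rightarrow> bool" where
  "finite_range m q r \<Phi> \<longleftrightarrow>
     (\<forall>X\<subseteq>torus_lattice m. \<forall>\<eta>\<in>coarse_configs m q.
        (\<exists>k\<in>X. \<exists>l\<in>X. torus_norm (k - l) > r) \<longrightarrow> \<Phi> X (restrict \<eta> X) = 0)"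

definition torus_shift :: "real ^ 'd::finite \<Rightarrow> real ^ 'd \<Rightarrow> real ^ 'd" where
  "torus_shift a k = (\<chi> i. frac (k $ i + a $ i))"

definition translation_invariant :: "nat \<Rightarrow> nat \<Rightarrow> 'd::finite potential \<Rightarrow> bool" where
  "translation_invariant m q \<Phi> \<longleftrightarrow>
     (\<forall>a\<in>torus_lattice m. \<forall>X\<subseteq>torus_lattice m. \<forall>\<eta>\<in>coarse_configs m q.
        \<Phi> (torus_shift a ` X) (restrict \<eta> (torus_shift a ` X))
          = \<Phi> X (restrict (\<eta> \<circ> torus_shift a) X))"


section \<open>The explicit first terms\<close>

definition J_bar ::
  "nat \<Rightarrow> nat \<Rightarrow> (real ^ 'd::finite \<Rightarrow> real) \<Rightarrow> real ^ 'd \<Rightarrow> real ^ 'd \<Rightarrow> real" where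
  "J_bar m q J k l =
     (let Q = real (q ^ CARD('d)) in
      if k = l
      then 1 / (Q * (Q - 1)) * (\<Sum>x\<in>cell m q k. \<Sum>y\<in>cell m q k - {x}. J (x - y))
      else 1 / Q\<^sup>2 * (\<Sum>x\<in>cell m q k. \<Sum>y\<in>cell m q l. J (x - y)))"

text \<open>The two points in a factor \<open>J (x - y)\<close> must be distinct when they lie in the same cell. As
  different cells are disjoint, removing \<open>x\<close> from the range of \<open>y\<close> expresses this in all cases.\<close>

definition j1 ::
  "nat \<Rightarrow> nat \<Rightarrow> (real ^ 'd::finite \<Rightarrow> real) \<Rightarrow> real ^ 'd \<Rightarrow> real ^ 'd \<Rightarrow> real" where
  "j1 m q J k l = (\<Sum>x\<in>cell m q k. \<Sum>y\<in>cell m q l - {x}. (J (x - y) - J_bar m q J k l)\<^sup>2)"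

definition j2 ::
  "nat \<Rightarrow> nat \<Rightarrow> (real ^ 'd::finite \<Rightarrow> real) \<Rightarrow> real ^ 'd \<Rightarrow> real ^ 'd \<Rightarrow> real" where
  "j2 m q J k l =
     (\<Sum>x\<in>cell m q k. \<Sum>y\<in>cell m q l - {x}. \<Sum>y'\<in>cell m q l - {x}.
        (J (x - y) - J_bar m q J k l) * (J (x - y') - J_bar m q J k l))"

definition j2_chain ::
  "nat \<Rightarrow> nat \<Rightarrow> (real ^ 'd::finite \<Rightarrow> real) \<Rightarrow> real ^ 'd \<Rightarrow> real ^ 'd \<Rightarrow> real ^ 'd \<Rightarrow> real" where
  "j2_chain m q J k1 k2 k3 =
     (\<Sum>x\<in>cell m q k1. \<Sum>y\<in>cell m q k2 - {x}. \<Sum>z\<in>cell m q k3 - {y}.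
        (J (x - y) - J_bar m q J k1 k2) * (J (y - z) - J_bar m q J k2 k3))"

text \<open>\<open>E1\<close>, \dots, \<open>E4\<close> as functions of \<open>Q\<close> and of the number \<open>a\<close> of plus spins. For \<open>Q < i\<close> a cell does
  not have \<open>i\<close> distinct sites and \<open>Ei Q a\<close> is the junk value \<open>0\<close>; the coefficients of these terms in
  the formulas below then vanish.\<close>

definition E1 :: "real \<Rightarrow> real \<Rightarrow> real" where
  "E1 Q a = (2 * a - Q) / Q"

definition E2 :: "real \<Rightarrow> real \<Rightarrow> real" where
  "E2 Q a = (let w = Q - a in (a * (a - 1) - 2 * a * w + w * (w - 1)) / (Q * (Q - 1)))"

definition E3 :: "real \<Rightarrow> real \<Rightarrow> real" where
  "E3 Q a = (let w = Q - a in
     (a * (a - 1) * (a - 2) - 3 * a * (a - 1) * w + 3 * a * (w - 1) * w - (w - 2) * (w - 1) * w)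
       / (Q * (Q - 1) * (Q - 2)))"

definition E4 :: "real \<Rightarrow> real \<Rightarrow> real" where
  "E4 Q a = (let w = Q - a in
     (a * (a - 1) * (a - 2) * (a - 3) - 4 * a * (a - 1) * (a - 2) * w)
       / (Q * (Q - 1) * (Q - 2) * (Q - 3))
     + (6 * a * (a - 1) * (w - 1) * w - 4 * a * (w - 2) * (w - 1) * w
         + w * (w - 1) * (w - 2) * (w - 3))
       / (Q * (Q - 1) * (Q - 2) * (Q - 3)))"

text \<open>\<open>r\<close> is a strict total order on the coarse lattice, \<open>(k, l) \<in> r\<close> meaning \<open>k < l\<close>.\<close>

definition H1 ::
  "nat \<Rightarrow> nat \<Rightarrow> (real ^ 'd::finite) rel \<Rightarrow> (real ^ 'd \<Rightarrow> real) \<Rightarrow> real \<Rightarrow> (real ^ 'd \<Rightarrow> real) \<Rightarrow> real" where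
  "H1 m q r J \<beta> \<eta> =
     (let \<Lambda> = torus_lattice m;
          Q = real (q ^ CARD('d));
          a = (\<lambda>k. (\<eta> k + Q) / 2);
          e1 = (\<lambda>k. E1 Q (a k)); e2 = (\<lambda>k. E2 Q (a k));
          e3 = (\<lambda>k. E3 Q (a k)); e4 = (\<lambda>k. E4 Q (a k))
      in - (\<beta> / 8 * (\<Sum>k\<in>\<Lambda>. 4 * j2 m q J k k * (- e4 k + e2 k)
                              + 2 * j1 m q J k k * (e4 k + 1 - 2 * e2 k))
          + \<beta> / 2 * (\<Sum>k\<in>\<Lambda>. \<Sum>l\<in>{l\<in>\<Lambda>. (k, l) \<in> r}.
                j1 m q J k l * (e2 k * e2 l - e2 l - e2 k + 1)
                + j2 m q J k l * (- 2 * e2 k * e2 l + e2 k + e2 l))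
          + \<beta> / 2 * (\<Sum>k\<in>\<Lambda>. \<Sum>l\<in>\<Lambda> - {k}.
                j2_chain m q J k k l * (- e3 k * e1 l + 2 * e1 k * e1 l - e3 l * e1 k))))"

text \<open>The overall minus sign, as in \<open>H1\<close>, comes from the cumulant expansion: with
  \<open>W = cond_expect m q H - H\<close>, the second-order term of \<open>- \<beta> * coarse_hamiltonian\<close> is
  \<open>\<beta>\<^sup>2 / 2 * cond_expect m q (\<lambda>\<sigma>. W\<^sup>2)\<close>. Its part involving three different cells is
  \<open>- \<beta> * H2\<close>, and the rest is \<open>- \<beta> * H1\<close>. (The formula is sometimes displayed without this sign,
  but then the error bound of order three fails.)\<close>
definition H2 ::
  "nat \<Rightarrow> nat \<Rightarrow> (real ^ 'd::finite) rel \<Rightarrow> (real ^ 'd \<Rightarrow> real) \<Rightarrow> real \<Rightarrow> (real ^ 'd \<Rightarrow> real) \<Rightarrow> real" where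
  "H2 m q r J \<beta> \<eta> =
     (let \<Lambda> = torus_lattice m;
          Q = real (q ^ CARD('d));
          a = (\<lambda>k. (\<eta> k + Q) / 2);
          e1 = (\<lambda>k. E1 Q (a k)); e2 = (\<lambda>k. E2 Q (a k))
      in - (\<beta> * (\<Sum>k1\<in>\<Lambda>. \<Sum>k2\<in>{k\<in>\<Lambda>. (k1, k) \<in> r}. \<Sum>k3\<in>{k\<in>\<Lambda>. (k2, k) \<in> r}.
              j2_chain m q J k1 k2 k3 * (- e1 k1 * e2 k2 * e1 k3 + e1 k1 * e1 k3)
              + j2_chain m q J k2 k3 k1 * (- e1 k2 * e2 k3 * e1 k1 + e1 k2 * e1 k1)
              + j2_chain m q J k3 k1 k2 * (- e1 k3 * e2 k1 * e1 k2 + e1 k3 * e1 k2))))"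

end

theory Submission
  imports Defs "HOL-Complex_Analysis.Complex_Analysis"
begin

no_notation fps_nth (infixl "$" 75)

text \<open>The coarse-grained energy is, up to its conditional mean, the logarithm of the partition function of
  a canonical ensemble: spins whose total is prescribed in every cell, with pair couplings of small row
  sums. For complex couplings with row sums at most 1/100 this partition function has no zeros. This is
  proved in the manner of Barvinok, by adding sites one at a time: the induction bounds the
  partition functions with one site pinned to plus or to minus by the unpinned one, comparing two sites of a
  cell by exchanging their spins. Hence the logarithm is analytic in a disc of radius of order 1/\<open>\<epsilon>\<close>, with
  derivative of order \<open>N \<epsilon>\<close>, and Cauchy's estimates make its Taylor series, the cumulant
  series, converge geometrically, uniformly in the cell size and in \<open>\<eta>\<close>.

  The energy is a sum over pairs of cells, so a cumulant is a sum of joint cumulants of pair energies; those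
  vanish unless the pairs involved form a connected cluster, which gives potentials of finite range. The
  second cumulant is evaluated by counting coincidences among the four sites involved and yields the explicit
  first terms. Finally, two Gibbs measures whose energies differ by at most \<open>t\<close> have relative
  entropy at most \<open>2 t\<close>.\<close>

subsection \<open>Zero-freeness of the canonical ensemble\<close>

text \<open>Conditioning on the block spins makes the spins of a cell dependent, and a single flip
  leaves the slice. Moreover the weights of plus and minus at a site compare roughly like the
  numbers of plus and minus sites in its cell, a ratio that can be arbitrarily large or small, so a
  bound on this ratio cannot be carried through an induction. What can be carried is
  \<open>|Z+| + |Z-| <= 2 |Z+ + Z-|\<close>: the two pinned partition functions are close to
  positive multiples of one complex number, however different their sizes.

  The field in \<open>energy\<close> serves this induction: pinning a site turns its row of
  couplings into a field on the remaining sites, and row sum plus field does not grow. Measuring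
  smallness by row sums keeps all bounds independent of the cell size.

  Subtracting the exact block means \<open>J_bar\<close> centres the couplings on each pair of
  cells. Hence the first cumulant vanishes, which leaves the orders one and two of the expansion to
  the two parts of the second cumulant, and in the second cumulant only coincidences of sites
  survive.\<close>

text \<open>Configurations are encoded by the set \<open>P\<close> of their plus sites.\<close>

definition spin :: "'a set \<Rightarrow> 'a \<Rightarrow> 'b::ring_1" where
  "spin P x = (if x \<in> P then 1 else - 1)"

text \<open>These sets carry the conditional prior given the block spins. Sites and occupation
  numbers are both variable because removing a site changes both. The condition concerns every
  \<open>k\<close>, so occupation numbers must be 0 where there is no cell.\<close>

definition slice :: "('a \<Rightarrow> 'c) \<Rightarrow> 'a set \<Rightarrow> ('c \<Rightarrow> nat) \<Rightarrow> 'a set set" where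
  "slice cl S a = {P. P \<subseteq> S \<and> (\<forall>k. card {x\<in>P. cl x = k} = a k)}"

lemma finite_slice: "finite S \<Longrightarrow> finite (slice cl S a)"
  unfolding slice_def by (rule finite_subset[of _ "Pow S"]) auto

lemma slice_plus:
  assumes "finite S" "x \<in> S" "a (cl x) > 0"
  shows "bij_betw (insert x) (slice cl (S - {x}) (a(cl x := a (cl x) - 1))) {P\<in>slice cl S a. x \<in> P}"
proof (rule bij_betw_byWitness[where f' = "\<lambda>P. P - {x}"])
  show "\<forall>P\<in>slice cl (S - {x}) (a(cl x := a (cl x) - 1)). insert x P - {x} = P"
    by (auto simp: slice_def)
  show "\<forall>P\<in>{P \<in> slice cl S a. x \<in> P}. insert x (P - {x}) = P" by auto
  show "insert x ` slice cl (S - {x}) (a(cl x := a (cl x) - 1)) \<subseteq> {P \<in> slice cl S a. x \<in> P}"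
  proof safe
    fix P assume P: "P \<in> slice cl (S - {x}) (a(cl x := a (cl x) - 1))"
    have fin: "finite P" using P assms by (auto simp: slice_def dest: finite_subset)
    have xP: "x \<notin> P" using P by (auto simp: slice_def)
    have "card {y\<in>insert x P. cl y = k} = a k" for k
    proof (cases "k = cl x")
      case True
      have "{y\<in>insert x P. cl y = k} = insert x {y\<in>P. cl y = k}" using True by auto
      then show ?thesis using fin xP True P assms by (simp add: slice_def)
    next
      case False
      then have "{y\<in>insert x P. cl y = k} = {y\<in>P. cl y = k}" by auto
      then show ?thesis using P False by (simp add: slice_def)
    qed
    then show "insert x P \<in> slice cl S a" using P assms by (auto simp: slice_def)
  qed
  show "(\<lambda>P. P - {x}) ` {P \<in> slice cl S a. x \<in> P} \<subseteq> slice cl (S - {x}) (a(cl x := a (cl x) - 1))"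
  proof safe
    fix P assume P: "P \<in> slice cl S a" and xP: "x \<in> P"
    have fin: "finite P" using P assms by (auto simp: slice_def dest: finite_subset)
    have "card {y\<in>P - {x}. cl y = k} = (a(cl x := a (cl x) - 1)) k" for k
    proof (cases "k = cl x")
      case True
      have "{y\<in>P - {x}. cl y = k} = {y\<in>P. cl y = k} - {x}" by auto
      then show ?thesis using fin xP True P assms by (simp add: slice_def)
    next
      case False
      then have "{y\<in>P - {x}. cl y = k} = {y\<in>P. cl y = k}" by auto
      then show ?thesis using P False by (simp add: slice_def)
    qed
    then show "P - {x} \<in> slice cl (S - {x}) (a(cl x := a (cl x) - 1))"
      using P assms by (auto simp: slice_def)
  qed
qed

lemma slice_minus: "{P\<in>slice cl S a. x \<notin> P} = slice cl (S - {x}) a"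
  by (auto simp: slice_def)

lemma slice_plus_empty:
  assumes "finite S" "a (cl x) = 0" "P \<in> slice cl S a"
  shows "x \<notin> P"
proof
  assume "x \<in> P"
  have "finite P" using assms by (auto simp: slice_def dest: finite_subset)
  moreover have "card {y\<in>P. cl y = cl x} = 0" using assms by (simp add: slice_def)
  ultimately show False using \<open>x \<in> P\<close> by auto
qed

text \<open>The weight of a configuration will be \<open>exp\<close> of this, without a minus sign;
  the factor 1/2 compensates that each pair occurs in both orders. In the application the field
  starts as 0 and then records the sites pinned so far.\<close>

definition energy :: "('a \<Rightarrow> 'a \<Rightarrow> complex) \<Rightarrow> ('a \<Rightarrow> complex) \<Rightarrow> 'a set \<Rightarrow> 'a set \<Rightarrow> complex" where
  "energy B h S P = (\<Sum>x\<in>S. \<Sum>y\<in>S. B x y * spin P x * spin P y) / 2 + (\<Sum>x\<in>S. h x * spin P x)"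

lemma energy_cong:
  assumes "\<And>x. x \<in> S \<Longrightarrow> x \<in> P \<longleftrightarrow> x \<in> P'" "\<And>x. x \<in> S \<Longrightarrow> h x = h' x"
  shows "energy B h S P = energy B h' S P'"
proof -
  have "spin P x = (spin P' x :: complex)" if "x \<in> S" for x
    using assms(1)[OF that] by (simp add: spin_def)
  then show ?thesis unfolding energy_def using assms(2) by (simp cong: sum.cong)
qed

lemma norm_diff_mult_le:
  fixes c :: complex
  assumes "norm (z - w) \<le> r * norm w"
  shows "norm (c * z - c * w) \<le> r * norm (c * w)"
  using mult_left_mono[OF assms norm_ge_zero[of c]]
  by (simp add: right_diff_distrib[symmetric] norm_mult mult.left_commute)

locale canonical_ensemble =
  fixes cl :: "'a \<Rightarrow> 'c" and B :: "'a \<Rightarrow> 'a \<Rightarrow> complex"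
  assumes B_sym: "B x y = B y x" and B_diag: "B x x = 0"
begin

lemma energy_remove:
  assumes "finite S" "x \<in> S"
  shows "energy B h S P = spin P x * h x + energy B (\<lambda>y. h y + spin P x * B x y) (S - {x}) P"
proof -
  let ?T = "S - {x}" and ?s = "spin P :: 'a \<Rightarrow> complex"
  have "(\<Sum>u\<in>S. \<Sum>y\<in>S. B u y * ?s u * ?s y)
      = (\<Sum>y\<in>S. B x y * ?s x * ?s y) + (\<Sum>u\<in>?T. \<Sum>y\<in>S. B u y * ?s u * ?s y)"
    by (rule sum.remove[OF assms])
  also have "(\<Sum>y\<in>S. B x y * ?s x * ?s y) = (\<Sum>y\<in>?T. B x y * ?s x * ?s y)"
    by (subst sum.remove[OF assms]) (simp add: B_diag)
  also have "(\<Sum>u\<in>?T. \<Sum>y\<in>S. B u y * ?s u * ?s y)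
      = (\<Sum>u\<in>?T. B u x * ?s u * ?s x) + (\<Sum>u\<in>?T. \<Sum>y\<in>?T. B u y * ?s u * ?s y)"
    by (subst sum.remove[OF assms]) (simp add: sum.distrib)
  also have "(\<Sum>u\<in>?T. B u x * ?s u * ?s x) = (\<Sum>y\<in>?T. B x y * ?s x * ?s y)"
    by (rule sum.cong) (auto simp: B_sym[of _ x])
  finally have 1: "(\<Sum>u\<in>S. \<Sum>y\<in>S. B u y * ?s u * ?s y)
      = 2 * (\<Sum>y\<in>?T. B x y * ?s x * ?s y) + (\<Sum>u\<in>?T. \<Sum>y\<in>?T. B u y * ?s u * ?s y)" by simp
  have 2: "(\<Sum>u\<in>S. h u * ?s u) = h x * ?s x + (\<Sum>u\<in>?T. h u * ?s u)"
    by (rule sum.remove[OF assms])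
  show ?thesis unfolding energy_def 1 2
    by (simp add: algebra_simps add_divide_distrib sum.distrib)
qed

text \<open>Expectations stay unnormalised: the weights are complex, and that the normalising
  constant \<open>Z h S a (\<lambda>_. 1)\<close> is nonzero is what has to be proved.\<close>

definition Z where
  "Z h S a \<phi> = (\<Sum>P\<in>slice cl S a. \<phi> P * exp (energy B h S P))"

definition pl where "pl x P = (of_bool (x \<in> P) :: complex)"
definition mi where "mi x P = (of_bool (x \<notin> P) :: complex)"

lemma Z_cong: "(\<And>P. P \<subseteq> S \<Longrightarrow> \<phi> P = \<psi> P) \<Longrightarrow> Z h S a \<phi> = Z h S a \<psi>"
  unfolding Z_def by (rule sum.cong) (auto simp: slice_def)

lemma Z_add: "Z h S a (\<lambda>P. \<phi> P + \<psi> P) = Z h S a \<phi> + Z h S a \<psi>"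
  by (simp add: Z_def algebra_simps sum.distrib)

lemma Z_diff: "Z h S a (\<lambda>P. \<phi> P - \<psi> P) = Z h S a \<phi> - Z h S a \<psi>"
  by (simp add: Z_def algebra_simps sum_subtractf)

lemma Z_scale: "Z h S a (\<lambda>P. c * \<phi> P) = c * Z h S a \<phi>"
  by (simp add: Z_def algebra_simps sum_distrib_left)

lemma Z_sum: "Z h S a (\<lambda>P. \<Sum>i\<in>I. \<phi> i P) = (\<Sum>i\<in>I. Z h S a (\<phi> i))"
  unfolding Z_def sum_distrib_right by (rule sum.swap)

text \<open>A pinned ensemble is again an ensemble, on one site less: a plus at \<open>x\<close>
  uses up one unit of the quota of its cell and acts on the other sites as the additional field
  \<open>B x\<close>. In \<open>Z_minus\<close> the quota is kept and the field has the opposite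
  sign. The induction over sites rests on these two identities.\<close>

lemma Z_plus:
  assumes "finite S" "x \<in> S" "a (cl x) > 0"
  shows "Z h S a (\<lambda>P. pl x P * \<phi> P)
    = exp (h x) * Z (\<lambda>y. h y + B x y) (S - {x}) (a(cl x := a (cl x) - 1)) (\<lambda>P. \<phi> (insert x P))"
proof -
  have "Z h S a (\<lambda>P. pl x P * \<phi> P) = (\<Sum>P\<in>{P\<in>slice cl S a. x \<in> P}. \<phi> P * exp (energy B h S P))"
    unfolding Z_def using finite_slice[OF assms(1), of cl a]
    by (intro sum.mono_neutral_cong_right) (auto simp: pl_def)
  also have "\<dots> = (\<Sum>P\<in>slice cl (S - {x}) (a(cl x := a (cl x) - 1)).
      \<phi> (insert x P) * exp (energy B h S (insert x P)))"
    by (rule sum.reindex_bij_betw[OF slice_plus[where a = a and cl = cl, OF assms], symmetric])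
  also have "\<dots> = (\<Sum>P\<in>slice cl (S - {x}) (a(cl x := a (cl x) - 1)).
      exp (h x) * (\<phi> (insert x P) * exp (energy B (\<lambda>y. h y + B x y) (S - {x}) P)))"
  proof (rule sum.cong[OF refl])
    fix P
    have "energy B h S (insert x P)
        = h x + energy B (\<lambda>y. h y + B x y) (S - {x}) (insert x P)"
      using energy_remove[OF assms(1,2), of h "insert x P"] by (simp add: spin_def)
    also have "energy B (\<lambda>y. h y + B x y) (S - {x}) (insert x P)
        = energy B (\<lambda>y. h y + B x y) (S - {x}) P" by (rule energy_cong) auto
    finally show "\<phi> (insert x P) * exp (energy B h S (insert x P))
        = exp (h x) * (\<phi> (insert x P) * exp (energy B (\<lambda>y. h y + B x y) (S - {x}) P))"
      by (simp add: exp_add)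
  qed
  finally show ?thesis by (simp add: Z_def sum_distrib_left)
qed

lemma Z_plus_0:
  assumes "finite S" "a (cl x) = 0"
  shows "Z h S a (\<lambda>P. pl x P * \<phi> P) = 0"
  unfolding Z_def using slice_plus_empty[where a = a and cl = cl, OF assms] by (intro sum.neutral) (auto simp: pl_def)

lemma Z_minus:
  assumes "finite S" "x \<in> S"
  shows "Z h S a (\<lambda>P. mi x P * \<phi> P) = exp (- h x) * Z (\<lambda>y. h y - B x y) (S - {x}) a \<phi>"
proof -
  have "Z h S a (\<lambda>P. mi x P * \<phi> P) = (\<Sum>P\<in>{P\<in>slice cl S a. x \<notin> P}. \<phi> P * exp (energy B h S P))"
    unfolding Z_def using finite_slice[OF assms(1), of cl a]
    by (intro sum.mono_neutral_cong_right) (auto simp: mi_def)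
  also have "\<dots> = (\<Sum>P\<in>slice cl (S - {x}) a. exp (- h x) * (\<phi> P * exp (energy B (\<lambda>y. h y - B x y) (S - {x}) P)))"
  proof (rule sum.cong[OF slice_minus])
    fix P assume "P \<in> slice cl (S - {x}) a"
    then have "x \<notin> P" by (auto simp: slice_def)
    then show "\<phi> P * exp (energy B h S P)
        = exp (- h x) * (\<phi> P * exp (energy B (\<lambda>y. h y - B x y) (S - {x}) P))"
      using energy_remove[OF assms(1,2), of h P]
      by (simp add: spin_def exp_diff exp_minus divide_simps)
  qed
  finally show ?thesis by (simp add: Z_def sum_distrib_left)
qed

text \<open>A budget shared by couplings and field. When \<open>x\<close> is pinned,
  \<open>norm (B u x)\<close> leaves the row sum of \<open>u\<close> and enters its field at most
  once, so the budget of \<open>u\<close> is never exceeded.\<close>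

definition small_field :: "('a \<Rightarrow> complex) \<Rightarrow> 'a set \<Rightarrow> bool" where
  "small_field h S \<longleftrightarrow> (\<forall>x\<in>S. (\<Sum>y\<in>S. norm (B x y)) + norm (h x) \<le> 1 / 100)"

lemma small_field_remove:
  assumes "finite S" "x \<in> S" "small_field h S" "norm (c::complex) \<le> 1"
  shows "small_field (\<lambda>y. h y + c * B x y) (S - {x})"
  unfolding small_field_def
proof
  fix u assume u: "u \<in> S - {x}"
  have "(\<Sum>y\<in>S. norm (B u y)) = norm (B u x) + (\<Sum>y\<in>S - {x}. norm (B u y))"
    by (rule sum.remove[OF assms(1,2)])
  moreover have "norm (h u + c * B x u) \<le> norm (h u) + norm (B u x)"
    by (rule order_trans[OF norm_triangle_ineq])
       (use assms(4) in \<open>simp add: norm_mult B_sym[of x u] mult_left_le_one_le\<close>)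
  moreover have "(\<Sum>y\<in>S. norm (B u y)) + norm (h u) \<le> 1 / 100" using assms(3) u by (auto simp: small_field_def)
  ultimately show "(\<Sum>y\<in>S - {x}. norm (B u y)) + norm (h u + c * B x u) \<le> 1 / 100" by linarith
qed

lemma small_field_plus: "finite S \<Longrightarrow> x \<in> S \<Longrightarrow> small_field h S \<Longrightarrow> small_field (\<lambda>y. h y + B x y) (S - {x})"
  using small_field_remove[of S x h 1] by simp

lemma small_field_minus: "finite S \<Longrightarrow> x \<in> S \<Longrightarrow> small_field h S \<Longrightarrow> small_field (\<lambda>y. h y - B x y) (S - {x})"
  using small_field_remove[of S x h "-1"] by simp

lemma Z_split: "Z h S a \<phi> = Z h S a (\<lambda>P. pl x P * \<phi> P) + Z h S a (\<lambda>P. mi x P * \<phi> P)"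
  unfolding Z_add[symmetric] by (rule Z_cong) (simp add: pl_def mi_def)

lemma Z_field_derivative:
  assumes "finite S"
  shows "((\<lambda>s. Z (\<lambda>w. h w + s * b w) S a \<phi>) has_field_derivative
           Z (\<lambda>w. h w + s * b w) S a (\<lambda>P. (\<Sum>w\<in>S. b w * spin P w) * \<phi> P)) (at s within T)"
proof -
  have "((\<lambda>s. energy B (\<lambda>w. h w + s * b w) S P) has_field_derivative (\<Sum>w\<in>S. b w * spin P w)) (at s within T)" for P
    unfolding energy_def by (auto intro!: derivative_eq_intros)
  then show ?thesis unfolding Z_def
    by (auto intro!: derivative_eq_intros sum.cong simp: mult_ac)
qed

text \<open>Exchanging the spins at two sites of a cell amounts to a bounded change of the fields on the other
  sites, and these fields can be interpolated linearly.\<close>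
lemma swap_bound:
  assumes S: "finite S" "x \<in> S" "y \<in> S" "x \<noteq> y" and cl: "cl x = cl y" and small_field: "small_field h S"
    and IH: "\<And>h a w. small_field h (S - {x} - {y}) \<Longrightarrow> w \<in> S - {x} - {y} \<Longrightarrow>
       norm (Z h (S - {x} - {y}) a (pl w)) + norm (Z h (S - {x} - {y}) a (mi w))
         \<le> 2 * norm (Z h (S - {x} - {y}) a (\<lambda>_. 1))"
  shows "norm (Z h S a (\<lambda>P. pl x P * mi y P) - Z h S a (\<lambda>P. pl y P * mi x P))
    \<le> 1/10 * norm (Z h S a (\<lambda>P. pl y P * mi x P))"
proof (cases "a (cl x) = 0")
  case True
  have "Z h S a (\<lambda>P. pl x P * mi y P) = 0" "Z h S a (\<lambda>P. pl y P * mi x P) = 0"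
    using True cl S by (auto intro!: Z_plus_0)
  then show ?thesis by simp
next
  case False
  define T where "T = S - {x} - {y}"
  define a' where "a' = a(cl x := a (cl x) - 1)"
  define b where "b w = B x w - B y w" for w
  \<comment> \<open>Up to the common factor \<open>exp (- B x y)\<close>, \<open>\<psi> 1\<close> is
    the ensemble with plus at \<open>x\<close> and minus at \<open>y\<close>, and
    \<open>\<psi> (- 1)\<close> the one with these spins exchanged. Either way one plus is spent in
    the common cell, hence the same \<open>a'\<close>; only the field on \<open>T\<close> differs,
    and it is linear in \<open>s\<close>.\<close>
  define \<psi> where "\<psi> s = exp (s * (h x - h y)) * Z (\<lambda>w. h w + s * b w) T a' (\<lambda>_. 1)" for s
  define \<psi>' where "\<psi>' s = (h x - h y) * \<psi> s
      + exp (s * (h x - h y)) * Z (\<lambda>w. h w + s * b w) T a' (\<lambda>P. \<Sum>w\<in>T. b w * spin P w)" for s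
  have finT: "finite T" using S by (simp add: T_def)
  have IH': "norm (Z h T a (pl w)) + norm (Z h T a (mi w)) \<le> 2 * norm (Z h T a (\<lambda>_. 1))"
    if "small_field h T" "w \<in> T" for h a w
    using IH that unfolding T_def by blast
  have px: "Z h S a (\<lambda>P. pl x P * mi y P) = exp (- B x y) * \<psi> 1"
  proof -
    have "Z h S a (\<lambda>P. pl x P * mi y P)
       = exp (h x) * Z (\<lambda>y. h y + B x y) (S - {x}) a' (\<lambda>P. mi y P * 1)"
      using False S by (subst Z_plus) (auto simp: a'_def mi_def intro!: Z_cong)
    also have "\<dots> = exp (h x) * (exp (- (h y + B x y)) * Z (\<lambda>w. h w + B x w - B y w) T a' (\<lambda>_. 1))"
      using S by (subst Z_minus) (auto simp: T_def)
    finally show ?thesis by (simp add: \<psi>_def b_def exp_add exp_diff exp_minus field_simps)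
  qed
  have py: "Z h S a (\<lambda>P. pl y P * mi x P) = exp (- B x y) * \<psi> (- 1)"
  proof -
    have "Z h S a (\<lambda>P. pl y P * mi x P)
       = exp (h y) * Z (\<lambda>w. h w + B y w) (S - {y}) a' (\<lambda>P. mi x P * 1)"
      using False S cl by (subst Z_plus) (auto simp: a'_def mi_def intro!: Z_cong)
    also have "\<dots> = exp (h y) * (exp (- (h x + B y x)) * Z (\<lambda>w. h w + B y w - B x w) (S - {y} - {x}) a' (\<lambda>_. 1))"
      using S by (subst Z_minus) auto
    also have "S - {y} - {x} = T" by (auto simp: T_def)
    finally show ?thesis by (simp add: \<psi>_def b_def exp_add exp_diff exp_minus field_simps B_sym[of y x])
  qed
  have deriv: "(\<psi> has_field_derivative \<psi>' s) (at s within cball 0 1)" for s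
    using Z_field_derivative[OF finT, of h b a' "\<lambda>_. 1" s "cball 0 1"] unfolding \<psi>_def \<psi>'_def
    by (auto intro!: derivative_eq_intros simp: algebra_simps)
  have sumB: "(\<Sum>w\<in>S. norm (B u w)) = norm (B u x) + norm (B u y) + (\<Sum>w\<in>T. norm (B u w))" for u
    using S by (subst sum.remove[of _ x], simp, simp, subst sum.remove[of _ y]) (auto simp: T_def)
  \<comment> \<open>The budgets of \<open>x\<close> and \<open>y\<close> are 1/100 each and the row
    sums are counted twice, which gives 4/100.\<close>
  have bT: "2 * (\<Sum>w\<in>T. norm (b w)) + norm (h x) + norm (h y) \<le> 4/100"
  proof -
    have "(\<Sum>w\<in>T. norm (b w)) \<le> (\<Sum>w\<in>T. norm (B x w)) + (\<Sum>w\<in>T. norm (B y w))"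
      unfolding b_def sum.distrib[symmetric] by (intro sum_mono norm_triangle_ineq4)
    moreover have "(\<Sum>w\<in>S. norm (B x w)) + norm (h x) \<le> 1/100" "(\<Sum>w\<in>S. norm (B y w)) + norm (h y) \<le> 1/100"
      using small_field S by (auto simp: small_field_def)
    ultimately show ?thesis using sumB[of x] sumB[of y]
        norm_ge_zero[of "h x"] norm_ge_zero[of "h y"] norm_ge_zero[of "B x x"] norm_ge_zero[of "B x y"]
        norm_ge_zero[of "B y x"] norm_ge_zero[of "B y y"] by linarith
  qed
  have bound: "norm (\<psi>' s) \<le> 4/100 * norm (\<psi> s)" if "s \<in> cball 0 1" for s
  proof -
    \<comment> \<open>Both \<open>x\<close> and \<open>y\<close> have left the site set, so the
      budget of \<open>u\<close> has room for \<open>B u x\<close> and \<open>B u y\<close>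
      together, for every complex \<open>s\<close> of modulus at most 1.\<close>
    have okT: "small_field (\<lambda>w. h w + s * b w) T"
      unfolding small_field_def
    proof
      fix u assume u: "u \<in> T"
      have "norm (h u + s * b u) \<le> norm (h u) + norm (b u)"
        by (rule order_trans[OF norm_triangle_ineq])
           (use that in \<open>simp add: norm_mult mult_left_le_one_le\<close>)
      also have "norm (b u) \<le> norm (B u x) + norm (B u y)"
        unfolding b_def by (metis B_sym norm_triangle_ineq4)
      finally show "(\<Sum>y\<in>T. norm (B u y)) + norm (h u + s * b u) \<le> 1 / 100"
        using sumB[of u] small_field u by (force simp: small_field_def T_def)
    qed
    let ?Z = "Z (\<lambda>w. h w + s * b w) T a'"
    have "norm (?Z (\<lambda>P. \<Sum>w\<in>T. b w * spin P w)) \<le> (\<Sum>w\<in>T. norm (b w) * (2 * norm (?Z (\<lambda>_. 1))))"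
      unfolding Z_sum
    proof (rule sum_norm_le)
      fix w assume w: "w \<in> T"
      have eq: "?Z (\<lambda>P. b w * spin P w) = b w * (?Z (pl w) - ?Z (mi w))"
        unfolding Z_scale Z_diff[symmetric]
        by (intro arg_cong2[where f = "(*)"] refl Z_cong) (simp add: pl_def mi_def spin_def)
      have "norm (?Z (pl w) - ?Z (mi w)) \<le> 2 * norm (?Z (\<lambda>_. 1))"
        by (rule order_trans[OF norm_triangle_ineq4 IH'[OF okT w]])
      then show "norm (?Z (\<lambda>P. b w * spin P w)) \<le> norm (b w) * (2 * norm (?Z (\<lambda>_. 1)))"
        unfolding eq norm_mult by (rule mult_left_mono) simp
    qed
    also have "\<dots> = (2 * (\<Sum>w\<in>T. norm (b w))) * norm (?Z (\<lambda>_. 1))"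
      unfolding sum_distrib_left sum_distrib_right by (rule sum.cong) (simp_all add: mult_ac)
    finally have 1: "norm (exp (s * (h x - h y))) * norm (?Z (\<lambda>P. \<Sum>w\<in>T. b w * spin P w))
      \<le> (2 * (\<Sum>w\<in>T. norm (b w))) * norm (\<psi> s)"
      unfolding \<psi>_def norm_mult
      by (subst mult.left_commute) (rule mult_left_mono[OF _ norm_ge_zero])
    have "norm (\<psi>' s) \<le> norm (h x - h y) * norm (\<psi> s) + (2 * (\<Sum>w\<in>T. norm (b w))) * norm (\<psi> s)"
      unfolding \<psi>'_def by (rule order_trans[OF norm_triangle_ineq]) (use 1 in \<open>simp add: norm_mult\<close>)
    also have "\<dots> = (norm (h x - h y) + 2 * (\<Sum>w\<in>T. norm (b w))) * norm (\<psi> s)"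
      by (simp add: algebra_simps)
    also have "\<dots> \<le> 4/100 * norm (\<psi> s)"
      using bT norm_triangle_ineq4[of "h x" "h y"] by (intro mult_right_mono) auto
    finally show ?thesis .
  qed
  have "continuous_on (cball 0 1) \<psi>"
    using deriv by (meson DERIV_continuous continuous_on_eq_continuous_within)
  then have "continuous_on (cball 0 1) (\<lambda>s. norm (\<psi> s))" by (rule continuous_on_norm)
  \<comment> \<open>The bound on \<open>\<psi>'\<close> is relative to \<open>\<psi>\<close> at the
    same point. At a maximum point \<open>t\<close> it closes up: \<open>norm (\<psi> t)\<close> is
    at most \<open>norm (\<psi> (- 1))\<close> plus 8/100 of itself, and 0.08 / 0.92 is less than
    1/10.\<close>
  then obtain t where t: "t \<in> cball 0 1" "\<And>s. s \<in> cball 0 1 \<Longrightarrow> norm (\<psi> s) \<le> norm (\<psi> t)"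
    using continuous_attains_sup[of "cball (0::complex) 1" "\<lambda>s. norm (\<psi> s)"] by auto
  have lip: "norm (\<psi> u - \<psi> (-1)) \<le> 4/100 * norm (\<psi> t) * norm (u - (-1))" if "u \<in> cball 0 1" for u
  proof (rule field_differentiable_bound[of "cball 0 1"])
    show "norm (\<psi>' s) \<le> 4/100 * norm (\<psi> t)" if "s \<in> cball 0 1" for s
      using bound[OF that] t(2)[OF that] by linarith
  qed (use deriv that in auto)
  have lip2: "norm (\<psi> u - \<psi> (-1)) \<le> 8/100 * norm (\<psi> t)" if "u \<in> cball 0 1" for u
  proof -
    have "norm (u - (-1)) \<le> 2" using norm_triangle_ineq4[of u "-1"] that by simp
    then have "4/100 * norm (\<psi> t) * norm (u - (-1)) \<le> 4/100 * norm (\<psi> t) * 2" by (intro mult_left_mono) auto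
    then show ?thesis using lip[OF that] by linarith
  qed
  have "norm (\<psi> t) \<le> norm (\<psi> (-1)) + 8/100 * norm (\<psi> t)"
    using lip2[OF t(1)] norm_triangle_sub[of "\<psi> t" "\<psi> (-1)"] by linarith
  moreover have "norm (\<psi> 1 - \<psi> (-1)) \<le> 8/100 * norm (\<psi> t)" by (rule lip2) simp
  ultimately have "norm (\<psi> 1 - \<psi> (-1)) \<le> 1/10 * norm (\<psi> (-1))"
    using norm_ge_zero[of "\<psi> (-1)"] by linarith
  then show ?thesis unfolding px py by (rule norm_diff_mult_le)
qed

lemma sum_weights_near:
  fixes v :: "'b \<Rightarrow> complex"
  assumes "\<And>y. y \<in> T \<Longrightarrow> norm (v y - v0) \<le> r * norm v0"
  shows "norm ((\<Sum>y\<in>T. v y) - of_nat (card T) * v0) \<le> r * norm (of_nat (card T) * v0)"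
proof -
  have "(\<Sum>y\<in>T. v y) - of_nat (card T) * v0 = (\<Sum>y\<in>T. v y - v0)" by (simp add: sum_subtractf)
  also have "norm \<dots> \<le> (\<Sum>y\<in>T. r * norm v0)" by (rule sum_norm_le) (use assms in auto)
  finally show ?thesis by (simp add: norm_mult mult_ac)
qed

text \<open>Origin of the factor 2: if two numbers lie within a third of \<open>A\<close> and
  \<open>B\<close>, which are positive multiples of the same \<open>w\<close>, then the modulus of
  their sum is at least 2/3, and the sum of their moduli at most 4/3, of \<open>|A| + |B|\<close>.
  The claim on two sites of one cell provides the near equality of weights that this requires. The
  claims use each other on smaller site sets and therefore share one induction.\<close>

theorem no_cancellation:
  assumes "finite S" "small_field h S"
  shows "\<And>x. x \<in> S \<Longrightarrow> norm (Z h S a (pl x)) + norm (Z h S a (mi x)) \<le> 2 * norm (Z h S a (\<lambda>_. 1))"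
    and "slice cl S a \<noteq> {} \<Longrightarrow> Z h S a (\<lambda>_. 1) \<noteq> 0"
    and "\<And>x y. x \<in> S \<Longrightarrow> y \<in> S \<Longrightarrow> cl x = cl y \<Longrightarrow>
      norm (Z h S a (pl x) - Z h S a (pl y)) \<le> 1/5 * norm (Z h S a (pl y))"
proof -
  have "small_field h S \<longrightarrow> (\<forall>x\<in>S. norm (Z h S a (pl x)) + norm (Z h S a (mi x)) \<le> 2 * norm (Z h S a (\<lambda>_. 1))) \<and>
    (slice cl S a \<noteq> {} \<longrightarrow> Z h S a (\<lambda>_. 1) \<noteq> 0) \<and>
    (\<forall>x\<in>S. \<forall>y\<in>S. cl x = cl y \<longrightarrow> norm (Z h S a (pl x) - Z h S a (pl y)) \<le> 1/5 * norm (Z h S a (pl y)))"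
    using assms(1)
  proof (induction S arbitrary: h a rule: finite_psubset_induct)
    case (psubset S)
    note fin = \<open>finite S\<close>
    show ?case
    proof
      assume okS: "small_field h S"
      have IH2: "norm (Z h' T a' (pl x)) + norm (Z h' T a' (mi x)) \<le> 2 * norm (Z h' T a' (\<lambda>_. 1))"
        if "T \<subset> S" "small_field h' T" "x \<in> T" for T h' a' x
        using psubset.IH[OF that(1), of h' a'] that by blast
      have IH1: "Z h' T a' (\<lambda>_. 1) \<noteq> 0"
        if "T \<subset> S" "small_field h' T" "slice cl T a' \<noteq> {}" for T h' a'
        using psubset.IH[OF that(1), of h' a'] that by blast
      have IH4: "norm (Z h' T a' (pl x) - Z h' T a' (pl y)) \<le> 1/5 * norm (Z h' T a' (pl y))"
        if "T \<subset> S" "small_field h' T" "x \<in> T" "y \<in> T" "cl x = cl y" for T h' a' x y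
        using psubset.IH[OF that(1), of h' a'] that by blast
      have swap: "norm (Z h S a (\<lambda>P. pl x P * mi y P) - Z h S a (\<lambda>P. pl y P * mi x P))
          \<le> 1/10 * norm (Z h S a (\<lambda>P. pl y P * mi x P))"
        if "x \<in> S" "y \<in> S" "x \<noteq> y" "cl x = cl y" for x y
        by (rule swap_bound) (use that okS fin in \<open>auto intro!: IH2\<close>)
      have split: "Z h S a (\<lambda>_. 1) = Z h S a (pl x) + Z h S a (mi x)" for x
        using Z_split[of h S a "\<lambda>_. 1" x] by (simp add: fun_eq_iff)
      \<comment> \<open>Configurations with equal spins at \<open>x\<close> and \<open>y\<close>
        cancel in the difference. The rest is compared by \<open>swap\<close> up to 1/10 of the
        mixed ensemble, which is at most twice the ensemble with \<open>y\<close> pinned to plus, by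
        the induction hypothesis after pinning \<open>y\<close>.\<close>
      have close: "norm (Z h S a (pl x) - Z h S a (pl y)) \<le> 1/5 * norm (Z h S a (pl y))"
        if xy: "x \<in> S" "y \<in> S" "cl x = cl y" for x y
      proof (cases "x = y \<or> a (cl y) = 0")
        case True
        then show ?thesis using Z_plus_0[OF fin, of a y h "\<lambda>_. 1"] Z_plus_0[OF fin, of a x h "\<lambda>_. 1"] xy by auto
      next
        case False
        have "Z h S a (pl x) - Z h S a (pl y) = Z h S a (\<lambda>P. pl x P * mi y P) - Z h S a (\<lambda>P. pl y P * mi x P)"
          unfolding Z_diff[symmetric] by (rule Z_cong) (simp add: pl_def mi_def)
        then have 1: "norm (Z h S a (pl x) - Z h S a (pl y)) \<le> 1/10 * norm (Z h S a (\<lambda>P. pl y P * mi x P))"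
          using swap[of x y] xy False by simp
        let ?a = "a(cl y := a (cl y) - 1)" and ?h = "\<lambda>w. h w + B y w"
        have e1: "Z h S a (pl y) = exp (h y) * Z ?h (S - {y}) ?a (\<lambda>_. 1)"
          using Z_plus[of S y a h "\<lambda>_. 1"] fin xy False by simp
        have e2: "Z h S a (\<lambda>P. pl y P * mi x P) = exp (h y) * Z ?h (S - {y}) ?a (mi x)"
          using False xy fin by (subst Z_plus) (auto simp: mi_def intro!: Z_cong)
        have "norm (Z ?h (S - {y}) ?a (pl x)) + norm (Z ?h (S - {y}) ?a (mi x)) \<le> 2 * norm (Z ?h (S - {y}) ?a (\<lambda>_. 1))"
          by (rule IH2) (use False xy fin okS in \<open>auto intro!: small_field_plus\<close>)
        then have "norm (Z ?h (S - {y}) ?a (mi x)) \<le> 2 * norm (Z ?h (S - {y}) ?a (\<lambda>_. 1))"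
          using norm_ge_zero[of "Z ?h (S - {y}) ?a (pl x)"] by linarith
        then have "norm (exp (h y)) * norm (Z ?h (S - {y}) ?a (mi x)) \<le> norm (exp (h y)) * (2 * norm (Z ?h (S - {y}) ?a (\<lambda>_. 1)))"
          by (intro mult_left_mono) auto
        then have "norm (Z h S a (\<lambda>P. pl y P * mi x P)) \<le> 2 * norm (Z h S a (pl y))"
          unfolding e1 e2 norm_mult by simp
        then show ?thesis using 1 by linarith
      qed
      have main: "norm (Z h S a (pl x)) + norm (Z h S a (mi x)) \<le> 2 * norm (Z h S a (\<lambda>_. 1))"
        if x: "x \<in> S" for x
      proof (cases "(\<exists>P\<in>slice cl S a. x \<in> P) \<and> (\<exists>P\<in>slice cl S a. x \<notin> P)")
        case False
        then have "Z h S a (pl x) = 0 \<or> Z h S a (mi x) = 0"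
          unfolding Z_def pl_def mi_def by (auto intro!: sum.neutral)
        then show ?thesis unfolding split[of x] by auto
      next
        case True
        define T where "T = {y\<in>S - {x}. cl y = cl x}"
        \<comment> \<open>Among the other sites \<open>T\<close> of the cell, exactly
          \<open>b\<close> are minus when \<open>x\<close> is plus, and exactly
          \<open>a (cl x)\<close> are plus when \<open>x\<close> is minus. Since both spins occur at
          \<open>x\<close>, both numbers are positive.\<close>
        define b where "b = card T + 1 - a (cl x)"
        have finT: "finite T" using fin by (simp add: T_def)
        obtain P where P: "P \<in> slice cl S a" "x \<in> P" using True by auto
        obtain P' where P': "P' \<in> slice cl S a" "x \<notin> P'" using True by auto
        have apos: "a (cl x) > 0" using slice_plus_empty[where a = a and cl = cl, OF fin _ P(1)] P(2) by auto
        have "{y\<in>P'. cl y = cl x} \<subseteq> T" using P' by (auto simp: slice_def T_def)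
        then have "a (cl x) \<le> card T" using card_mono[OF finT, of "{y\<in>P'. cl y = cl x}"] P'(1) by (auto simp: slice_def)
        then have bpos: "b > 0" "card T > 0" using apos by (auto simp: b_def)
        then obtain y0 where y0: "y0 \<in> T" by fastforce
        \<comment> \<open>\<open>v y\<close> has minus at \<open>x\<close> and plus at
          \<open>y\<close>, \<open>u y\<close> the exchanged spins. Summed over \<open>T\<close>,
          the \<open>v y\<close> count each configuration with \<open>x\<close> minus
          \<open>a (cl x)\<close> times, and the \<open>u y\<close> count each one with
          \<open>x\<close> plus \<open>b\<close> times. This links the two pinned ensembles although
          single spins cannot be flipped.\<close>
        define v where "v y = Z h S a (\<lambda>P. pl y P * mi x P)" for y
        define u where "u y = Z h S a (\<lambda>P. pl x P * mi y P)" for y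
        have vsum: "(\<Sum>y\<in>T. v y) = of_nat (a (cl x)) * Z h S a (mi x)"
          unfolding v_def Z_sum[symmetric] Z_scale[symmetric] unfolding Z_def
        proof (rule sum.cong[OF refl])
          fix P assume P: "P \<in> slice cl S a"
          have "(\<Sum>y\<in>T. pl y P * mi x P) = of_nat (a (cl x)) * mi x P"
          proof (cases "x \<in> P")
            case False
            have "{y\<in>P. cl y = cl x} = T \<inter> P" using False P by (auto simp: T_def slice_def)
            moreover have "card {y\<in>P. cl y = cl x} = a (cl x)" using P by (simp add: slice_def)
            ultimately have "card (T \<inter> P) = a (cl x)" by simp
            moreover have "(\<Sum>y\<in>T. pl y P) = of_nat (card (T \<inter> P))"
              using finT by (simp add: pl_def sum.If_cases of_bool_def Int_def)
            ultimately show ?thesis using False by (simp add: mi_def)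
          qed (simp add: mi_def)
          then show "(\<Sum>y\<in>T. pl y P * mi x P) * exp (energy B h S P) = of_nat (a (cl x)) * mi x P * exp (energy B h S P)" by simp
        qed
        have usum: "(\<Sum>y\<in>T. u y) = of_nat b * Z h S a (pl x)"
          unfolding u_def Z_sum[symmetric] Z_scale[symmetric] unfolding Z_def
        proof (rule sum.cong[OF refl])
          fix P assume P: "P \<in> slice cl S a"
          have "(\<Sum>y\<in>T. pl x P * mi y P) = of_nat b * pl x P"
          proof (cases "x \<in> P")
            case True
            have "{y\<in>P. cl y = cl x} = insert x (T \<inter> P)" using True P by (auto simp: T_def slice_def)
            moreover have "card {y\<in>P. cl y = cl x} = a (cl x)" using P by (simp add: slice_def)
            ultimately have "a (cl x) = card (insert x (T \<inter> P))" by simp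
            also have "\<dots> = Suc (card (T \<inter> P))" using finT by (simp add: T_def)
            finally have "card (T - P) = b" unfolding b_def using finT by (simp add: card_Diff_subset_Int)
            moreover have "(\<Sum>y\<in>T. mi y P) = of_nat (card (T - P))"
              using finT by (simp add: mi_def sum.If_cases of_bool_def Diff_eq Compl_eq Int_def)
            ultimately show ?thesis using True by (simp add: pl_def)
          qed (simp add: pl_def)
          then show "(\<Sum>y\<in>T. pl x P * mi y P) * exp (energy B h S P) = of_nat b * pl x P * exp (energy B h S P)" by simp
        qed
        have vZ: "v y = exp (- h x) * Z (\<lambda>w. h w - B x w) (S - {x}) a (pl y)" if "y \<in> T" for y
        proof -
          have "v y = Z h S a (\<lambda>P. mi x P * pl y P)" by (simp add: v_def mult.commute)
          then show ?thesis using Z_minus[OF fin x] by simp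
        qed
        \<comment> \<open>With \<open>x\<close> pinned to minus, this compares the two sites
          \<open>y\<close> and \<open>y0\<close> of one cell in the ensemble on
          \<open>S - {x}\<close>.\<close>
        have vv: "norm (v y - v y0) \<le> 1/5 * norm (v y0)" if "y \<in> T" for y
        proof -
          let ?W = "Z (\<lambda>w. h w - B x w) (S - {x}) a"
          have "norm (?W (pl y) - ?W (pl y0)) \<le> 1/5 * norm (?W (pl y0))"
            by (rule IH4) (use x y0 that okS fin in \<open>auto simp: T_def intro!: small_field_minus\<close>)
          then show ?thesis unfolding vZ[OF that] vZ[OF y0] by (rule norm_diff_mult_le)
        qed
        \<comment> \<open>Exchanging costs 1/10 of \<open>v y\<close> and moving from
          \<open>y\<close> to \<open>y0\<close> costs 1/5 of \<open>v y0\<close>: in total 1/10 *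
          6/5 + 1/5 = 0.32, below 1/3.\<close>
        have uv: "norm (u y - v y0) \<le> 1/3 * norm (v y0)" if "y \<in> T" for y
        proof -
          have "norm (u y - v y) \<le> 1/10 * norm (v y)"
            unfolding u_def v_def by (rule swap) (use x that in \<open>auto simp: T_def\<close>)
          moreover have "norm (v y) \<le> norm (v y0) + norm (v y - v y0)" by (rule norm_triangle_sub)
          moreover have "norm (u y - v y0) \<le> norm (u y - v y) + norm (v y - v y0)"
            using norm_triangle_ineq[of "u y - v y" "v y - v y0"] by simp
          ultimately show ?thesis using vv[OF that] norm_ge_zero[of "v y0"] by linarith
        qed
        define w where "w = of_nat (card T) * v y0"
        have Zm: "norm (of_nat (a (cl x)) * Z h S a (mi x) - w) \<le> 1/3 * norm w"
          unfolding vsum[symmetric] w_def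
          proof (rule sum_weights_near)
          show "norm (v y - v y0) \<le> 1/3 * norm (v y0)" if "y \<in> T" for y
            using vv[OF that] norm_ge_zero[of "v y0"] by linarith
        qed
        have Zp: "norm (of_nat b * Z h S a (pl x) - w) \<le> 1/3 * norm w"
          unfolding usum[symmetric] w_def by (rule sum_weights_near) (use uv in auto)
        define \<alpha> \<gamma> where "\<alpha> = real (a (cl x))" "\<gamma> = real b"
        have ab: "\<alpha> > 0" "\<gamma> > 0" using apos bpos by (auto simp: \<alpha>_\<gamma>_def)
        have sc: "norm (z - w / of_real s) \<le> 1/3 * (norm w / s)" if "norm (of_real s * z - w) \<le> 1/3 * norm w" "s > 0" for s z
        proof -
          have "z - w / of_real s = (of_real s * z - w) / of_real s" using that by (simp add: field_simps)
          then have "norm (z - w / of_real s) = norm (of_real s * z - w) / s" using that by (simp add: norm_divide)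
          also have "\<dots> \<le> (1/3 * norm w) / s" using that by (intro divide_right_mono) auto
          finally show ?thesis by simp
        qed
        have m1: "norm (Z h S a (mi x) - w / of_real \<alpha>) \<le> 1/3 * (norm w / \<alpha>)"
          by (rule sc) (use Zm ab in \<open>auto simp: \<alpha>_\<gamma>_def\<close>)
        have p1: "norm (Z h S a (pl x) - w / of_real \<gamma>) \<le> 1/3 * (norm w / \<gamma>)"
          by (rule sc) (use Zp ab in \<open>auto simp: \<alpha>_\<gamma>_def\<close>)
        have n1: "norm (w / of_real \<alpha>) = norm w / \<alpha>" "norm (w / of_real \<gamma>) = norm w / \<gamma>"
          using ab by (auto simp: norm_divide)
        \<comment> \<open>The two approximants are positive multiples of the same \<open>w\<close>,
          so their moduli add up without loss; the cell may be filled in any proportion.\<close>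
        have n2: "norm (w / of_real \<alpha> + w / of_real \<gamma>) = norm w / \<alpha> + norm w / \<gamma>"
        proof -
          have "w / of_real \<alpha> + w / of_real \<gamma> = of_real (1/\<alpha> + 1/\<gamma>) * w" by (simp add: algebra_simps)
          then have "norm (w / of_real \<alpha> + w / of_real \<gamma>) = \<bar>1/\<alpha> + 1/\<gamma>\<bar> * norm w"
            by (simp only: norm_mult norm_of_real)
          then show ?thesis using ab by (simp add: algebra_simps)
        qed
        have "norm (w / of_real \<alpha> + w / of_real \<gamma>) \<le> norm (Z h S a (pl x) + Z h S a (mi x))
            + norm (Z h S a (mi x) - w / of_real \<alpha>) + norm (Z h S a (pl x) - w / of_real \<gamma>)"
          using norm_triangle_ineq4[of "Z h S a (pl x) + Z h S a (mi x)"
              "(Z h S a (mi x) - w / of_real \<alpha>) + (Z h S a (pl x) - w / of_real \<gamma>)"]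
            norm_triangle_ineq[of "Z h S a (mi x) - w / of_real \<alpha>" "Z h S a (pl x) - w / of_real \<gamma>"]
          by (simp add: algebra_simps)
        moreover have "norm (Z h S a (mi x)) \<le> norm w / \<alpha> + norm (Z h S a (mi x) - w / of_real \<alpha>)"
          using norm_triangle_sub[of "Z h S a (mi x)" "w / of_real \<alpha>"] n1 by simp
        moreover have "norm (Z h S a (pl x)) \<le> norm w / \<gamma> + norm (Z h S a (pl x) - w / of_real \<gamma>)"
          using norm_triangle_sub[of "Z h S a (pl x)" "w / of_real \<gamma>"] n1 by simp
        ultimately show ?thesis unfolding split[of x] using n2 m1 p1 by linarith
      qed
      \<comment> \<open>A configuration of the slice has some spin at \<open>x\<close>. The ensemble
        with this spin pinned is nonempty, hence nonzero by induction, and \<open>main\<close>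
        excludes that the two pinned parts cancel.\<close>
      have nz: "Z h S a (\<lambda>_. 1) \<noteq> 0" if ne: "slice cl S a \<noteq> {}"
      proof (cases "S = {}")
        case True
        then have "slice cl S a = {{}}" using ne by (auto simp: slice_def)
        then show ?thesis by (simp add: Z_def)
      next
        case False
        then obtain x where x: "x \<in> S" by auto
        obtain P where P: "P \<in> slice cl S a" using ne by auto
        have "Z h S a (pl x) \<noteq> 0 \<or> Z h S a (mi x) \<noteq> 0"
        proof (cases "x \<in> P")
          case True
          have apos: "a (cl x) > 0" using slice_plus_empty[where a = a and cl = cl, OF fin _ P] True by auto
          let ?a = "a(cl x := a (cl x) - 1)"
          have "slice cl (S - {x}) ?a \<noteq> {}"
            using slice_plus[OF fin x, of a cl] apos P True by (auto simp: bij_betw_def)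
          then have "Z (\<lambda>y. h y + B x y) (S - {x}) ?a (\<lambda>_. 1) \<noteq> 0"
            by (intro IH1) (use x okS fin in \<open>auto intro!: small_field_plus\<close>)
          then show ?thesis using Z_plus[OF fin x, of a h "\<lambda>_. 1"] apos by auto
        next
          case False
          then have "slice cl (S - {x}) a \<noteq> {}" using P slice_minus[of cl S a x] by blast
          then have "Z (\<lambda>y. h y - B x y) (S - {x}) a (\<lambda>_. 1) \<noteq> 0"
            by (intro IH1) (use x okS fin in \<open>auto intro!: small_field_minus\<close>)
          then show ?thesis using Z_minus[OF fin x, of h a "\<lambda>_. 1"] by auto
        qed
        then have "norm (Z h S a (pl x)) + norm (Z h S a (mi x)) > 0"
          by (metis add_nonneg_pos add_pos_nonneg norm_ge_zero zero_less_norm_iff)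
        then show ?thesis using main[OF x] by auto
      qed
      show "(\<forall>x\<in>S. norm (Z h S a (pl x)) + norm (Z h S a (mi x)) \<le> 2 * norm (Z h S a (\<lambda>_. 1))) \<and>
    (slice cl S a \<noteq> {} \<longrightarrow> Z h S a (\<lambda>_. 1) \<noteq> 0) \<and>
    (\<forall>x\<in>S. \<forall>y\<in>S. cl x = cl y \<longrightarrow> norm (Z h S a (pl x) - Z h S a (pl y)) \<le> 1/5 * norm (Z h S a (pl y)))"
        using main nz close by blast
    qed
  qed
  with assms(2) show "\<And>x. x \<in> S \<Longrightarrow> norm (Z h S a (pl x)) + norm (Z h S a (mi x)) \<le> 2 * norm (Z h S a (\<lambda>_. 1))"
    and "slice cl S a \<noteq> {} \<Longrightarrow> Z h S a (\<lambda>_. 1) \<noteq> 0"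
    and "\<And>x y. x \<in> S \<Longrightarrow> y \<in> S \<Longrightarrow> cl x = cl y \<Longrightarrow>
      norm (Z h S a (pl x) - Z h S a (pl y)) \<le> 1/5 * norm (Z h S a (pl y))"
    by blast+
qed

text \<open>With \<open>x\<close> pinned, no cancellation at \<open>y\<close> costs a factor 2, and
  no cancellation at \<open>x\<close> another 2. For real couplings the factor would be 1; any
  absolute constant suffices for the logarithmic derivative.\<close>

lemma two_point_bound:
  assumes S: "finite S" "x \<in> S" "y \<in> S" "x \<noteq> y" and small_field: "small_field h S"
  shows "norm (Z h S a (\<lambda>P. spin P x * spin P y)) \<le> 4 * norm (Z h S a (\<lambda>_. 1))"
proof -
  let ?d = "\<lambda>P. pl y P - mi y P"
  have d: "norm (Z h' (S - {x}) a' ?d) \<le> 2 * norm (Z h' (S - {x}) a' (\<lambda>_. 1))" if "small_field h' (S - {x})" for h' a'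
    unfolding Z_diff by (rule order_trans[OF norm_triangle_ineq4 no_cancellation(1)]) (use that S in auto)
  have p: "norm (Z h S a (\<lambda>P. pl x P * ?d P)) \<le> 2 * norm (Z h S a (pl x))"
  proof (cases "a (cl x) = 0")
    case True
    then show ?thesis using Z_plus_0[OF S(1), of a x h ?d] by simp
  next
    case False
    let ?W = "Z (\<lambda>y. h y + B x y) (S - {x}) (a(cl x := a (cl x) - 1))"
    have "Z h S a (\<lambda>P. pl x P * ?d P) = exp (h x) * ?W (\<lambda>P. ?d (insert x P))"
      by (rule Z_plus) (use S False in auto)
    also have "?W (\<lambda>P. ?d (insert x P)) = ?W ?d"
      by (rule Z_cong) (use S in \<open>auto simp: pl_def mi_def\<close>)
    finally have 1: "Z h S a (\<lambda>P. pl x P * ?d P) = exp (h x) * ?W ?d" .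
    have 2: "Z h S a (pl x) = exp (h x) * ?W (\<lambda>_. 1)"
      using Z_plus[of S x a h "\<lambda>_. 1"] S False by simp
    show ?thesis unfolding 1 2 norm_mult
      using mult_left_mono[OF d[OF small_field_plus[OF S(1,2) small_field]] norm_ge_zero[of "exp (h x)"], of "a(cl x := a (cl x) - 1)"]
      by simp
  qed
  have m: "norm (Z h S a (\<lambda>P. mi x P * ?d P)) \<le> 2 * norm (Z h S a (mi x))"
  proof -
    have 1: "Z h S a (\<lambda>P. mi x P * ?d P) = exp (- h x) * Z (\<lambda>y. h y - B x y) (S - {x}) a ?d"
      by (rule Z_minus) (use S in auto)
    have 2: "Z h S a (mi x) = exp (- h x) * Z (\<lambda>y. h y - B x y) (S - {x}) a (\<lambda>_. 1)"
      using Z_minus[of S x h a "\<lambda>_. 1"] S by simp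
    show ?thesis unfolding 1 2 norm_mult
      using mult_left_mono[OF d[OF small_field_minus[OF S(1,2) small_field]] norm_ge_zero[of "exp (- h x)"], of a] by simp
  qed
  have "Z h S a (\<lambda>P. spin P x * spin P y) = Z h S a (\<lambda>P. pl x P * ?d P) - Z h S a (\<lambda>P. mi x P * ?d P)"
    unfolding Z_diff[symmetric] by (rule Z_cong) (simp add: pl_def mi_def spin_def)
  then have "norm (Z h S a (\<lambda>P. spin P x * spin P y)) \<le> 2 * norm (Z h S a (pl x)) + 2 * norm (Z h S a (mi x))"
    using p m norm_triangle_ineq4 by (smt (verit))
  also have "\<dots> \<le> 2 * (2 * norm (Z h S a (\<lambda>_. 1)))"
    using no_cancellation(1)[OF S(1) small_field S(2), of a] by simp
  finally show ?thesis by simp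
qed

end

section \<open>The logarithm of the partition function and its Taylor series\<close>

definition pair_energy :: "('a \<Rightarrow> 'a \<Rightarrow> real) \<Rightarrow> 'a set \<Rightarrow> 'a set \<Rightarrow> real" where
  "pair_energy b S P = (\<Sum>x\<in>S. \<Sum>y\<in>S. b x y * spin P x * spin P y) / 2"

definition avg :: "('a \<Rightarrow> 'c) \<Rightarrow> 'a set \<Rightarrow> ('c \<Rightarrow> nat) \<Rightarrow> ('a set \<Rightarrow> real) \<Rightarrow> real" where
  "avg cl S a f = (\<Sum>P\<in>slice cl S a. f P) / card (slice cl S a)"

lemma of_real_spin: "of_real (spin P x) = spin P x"
  by (simp add: spin_def)

text \<open>The complex parameter \<open>z\<close> scales the couplings, so zero-freeness holds as
  long as the scaled row sums stay below 1/100. The second claim bounds the logarithmic derivative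
  in \<open>z\<close>: each ordered pair contributes \<open>\<bar>b x y\<bar> / 2\<close> times the
  4 of \<open>two_point_bound\<close>, and the rows sum to at most \<open>e\<close>.\<close>

lemma exponential_sum_bounds:
  fixes b :: "'a \<Rightarrow> 'a \<Rightarrow> real" and e :: real and z :: complex
  assumes S: "finite S" "slice cl S a \<noteq> {}" and b: "\<And>x y. b x y = b y x" "\<And>x. b x x = 0"
    and e: "\<And>x. x \<in> S \<Longrightarrow> (\<Sum>y\<in>S. \<bar>b x y\<bar>) \<le> e" and z: "norm z * e \<le> 1 / 100"
  shows "(\<Sum>P\<in>slice cl S a. exp (z * pair_energy b S P)) \<noteq> 0"
    and "norm (\<Sum>P\<in>slice cl S a. pair_energy b S P * exp (z * pair_energy b S P))
           \<le> 2 * card S * e * norm (\<Sum>P\<in>slice cl S a. exp (z * pair_energy b S P))"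
proof -
  define B where "B x y = z * b x y" for x y
  interpret canonical_ensemble cl B
    by unfold_locales (use b in \<open>auto simp: B_def\<close>)
  have en: "energy B (\<lambda>_. 0) S P = z * pair_energy b S P" for P
    unfolding energy_def pair_energy_def
    by (simp add: B_def sum_distrib_left of_real_spin mult.assoc)
  have small_field: "small_field (\<lambda>_. 0) S"
    unfolding small_field_def
  proof
    fix x assume "x \<in> S"
    have "(\<Sum>y\<in>S. norm (B x y)) = norm z * (\<Sum>y\<in>S. \<bar>b x y\<bar>)"
      by (simp add: B_def norm_mult sum_distrib_left)
    also have "\<dots> \<le> norm z * e" using e[OF \<open>x \<in> S\<close>] by (intro mult_left_mono) auto
    finally show "(\<Sum>y\<in>S. norm (B x y)) + norm (0::complex) \<le> 1 / 100" using z by simp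
  qed
  have Z1: "(\<Sum>P\<in>slice cl S a. exp (z * pair_energy b S P)) = Z (\<lambda>_. 0) S a (\<lambda>_. 1)"
    by (simp add: Z_def en)
  show "(\<Sum>P\<in>slice cl S a. exp (z * pair_energy b S P)) \<noteq> 0"
    unfolding Z1 using no_cancellation(2)[OF S(1) small_field S(2)] .
  have "(\<Sum>P\<in>slice cl S a. pair_energy b S P * exp (z * pair_energy b S P))
      = Z (\<lambda>_. 0) S a (\<lambda>P. \<Sum>x\<in>S. \<Sum>y\<in>S. of_real (b x y / 2) * (spin P x * spin P y))"
    unfolding Z_def en
    by (intro sum.cong refl arg_cong2[where f = "(*)"])
       (simp add: pair_energy_def of_real_spin sum_divide_distrib mult.assoc)
  also have "\<dots> = (\<Sum>x\<in>S. \<Sum>y\<in>S. of_real (b x y / 2) * Z (\<lambda>_. 0) S a (\<lambda>P. spin P x * spin P y))"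
    unfolding Z_sum Z_scale ..
  also have "norm \<dots> \<le> (\<Sum>x\<in>S. \<Sum>y\<in>S. (\<bar>b x y\<bar> / 2) * (4 * norm (Z (\<lambda>_. 0) S a (\<lambda>_. 1))))"
  proof (intro sum_norm_le)
    fix x y assume xy: "x \<in> S" "y \<in> S"
    show "norm (of_real (b x y / 2) * Z (\<lambda>_. 0) S a (\<lambda>P. spin P x * spin P y))
        \<le> (\<bar>b x y\<bar> / 2) * (4 * norm (Z (\<lambda>_. 0) S a (\<lambda>_. 1)))"
    proof (cases "x = y")
      case False
      have n: "norm (of_real (b x y / 2) :: complex) = \<bar>b x y\<bar> / 2" unfolding norm_of_real by simp
      show ?thesis unfolding norm_mult n
        using two_point_bound[OF S(1) xy False small_field, of a] by (intro mult_left_mono) auto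
    qed (simp add: b)
  qed
  also have "\<dots> = (\<Sum>x\<in>S. 2 * norm (Z (\<lambda>_. 0) S a (\<lambda>_. 1)) * (\<Sum>y\<in>S. \<bar>b x y\<bar>))"
    unfolding sum_distrib_left by (intro sum.cong) auto
  also have "\<dots> \<le> (\<Sum>x\<in>S. 2 * norm (Z (\<lambda>_. 0) S a (\<lambda>_. 1)) * e)"
    by (intro sum_mono mult_left_mono e) auto
  also have "\<dots> = 2 * card S * e * norm (Z (\<lambda>_. 0) S a (\<lambda>_. 1))" by simp
  finally show "norm (\<Sum>P\<in>slice cl S a. pair_energy b S P * exp (z * pair_energy b S P))
           \<le> 2 * card S * e * norm (\<Sum>P\<in>slice cl S a. exp (z * pair_energy b S P))"
    unfolding Z1 .
qed

text \<open>Here \<open>\<kappa>\<close> lists the derivatives at 0 of the logarithm of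
  \<open>A\<close>. The logarithmic derivative is bounded by \<open>G\<close> on the disc, so
  Cauchy's inequality bounds the n-th Taylor coefficient of the logarithm by
  \<open>G / r ^ (n - 1)\<close> for positive n. As \<open>r >= 2\<close>, the remaining geometric
  tail is at most twice its first term.\<close>

lemma log_taylor_bound:
  fixes A :: "complex \<Rightarrow> complex" and \<kappa> \<mu> :: "nat \<Rightarrow> real"
  assumes hol: "A holomorphic_on UNIV" and nz: "\<And>z. norm z \<le> r \<Longrightarrow> A z \<noteq> 0"
    and G: "\<And>z. norm z \<le> r \<Longrightarrow> norm (deriv A z) \<le> G * norm (A z)"
    and r: "r \<ge> 2"
    and mu: "\<And>n. (deriv ^^ n) A 0 = of_real (\<mu> n)" "\<mu> 0 = 1"
    and rec: "\<And>n. \<mu> (Suc n) = (\<Sum>i\<le>n. of_nat (n choose i) * \<kappa> (Suc i) * \<mu> (n - i))"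
    and A1: "A 1 = of_real v" "v > 0"
  shows "(\<lambda>j. \<kappa> (Suc j) / fact (Suc j)) sums ln v"
    and "\<bar>ln v - (\<Sum>j<p. \<kappa> (Suc j) / fact (Suc j))\<bar> \<le> 2 * G / r ^ p"
proof -
  let ?B = "ball (0::complex) r"
  define g where "g z = deriv A z / A z" for z
  have hol': "deriv A holomorphic_on UNIV" using hol by (intro holomorphic_deriv) auto
  have ghol: "g holomorphic_on ?B"
    unfolding g_def by (intro holomorphic_intros holomorphic_on_subset[OF hol] holomorphic_on_subset[OF hol'])
      (use nz in auto)
  have gcont: "continuous_on (cball 0 r) g"
    unfolding g_def
    by (intro continuous_intros holomorphic_on_imp_continuous_on holomorphic_on_subset[OF hol] holomorphic_on_subset[OF hol'])
      (use nz in auto)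
  have gbound: "norm (g z) \<le> G" if "norm z \<le> r" for z
    using G[OF that] nz[OF that] by (simp add: g_def norm_divide divide_le_eq)
  have gA: "deriv A z = g z * A z" if "z \<in> ?B" for z
    using nz[of z] that by (simp add: g_def)
  have cauchy: "norm ((deriv ^^ n) g 0) \<le> fact n * G / r ^ n" for n
    by (rule Cauchy_inequality[OF ghol gcont]) (use r gbound in auto)
  \<comment> \<open>Leibniz' rule for \<open>deriv A = g * A\<close> at 0 has the shape of
    \<open>rec\<close>. In both, the newest coefficient is multiplied by \<open>\<mu> 0 = 1\<close>,
    so both determine it in the same way.\<close>
  have gk: "(deriv ^^ n) g 0 = of_real (\<kappa> (Suc n))" for n
  proof (induction n rule: less_induct)
    case (less n)
    have "of_real (\<mu> (Suc n)) = (deriv ^^ n) (deriv A) 0" using mu(1)[of "Suc n"] by (simp add: funpow_Suc_right del: funpow.simps)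
    also have "\<dots> = (deriv ^^ n) (\<lambda>z. g z * A z) 0"
      by (rule higher_deriv_transform_within_open[of _ ?B])
        (use r gA in \<open>auto intro!: holomorphic_intros ghol holomorphic_on_subset[OF hol] holomorphic_on_subset[OF hol']\<close>)
    also have "\<dots> = (\<Sum>i = 0..n. of_nat (n choose i) * (deriv ^^ i) g 0 * (deriv ^^ (n - i)) A 0)"
      by (rule higher_deriv_mult[of _ ?B]) (use r ghol in \<open>auto intro: holomorphic_on_subset[OF hol]\<close>)
    also have "\<dots> = (\<Sum>i<n. of_nat (n choose i) * (deriv ^^ i) g 0 * (deriv ^^ (n - i)) A 0) + (deriv ^^ n) g 0"
      using mu by (simp add: atLeast0AtMost lessThan_Suc_atMost[symmetric])
    also have "(\<Sum>i<n. of_nat (n choose i) * (deriv ^^ i) g 0 * (deriv ^^ (n - i)) A 0)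
      = of_real (\<Sum>i<n. of_nat (n choose i) * \<kappa> (Suc i) * \<mu> (n - i))"
      by (simp add: less mu)
    also have "(\<Sum>i<n. of_nat (n choose i) * \<kappa> (Suc i) * \<mu> (n - i)) = \<mu> (Suc n) - \<kappa> (Suc n)"
      using rec[of n] mu(2) by (simp add: lessThan_Suc_atMost[symmetric])
    finally show ?case by simp
  qed
  have kb: "\<bar>\<kappa> (Suc n) / fact (Suc n)\<bar> \<le> G / r ^ n" for n
  proof -
    have "\<bar>\<kappa> (Suc n)\<bar> \<le> fact n * G / r ^ n" using cauchy[of n] by (simp add: gk)
    moreover have "G \<ge> 0" using order_trans[OF norm_ge_zero gbound[of 0]] r by simp
    ultimately have "\<bar>\<kappa> (Suc n)\<bar> / fact n \<le> G / r ^ n"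
      by (simp add: divide_le_eq mult_ac)
    moreover have "\<bar>\<kappa> (Suc n)\<bar> / fact (Suc n) \<le> \<bar>\<kappa> (Suc n)\<bar> / fact n"
      by (intro divide_left_mono) (auto simp: fact_mono)
    ultimately show ?thesis by (simp add: abs_divide del: fact_Suc)
  qed
  obtain F where F: "F holomorphic_on ?B" "\<And>z. z \<in> ?B \<Longrightarrow> A z = exp (F z)"
    using contractible_imp_holomorphic_log[of A ?B] hol nz
    by (metis convex_ball convex_imp_contractible holomorphic_on_subset mem_ball_0 order.strict_implies_order top_greatest)
  have dF: "deriv F z = g z" if "z \<in> ?B" for z
  proof -
    have d: "(F has_field_derivative deriv F z) (at z)"
      using F(1) that by (intro holomorphic_derivI[of _ ?B]) auto
    have "deriv A z = deriv (\<lambda>z. exp (F z)) z"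
      by (rule deriv_cong_ev) (use that F(2) in \<open>auto intro!: eventually_nhds_in_open[of ?B, THEN eventually_mono]\<close>)
    also have "\<dots> = exp (F z) * deriv F z"
      by (rule DERIV_imp_deriv) (auto intro!: derivative_eq_intros d)
    finally show ?thesis using F(2)[OF that] by (simp add: g_def)
  qed
  have hF: "(deriv ^^ Suc n) F 0 = of_real (\<kappa> (Suc n))" for n
  proof -
    have "(deriv ^^ Suc n) F 0 = (deriv ^^ n) (deriv F) 0" by (simp add: funpow_Suc_right del: funpow.simps)
    also have "\<dots> = (deriv ^^ n) g 0"
      by (rule higher_deriv_transform_within_open[of _ ?B])
        (use r dF F(1) ghol in \<open>auto intro!: holomorphic_deriv\<close>)
    finally show ?thesis by (simp add: gk)
  qed
  have "(\<lambda>n. (deriv ^^ n) F 0 / fact n * (1 - 0) ^ n) sums F 1"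
    by (rule holomorphic_power_series[OF F(1)]) (use r in auto)
  then have "(\<lambda>n. (deriv ^^ Suc n) F 0 / fact (Suc n)) sums (F 1 - F 0)"
    using sums_Suc_iff[of "\<lambda>n. (deriv ^^ n) F 0 / fact n * (1 - 0) ^ n" "F 1 - F 0"]
    by (simp del: fact_Suc funpow.simps)
  then have sumsF: "(\<lambda>n. of_real (\<kappa> (Suc n) / fact (Suc n)) :: complex) sums (F 1 - F 0)"
    unfolding hF by (simp del: fact_Suc)
  have geo: "(\<lambda>n. G / r ^ n) sums (G * (1 / (1 - 1 / r)))"
    using sums_mult[OF geometric_sums[of "1 / r"], of G] r by (simp add: power_divide)
  have summ: "summable (\<lambda>n. \<kappa> (Suc n) / fact (Suc n))"
    by (rule summable_comparison_test[OF _ sums_summable[OF geo]]) (use kb in \<open>auto simp del: fact_Suc\<close>)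
  define s where "s = (\<Sum>n. \<kappa> (Suc n) / fact (Suc n))"
  have sums: "(\<lambda>n. \<kappa> (Suc n) / fact (Suc n)) sums s" unfolding s_def using summ by (rule summable_sums)
  \<comment> \<open>The branch \<open>F\<close> is only fixed up to multiples of 2 pi i. As the
    series has real terms, \<open>F 1 - F 0\<close> is real and must be the real logarithm of
    \<open>v\<close>.\<close>
  have "F 1 - F 0 = of_real s"
    using sumsF sums_of_real[OF sums, where ?'a = complex] sums_unique2 by blast
  moreover have "exp (F 1 - F 0) = of_real v"
    using F(2)[of 1] F(2)[of 0] mu(1)[of 0] mu(2) A1 r by (simp add: exp_diff)
  ultimately have "of_real (exp s) = (of_real v :: complex)" by (simp add: exp_of_real)
  then have "exp s = v" by (simp only: of_real_eq_iff)
  then have s: "s = ln v" by auto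
  show "(\<lambda>j. \<kappa> (Suc j) / fact (Suc j)) sums ln v" using sums s by simp
  have tail: "(\<lambda>n. \<kappa> (Suc (n + p)) / fact (Suc (n + p))) sums (ln v - (\<Sum>j<p. \<kappa> (Suc j) / fact (Suc j)))"
    using sums_iff_shift'[of "\<lambda>n. \<kappa> (Suc n) / fact (Suc n)" p "ln v"] sums s by blast
  have geop: "(\<lambda>n. G / r ^ (n + p)) sums (G * (1 / (1 - 1 / r)) / r ^ p)"
    using sums_divide[OF geo, of "r ^ p"] by (simp add: power_add)
  have "\<bar>ln v - (\<Sum>j<p. \<kappa> (Suc j) / fact (Suc j))\<bar> \<le> G * (1 / (1 - 1 / r)) / r ^ p"
    unfolding sums_unique[OF tail] sums_unique[OF geop] real_norm_def[symmetric]
    by (rule norm_suminf_le) (use kb sums_summable[OF geop] in \<open>auto simp del: fact_Suc\<close>)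
  also have "\<dots> \<le> G * 2 / r ^ p"
  proof -
    have "G \<ge> 0" using order_trans[OF norm_ge_zero gbound[of 0]] r by simp
    moreover have "1 / (1 - 1 / r) \<le> 2" using r by (simp add: field_simps)
    ultimately show ?thesis using r by (intro divide_right_mono mult_left_mono) auto
  qed
  finally show "\<bar>ln v - (\<Sum>j<p. \<kappa> (Suc j) / fact (Suc j))\<bar> \<le> 2 * G / r ^ p" by (simp add: mult.commute)
qed

text \<open>The radius is \<open>1 / (100 * e)\<close>, for which the scaled row sums just reach
  1/100, and \<open>G = 2 * card S * e\<close>; then \<open>2 * G / r ^ p\<close> is the stated
  bound, and \<open>e <= 1 / 200\<close> expresses \<open>r >= 2\<close>. The cumulants enter only
  through their recursion, so that any construction of them can be inserted.\<close>

theorem canonical_cumulant_expansion: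
  fixes b :: "'a \<Rightarrow> 'a \<Rightarrow> real" and e :: real
  assumes S: "finite S" "slice cl S a \<noteq> {}" and b: "\<And>x y. b x y = b y x" "\<And>x. b x x = 0"
    and e: "\<And>x. x \<in> S \<Longrightarrow> (\<Sum>y\<in>S. \<bar>b x y\<bar>) \<le> e" "0 < e" "e \<le> 1 / 200"
    and rec: "\<And>n. avg cl S a (\<lambda>P. pair_energy b S P ^ Suc n)
      = (\<Sum>i\<le>n. of_nat (n choose i) * \<kappa> (Suc i) * avg cl S a (\<lambda>P. pair_energy b S P ^ (n - i)))"
  shows "(\<lambda>j. \<kappa> (Suc j) / fact (Suc j)) sums ln (avg cl S a (\<lambda>P. exp (pair_energy b S P)))"
    and "\<bar>ln (avg cl S a (\<lambda>P. exp (pair_energy b S P))) - (\<Sum>j<p. \<kappa> (Suc j) / fact (Suc j))\<bar>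
      \<le> 4 * card S * e * (100 * e) ^ p"
proof -
  let ?W = "pair_energy b S" and ?\<Omega> = "slice cl S a"
  define A where "A z = (\<Sum>P\<in>?\<Omega>. exp (z * ?W P)) / of_nat (card ?\<Omega>)" for z :: complex
  define D where "D n z = (\<Sum>P\<in>?\<Omega>. of_real (?W P) ^ n * exp (z * ?W P)) / of_nat (card ?\<Omega>)" for n and z :: complex
  have c: "card ?\<Omega> > 0" using S finite_slice[OF S(1)] by (simp add: card_gt_0_iff)
  have dD: "(D n has_field_derivative D (Suc n) z) (at z)" for n z
    unfolding D_def using c by (auto intro!: derivative_eq_intros sum.cong simp: sum_divide_distrib)
  have hD: "(deriv ^^ n) A = D n" for n
  proof (induction n)
    case 0
    show ?case by (simp add: fun_eq_iff A_def D_def)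
  next
    case (Suc n)
    have "(deriv ^^ Suc n) A = deriv (D n)" by (simp add: Suc.IH)
    also have "\<dots> = D (Suc n)" using dD by (intro ext DERIV_imp_deriv)
    finally show ?case .
  qed
  have hol: "A holomorphic_on UNIV"
    unfolding A_def by (intro holomorphic_intros) (use c in auto)
  have le: "norm z * e \<le> 1 / 100" if "norm z \<le> 1 / (100 * e)" for z :: complex
    using mult_right_mono[OF that, of e] e(2) by simp
  have nz: "A z \<noteq> 0" if "norm z \<le> 1 / (100 * e)" for z
    using exponential_sum_bounds(1)[where z = z, OF S b e(1) le[OF that]] c by (auto simp: A_def)
  have G: "norm (deriv A z) \<le> 2 * card S * e * norm (A z)" if "norm z \<le> 1 / (100 * e)" for z
  proof -
    have "deriv A z = D 1 z" using hD[of 1] by (simp add: fun_eq_iff)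
    then show ?thesis
      using exponential_sum_bounds(2)[where z = z, OF S b e(1) le[OF that]] c
      by (simp add: A_def D_def norm_divide divide_right_mono)
  qed
  have mu: "(deriv ^^ n) A 0 = of_real (avg cl S a (\<lambda>P. ?W P ^ n))" for n
    unfolding hD by (simp add: D_def avg_def)
  have mu0: "avg cl S a (\<lambda>P. ?W P ^ 0) = 1" using c by (simp add: avg_def)
  have A1: "A 1 = of_real (avg cl S a (\<lambda>P. exp (?W P)))"
    by (simp add: A_def avg_def exp_of_real)
  have pos: "avg cl S a (\<lambda>P. exp (?W P)) > 0"
    unfolding avg_def using c S finite_slice[OF S(1)] by (intro divide_pos_pos sum_pos) auto
  have r: "1 / (100 * e) \<ge> 2" using e by (simp add: field_simps)
  note * = log_taylor_bound[OF hol nz G r mu mu0 rec A1 pos]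
  show "(\<lambda>j. \<kappa> (Suc j) / fact (Suc j)) sums ln (avg cl S a (\<lambda>P. exp (?W P)))" using *(1) .
  have "\<bar>ln (avg cl S a (\<lambda>P. exp (?W P))) - (\<Sum>j<p. \<kappa> (Suc j) / fact (Suc j))\<bar>
     \<le> 2 * (2 * card S * e) / (1 / (100 * e)) ^ p" using *(2) .
  also have "\<dots> = 4 * card S * e * (100 * e) ^ p" by (simp add: power_divide)
  finally show "\<bar>ln (avg cl S a (\<lambda>P. exp (?W P))) - (\<Sum>j<p. \<kappa> (Suc j) / fact (Suc j))\<bar>
      \<le> 4 * card S * e * (100 * e) ^ p" .
qed

subsection \<open>Joint cumulants\<close>

text \<open>Here \<open>m S\<close> stands for the moment of the subfamily indexed by \<open>S\<close>. Singling out the block that contains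
  \<open>Min I\<close> replaces the usual sum over set partitions by a recursion.\<close>
function joint_cumulant :: "(nat set \<Rightarrow> real) \<Rightarrow> nat set \<Rightarrow> real" where
  "joint_cumulant m I = (if finite I
     then m I - (\<Sum>S | S \<subset> I \<and> Min I \<in> S. joint_cumulant m S * m (I - S)) else 0)"
  by pat_completeness auto
termination
  by (relation "Wellfounded.measure (\<lambda>(m, I). card I)") (auto intro: psubset_card_mono)

declare joint_cumulant.simps [simp del]

lemma joint_cumulant_unfold:
  assumes "finite I" "I \<noteq> {}" "m {} = 1"
  shows "m I = (\<Sum>S | S \<subseteq> I \<and> Min I \<in> S. joint_cumulant m S * m (I - S))"
proof -
  have "{S. S \<subseteq> I \<and> Min I \<in> S} = insert I {S. S \<subset> I \<and> Min I \<in> S}"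
    using Min_in[OF assms(1,2)] by auto
  moreover have "finite {S. S \<subset> I \<and> Min I \<in> S}"
    by (rule finite_subset[of _ "Pow I"]) (use assms in auto)
  ultimately show ?thesis using assms by (simp add: joint_cumulant.simps[of m I])
qed

lemma joint_cumulant_cong:
  assumes "\<And>S. S \<subseteq> I \<Longrightarrow> m S = m' S"
  shows "joint_cumulant m I = joint_cumulant m' I"
proof (cases "finite I")
  case True
  then show ?thesis using assms
  proof (induction I rule: finite_psubset_induct)
    case (psubset I)
    show ?case unfolding joint_cumulant.simps[of _ I] using psubset
      by (auto intro!: sum.cong arg_cong2[where f = "(-)"] arg_cong2[where f = "(*)"])
  qed
qed (simp add: joint_cumulant.simps)

text \<open>In every product of the recursion, \<open>i\<close> belongs either to the block or to
  its complement, and both factors vanish in their case.\<close>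

lemma joint_cumulant_zero:
  assumes "finite I" "i \<in> I" "\<And>S. S \<subseteq> I \<Longrightarrow> i \<in> S \<Longrightarrow> m S = 0"
  shows "joint_cumulant m I = 0"
  using assms
proof (induction I rule: finite_psubset_induct)
  case (psubset I)
  have "joint_cumulant m S * m (I - S) = 0" if "S \<subset> I" for S
  proof (cases "i \<in> S")
    case True
    then have "joint_cumulant m S = 0" using psubset.prems that by (intro psubset.IH) auto
    then show ?thesis by simp
  next
    case False
    then show ?thesis using psubset.prems by simp
  qed
  then show ?case unfolding joint_cumulant.simps[of m I] using psubset.prems by (simp add: sum.neutral)
qed

text \<open>Let the minimum lie in \<open>I1\<close>. In the recursion, blocks that meet both parts
  vanish by induction. The blocks inside \<open>I1\<close> resum to \<open>m I1 * m I2\<close>,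
  which is \<open>m I\<close>, so nothing is left for the cumulant.\<close>

lemma joint_cumulant_independent:
  assumes "finite (I1 \<union> I2)" "I1 \<noteq> {}" "I2 \<noteq> {}" "I1 \<inter> I2 = {}" "m {} = 1"
    and "\<And>S. S \<subseteq> I1 \<union> I2 \<Longrightarrow> m S = m (S \<inter> I1) * m (S \<inter> I2)"
  shows "joint_cumulant m (I1 \<union> I2) = 0"
proof -
  have "joint_cumulant m I = 0" if "finite I" "I = I1 \<union> I2" "I1 \<noteq> {}" "I2 \<noteq> {}" "I1 \<inter> I2 = {}"
    "\<And>S. S \<subseteq> I \<Longrightarrow> m S = m (S \<inter> I1) * m (S \<inter> I2)" for I I1 I2
    using that
  proof (induction I arbitrary: I1 I2 rule: finite_psubset_induct)
    case (psubset I I1 I2)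
    have *: "joint_cumulant m I = 0"
      if I: "I = I1 \<union> I2" "I1 \<noteq> {}" "I2 \<noteq> {}" "I1 \<inter> I2 = {}" and min: "Min I \<in> I1"
        and fac: "\<And>S. S \<subseteq> I \<Longrightarrow> m S = m (S \<inter> I1) * m (S \<inter> I2)" for I1 I2
    proof -
      have fin: "finite I1" using psubset.hyps I by auto
      have minI1: "Min I1 = Min I"
        using min psubset.hyps I fin by (metis Min_eqI Min_le UnI1)
      \<comment> \<open>The block \<open>S = I1\<close> is a proper subset of \<open>I\<close>
        because \<open>I2\<close> is nonempty. So the surviving terms are the complete expansion of
        \<open>m I1\<close>, not that of \<open>m I1\<close> minus its own cumulant.\<close>
      have "(\<Sum>S | S \<subset> I \<and> Min I \<in> S. joint_cumulant m S * m (I - S))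
          = (\<Sum>S | S \<subseteq> I1 \<and> Min I1 \<in> S. joint_cumulant m S * m (I1 - S) * m I2)"
      proof (rule sum.mono_neutral_cong_right)
        show "finite {S. S \<subset> I \<and> Min I \<in> S}"
          by (rule finite_subset[of _ "Pow I"]) (use psubset.hyps in auto)
        show "{S. S \<subseteq> I1 \<and> Min I1 \<in> S} \<subseteq> {S. S \<subset> I \<and> Min I \<in> S}" using I minI1 by auto
        show "\<forall>S\<in>{S. S \<subset> I \<and> Min I \<in> S} - {S. S \<subseteq> I1 \<and> Min I1 \<in> S}. joint_cumulant m S * m (I - S) = 0"
        proof
          fix S assume "S \<in> {S. S \<subset> I \<and> Min I \<in> S} - {S. S \<subseteq> I1 \<and> Min I1 \<in> S}"
          then have S: "S \<subset> I" "Min I \<in> S" "\<not> S \<subseteq> I1" using minI1 by auto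
          have "joint_cumulant m S = 0"
          proof (rule psubset.IH[of _ "S \<inter> I1" "S \<inter> I2"])
            show "m T = m (T \<inter> (S \<inter> I1)) * m (T \<inter> (S \<inter> I2))" if "T \<subseteq> S" for T
              using fac[of T] that S by (simp add: Int_absorb2 inf.assoc[symmetric])
          qed (use S I min minI1 in auto)
          then show "joint_cumulant m S * m (I - S) = 0" by simp
        qed
        fix S assume "S \<in> {S. S \<subseteq> I1 \<and> Min I1 \<in> S}"
        then have "(I - S) \<inter> I1 = I1 - S" "(I - S) \<inter> I2 = I2" using I by auto
        then show "joint_cumulant m S * m (I - S) = joint_cumulant m S * m (I1 - S) * m I2"
          using fac[of "I - S"] by simp
      qed
      also have "\<dots> = m I1 * m I2"
        using joint_cumulant_unfold[of I1 m] fin I assms(5) by (simp add: sum_distrib_right)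
      also have "\<dots> = m I" using fac[of I] I by (simp add: Int_absorb1 Int_absorb2)
      finally show ?thesis using psubset.hyps by (simp add: joint_cumulant.simps[of m I])
    qed
    have "Min I \<in> I" by (rule Min_in) (use psubset.hyps psubset.prems in auto)
    then show ?case using *[of I1 I2] *[of I2 I1] psubset.prems
      by (metis Int_commute Un_commute Un_iff mult.commute)
  qed
  from this[OF assms(1) refl assms(2-4) assms(6)] show ?thesis .
qed

lemma sum_PiE_Un:
  fixes f g :: "(nat \<Rightarrow> 'e) \<Rightarrow> real"
  assumes "S \<inter> T = {}"
    and f: "\<And>e e'. (\<And>i. i \<in> S \<Longrightarrow> e i = e' i) \<Longrightarrow> f e = f e'"
    and g: "\<And>e e'. (\<And>i. i \<in> T \<Longrightarrow> e i = e' i) \<Longrightarrow> g e = g e'"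
  shows "(\<Sum>e\<in>PiE (S \<union> T) (\<lambda>_. E). f e * g e) = (\<Sum>e\<in>PiE S (\<lambda>_. E). f e) * (\<Sum>e\<in>PiE T (\<lambda>_. E). g e)"
proof -
  have "(\<Sum>e\<in>PiE (S \<union> T) (\<lambda>_. E). f e * g e)
     = (\<Sum>(u, v)\<in>PiE S (\<lambda>_. E) \<times> PiE T (\<lambda>_. E). f u * g v)"
  proof (rule sum.reindex_bij_witness[where j = "\<lambda>e. (restrict e S, restrict e T)"
        and i = "\<lambda>(u, v) i. if i \<in> S then u i else if i \<in> T then v i else undefined"])
    show "(case case (u::_ \<times> _) of (u, v) \<Rightarrow> (\<lambda>i. if i \<in> S then u i else if i \<in> T then v i else undefined) of e \<Rightarrow>
        (restrict e S, restrict e T)) = u" if "u \<in> PiE S (\<lambda>_. E) \<times> PiE T (\<lambda>_. E)" for u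
      using that assms(1) by (auto simp: fun_eq_iff PiE_def extensional_def restrict_def)
    show "(case (restrict e S, restrict e T) of (u, v) \<Rightarrow> f u * g v) = f e * g e" if "e \<in> PiE (S \<union> T) (\<lambda>_. E)" for e
      using f[of "restrict e S" e] g[of "restrict e T" e] by simp
  qed (use assms(1) in \<open>auto simp: fun_eq_iff PiE_def extensional_def Pi_def\<close>)
  also have "\<dots> = (\<Sum>e\<in>PiE S (\<lambda>_. E). f e) * (\<Sum>e\<in>PiE T (\<lambda>_. E). g e)"
    by (simp add: sum_product sum.cartesian_product)
  finally show ?thesis .
qed

text \<open>Multilinearity. A block and its complement carry disjoint sets of labels, so the sum
  over labellings factors in each product of the recursion.\<close>

lemma sum_joint_cumulant:
  fixes m :: "(nat \<Rightarrow> 'e) \<Rightarrow> nat set \<Rightarrow> real"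
  assumes "finite I" and m: "\<And>e e' S. (\<And>i. i \<in> S \<Longrightarrow> e i = e' i) \<Longrightarrow> m e S = m e' S"
  shows "(\<Sum>e\<in>PiE I (\<lambda>_. E). joint_cumulant (m e) I)
    = joint_cumulant (\<lambda>S. \<Sum>e\<in>PiE S (\<lambda>_. E). m e S) I"
  using assms(1)
proof (induction I rule: finite_psubset_induct)
  case (psubset I)
  have "(\<Sum>e\<in>PiE I (\<lambda>_. E). joint_cumulant (m e) S * m e (I - S))
      = joint_cumulant (\<lambda>S. \<Sum>e\<in>PiE S (\<lambda>_. E). m e S) S * (\<Sum>e\<in>PiE (I - S) (\<lambda>_. E). m e (I - S))"
    if "S \<subset> I" for S
  proof -
    have "(\<Sum>e\<in>PiE (S \<union> (I - S)) (\<lambda>_. E). joint_cumulant (m e) S * m e (I - S))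
      = (\<Sum>e\<in>PiE S (\<lambda>_. E). joint_cumulant (m e) S) * (\<Sum>e\<in>PiE (I - S) (\<lambda>_. E). m e (I - S))"
      by (rule sum_PiE_Un) (auto intro!: joint_cumulant_cong m)
    moreover have "S \<union> (I - S) = I" using that by auto
    ultimately show ?thesis using psubset.IH[OF that] by simp
  qed
  then show ?case using psubset.hyps
    by (simp add: joint_cumulant.simps[of _ I] sum_subtractf sum.swap[of _ "{S. S \<subset> I \<and> Min I \<in> S}"])
qed

text \<open>The recursion refers to the order of the indices through \<open>Min\<close>. A bijection
  that sends minimum to minimum carries the blocks of one recursion to those of the other, and the
  block sizes agree.\<close>

lemma joint_cumulant_card:
  assumes "finite I" "finite J" "card I = card J"
  shows "joint_cumulant (\<lambda>S. \<mu> (card S)) I = joint_cumulant (\<lambda>S. \<mu> (card S)) J"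
  using assms
proof (induction I arbitrary: J rule: finite_psubset_induct)
  case (psubset I J)
  show ?case
  proof (cases "I = {}")
    case True
    then show ?thesis using psubset.prems by simp
  next
    case False
    then have J: "J \<noteq> {}" using psubset by auto
    have "card (I - {Min I}) = card (J - {Min J})" using False J psubset by simp
    then obtain g where g: "bij_betw g (I - {Min I}) (J - {Min J})"
      using psubset by (metis bij_betw_iff_card finite_Diff)
    define f where "f = g(Min I := Min J)"
    have "bij_betw f ((I - {Min I}) \<union> {Min I}) ((J - {Min J}) \<union> {Min J})"
      unfolding f_def by (rule bij_betw_combine) (use g in \<open>auto simp: bij_betw_def inj_on_def\<close>)
    moreover have "(I - {Min I}) \<union> {Min I} = I" "(J - {Min J}) \<union> {Min J} = J"
      using Min_in[OF psubset.hyps False] Min_in[OF psubset.prems(1) J] by blast+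
    ultimately have f: "bij_betw f I J" by simp
    have fM: "f (Min I) = Min J" by (simp add: f_def)
    have inj: "inj_on f I" and im: "f ` I = J" using f by (auto simp: bij_betw_def)
    have MI: "Min I \<in> I" using False psubset by simp
    have "(`) f ` {S. S \<subset> I \<and> Min I \<in> S} = {S. S \<subset> J \<and> Min J \<in> S}" (is "_ ` ?A = ?B")
    proof (intro equalityI subsetI)
      fix T assume "T \<in> (`) f ` ?A"
      then obtain S where S: "T = f ` S" "S \<subset> I" "Min I \<in> S" by auto
      then have "f ` S \<noteq> J" using inj_on_image_eq_iff[OF inj, of S I] im by auto
      moreover have "Min J \<in> T" using S(1,3) fM by (metis imageI)
      moreover have "T \<subseteq> J" using S im by blast
      ultimately show "T \<in> ?B" using S(1) by blast
    next
      fix T assume T: "T \<in> ?B"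
      then obtain S where S: "T = f ` S" "S \<subseteq> I" using im by (metis mem_Collect_eq psubset_imp_subset subset_imageE)
      have "Min J \<in> f ` S" using T S(1) by blast
      then obtain i where i: "i \<in> S" "f i = Min J" by auto
      then have "i = Min I" using inj_onD[OF inj, of i "Min I"] S(2) MI fM by auto
      moreover have "S \<noteq> I" using T S im by blast
      ultimately have "S \<in> ?A" using S i by blast
      then show "T \<in> (`) f ` ?A" unfolding S(1) by (rule imageI)
    qed
    then have bij: "bij_betw ((`) f) ?A ?B"
      by (intro bij_betw_subset[OF bij_betw_Pow[OF f]]) auto
    have "(\<Sum>S\<in>?A. joint_cumulant (\<lambda>S. \<mu> (card S)) S * \<mu> (card (I - S)))
       = (\<Sum>S\<in>?A. joint_cumulant (\<lambda>S. \<mu> (card S)) (f ` S) * \<mu> (card (J - f ` S)))"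
    proof (rule sum.cong[OF refl])
      fix S assume "S \<in> ?A"
      then have S: "S \<subset> I" "finite S" using psubset.hyps by (auto dest: finite_subset)
      have c: "card (f ` S) = card S" using S inj by (meson card_image inj_on_subset psubset_imp_subset)
      have "card (J - f ` S) = card (I - S)"
        using S c im psubset.hyps psubset.prems by (subst (1 2) card_Diff_subset) auto
      moreover have "joint_cumulant (\<lambda>S. \<mu> (card S)) S = joint_cumulant (\<lambda>S. \<mu> (card S)) (f ` S)"
        by (rule psubset.IH) (use S c in auto)
      ultimately show "joint_cumulant (\<lambda>S. \<mu> (card S)) S * \<mu> (card (I - S))
        = joint_cumulant (\<lambda>S. \<mu> (card S)) (f ` S) * \<mu> (card (J - f ` S))" by simp
    qed
    also have "\<dots> = (\<Sum>S\<in>?B. joint_cumulant (\<lambda>S. \<mu> (card S)) S * \<mu> (card (J - S)))"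
      by (rule sum.reindex_bij_betw[OF bij])
    finally show ?thesis using psubset by (simp add: joint_cumulant.simps[of _ I] joint_cumulant.simps[of _ J])
  qed
qed

text \<open>The case of equal variables: the moment of a subfamily depends on its size only. The
  index set is immaterial by \<open>joint_cumulant_card\<close>.\<close>

definition cumulant :: "(nat \<Rightarrow> real) \<Rightarrow> nat \<Rightarrow> real" where
  "cumulant \<mu> n = joint_cumulant (\<lambda>S. \<mu> (card S)) {..<n}"

lemma sum_Pow_card:
  assumes "finite A"
  shows "(\<Sum>T\<in>Pow A. F (card T)) = (\<Sum>i\<le>card A. of_nat (card A choose i) * F i :: real)"
proof -
  have "(\<Sum>T\<in>Pow A. F (card T)) = (\<Sum>i\<in>{..card A}. \<Sum>T\<in>{T\<in>Pow A. card T = i}. F (card T))"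
    by (rule sum.group[symmetric]) (use assms card_mono in auto)
  also have "\<dots> = (\<Sum>i\<le>card A. of_nat (card A choose i) * F i)"
  proof (rule sum.cong[OF refl])
    fix i
    have "{T \<in> Pow A. card T = i} = {T. T \<subseteq> A \<and> card T = i}" by auto
    then show "(\<Sum>T\<in>{T\<in>Pow A. card T = i}. F (card T)) = of_nat (card A choose i) * F i"
      using n_subsets[OF assms, of i] by simp
  qed
  finally show ?thesis .
qed

text \<open>The block of 0 in \<open>{..n}\<close> is 0 together with a subset of
  \<open>{1..n}\<close>, and \<open>n choose i\<close> of these have i further elements.\<close>

lemma cumulant_recursion:
  assumes "\<mu> 0 = 1"
  shows "\<mu> (Suc n) = (\<Sum>i\<le>n. of_nat (n choose i) * cumulant \<mu> (Suc i) * \<mu> (n - i))"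
proof -
  let ?F = "\<lambda>i. cumulant \<mu> (Suc i) * \<mu> (n - i)"
  have M: "Min {..n} = (0::nat)" by (rule Min_eqI) auto
  have inj: "inj_on (insert 0) (Pow {1..n})" by (rule inj_onI) (auto dest!: insert_ident[THEN iffD1, rotated 2])
  have im: "{S. S \<subseteq> {..n} \<and> 0 \<in> S} = insert 0 ` Pow {1..n}"
  proof (intro equalityI subsetI)
    fix S assume S: "S \<in> {S. S \<subseteq> {..n} \<and> 0 \<in> S}"
    then have "S = insert 0 (S - {0})" by auto
    moreover have "S - {0} \<in> Pow {1..n}" using S by (auto simp: Suc_le_eq)
    ultimately show "S \<in> insert 0 ` Pow {1..n}" by blast
  qed auto
  have "\<mu> (Suc n) = \<mu> (card {..n})" by simp
  also have "\<dots> = (\<Sum>S | S \<subseteq> {..n} \<and> Min {..n} \<in> S. joint_cumulant (\<lambda>S. \<mu> (card S)) S * \<mu> (card ({..n} - S)))"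
    by (rule joint_cumulant_unfold[where m = "\<lambda>S. \<mu> (card S)"]) (use assms in auto)
  also have "\<dots> = (\<Sum>T\<in>Pow {1..n}. joint_cumulant (\<lambda>S. \<mu> (card S)) (insert 0 T) * \<mu> (card ({..n} - insert 0 T)))"
    unfolding M im by (subst sum.reindex[OF inj]) simp
  also have "\<dots> = (\<Sum>T\<in>Pow {1..n}. ?F (card T))"
  proof (rule sum.cong[OF refl])
    fix T assume T: "T \<in> Pow {1..n}"
    then have fin: "finite T" and 0: "0 \<notin> T" by (auto dest: finite_subset)
    then have c: "card (insert 0 T) = Suc (card T)" by simp
    have "card ({..n} - insert 0 T) = n - card T"
      by (subst card_Diff_subset) (use T fin c in auto)
    moreover have "joint_cumulant (\<lambda>S. \<mu> (card S)) (insert 0 T) = cumulant \<mu> (Suc (card T))"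
      unfolding cumulant_def by (rule joint_cumulant_card) (use fin c in auto)
    ultimately show "joint_cumulant (\<lambda>S. \<mu> (card S)) (insert 0 T) * \<mu> (card ({..n} - insert 0 T)) = ?F (card T)"
      by simp
  qed
  also have "\<dots> = (\<Sum>i\<le>n. of_nat (n choose i) * ?F i)" using sum_Pow_card[of "{1..n}" ?F] by simp
  finally show ?thesis by (simp add: mult.assoc)
qed

text \<open>The passage from the total energy to clusters of pair energies: the power of a sum over
  \<open>S\<close> factors is a sum over labellings of \<open>S\<close>, and joint cumulants are
  linear in each label. Of the expectation only finite additivity is used.\<close>

theorem cumulant_sum:
  fixes Ex :: "('b \<Rightarrow> real) \<Rightarrow> real" and U :: "'e \<Rightarrow> 'b \<Rightarrow> real"
  assumes E: "finite E" and lin: "\<And>A :: (nat \<Rightarrow> 'e) set. \<And>F. finite A \<Longrightarrow> Ex (\<lambda>\<omega>. \<Sum>i\<in>A. F i \<omega>) = (\<Sum>i\<in>A. Ex (F i))"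
  shows "cumulant (\<lambda>n. Ex (\<lambda>\<omega>. (\<Sum>e\<in>E. U e \<omega>) ^ n)) p
    = (\<Sum>e\<in>PiE {..<p} (\<lambda>_. E). joint_cumulant (\<lambda>S. Ex (\<lambda>\<omega>. \<Prod>i\<in>S. U (e i) \<omega>)) {..<p})"
proof -
  have "(\<Sum>e\<in>PiE S (\<lambda>_. E). Ex (\<lambda>\<omega>. \<Prod>i\<in>S. U (e i) \<omega>)) = Ex (\<lambda>\<omega>. (\<Sum>e\<in>E. U e \<omega>) ^ card S)"
    if "finite S" for S :: "nat set"
  proof -
    have "(\<Sum>e\<in>PiE S (\<lambda>_. E). \<Prod>i\<in>S. U (e i) \<omega>) = (\<Sum>e\<in>E. U e \<omega>) ^ card S" for \<omega>
      using prod_sum_PiE[of S "\<lambda>_. E" "\<lambda>_ e. U e \<omega>"] that E by simp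
    then show ?thesis using that E by (subst lin[of "PiE S (\<lambda>_. E)" "\<lambda>e \<omega>. \<Prod>i\<in>S. U (e i) \<omega>", symmetric])
      (simp_all add: finite_PiE)
  qed
  then have "joint_cumulant (\<lambda>S. \<Sum>e\<in>PiE S (\<lambda>_. E). Ex (\<lambda>\<omega>. \<Prod>i\<in>S. U (e i) \<omega>)) {..<p}
      = cumulant (\<lambda>n. Ex (\<lambda>\<omega>. (\<Sum>e\<in>E. U e \<omega>) ^ n)) p"
    unfolding cumulant_def by (intro joint_cumulant_cong) (auto dest: finite_subset)
  moreover have "(\<Sum>e\<in>PiE {..<p} (\<lambda>_. E). joint_cumulant (\<lambda>S. Ex (\<lambda>\<omega>. \<Prod>i\<in>S. U (e i) \<omega>)) {..<p})
      = joint_cumulant (\<lambda>S. \<Sum>e\<in>PiE S (\<lambda>_. E). Ex (\<lambda>\<omega>. \<Prod>i\<in>S. U (e i) \<omega>)) {..<p}"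
    by (rule sum_joint_cumulant) (auto intro!: arg_cong[where f = Ex] prod.cong)
  ultimately show ?thesis by simp
qed

subsection \<open>Averages over block spins\<close>

definition local_to :: "('a \<Rightarrow> 'c) \<Rightarrow> 'c set \<Rightarrow> ('a set \<Rightarrow> 'b) \<Rightarrow> bool" where
  "local_to cl X f \<longleftrightarrow> (\<forall>P. f P = f {x\<in>P. cl x \<in> X})"

lemma local_to_mono: "local_to cl X f \<Longrightarrow> X \<subseteq> Y \<Longrightarrow> local_to cl Y f"
  unfolding local_to_def
proof
  fix P assume *: "\<forall>P. f P = f {x \<in> P. cl x \<in> X}" "X \<subseteq> Y"
  have "{x \<in> {x \<in> P. cl x \<in> Y}. cl x \<in> X} = {x \<in> P. cl x \<in> X}" using *(2) by auto
  then show "f P = f {x \<in> P. cl x \<in> Y}" using *(1) by metis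
qed

lemma local_to_spin: "cl x \<in> X \<Longrightarrow> local_to cl X (\<lambda>P. spin P x)"
  by (auto simp: local_to_def spin_def)

lemma local_to_const: "local_to cl X (\<lambda>_. c)"
  by (simp add: local_to_def)

lemma local_to_mult: "local_to cl X f \<Longrightarrow> local_to cl X g \<Longrightarrow> local_to cl X (\<lambda>P. f P * g P)"
  unfolding local_to_def by metis

lemma local_to_add: "local_to cl X f \<Longrightarrow> local_to cl X g \<Longrightarrow> local_to cl X (\<lambda>P. f P + g P)"
  unfolding local_to_def by metis

lemma local_to_sum: "(\<And>i. i \<in> A \<Longrightarrow> local_to cl X (f i)) \<Longrightarrow> local_to cl X (\<lambda>P. \<Sum>i\<in>A. f i P)"
  unfolding local_to_def by (metis (no_types, lifting) sum.cong)

lemma local_to_prod: "(\<And>i. i \<in> A \<Longrightarrow> local_to cl X (f i)) \<Longrightarrow> local_to cl X (\<lambda>P. \<Prod>i\<in>A. f i P)"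
  unfolding local_to_def by (metis (no_types, lifting) prod.cong)

lemma avg_cong: "(\<And>P. P \<in> slice cl S a \<Longrightarrow> f P = g P) \<Longrightarrow> avg cl S a f = avg cl S a g"
  by (simp add: avg_def)

lemma avg_sum: "avg cl S a (\<lambda>P. \<Sum>i\<in>A. f i P) = (\<Sum>i\<in>A. avg cl S a (f i))"
  unfolding avg_def by (subst sum.swap) (simp add: sum_divide_distrib)

lemma avg_add: "avg cl S a (\<lambda>P. f P + g P) = avg cl S a f + avg cl S a g"
  by (simp add: avg_def sum.distrib add_divide_distrib)

lemma avg_scale: "avg cl S a (\<lambda>P. c * f P) = c * avg cl S a f"
  by (simp add: avg_def sum_distrib_left)

lemma avg_const: "finite S \<Longrightarrow> slice cl S a \<noteq> {} \<Longrightarrow> avg cl S a (\<lambda>_. c) = c"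
  using finite_slice[of S cl a] by (simp add: avg_def)

text \<open>Occupation 0 outside \<open>X\<close> forces minus spins there, so the slice for
  \<open>on_cells X a\<close>, still over all of \<open>S\<close>, is a copy of the marginal
  ensemble on the cells in \<open>X\<close>.\<close>

definition on_cells :: "'c set \<Rightarrow> ('c \<Rightarrow> nat) \<Rightarrow> 'c \<Rightarrow> nat" where
  "on_cells X a = (\<lambda>k. if k \<in> X then a k else 0)"

lemma slice_cells:
  assumes "finite S" "P \<in> slice cl S (on_cells X a)" "x \<in> P"
  shows "cl x \<in> X"
proof (rule ccontr)
  assume "cl x \<notin> X"
  then have "card {y\<in>P. cl y = cl x} = 0" using assms by (simp add: slice_def on_cells_def)
  moreover have "finite P" using assms by (auto simp: slice_def dest: finite_subset)
  ultimately show False using assms(3) by auto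
qed

text \<open>The constraint on a configuration is imposed cell by cell, so the uniform measure on a
  slice is a product over cells. This is the source of all independence used later.\<close>

lemma slice_product:
  assumes "finite S"
  shows "bij_betw (\<lambda>(A, B). A \<union> B) (slice cl S (on_cells X a) \<times> slice cl S (on_cells (- X) a)) (slice cl S a)"
proof (rule bij_betw_byWitness[where f' = "\<lambda>P. ({x\<in>P. cl x \<in> X}, {x\<in>P. cl x \<notin> X})"])
  let ?A = "slice cl S (on_cells X a)" and ?B = "slice cl S (on_cells (- X) a)"
  note cellA = slice_cells[OF assms, of _ cl X a] and cellB = slice_cells[OF assms, of _ cl "- X" a]
  show "\<forall>p\<in>?A \<times> ?B. (\<lambda>P. ({x\<in>P. cl x \<in> X}, {x\<in>P. cl x \<notin> X})) ((\<lambda>(A, B). A \<union> B) p) = p"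
    using cellA cellB by fastforce
  show "\<forall>P\<in>slice cl S a. (\<lambda>(A, B). A \<union> B) ({x\<in>P. cl x \<in> X}, {x\<in>P. cl x \<notin> X}) = P" by auto
  show "(\<lambda>(A, B). A \<union> B) ` (?A \<times> ?B) \<subseteq> slice cl S a"
  proof clarify
    fix A B assume A: "A \<in> ?A" and B: "B \<in> ?B"
    have "card {x\<in>A \<union> B. cl x = k} = a k" for k
    proof (cases "k \<in> X")
      case True
      then have "{x\<in>A \<union> B. cl x = k} = {x\<in>A. cl x = k}" using cellB[OF B] by auto
      then show ?thesis using A True by (simp add: slice_def on_cells_def)
    next
      case False
      then have "{x\<in>A \<union> B. cl x = k} = {x\<in>B. cl x = k}" using cellA[OF A] by auto
      then show ?thesis using B False by (simp add: slice_def on_cells_def)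
    qed
    then show "A \<union> B \<in> slice cl S a" using A B by (auto simp: slice_def)
  qed
  show "(\<lambda>P. ({x\<in>P. cl x \<in> X}, {x\<in>P. cl x \<notin> X})) ` slice cl S a \<subseteq> ?A \<times> ?B"
  proof clarify
    fix P assume P: "P \<in> slice cl S a"
    have "card {x\<in>{x\<in>P. cl x \<in> X}. cl x = k} = on_cells X a k"
      "card {x\<in>{x\<in>P. cl x \<notin> X}. cl x = k} = on_cells (- X) a k" for k
      using P by (cases "k \<in> X"; auto simp: slice_def on_cells_def conj_commute cong: conj_cong)+
    then show "{x\<in>P. cl x \<in> X} \<in> ?A \<and> {x\<in>P. cl x \<notin> X} \<in> ?B" using P by (auto simp: slice_def)
  qed
qed

lemma avg_product:
  assumes "finite S" "local_to cl X f" "local_to cl (- X) g"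
  shows "avg cl S a (\<lambda>P. f P * g P) = avg cl S (on_cells X a) f * avg cl S (on_cells (- X) a) g"
proof -
  let ?A = "slice cl S (on_cells X a)" and ?B = "slice cl S (on_cells (- X) a)"
  have "(\<Sum>P\<in>slice cl S a. f P * g P) = (\<Sum>p\<in>?A \<times> ?B. f (case p of (A, B) \<Rightarrow> A \<union> B) * g (case p of (A, B) \<Rightarrow> A \<union> B))"
    by (rule sum.reindex_bij_betw[OF slice_product[OF assms(1)], symmetric])
  also have "\<dots> = (\<Sum>(A, B)\<in>?A \<times> ?B. f A * g B)"
  proof (rule sum.cong[OF refl], clarify)
    fix A B assume A: "A \<in> ?A" and B: "B \<in> ?B"
    note cellA = slice_cells[OF assms(1) A] and cellB = slice_cells[OF assms(1) B]
    have "{x\<in>A \<union> B. cl x \<in> X} = A" using cellA cellB by auto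
    then have "f (A \<union> B) = f A" using assms(2) unfolding local_to_def by metis
    moreover have "{x\<in>A \<union> B. cl x \<in> - X} = B" using cellA cellB by auto
    then have "g (A \<union> B) = g B" using assms(3) unfolding local_to_def by metis
    ultimately show "f (A \<union> B) * g (A \<union> B) = f A * g B" by simp
  qed
  also have "\<dots> = sum f ?A * sum g ?B" by (simp add: sum_product sum.cartesian_product)
  finally have 1: "(\<Sum>P\<in>slice cl S a. f P * g P) = sum f ?A * sum g ?B" .
  have 2: "card (slice cl S a) = card ?A * card ?B"
    using bij_betw_same_card[OF slice_product[OF assms(1)]] by (metis card_cartesian_product)
  show ?thesis unfolding avg_def 1 2 by simp
qed

lemma slice_on_cells_ne: "finite S \<Longrightarrow> slice cl S a \<noteq> {} \<Longrightarrow> slice cl S (on_cells X a) \<noteq> {}"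
  using slice_product[of S cl X a] by (auto simp: bij_betw_def)

lemma avg_local:
  assumes "finite S" "slice cl S a \<noteq> {}" "local_to cl X f"
  shows "avg cl S a f = avg cl S (on_cells X a) f"
  using avg_product[OF assms(1,3) local_to_const[of cl "- X" 1], of a]
    avg_const[OF assms(1) slice_on_cells_ne[OF assms(1,2)]] by simp

lemma avg_indep:
  assumes "finite S" "slice cl S a \<noteq> {}" "local_to cl X f" "local_to cl Y g" "X \<inter> Y = {}"
  shows "avg cl S a (\<lambda>P. f P * g P) = avg cl S a f * avg cl S a g"
proof -
  have g: "local_to cl (- X) g" using assms(4,5) by (auto intro: local_to_mono)
  show ?thesis
    using avg_product[OF assms(1,3) g, of a] avg_local[OF assms(1-3)] avg_local[OF assms(1,2) g] by simp
qed

section \<open>Spin products within one cell and the functions E1 to E4\<close>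

fun spin_count :: "nat \<Rightarrow> nat \<Rightarrow> nat \<Rightarrow> int" where
  "spin_count n 0 \<alpha> = int (n choose \<alpha>)"
| "spin_count n (Suc i) \<alpha> = (if \<alpha> = 0 then 0 else spin_count (n - 1) i (\<alpha> - 1)) - spin_count (n - 1) i \<alpha>"

text \<open>Splitting by the spin at one site of \<open>A\<close>: a plus lowers both the size and
  the number of pluses, a minus lowers the size and changes the sign. Thus
  \<open>spin_count n i \<alpha>\<close> is the coefficient of x^\<alpha> in (x - 1)^i (1 + x)^(n -
  i), a Krawtchouk polynomial up to sign.\<close>

lemma sum_spin_prod:
  assumes "finite T" "A \<subseteq> T"
  shows "(\<Sum>P | P \<subseteq> T \<and> card P = \<alpha>. \<Prod>x\<in>A. spin P x) = (of_int (spin_count (card T) (card A) \<alpha>) :: real)"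
proof -
  have "finite A" using assms finite_subset by auto
  then show ?thesis using assms
  proof (induction A arbitrary: T \<alpha> rule: finite_induct)
    case empty
    then show ?case using n_subsets[of T \<alpha>] by simp
  next
    case (insert x A)
    let ?T = "T - {x}"
    have xT: "x \<in> T" using insert by auto
    have fin: "finite {P. P \<subseteq> T \<and> card P = \<alpha>}" by (rule finite_subset[of _ "Pow T"]) (use insert in auto)
    have "(\<Sum>P | P \<subseteq> T \<and> card P = \<alpha>. \<Prod>y\<in>insert x A. spin P y :: real)
      = (\<Sum>P | P \<subseteq> T \<and> card P = \<alpha>. spin P x * (\<Prod>y\<in>A. spin P y))"
      using insert by simp
    also have "\<dots> = (\<Sum>P | (P \<subseteq> T \<and> card P = \<alpha>) \<and> x \<in> P. spin P x * (\<Prod>y\<in>A. spin P y))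
       + (\<Sum>P | (P \<subseteq> T \<and> card P = \<alpha>) \<and> x \<notin> P. spin P x * (\<Prod>y\<in>A. spin P y))"
      by (subst sum.union_disjoint[symmetric])
        (auto intro!: sum.cong finite_subset[OF _ fin])
    also have "(\<Sum>P | (P \<subseteq> T \<and> card P = \<alpha>) \<and> x \<notin> P. spin P x * (\<Prod>y\<in>A. spin P y))
      = - (\<Sum>P | P \<subseteq> ?T \<and> card P = \<alpha>. \<Prod>y\<in>A. spin P y)"
      unfolding sum_negf[symmetric] by (intro sum.cong) (auto simp: spin_def)
    also have "(\<Sum>P | P \<subseteq> ?T \<and> card P = \<alpha>. \<Prod>y\<in>A. spin P y :: real) = of_int (spin_count (card T - 1) (card A) \<alpha>)"
      using insert.IH[of ?T \<alpha>] insert.prems insert.hyps xT by auto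
    also have "(\<Sum>P | (P \<subseteq> T \<and> card P = \<alpha>) \<and> x \<in> P. spin P x * (\<Prod>y\<in>A. spin P y :: real))
      = (if \<alpha> = 0 then 0 else of_int (spin_count (card T - 1) (card A) (\<alpha> - 1)))"
    proof (cases "\<alpha> = 0")
      case True
      have "{P. (P \<subseteq> T \<and> card P = \<alpha>) \<and> x \<in> P} = {}"
        using True insert.prems finite_subset[of _ T] by fastforce
      then show ?thesis unfolding True by (simp only: sum.empty if_True simp_thms)
    next
      case False
      have "(\<Sum>P | (P \<subseteq> T \<and> card P = \<alpha>) \<and> x \<in> P. spin P x * (\<Prod>y\<in>A. spin P y :: real))
        = (\<Sum>P | P \<subseteq> ?T \<and> card P = \<alpha> - 1. \<Prod>y\<in>A. spin P y)"
      proof (rule sum.reindex_bij_witness[where i = "insert x" and j = "\<lambda>P. P - {x}"])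
        fix P assume P: "P \<in> {P. P \<subseteq> ?T \<and> card P = \<alpha> - 1}"
        then have "finite P" "x \<notin> P" using insert.prems finite_subset[of P T] by auto
        then show "insert x P \<in> {P. (P \<subseteq> T \<and> card P = \<alpha>) \<and> x \<in> P}" "insert x P - {x} = P"
          using P False xT by auto
      next
        fix P assume P: "P \<in> {P. (P \<subseteq> T \<and> card P = \<alpha>) \<and> x \<in> P}"
        then show "insert x (P - {x}) = P" "P - {x} \<in> {P. P \<subseteq> ?T \<and> card P = \<alpha> - 1}"
          using insert.prems finite_subset[of P T] by auto
        show "(\<Prod>y\<in>A. spin (P - {x}) y) = spin P x * (\<Prod>y\<in>A. spin P y :: real)"
          using P insert.hyps by (auto simp: spin_def intro!: prod.cong)
      qed
      then show ?thesis using insert.IH[of ?T "\<alpha> - 1"] insert.prems insert.hyps xT False by auto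
    qed
    finally show ?case using insert.hyps by simp
  qed
qed

text \<open>\<open>F\<close> stands for the expected product of i spins. One more site is plus with
  probability \<alpha>/n and minus with probability (n - \<alpha>)/n, and the other i spins then
  live on n - 1 sites. Taking \<open>F\<close> with real arguments avoids truncated subtraction: at
  \<alpha> = 0 its value at -1 is multiplied by 0.\<close>

lemma spin_count_step:
  assumes "n \<ge> 1" and F: "\<And>\<beta>. real_of_int (spin_count (n - 1) i \<beta>) = F (real n - 1) (real \<beta>) * real ((n - 1) choose \<beta>)"
  shows "real_of_int (spin_count n (Suc i) \<alpha>)
    = (real \<alpha> * F (real n - 1) (real \<alpha> - 1) - (real n - real \<alpha>) * F (real n - 1) (real \<alpha>)) / real n * real (n choose \<alpha>)"
proof (cases "\<alpha> \<le> n")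
  case False
  then show ?thesis using F[of \<alpha>] F[of "\<alpha> - 1"] assms(1) by (simp add: binomial_eq_0)
next
  case True
  obtain n' where n: "n = Suc n'" using assms(1) by (cases n) auto
  have p: "real (n choose \<alpha>) * real \<alpha> = real n * real ((n - 1) choose (\<alpha> - 1))" if "\<alpha> > 0"
  proof -
    obtain b where b: "\<alpha> = Suc b" using \<open>\<alpha> > 0\<close> by (cases \<alpha>) auto
    have "Suc b * (Suc n' choose Suc b) = Suc n' * (n' choose b)" by (rule Suc_times_binomial)
    then have "real (Suc b * (Suc n' choose Suc b)) = real (Suc n' * (n' choose b))" by (rule arg_cong)
    then show ?thesis unfolding n b of_nat_mult by (simp add: mult.commute del: of_nat_Suc binomial_Suc_Suc)
  qed
  have m: "real (n choose \<alpha>) * (real n - real \<alpha>) = real n * real ((n - 1) choose \<alpha>)"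
  proof -
    have "(n - \<alpha>) * (n choose \<alpha>) = n * ((n - 1) choose \<alpha>)"
      using binomial_absorb_comp[of n \<alpha>] by simp
    then have "real ((n - \<alpha>) * (n choose \<alpha>)) = real (n * ((n - 1) choose \<alpha>))" by simp
    then show ?thesis using True by (simp add: of_nat_diff mult.commute)
  qed
  have n0: "real n \<noteq> 0" using assms(1) by simp
  show ?thesis
  proof (cases "\<alpha> = 0")
    case True
    then show ?thesis using F[of \<alpha>] n0 by simp
  next
    case False
    then have "real (\<alpha> - 1) = real \<alpha> - 1" by simp
    then have "real_of_int (spin_count n (Suc i) \<alpha>)
      = F (real n - 1) (real \<alpha> - 1) * real ((n - 1) choose (\<alpha> - 1)) - F (real n - 1) (real \<alpha>) * real ((n - 1) choose \<alpha>)"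
      using False F[of "\<alpha> - 1"] F[of \<alpha>] by simp
    also have "\<dots> * real n = F (real n - 1) (real \<alpha> - 1) * (real n * real ((n - 1) choose (\<alpha> - 1)))
        - F (real n - 1) (real \<alpha>) * (real n * real ((n - 1) choose \<alpha>))" by (simp add: algebra_simps)
    also have "\<dots> = (real \<alpha> * F (real n - 1) (real \<alpha> - 1) - (real n - real \<alpha>) * F (real n - 1) (real \<alpha>)) * real (n choose \<alpha>)"
      unfolding m[symmetric] p[OF False[unfolded neq0_conv], symmetric] by (simp add: algebra_simps)
    finally show ?thesis using n0 by (simp add: field_simps)
  qed
qed

lemma spin_count_1: "n \<ge> 1 \<Longrightarrow> real_of_int (spin_count n 1 \<alpha>) = E1 (real n) (real \<alpha>) * real (n choose \<alpha>)"
  using spin_count_step[of n 0 "\<lambda>_ _. 1" \<alpha>] by (simp add: E1_def One_nat_def)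

lemma spin_count_2:
  assumes "n \<ge> 2"
  shows "real_of_int (spin_count n 2 \<alpha>) = E2 (real n) (real \<alpha>) * real (n choose \<alpha>)"
proof -
  have n: "real (n - 1) = real n - 1" "real n \<noteq> 0" "real n - 1 \<noteq> 0" using assms by auto
  have "real_of_int (spin_count n (Suc 1) \<alpha>) = (real \<alpha> * E1 (real n - 1) (real \<alpha> - 1) - (real n - real \<alpha>) * E1 (real n - 1) (real \<alpha>)) / real n * real (n choose \<alpha>)"
    by (rule spin_count_step) (use assms spin_count_1[of "n - 1"] n in auto)
  also have "(real \<alpha> * E1 (real n - 1) (real \<alpha> - 1) - (real n - real \<alpha>) * E1 (real n - 1) (real \<alpha>)) / real n = E2 (real n) (real \<alpha>)"
    using n by (simp add: E1_def E2_def Let_def divide_simps) (simp add: algebra_simps)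
  finally show ?thesis by (simp add: numeral_2_eq_2)
qed

lemma spin_count_3:
  assumes "n \<ge> 3"
  shows "real_of_int (spin_count n 3 \<alpha>) = E3 (real n) (real \<alpha>) * real (n choose \<alpha>)"
proof -
  have n: "real (n - 1) = real n - 1" "real n \<noteq> 0" "real n - 1 \<noteq> 0" "real n - 2 \<noteq> 0" "real n - 1 - 1 = real n - 2" using assms by auto
  have "real_of_int (spin_count n (Suc 2) \<alpha>) = (real \<alpha> * E2 (real n - 1) (real \<alpha> - 1) - (real n - real \<alpha>) * E2 (real n - 1) (real \<alpha>)) / real n * real (n choose \<alpha>)"
    by (rule spin_count_step) (use assms spin_count_2[of "n - 1"] n in auto)
  also have "(real \<alpha> * E2 (real n - 1) (real \<alpha> - 1) - (real n - real \<alpha>) * E2 (real n - 1) (real \<alpha>)) / real n = E3 (real n) (real \<alpha>)"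
    unfolding E3_def E2_def Let_def n(5) using n by (simp add: divide_simps) (simp add: algebra_simps)
  finally show ?thesis by (simp add: numeral_3_eq_3 numeral_2_eq_2)
qed

lemma spin_count_4:
  assumes "n \<ge> 4"
  shows "real_of_int (spin_count n 4 \<alpha>) = E4 (real n) (real \<alpha>) * real (n choose \<alpha>)"
proof -
  have n: "real (n - 1) = real n - 1" "real n \<noteq> 0" "real n - 1 \<noteq> 0" "real n - 2 \<noteq> 0" "real n - 3 \<noteq> 0"
    "real n - 1 - 1 = real n - 2" "real n - 1 - 2 = real n - 3" using assms by auto
  have "real_of_int (spin_count n (Suc 3) \<alpha>) = (real \<alpha> * E3 (real n - 1) (real \<alpha> - 1) - (real n - real \<alpha>) * E3 (real n - 1) (real \<alpha>)) / real n * real (n choose \<alpha>)"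
    by (rule spin_count_step) (use assms spin_count_3[of "n - 1"] n in auto)
  also have "(real \<alpha> * E3 (real n - 1) (real \<alpha> - 1) - (real n - real \<alpha>) * E3 (real n - 1) (real \<alpha>)) / real n = E4 (real n) (real \<alpha>)"
    unfolding E4_def E3_def Let_def n(6,7) using n by (simp add: divide_simps) (simp add: algebra_simps)
  moreover have "Suc 3 = 4" by simp
  ultimately show ?thesis by metis
qed

lemma spin_square [simp]: "spin P x * (spin P x * r) = (r :: 'b::comm_ring_1)"
  by (simp add: spin_def)

lemma spin_square' [simp]: "spin P x * spin P x = (1 :: 'b::comm_ring_1)"
  by (simp add: spin_def)

locale block_ensemble =
  fixes S :: "'a set" and \<Lambda> :: "'c set" and cl :: "'a \<Rightarrow> 'c" and Q :: nat and a :: "'c \<Rightarrow> nat"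
  assumes finS: "finite S" and fin\<Lambda>: "finite \<Lambda>" and cl: "x \<in> S \<Longrightarrow> cl x \<in> \<Lambda>"
    and cardC: "k \<in> \<Lambda> \<Longrightarrow> card {x\<in>S. cl x = k} = Q"
    and a_le: "k \<in> \<Lambda> \<Longrightarrow> a k \<le> Q" and a_0: "k \<notin> \<Lambda> \<Longrightarrow> a k = 0"
begin

definition C :: "'c \<Rightarrow> 'a set" where "C k = {x\<in>S. cl x = k}"

abbreviation av :: "('a set \<Rightarrow> real) \<Rightarrow> real" where "av \<equiv> avg cl S a"

definition e1 where "e1 k = E1 (real Q) (real (a k))"
definition e2 where "e2 k = E2 (real Q) (real (a k))"
definition e3 where "e3 k = E3 (real Q) (real (a k))"
definition e4 where "e4 k = E4 (real Q) (real (a k))"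

lemma finC: "finite (C k)" using finS by (simp add: C_def)

lemma card_C: "k \<in> \<Lambda> \<Longrightarrow> card (C k) = Q" using cardC by (simp add: C_def)

lemma slice_ne: "slice cl S a \<noteq> {}"
proof -
  have "\<exists>P. P \<subseteq> C k \<and> card P = a k" if "k \<in> \<Lambda>" for k
    using obtain_subset_with_card_n[of "a k" "C k"] a_le[OF that] card_C[OF that] by metis
  then obtain f where f: "\<And>k. k \<in> \<Lambda> \<Longrightarrow> f k \<subseteq> C k \<and> card (f k) = a k" by metis
  define P where "P = (\<Union>k\<in>\<Lambda>. f k)"
  have "card {x\<in>P. cl x = k} = a k" for k
  proof (cases "k \<in> \<Lambda>")
    case True
    then have "{x\<in>P. cl x = k} = f k" using f unfolding P_def C_def by fastforce
    then show ?thesis using f True by simp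
  next
    case False
    have "cl x \<in> \<Lambda>" if "x \<in> P" for x
      using that f cl unfolding P_def C_def by blast
    then have "{x\<in>P. cl x = k} = {}" using False by auto
    then show ?thesis using a_0[OF False] by (simp only: card.empty)
  qed
  moreover have "P \<subseteq> S" using f by (auto simp: P_def C_def)
  ultimately show ?thesis by (auto simp: slice_def)
qed

lemma slice_cell:
  "slice cl S (on_cells {k} a) = {P. P \<subseteq> C k \<and> card P = a k}"
proof (intro equalityI subsetI)
  fix P assume P: "P \<in> slice cl S (on_cells {k} a)"
  have "cl x = k" if "x \<in> P" for x using slice_cells[OF finS P that] by simp
  then have "{x\<in>P. cl x = k} = P" "P \<subseteq> C k" using P by (auto simp: slice_def C_def)
  moreover have "card {x\<in>P. cl x = k} = on_cells {k} a k" using P by (simp add: slice_def)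
  ultimately show "P \<in> {P. P \<subseteq> C k \<and> card P = a k}" by (simp add: on_cells_def)
next
  fix P assume P: "P \<in> {P. P \<subseteq> C k \<and> card P = a k}"
  have "{x\<in>P. cl x = l} = (if l = k then P else {})" for l using P by (auto simp: C_def)
  then show "P \<in> slice cl S (on_cells {k} a)" using P by (auto simp: slice_def on_cells_def C_def)
qed

lemma av_spins:
  assumes "k \<in> \<Lambda>" "A \<subseteq> C k"
  shows "av (\<lambda>P. \<Prod>x\<in>A. spin P x) = spin_count Q (card A) (a k) / (Q choose a k)"
proof -
  have "av (\<lambda>P. \<Prod>x\<in>A. spin P x) = avg cl S (on_cells {k} a) (\<lambda>P. \<Prod>x\<in>A. spin P x)"
    by (rule avg_local[OF finS slice_ne]) (use assms in \<open>auto intro!: local_to_prod local_to_spin simp: C_def\<close>)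
  also have "\<dots> = spin_count Q (card A) (a k) / (Q choose a k)"
    unfolding avg_def slice_cell
    using sum_spin_prod[OF finC assms(2), of "a k"] n_subsets[OF finC, of k "a k"] card_C[OF assms(1)] by simp
  finally show ?thesis .
qed

lemma choose_pos: "k \<in> \<Lambda> \<Longrightarrow> real (Q choose a k) \<noteq> 0"
  using a_le[of k] by (simp add: binomial_eq_0_iff)

lemma card_le_Q: "k \<in> \<Lambda> \<Longrightarrow> A \<subseteq> C k \<Longrightarrow> card A \<le> Q"
  using card_mono[OF finC, of A k] card_C[of k] by simp

lemma av1:
  assumes "k \<in> \<Lambda>" "x \<in> C k"
  shows "av (\<lambda>P. spin P x) = e1 k"
  using av_spins[OF assms(1), of "{x}"] card_le_Q[OF assms(1), of "{x}"] spin_count_1[of Q "a k"] choose_pos[OF assms(1)] assms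
  by (simp add: e1_def)

lemma av2:
  assumes "k \<in> \<Lambda>" "x \<in> C k" "y \<in> C k" "x \<noteq> y"
  shows "av (\<lambda>P. spin P x * spin P y) = e2 k"
proof -
  have c: "card {x, y} = 2" using assms by simp
  show ?thesis
    using av_spins[OF assms(1), of "{x, y}"] card_le_Q[OF assms(1), of "{x, y}"] spin_count_2[of Q "a k"] choose_pos[OF assms(1)] assms
    unfolding c by (simp add: e2_def)
qed

lemma av3:
  assumes "k \<in> \<Lambda>" "x \<in> C k" "y \<in> C k" "z \<in> C k" "x \<noteq> y" "x \<noteq> z" "y \<noteq> z"
  shows "av (\<lambda>P. spin P x * (spin P y * spin P z)) = e3 k"
proof -
  have c: "card {x, y, z} = 3" using assms by simp
  show ?thesis
    using av_spins[OF assms(1), of "{x, y, z}"] card_le_Q[OF assms(1), of "{x, y, z}"] spin_count_3[of Q "a k"] choose_pos[OF assms(1)] assms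
    unfolding c by (simp add: e3_def)
qed

lemma av4:
  assumes "k \<in> \<Lambda>" "{x, y, z, w} \<subseteq> C k" "distinct [x, y, z, w]"
  shows "av (\<lambda>P. spin P x * (spin P y * (spin P z * spin P w))) = e4 k"
proof -
  have c: "card {x, y, z, w} = 4" using assms by simp
  show ?thesis
    using av_spins[OF assms(1,2)] card_le_Q[OF assms(1,2)] spin_count_4[of Q "a k"] choose_pos[OF assms(1)] assms(3)
    unfolding c by (simp add: e4_def)
qed

lemma av_one: "av (\<lambda>_. 1) = 1"
  by (rule avg_const[OF finS slice_ne])

text \<open>Coincidences enter as numbers instead of case distinctions: a correlation becomes a
  polynomial in \<open>d\<close>, and sums against it can be evaluated term by term.\<close>

definition d :: "'a \<Rightarrow> 'a \<Rightarrow> real" where "d x y = of_bool (x = y)"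

lemma av2':
  assumes "k \<in> \<Lambda>" "x \<in> C k" "y \<in> C k"
  shows "av (\<lambda>P. spin P x * spin P y) = (1 - e2 k) * d x y + e2 k"
  using av2[OF assms] av_one by (cases "x = y") (auto simp: d_def)

lemma av3':
  assumes "k \<in> \<Lambda>" "x \<in> C k" "y \<in> C k" "z \<in> C k" "x \<noteq> y"
  shows "av (\<lambda>P. spin P x * (spin P y * spin P z)) = (e1 k - e3 k) * d x z + ((e1 k - e3 k) * d y z + e3 k)"
proof -
  have 1: "av (\<lambda>P. spin P x * (spin P y * spin P x)) = e1 k"
  proof -
    have "av (\<lambda>P. spin P x * (spin P y * spin P x)) = av (\<lambda>P. spin P y)"
      by (rule avg_cong) (simp add: spin_def)
    then show ?thesis using av1[OF assms(1,3)] by simp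
  qed
  have 2: "av (\<lambda>P. spin P x * (spin P y * spin P y)) = e1 k"
    using av1[OF assms(1,2)] by simp
  show ?thesis using 1 2 av3[of k x y z] assms by (cases "z = x"; cases "z = y") (auto simp: d_def)
qed

text \<open>With \<open>x \<noteq> y\<close> and \<open>z \<noteq> w\<close>, one coincidence leaves
  two distinct spins and average \<open>e2 k\<close>, two coincidences leave the constant 1. A
  double coincidence already contains two single ones, so its own coefficient solves
  \<open>e4 k + 2 * (e2 k - e4 k) + c = 1\<close>. If the cell has fewer than four sites, the junk
  value in \<open>e4\<close> cancels.\<close>

lemma av4':
  assumes "k \<in> \<Lambda>" "x \<in> C k" "y \<in> C k" "z \<in> C k" "w \<in> C k" "x \<noteq> y" "z \<noteq> w"
  shows "av (\<lambda>P. spin P x * spin P y * (spin P z * spin P w)) =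
    (e2 k - e4 k) * d x z + ((e2 k - e4 k) * d x w + ((e2 k - e4 k) * d y z + ((e2 k - e4 k) * d y w
     + ((1 - 2 * e2 k + e4 k) * (d x z * d y w) + ((1 - 2 * e2 k + e4 k) * (d x w * d y z) + e4 k)))))"
proof -
  have s: "spin P x * (spin P y * (spin P z * spin P w)) = (spin P x * spin P y) * (spin P z * (spin P w :: real))"
    for P by (simp only: mult.assoc)
  consider "z = x" "w = y" | "z = y" "w = x" | "z = x" "w \<noteq> y" | "w = x" "z \<noteq> y"
    | "z = y" "w \<noteq> x" | "w = y" "z \<noteq> x" | "z \<noteq> x" "z \<noteq> y" "w \<noteq> x" "w \<noteq> y"
    by (cases "z = x"; cases "w = y"; cases "z = y"; cases "w = x"; simp)
  then show ?thesis
  proof cases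
    case 1
    have "av (\<lambda>P. spin P x * spin P y * (spin P x * spin P y)) = av (\<lambda>_. 1)"
      by (rule avg_cong) (simp add: spin_def)
    then show ?thesis using 1 assms av_one by (simp add: d_def)
  next
    case 2
    have "av (\<lambda>P. spin P x * spin P y * (spin P y * spin P x)) = av (\<lambda>_. 1)"
      by (rule avg_cong) (simp add: spin_def)
    then show ?thesis using 2 assms av_one by (simp add: d_def)
  next
    case 3
    have "av (\<lambda>P. spin P x * spin P y * (spin P x * spin P w)) = av (\<lambda>P. spin P y * spin P w)"
      by (rule avg_cong) (simp add: spin_def)
    then show ?thesis using 3 assms av2[of k y w] by (simp add: d_def)
  next
    case 4
    have "av (\<lambda>P. spin P x * spin P y * (spin P z * spin P x)) = av (\<lambda>P. spin P y * spin P z)"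
      by (rule avg_cong) (simp add: spin_def)
    then show ?thesis using 4 assms av2[of k y z] by (simp add: d_def)
  next
    case 5
    have "av (\<lambda>P. spin P x * spin P y * (spin P y * spin P w)) = av (\<lambda>P. spin P x * spin P w)"
      by (rule avg_cong) (simp add: spin_def)
    then show ?thesis using 5 assms av2[of k x w] by (simp add: d_def)
  next
    case 6
    have "av (\<lambda>P. spin P x * spin P y * (spin P z * spin P y)) = av (\<lambda>P. spin P x * spin P z)"
      by (rule avg_cong) (simp add: spin_def)
    then show ?thesis using 6 assms av2[of k x z] by (simp add: d_def)
  next
    case 7
    then show ?thesis using av4[of k x y z w] assms unfolding s by (simp add: d_def)
  qed
qed

end

section \<open>The second moment of centred pair energies\<close>

locale pair_block_ensemble = block_ensemble S \<Lambda> cl Q a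
  for S :: "'a set" and \<Lambda> :: "'c set" and cl Q a +
  fixes c :: "'a \<Rightarrow> 'a \<Rightarrow> real"
  assumes c_sym: "c x y = c y x" and c_diag: "c x x = 0"
    and c_sum: "k \<in> \<Lambda> \<Longrightarrow> l \<in> \<Lambda> \<Longrightarrow> (\<Sum>x\<in>C k. \<Sum>y\<in>C l. c x y) = 0"
begin

definition V :: "'c \<Rightarrow> 'c \<Rightarrow> 'a set \<Rightarrow> real" where
  "V k l P = (\<Sum>x\<in>C k. \<Sum>y\<in>C l. c x y * (spin P x * spin P y))"

definition F :: "'a set \<Rightarrow> 'a set \<Rightarrow> 'a set \<Rightarrow> 'a set \<Rightarrow> ('a \<Rightarrow> 'a \<Rightarrow> 'a \<Rightarrow> 'a \<Rightarrow> real) \<Rightarrow> real" where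
  "F A B A' B' \<delta> = (\<Sum>x\<in>A. \<Sum>y\<in>B. \<Sum>z\<in>A'. \<Sum>w\<in>B'. c x y * c z w * \<delta> x y z w)"

lemma F_add: "F A B A' B' (\<lambda>x y z w. \<delta> x y z w + \<gamma> x y z w) = F A B A' B' \<delta> + F A B A' B' \<gamma>"
  by (simp add: F_def ring_distribs sum.distrib)

lemma F_scale: "F A B A' B' (\<lambda>x y z w. r * \<delta> x y z w) = r * F A B A' B' \<delta>"
  by (simp add: F_def sum_distrib_left mult_ac)

text \<open>The couplings sum to zero over each pair of cells, so a part of a correlation that does
  not depend on the sites contributes nothing. Only terms with a coincidence \<open>d\<close>
  survive.\<close>

lemma F_const:
  "k \<in> \<Lambda> \<Longrightarrow> l \<in> \<Lambda> \<Longrightarrow> k' \<in> \<Lambda> \<Longrightarrow> l' \<in> \<Lambda> \<Longrightarrow> F (C k) (C l) (C k') (C l') (\<lambda>_ _ _ _. r) = 0"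
proof -
  assume *: "k \<in> \<Lambda>" "l \<in> \<Lambda>" "k' \<in> \<Lambda>" "l' \<in> \<Lambda>"
  have "F (C k) (C l) (C k') (C l') (\<lambda>_ _ _ _. r)
    = (\<Sum>x\<in>C k. \<Sum>y\<in>C l. c x y * r * (\<Sum>z\<in>C k'. \<Sum>w\<in>C l'. c z w))"
    unfolding F_def sum_distrib_left by (intro sum.cong refl) simp
  then show ?thesis by (simp add: c_sum *)
qed

lemma d_collapse: "finite A \<Longrightarrow> x \<in> A \<Longrightarrow> (\<Sum>z\<in>A. f z * d x z) = f x"
  by (simp add: d_def of_bool_def if_distrib cong: if_cong)

lemma F_xz:
  assumes "finite A"
  shows "F A B A B' (\<lambda>x y z w. d x z) = (\<Sum>x\<in>A. \<Sum>y\<in>B. \<Sum>w\<in>B'. c x y * c x w)"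
  unfolding F_def
proof (rule sum.cong[OF refl], rule sum.cong[OF refl])
  fix x y assume x: "x \<in> A"
  have "(\<Sum>z\<in>A. \<Sum>w\<in>B'. c x y * c z w * d x z) = (\<Sum>z\<in>A. (\<Sum>w\<in>B'. c x y * c z w) * d x z)"
    by (simp add: sum_distrib_right)
  also have "\<dots> = (\<Sum>w\<in>B'. c x y * c x w)" by (rule d_collapse[OF assms x])
  finally show "(\<Sum>z\<in>A. \<Sum>w\<in>B'. c x y * c z w * d x z) = (\<Sum>w\<in>B'. c x y * c x w)" .
qed

lemma F_yz:
  assumes "finite B"
  shows "F A B B B' (\<lambda>x y z w. d y z) = (\<Sum>x\<in>A. \<Sum>y\<in>B. \<Sum>w\<in>B'. c x y * c y w)"
  unfolding F_def
proof (rule sum.cong[OF refl], rule sum.cong[OF refl])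
  fix x y assume y: "y \<in> B"
  have "(\<Sum>z\<in>B. \<Sum>w\<in>B'. c x y * c z w * d y z) = (\<Sum>z\<in>B. (\<Sum>w\<in>B'. c x y * c z w) * d y z)"
    by (simp add: sum_distrib_right)
  also have "\<dots> = (\<Sum>w\<in>B'. c x y * c y w)" by (rule d_collapse[OF assms y])
  finally show "(\<Sum>z\<in>B. \<Sum>w\<in>B'. c x y * c z w * d y z) = (\<Sum>w\<in>B'. c x y * c y w)" .
qed

lemma F_swap: "F A B A' B' (\<lambda>x y z w. \<delta> x y w z) = F A B B' A' \<delta>"
  unfolding F_def by (rule sum.cong[OF refl], rule sum.cong[OF refl], subst sum.swap) (simp add: c_sym)

lemma F_swap': "F A B A' B' (\<lambda>x y z w. \<delta> y x z w) = F B A A' B' \<delta>"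
  unfolding F_def by (subst sum.swap) (simp add: c_sym)

lemma F_xw: "finite A \<Longrightarrow> F A B B' A (\<lambda>x y z w. d x w) = (\<Sum>x\<in>A. \<Sum>y\<in>B. \<Sum>w\<in>B'. c x y * c x w)"
  using F_swap[of A B B' A "\<lambda>x y z w. d x z"] F_xz by simp

lemma F_yw: "finite B \<Longrightarrow> F A B A' B (\<lambda>x y z w. d y w) = (\<Sum>y\<in>B. \<Sum>x\<in>A. \<Sum>z\<in>A'. c y x * c y z)"
  using F_swap'[of A B A' B "\<lambda>x y z w. d x w"] F_xw[of B A A'] by simp

lemma F_xz_yw:
  assumes "finite A" "finite B"
  shows "F A B A B (\<lambda>x y z w. d x z * d y w) = (\<Sum>x\<in>A. \<Sum>y\<in>B. (c x y)\<^sup>2)"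
  unfolding F_def
proof (intro sum.cong refl)
  fix x y assume xy: "x \<in> A" "y \<in> B"
  have "(\<Sum>z\<in>A. \<Sum>w\<in>B. c x y * c z w * (d x z * d y w)) = (\<Sum>z\<in>A. (\<Sum>w\<in>B. c x y * c z w * d y w) * d x z)"
    unfolding sum_distrib_right by (intro sum.cong refl) simp
  also have "\<dots> = (\<Sum>w\<in>B. c x y * c x w * d y w)" by (rule d_collapse[OF assms(1) xy(1)])
  also have "\<dots> = c x y * c x y" by (rule d_collapse[OF assms(2) xy(2)])
  finally show "(\<Sum>z\<in>A. \<Sum>w\<in>B. c x y * c z w * (d x z * d y w)) = (c x y)\<^sup>2" by (simp add: power2_eq_square)
qed

lemma F_xw_yz:
  "finite A \<Longrightarrow> finite B \<Longrightarrow> F A B B A (\<lambda>x y z w. d x w * d y z) = (\<Sum>x\<in>A. \<Sum>y\<in>B. (c x y)\<^sup>2)"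
  using F_swap[of A B B A "\<lambda>x y z w. d x z * d y w"] F_xz_yw by simp

lemma av_VV: "av (\<lambda>P. V k l P * V k' l' P) = F (C k) (C l) (C k') (C l') (\<lambda>x y z w. av (\<lambda>P. spin P x * spin P y * (spin P z * spin P w)))"
proof -
  have "V k l P * V k' l' P = (\<Sum>x\<in>C k. \<Sum>y\<in>C l. \<Sum>z\<in>C k'. \<Sum>w\<in>C l'. (c x y * c z w) * (spin P x * spin P y * (spin P z * spin P w)))" for P
    unfolding V_def sum_distrib_right unfolding sum_distrib_left by (intro sum.cong refl) (simp only: mult_ac)
  then show ?thesis by (simp only: F_def avg_sum avg_scale)
qed

lemma F_cong:
  assumes "\<And>x y z w. x \<in> A \<Longrightarrow> y \<in> B \<Longrightarrow> z \<in> A' \<Longrightarrow> w \<in> B' \<Longrightarrow> x \<noteq> y \<Longrightarrow> z \<noteq> w \<Longrightarrow> \<delta> x y z w = \<gamma> x y z w"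
  shows "F A B A' B' \<delta> = F A B A' B' \<gamma>"
  unfolding F_def
proof (intro sum.cong refl)
  fix x y z w assume "x \<in> A" "y \<in> B" "z \<in> A'" "w \<in> B'"
  then show "c x y * c z w * \<delta> x y z w = c x y * c z w * \<gamma> x y z w"
    using assms[of x y z w] c_diag by (cases "x = y"; cases "z = w") auto
qed

definition j1 where "j1 k l = (\<Sum>x\<in>C k. \<Sum>y\<in>C l. (c x y)\<^sup>2)"
definition j2 where "j2 k l = (\<Sum>x\<in>C k. \<Sum>y\<in>C l. \<Sum>w\<in>C l. c x y * c x w)"
definition j2_chain where "j2_chain k m l = (\<Sum>x\<in>C k. \<Sum>y\<in>C m. \<Sum>z\<in>C l. c x y * c y z)"

lemma local_spin: "x \<in> C k \<Longrightarrow> k \<in> X \<Longrightarrow> local_to cl X (\<lambda>P. spin P x)"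
  by (rule local_to_spin) (auto simp: C_def)

lemma local_V: "k \<in> X \<Longrightarrow> l \<in> X \<Longrightarrow> local_to cl X (V k l)"
  unfolding V_def[abs_def]
  by (intro local_to_sum local_to_mult local_to_const) (auto intro: local_spin)

lemma indep: "local_to cl X f \<Longrightarrow> local_to cl Y g \<Longrightarrow> X \<inter> Y = {} \<Longrightarrow> av (\<lambda>P. f P * g P) = av f * av g"
  by (rule avg_indep[OF finS slice_ne])

text \<open>The correlation of two distinct sites depends on their cells only, and the couplings are
  centred. Consequently the first cumulant vanishes and the second one is a plain second
  moment.\<close>

lemma av_V: 
  assumes "k \<in> \<Lambda>" "l \<in> \<Lambda>"
  shows "av (V k l) = 0"
proof -
  obtain r where r: "\<And>x y. x \<in> C k \<Longrightarrow> y \<in> C l \<Longrightarrow> x \<noteq> y \<Longrightarrow> av (\<lambda>P. spin P x * spin P y) = r"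
  proof (cases "k = l")
    case True
    then show ?thesis using that av2[OF assms(1)] by metis
  next
    case False
    have "av (\<lambda>P. spin P x * spin P y) = e1 k * e1 l" if "x \<in> C k" "y \<in> C l" for x y
      using indep[OF local_spin local_spin, of x k "{k}" y l "{l}"] that False av1 assms by simp
    then show ?thesis using that by blast
  qed
  have "av (V k l) = (\<Sum>x\<in>C k. \<Sum>y\<in>C l. c x y * av (\<lambda>P. spin P x * spin P y))"
    unfolding V_def[abs_def] by (simp only: avg_sum avg_scale)
  also have "\<dots> = (\<Sum>x\<in>C k. \<Sum>y\<in>C l. c x y * r)"
  proof (intro sum.cong refl)
    fix x y assume "x \<in> C k" "y \<in> C l"
    then show "c x y * av (\<lambda>P. spin P x * spin P y) = c x y * r"
      using r[of x y] c_diag by (cases "x = y") auto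
  qed
  also have "\<dots> = (\<Sum>x\<in>C k. \<Sum>y\<in>C l. c x y) * r" by (simp add: sum_distrib_right)
  finally show ?thesis using c_sum[OF assms] by simp
qed

lemma V_sym: "V k l P = V l k P"
  unfolding V_def by (subst sum.swap) (simp add: c_sym mult.commute)

lemma av_VV_disjoint:
  assumes "k \<in> \<Lambda>" "l \<in> \<Lambda>" "k' \<in> \<Lambda>" "l' \<in> \<Lambda>" "{k, l} \<inter> {k', l'} = {}"
  shows "av (\<lambda>P. V k l P * V k' l' P) = 0"
  using indep[OF local_V local_V assms(5)] av_V assms by simp

lemma av_chain:
  assumes \<Lambda>: "k \<in> \<Lambda>" "m \<in> \<Lambda>" "l \<in> \<Lambda>" and ne: "k \<noteq> m" "l \<noteq> m" "k \<noteq> l"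
  shows "av (\<lambda>P. V k m P * V m l P) = e1 k * e1 l * (1 - e2 m) * j2_chain k m l"
proof -
  have "av (\<lambda>P. spin P x * spin P y * (spin P z * spin P w))
      = e1 k * e1 l * (1 - e2 m) * d y z + e1 k * e1 l * e2 m"
    if "x \<in> C k" "y \<in> C m" "z \<in> C m" "w \<in> C l" for x y z w
  proof -
    have "av (\<lambda>P. spin P x * spin P y * (spin P z * spin P w)) = av (\<lambda>P. spin P x * (spin P w * (spin P y * spin P z)))"
      by (simp add: mult_ac)
    also have "\<dots> = av (\<lambda>P. spin P x) * av (\<lambda>P. spin P w * (spin P y * spin P z))"
      by (rule indep[of "{k}" _ "{l, m}"]) (use that ne in \<open>auto intro!: local_to_mult intro: local_spin\<close>)
    also have "av (\<lambda>P. spin P w * (spin P y * spin P z)) = av (\<lambda>P. spin P w) * av (\<lambda>P. spin P y * spin P z)"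
      by (rule indep[of "{l}" _ "{m}"]) (use that ne in \<open>auto intro!: local_to_mult intro: local_spin\<close>)
    finally show ?thesis using av1[OF \<Lambda>(1) that(1)] av1[OF \<Lambda>(3) that(4)] av2'[OF \<Lambda>(2) that(2,3)]
      by (simp add: algebra_simps)
  qed
  then have "av (\<lambda>P. V k m P * V m l P) = F (C k) (C m) (C m) (C l) (\<lambda>x y z w. e1 k * e1 l * (1 - e2 m) * d y z + e1 k * e1 l * e2 m)"
    unfolding av_VV by (intro F_cong) simp
  also have "\<dots> = e1 k * e1 l * (1 - e2 m) * j2_chain k m l"
    unfolding F_add F_scale F_const[OF \<Lambda>(1,2,2,3)] F_yz[OF finC] j2_chain_def by simp
  finally show ?thesis .
qed

text \<open>The third site can coincide with either site of the diagonal pair. By symmetry of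
  \<open>c\<close> both coincidences give the same chain sum, whence the factor 2.\<close>

lemma av_diag_edge:
  assumes \<Lambda>: "k \<in> \<Lambda>" "l \<in> \<Lambda>" and ne: "k \<noteq> l"
  shows "av (\<lambda>P. V k k P * V k l P) = 2 * (e1 k - e3 k) * e1 l * j2_chain k k l"
proof -
  have "av (\<lambda>P. spin P x * spin P y * (spin P z * spin P w))
      = (e1 k - e3 k) * e1 l * d x z + ((e1 k - e3 k) * e1 l * d y z + e3 k * e1 l)"
    if "x \<in> C k" "y \<in> C k" "z \<in> C k" "w \<in> C l" "x \<noteq> y" for x y z w
  proof -
    have "av (\<lambda>P. spin P x * spin P y * (spin P z * spin P w)) = av (\<lambda>P. (spin P x * (spin P y * spin P z)) * spin P w)"
      by (simp add: mult_ac)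
    also have "\<dots> = av (\<lambda>P. spin P x * (spin P y * spin P z)) * av (\<lambda>P. spin P w)"
      by (rule indep[of "{k}" _ "{l}"]) (use that ne in \<open>auto intro!: local_to_mult intro: local_spin\<close>)
    finally show ?thesis using av1[OF \<Lambda>(2) that(4)] av3'[OF \<Lambda>(1) that(1,2,3,5)]
      by (simp add: algebra_simps)
  qed
  then have "av (\<lambda>P. V k k P * V k l P) = F (C k) (C k) (C k) (C l)
      (\<lambda>x y z w. (e1 k - e3 k) * e1 l * d x z + ((e1 k - e3 k) * e1 l * d y z + e3 k * e1 l))"
    unfolding av_VV by (intro F_cong) simp
  also have "\<dots> = (e1 k - e3 k) * e1 l * (\<Sum>x\<in>C k. \<Sum>y\<in>C k. \<Sum>w\<in>C l. c x y * c x w) + (e1 k - e3 k) * e1 l * j2_chain k k l"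
    unfolding F_add F_scale F_const[OF \<Lambda>(1,1,1,2)] F_yz[OF finC] F_xz[OF finC] j2_chain_def by simp
  also have "(\<Sum>x\<in>C k. \<Sum>y\<in>C k. \<Sum>w\<in>C l. c x y * c x w) = j2_chain k k l"
    unfolding j2_chain_def by (subst sum.swap) (simp add: c_sym)
  finally show ?thesis by simp
qed

text \<open>Coincidence in both cells gives \<open>j1\<close>, coincidence in \<open>k\<close> alone
  gives \<open>j2 k l\<close>, and coincidence in \<open>l\<close> alone gives
  \<open>j2 l k\<close>. That the last two agree depends on the geometry of the cells and is shown
  later by a reflection.\<close>

lemma av_edge_square:
  assumes \<Lambda>: "k \<in> \<Lambda>" "l \<in> \<Lambda>" and ne: "k \<noteq> l"
  shows "av (\<lambda>P. V k l P * V k l P) = (1 - e2 k) * (1 - e2 l) * j1 k l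
     + (1 - e2 k) * e2 l * j2 k l + e2 k * (1 - e2 l) * j2 l k"
proof -
  have "av (\<lambda>P. spin P x * spin P y * (spin P z * spin P w))
      = (1 - e2 k) * (1 - e2 l) * (d x z * d y w) + ((1 - e2 k) * e2 l * d x z + (e2 k * (1 - e2 l) * d y w + e2 k * e2 l))"
    if "x \<in> C k" "y \<in> C l" "z \<in> C k" "w \<in> C l" for x y z w
  proof -
    have "av (\<lambda>P. spin P x * spin P y * (spin P z * spin P w)) = av (\<lambda>P. (spin P x * spin P z) * (spin P y * spin P w))"
      by (simp add: mult_ac)
    also have "\<dots> = av (\<lambda>P. spin P x * spin P z) * av (\<lambda>P. spin P y * spin P w)"
      by (rule indep[of "{k}" _ "{l}"]) (use that ne in \<open>auto intro!: local_to_mult intro: local_spin\<close>)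
    finally show ?thesis unfolding av2'[OF \<Lambda>(1) that(1,3)] av2'[OF \<Lambda>(2) that(2,4)]
      by (simp add: algebra_simps)
  qed
  then have "av (\<lambda>P. V k l P * V k l P) = F (C k) (C l) (C k) (C l)
      (\<lambda>x y z w. (1 - e2 k) * (1 - e2 l) * (d x z * d y w) + ((1 - e2 k) * e2 l * d x z + (e2 k * (1 - e2 l) * d y w + e2 k * e2 l)))"
    unfolding av_VV by (intro F_cong) simp
  also have "\<dots> = (1 - e2 k) * (1 - e2 l) * j1 k l
     + (1 - e2 k) * e2 l * j2 k l + e2 k * (1 - e2 l) * j2 l k"
    unfolding F_add F_scale F_const[OF \<Lambda>(1,2,1,2)] F_xz_yw[OF finC finC] F_yw[OF finC] F_xz[OF finC] j1_def j2_def by simp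
  finally show ?thesis .
qed

lemma av_diag_square:
  assumes \<Lambda>: "k \<in> \<Lambda>"
  shows "av (\<lambda>P. V k k P * V k k P) = 4 * (e2 k - e4 k) * j2 k k + 2 * (1 - 2 * e2 k + e4 k) * j1 k k"
proof -
  have "av (\<lambda>P. V k k P * V k k P) = F (C k) (C k) (C k) (C k)
     (\<lambda>x y z w. (e2 k - e4 k) * d x z + ((e2 k - e4 k) * d x w + ((e2 k - e4 k) * d y z + ((e2 k - e4 k) * d y w
     + ((1 - 2 * e2 k + e4 k) * (d x z * d y w) + ((1 - 2 * e2 k + e4 k) * (d x w * d y z) + e4 k))))))"
    unfolding av_VV by (intro F_cong av4') (use \<Lambda> in auto)
  also have "\<dots> = (e2 k - e4 k) * j2 k k + (e2 k - e4 k) * j2 k k + (e2 k - e4 k) * (\<Sum>x\<in>C k. \<Sum>y\<in>C k. \<Sum>w\<in>C k. c x y * c y w)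
     + (e2 k - e4 k) * j2 k k + 2 * (1 - 2 * e2 k + e4 k) * j1 k k"
    unfolding F_add F_scale F_const[OF \<Lambda> \<Lambda> \<Lambda> \<Lambda>] F_xz_yw[OF finC finC] F_xw_yz[OF finC finC] F_yw[OF finC] F_xz[OF finC] F_xw[OF finC] F_yz[OF finC]
      j1_def j2_def by simp
  also have "(\<Sum>x\<in>C k. \<Sum>y\<in>C k. \<Sum>w\<in>C k. c x y * c y w) = j2 k k"
    unfolding j2_def by (subst sum.swap) (simp add: c_sym)
  finally show ?thesis by (simp add: algebra_simps)
qed

end

lemma sum_hitting_pairs:
  fixes G :: "'c \<Rightarrow> 'c \<Rightarrow> real"
  assumes "finite \<Lambda>" "A \<subseteq> \<Lambda>" "\<And>k l. G k l = G l k"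
    and "\<And>k l. k \<in> \<Lambda> - A \<Longrightarrow> l \<in> \<Lambda> - A \<Longrightarrow> G k l = 0"
  shows "(\<Sum>k\<in>\<Lambda>. \<Sum>l\<in>\<Lambda>. G k l) = (\<Sum>k\<in>A. \<Sum>l\<in>A. G k l) + 2 * (\<Sum>k\<in>A. \<Sum>l\<in>\<Lambda> - A. G k l)"
proof -
  have s: "(\<Sum>k\<in>\<Lambda>. f k) = (\<Sum>k\<in>\<Lambda> - A. f k) + (\<Sum>k\<in>A. f k)" for f :: "'c \<Rightarrow> real"
    by (rule sum.subset_diff[OF assms(2,1)])
  have "(\<Sum>k\<in>\<Lambda> - A. \<Sum>l\<in>A. G k l) = (\<Sum>k\<in>A. \<Sum>l\<in>\<Lambda> - A. G k l)"
    by (subst sum.swap) (simp add: assms(3))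
  moreover have "(\<Sum>k\<in>\<Lambda> - A. \<Sum>l\<in>\<Lambda> - A. G k l) = 0" by (intro sum.neutral ballI) (use assms(4) in auto)
  ultimately show ?thesis by (simp add: s sum.distrib)
qed

lemma sum_offdiag_swap:
  fixes G :: "'c \<Rightarrow> 'c \<Rightarrow> real"
  assumes "finite \<Lambda>"
  shows "(\<Sum>k\<in>\<Lambda>. \<Sum>l\<in>\<Lambda> - {k}. G l k) = (\<Sum>k\<in>\<Lambda>. \<Sum>l\<in>\<Lambda> - {k}. G k l)"
proof -
  have o: "(\<Sum>l\<in>\<Lambda> - {k}. f l) = (\<Sum>l\<in>\<Lambda>. if l = k then 0 else f l)" for f :: "'c \<Rightarrow> real" and k
    by (rule sum.mono_neutral_cong_left) (use assms in auto)
  show ?thesis unfolding o by (subst sum.swap) (intro sum.cong refl, auto)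
qed

text \<open>The coefficients count orientations and orders. A diagonal pair with an edge: two
  orientations of the edge and two orders give 4. The same edge twice: the second copy has two
  orientations. Two edges sharing just one cell \<open>m\<close>: two orientations each give 4, the
  order being counted by the ordered pair \<open>(k, l)\<close>.\<close>

lemma sum_interacting_pairs:
  fixes M :: "'c \<Rightarrow> 'c \<Rightarrow> 'c \<Rightarrow> 'c \<Rightarrow> real"
  assumes fin: "finite \<Lambda>" and s1: "\<And>k l k' l'. M k l k' l' = M l k k' l'" and s2: "\<And>k l k' l'. M k l k' l' = M k' l' k l"
    and z: "\<And>k l k' l'. k \<in> \<Lambda> \<Longrightarrow> l \<in> \<Lambda> \<Longrightarrow> k' \<in> \<Lambda> \<Longrightarrow> l' \<in> \<Lambda> \<Longrightarrow> {k, l} \<inter> {k', l'} = {} \<Longrightarrow> M k l k' l' = 0"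
  shows "(\<Sum>k\<in>\<Lambda>. \<Sum>l\<in>\<Lambda>. \<Sum>k'\<in>\<Lambda>. \<Sum>l'\<in>\<Lambda>. M k l k' l')
    = (\<Sum>k\<in>\<Lambda>. M k k k k) + 4 * (\<Sum>k\<in>\<Lambda>. \<Sum>l\<in>\<Lambda> - {k}. M k k k l) + 2 * (\<Sum>k\<in>\<Lambda>. \<Sum>l\<in>\<Lambda> - {k}. M k l k l)
      + 4 * (\<Sum>m\<in>\<Lambda>. \<Sum>k\<in>\<Lambda> - {m}. \<Sum>l\<in>\<Lambda> - {m, k}. M k m m l)"
proof -
  have s1': "M k l k' l' = M k l l' k'" for k l k' l' using s1 s2 by metis
  have diag: "(\<Sum>k'\<in>\<Lambda>. \<Sum>l'\<in>\<Lambda>. M k k k' l') = M k k k k + 2 * (\<Sum>l\<in>\<Lambda> - {k}. M k k k l)" if "k \<in> \<Lambda>" for k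
    using sum_hitting_pairs[OF fin, of "{k}" "M k k"] that s1' z[of k k] by auto
  have off: "(\<Sum>k'\<in>\<Lambda>. \<Sum>l'\<in>\<Lambda>. M k l k' l') = M k k k l + M l l l k + 2 * M k l k l
      + 2 * (\<Sum>n\<in>\<Lambda> - {k, l}. M l k k n) + 2 * (\<Sum>n\<in>\<Lambda> - {l, k}. M k l l n)" if "k \<in> \<Lambda>" "l \<in> \<Lambda> - {k}" for k l
  proof -
    have *: "(\<Sum>k'\<in>\<Lambda>. \<Sum>l'\<in>\<Lambda>. M k l k' l') = (\<Sum>k'\<in>{k,l}. \<Sum>l'\<in>{k,l}. M k l k' l') + 2 * (\<Sum>k'\<in>{k,l}. \<Sum>l'\<in>\<Lambda> - {k,l}. M k l k' l')"
      by (rule sum_hitting_pairs[OF fin]) (use that s1' z[of k l] in auto)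
    have "M k l k k = M k k k l" "M k l l l = M l l l k" "M k l l k = M k l k l" using s1 s2 s1' by metis+
    moreover have "M k l k n = M l k k n" for n using s1 by metis
    moreover have "{l, k} = {k, l}" by auto
    moreover have "k \<noteq> l" using that by auto
    ultimately show ?thesis unfolding * using that by (simp add: sum.distrib)
  qed
  have "(\<Sum>k\<in>\<Lambda>. \<Sum>l\<in>\<Lambda>. \<Sum>k'\<in>\<Lambda>. \<Sum>l'\<in>\<Lambda>. M k l k' l')
    = (\<Sum>k\<in>\<Lambda>. (\<Sum>k'\<in>\<Lambda>. \<Sum>l'\<in>\<Lambda>. M k k k' l') + (\<Sum>l\<in>\<Lambda> - {k}. \<Sum>k'\<in>\<Lambda>. \<Sum>l'\<in>\<Lambda>. M k l k' l'))"
    by (rule sum.cong[OF refl], rule sum.remove[OF fin])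
  also have "\<dots> = (\<Sum>k\<in>\<Lambda>. M k k k k + 2 * (\<Sum>l\<in>\<Lambda> - {k}. M k k k l)
     + ((\<Sum>l\<in>\<Lambda> - {k}. M k k k l) + (\<Sum>l\<in>\<Lambda> - {k}. M l l l k) + 2 * (\<Sum>l\<in>\<Lambda> - {k}. M k l k l)
      + 2 * (\<Sum>l\<in>\<Lambda> - {k}. \<Sum>n\<in>\<Lambda> - {k, l}. M l k k n) + 2 * (\<Sum>l\<in>\<Lambda> - {k}. \<Sum>n\<in>\<Lambda> - {l, k}. M k l l n)))"
    by (rule sum.cong[OF refl]) (simp add: diag off sum.distrib sum_distrib_left)
  also have "\<dots> = (\<Sum>k\<in>\<Lambda>. M k k k k) + 3 * (\<Sum>k\<in>\<Lambda>. \<Sum>l\<in>\<Lambda> - {k}. M k k k l)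
     + (\<Sum>k\<in>\<Lambda>. \<Sum>l\<in>\<Lambda> - {k}. M l l l k) + 2 * (\<Sum>k\<in>\<Lambda>. \<Sum>l\<in>\<Lambda> - {k}. M k l k l)
     + 2 * (\<Sum>m\<in>\<Lambda>. \<Sum>k\<in>\<Lambda> - {m}. \<Sum>l\<in>\<Lambda> - {m, k}. M k m m l)
     + 2 * (\<Sum>k\<in>\<Lambda>. \<Sum>m\<in>\<Lambda> - {k}. \<Sum>l\<in>\<Lambda> - {m, k}. M k m m l)"
    by (simp add: sum.distrib sum_distrib_left[symmetric])
  also have "(\<Sum>k\<in>\<Lambda>. \<Sum>l\<in>\<Lambda> - {k}. M l l l k) = (\<Sum>k\<in>\<Lambda>. \<Sum>l\<in>\<Lambda> - {k}. M k k k l)"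
    by (rule sum_offdiag_swap[OF fin])
  also have "(\<Sum>k\<in>\<Lambda>. \<Sum>m\<in>\<Lambda> - {k}. \<Sum>l\<in>\<Lambda> - {m, k}. M k m m l) = (\<Sum>m\<in>\<Lambda>. \<Sum>k\<in>\<Lambda> - {m}. \<Sum>l\<in>\<Lambda> - {m, k}. M k m m l)"
    by (rule sum_offdiag_swap[OF fin, of "\<lambda>k m. \<Sum>l\<in>\<Lambda> - {k, m}. M m k k l"])
  finally show ?thesis by simp
qed

context pair_block_ensemble
begin

theorem second_moment:
  "av (\<lambda>P. (\<Sum>k\<in>\<Lambda>. \<Sum>l\<in>\<Lambda>. V k l P)\<^sup>2)
    = (\<Sum>k\<in>\<Lambda>. av (\<lambda>P. V k k P * V k k P)) + 4 * (\<Sum>k\<in>\<Lambda>. \<Sum>l\<in>\<Lambda> - {k}. av (\<lambda>P. V k k P * V k l P))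
      + 2 * (\<Sum>k\<in>\<Lambda>. \<Sum>l\<in>\<Lambda> - {k}. av (\<lambda>P. V k l P * V k l P))
      + 4 * (\<Sum>m\<in>\<Lambda>. \<Sum>k\<in>\<Lambda> - {m}. \<Sum>l\<in>\<Lambda> - {m, k}. av (\<lambda>P. V k m P * V m l P))"
proof -
  have "(\<Sum>k\<in>\<Lambda>. \<Sum>l\<in>\<Lambda>. V k l P)\<^sup>2 = (\<Sum>k\<in>\<Lambda>. \<Sum>l\<in>\<Lambda>. \<Sum>k'\<in>\<Lambda>. \<Sum>l'\<in>\<Lambda>. V k l P * V k' l' P)" for P
    unfolding power2_eq_square sum_distrib_right unfolding sum_distrib_left ..
  then have "av (\<lambda>P. (\<Sum>k\<in>\<Lambda>. \<Sum>l\<in>\<Lambda>. V k l P)\<^sup>2) = (\<Sum>k\<in>\<Lambda>. \<Sum>l\<in>\<Lambda>. \<Sum>k'\<in>\<Lambda>. \<Sum>l'\<in>\<Lambda>. av (\<lambda>P. V k l P * V k' l' P))"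
    by (simp only: avg_sum)
  then show ?thesis
    using sum_interacting_pairs[OF fin\<Lambda>, of "\<lambda>k l k' l'. av (\<lambda>P. V k l P * V k' l' P)"] av_VV_disjoint
    by (simp add: V_sym mult.commute)
qed

end

subsection \<open>The torus\<close>

lemma torus_norm_ge_0: "torus_norm v \<ge> 0"
  by (simp add: torus_norm_def infdist_nonneg)

lemma integer_lattice_ne: "{z :: real ^ 'd::finite. \<forall>i. z $ i \<in> \<int>} \<noteq> {}"
  by (auto intro!: exI[of _ 0])

lemma torus_norm_INF: "torus_norm v = (INF z\<in>{z. \<forall>i. z $ i \<in> \<int>}. dist v z)"
  by (simp only: torus_norm_def infdist_def integer_lattice_ne if_False)

lemma torus_norm_le_norm: "torus_norm v \<le> norm v"
  unfolding torus_norm_def by (rule infdist_le2[of 0]) (auto simp: dist_norm)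

lemma torus_norm_diff: "torus_norm u \<le> torus_norm v + norm (u - v)"
  unfolding torus_norm_def using infdist_triangle[of u _ v] by (simp add: dist_norm)

lemma torus_norm_add_int:
  assumes "\<And>i. z $ i \<in> \<int>"
  shows "torus_norm (v + z) = torus_norm v"
proof -
  let ?Z = "{z :: real ^ 'a. \<forall>i. z $ i \<in> \<int>}"
  have "?Z = (\<lambda>w. w + z) ` ?Z"
  proof (intro equalityI subsetI)
    fix w assume "w \<in> ?Z"
    then have "w - z \<in> ?Z" using assms by auto
    then show "w \<in> (\<lambda>w. w + z) ` ?Z" by (intro image_eqI[of _ _ "w - z"]) auto
  qed (use assms in auto)
  then have "(INF w\<in>?Z. dist (v + z) w) = (INF w\<in>(\<lambda>w. w + z) ` ?Z. dist (v + z) w)" by simp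
  also have "\<dots> = (INF w\<in>?Z. dist v w)" by (simp add: image_image dist_norm)
  finally show ?thesis by (simp only: torus_norm_INF)
qed

lemma torus_norm_minus: "torus_norm (- v) = torus_norm v"
proof -
  let ?Z = "{z :: real ^ 'a. \<forall>i. z $ i \<in> \<int>}"
  have "?Z = uminus ` ?Z"
  proof (intro equalityI subsetI)
    fix w assume "w \<in> ?Z"
    then have "- w \<in> ?Z" by auto
    then show "w \<in> uminus ` ?Z" by (intro image_eqI[of _ _ "- w"]) auto
  qed auto
  then have "(INF w\<in>?Z. dist (- v) w) = (INF w\<in>uminus ` ?Z. dist (- v) w)" by simp
  also have "\<dots> = (INF w\<in>?Z. dist v w)" by (simp add: image_image dist_minus)
  finally show ?thesis by (simp only: torus_norm_INF)
qed

lemma torus_norm_triangle: "torus_norm (u + v) \<le> torus_norm u + torus_norm v"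
proof -
  let ?Z = "{z :: real ^ 'a. \<forall>i. z $ i \<in> \<int>}"
  have "torus_norm (u + v) - torus_norm v \<le> dist u z" if "z \<in> ?Z" for z
  proof -
    have "torus_norm (u + v) = torus_norm (u + v + (- z))"
      by (rule torus_norm_add_int[symmetric]) (use that in auto)
    also have "\<dots> \<le> torus_norm v + norm (u - z)"
      using torus_norm_diff[of "u + v + (- z)" v] by simp
    finally show ?thesis by (simp add: dist_norm)
  qed
  then have "torus_norm (u + v) - torus_norm v \<le> (INF z\<in>?Z. dist u z)"
    using integer_lattice_ne by (intro cINF_greatest) auto
  then show ?thesis by (simp add: torus_norm_INF)
qed

lemma torus_norm_lt_imp:
  assumes "torus_norm v < r"
  obtains z where "\<And>i. z $ i \<in> \<int>" "norm (v - z) < r"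
proof -
  let ?Z = "{z :: real ^ 'a. \<forall>i. z $ i \<in> \<int>}"
  have "(INF z\<in>?Z. dist v z) < r"
    using assms by (simp add: torus_norm_INF)
  then obtain z where "z \<in> ?Z" "dist v z < r"
    using integer_lattice_ne by (subst (asm) cINF_less_iff) (auto intro: bdd_belowI[of _ 0])
  then show ?thesis using that by (auto simp: dist_norm)
qed

subsection \<open>Lattices and cells\<close>

lemma torus_lattice_eq: "torus_lattice n = (\<lambda>f. \<chi> i. real (f i) / real n) ` (UNIV \<rightarrow>\<^sub>E {..<n})"
proof (intro equalityI subsetI)
  fix x :: "real ^ 'a" assume "x \<in> torus_lattice n"
  then obtain f where "\<And>i. f i < n \<and> x $ i = real (f i) / real n"
    unfolding torus_lattice_def by auto metis
  then show "x \<in> (\<lambda>f. \<chi> i. real (f i) / real n) ` (UNIV \<rightarrow>\<^sub>E {..<n})"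
    by (intro image_eqI[of _ _ f]) (auto simp: vec_eq_iff)
qed (auto simp: torus_lattice_def PiE_iff, blast)

lemma finite_torus_lattice: "finite (torus_lattice n)"
  unfolding torus_lattice_eq by (intro finite_imageI finite_PiE) auto

lemma card_torus_lattice:
  assumes "n \<ge> 1"
  shows "card (torus_lattice n :: (real ^ 'd::finite) set) = n ^ CARD('d)"
proof -
  have "inj_on (\<lambda>f. (\<chi> i. real (f i) / real n) :: real ^ 'd) (UNIV \<rightarrow>\<^sub>E {..<n})"
    using assms by (auto simp: inj_on_def vec_eq_iff fun_eq_iff)
  then show ?thesis unfolding torus_lattice_eq by (simp add: card_image card_PiE)
qed

lemma torus_latticeD:
  assumes "x \<in> torus_lattice n"
  obtains f where "\<And>i. f i < n" "\<And>i. x $ i = real (f i) / real n"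
  using assms unfolding torus_lattice_def by auto metis

lemma torus_latticeI: "(\<And>i. f i < n) \<Longrightarrow> (\<And>i. x $ i = real (f i) / real n) \<Longrightarrow> x \<in> torus_lattice n"
  unfolding torus_lattice_def by auto

lemma torus_lattice_bounds: "x \<in> torus_lattice n \<Longrightarrow> 0 \<le> x $ i" "x \<in> torus_lattice n \<Longrightarrow> x $ i < 1"
  by (auto elim!: torus_latticeD simp: divide_less_eq)

text \<open>Rounding down to the coarse lattice. This is the map from sites to cells with which the
  abstract ensembles are instantiated, a cell being named by its lower corner.\<close>

definition corner :: "nat \<Rightarrow> real ^ 'd::finite \<Rightarrow> real ^ 'd" where
  "corner m x = (\<chi> i. of_int \<lfloor>real m * x $ i\<rfloor> / real m)"

lemma corner_coordinate:
  assumes "m \<ge> 1" "q \<ge> 1" "x $ i = real j / real (m * q)"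
  shows "corner m x $ i = real (j div q) / real m"
proof -
  have "real m * x $ i = real j / real q" using assms by simp
  then show ?thesis unfolding corner_def by (simp add: floor_divide_of_nat_eq)
qed

lemma corner_in:
  assumes "m \<ge> 1" "q \<ge> 1" "x \<in> torus_lattice (m * q)"
  shows "corner m x \<in> torus_lattice m"
proof -
  obtain f where f: "\<And>i. f i < m * q" "\<And>i. x $ i = real (f i) / real (m * q)"
    using torus_latticeD[OF assms(3)] by blast
  show ?thesis
    by (rule torus_latticeI[of "\<lambda>i. f i div q"])
      (use f corner_coordinate[OF assms(1,2) f(2)] assms in \<open>auto simp: less_mult_imp_div_less\<close>)
qed

lemma cell_eq:
  assumes "m \<ge> 1" "q \<ge> 1" "k \<in> torus_lattice m"
  shows "cell m q k = {x \<in> torus_lattice (m * q). corner m x = k}"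
proof -
  obtain g where g: "\<And>i. g i < m" "\<And>i. k $ i = real (g i) / real m"
    using torus_latticeD[OF assms(3)] by blast
  have "(\<forall>i. k $ i \<le> x $ i \<and> x $ i < k $ i + 1 / real m) \<longleftrightarrow> corner m x = k" for x :: "real ^ 'a"
  proof -
    have "(k $ i \<le> x $ i \<and> x $ i < k $ i + 1 / real m) \<longleftrightarrow> corner m x $ i = k $ i" for i
    proof -
      have 1: "k $ i \<le> x $ i \<longleftrightarrow> real m * k $ i \<le> real m * x $ i" using assms(1) by simp
      have 2: "x $ i < k $ i + 1 / real m \<longleftrightarrow> real m * x $ i < real m * k $ i + 1"
        using assms(1) mult_less_cancel_left_pos[of "real m" "x $ i" "k $ i + 1 / real m"]
        by (simp add: distrib_left)
      have "(k $ i \<le> x $ i \<and> x $ i < k $ i + 1 / real m) \<longleftrightarrow>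
          real_of_int (int (g i)) \<le> real m * x $ i \<and> real m * x $ i < real_of_int (int (g i)) + 1"
        unfolding 1 2 using assms(1) g(2)[of i] by simp
      also have "\<dots> \<longleftrightarrow> \<lfloor>real m * x $ i\<rfloor> = int (g i)" by (simp add: floor_eq_iff)
      also have "\<dots> \<longleftrightarrow> corner m x $ i = k $ i"
        using assms(1) g(2)[of i] by (simp add: corner_def) linarith
      finally show ?thesis .
    qed
    then show ?thesis by (simp add: vec_eq_iff)
  qed
  then show ?thesis unfolding cell_def by auto
qed

lemma cell_param:
  fixes k :: "real ^ 'd::finite"
  assumes "m \<ge> 1" "q \<ge> 1" "k \<in> torus_lattice m"
  shows "cell m q k = (\<lambda>s. \<chi> i. k $ i + real (s i) / real (m * q)) ` (UNIV \<rightarrow>\<^sub>E {..<q})"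
proof (intro equalityI subsetI)
  obtain g where g: "\<And>i. g i < m" "\<And>i. k $ i = real (g i) / real m"
    using torus_latticeD[OF assms(3)] by blast
  fix x
  {
    assume x: "x \<in> cell m q k"
    then obtain f where f: "\<And>i. f i < m * q" "\<And>i. x $ i = real (f i) / real (m * q)"
      using torus_latticeD unfolding cell_def by blast
    have "corner m x = k" using x cell_eq[OF assms] by simp
    then have "real (f i div q) / real m = real (g i) / real m" for i
      using corner_coordinate[OF assms(1,2) f(2)[of i]] g(2)[of i] by metis
    then have fg: "f i div q = g i" for i using assms by simp
    have "x $ i = k $ i + real (f i mod q) / real (m * q)" for i
    proof -
      have "real (f i) = real (g i) * real q + real (f i mod q)"
        unfolding fg[symmetric] of_nat_mult[symmetric] of_nat_add[symmetric] by simp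
      then show ?thesis using f(2) g(2) assms by (simp add: add_divide_distrib)
    qed
    then show "x \<in> (\<lambda>s. \<chi> i. k $ i + real (s i) / real (m * q)) ` (UNIV \<rightarrow>\<^sub>E {..<q})"
      using assms by (intro image_eqI[of _ _ "\<lambda>i. f i mod q"]) (auto simp: vec_eq_iff)
  next
    assume "x \<in> (\<lambda>s. \<chi> i. k $ i + real (s i) / real (m * q)) ` (UNIV \<rightarrow>\<^sub>E {..<q})"
    then obtain s where s': "s \<in> UNIV \<rightarrow>\<^sub>E {..<q}" and s2: "x = (\<chi> i. k $ i + real (s i) / real (m * q))"
      by (rule imageE)
    then have s: "\<And>i. s i < q" "x = (\<chi> i. k $ i + real (s i) / real (m * q))" by (auto simp: PiE_iff)
    have x: "x $ i = real (g i * q + s i) / real (m * q)" for i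
      using s g assms by (simp add: add_divide_distrib)
    have "g i * q + s i < m * q" for i
    proof -
      have "g i * q + s i < (g i + 1) * q" using s(1)[of i] by simp
      also have "\<dots> \<le> m * q" using g(1)[of i] by (intro mult_le_mono1) simp
      finally show ?thesis .
    qed
    then have "x \<in> torus_lattice (m * q)" using x by (rule torus_latticeI)
    moreover have "corner m x $ i = k $ i" for i
      using corner_coordinate[OF assms(1,2) x[of i]] g(2)[of i] s(1)[of i] by simp
    then have "corner m x = k" by (simp add: vec_eq_iff)
    ultimately show "x \<in> cell m q k" using cell_eq[OF assms] by simp
  }
qed

lemma card_cell:
  fixes k :: "real ^ 'd::finite"
  assumes "m \<ge> 1" "q \<ge> 1" "k \<in> torus_lattice m"
  shows "card (cell m q k) = q ^ CARD('d)"
proof -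
  have "inj_on (\<lambda>s. (\<chi> i. k $ i + real (s i) / real (m * q)) :: real ^ 'd) (UNIV \<rightarrow>\<^sub>E {..<q})"
    using assms by (auto simp: inj_on_def vec_eq_iff fun_eq_iff)
  then show ?thesis unfolding cell_param[OF assms] by (simp add: card_image card_PiE)
qed

text \<open>Each coordinate varies by at most \<open>1 / m\<close> in a cell; estimating the
  Euclidean norm by the sum of the coordinates gives the constant \<open>CARD('d)\<close>.\<close>

lemma corner_dist:
  fixes x :: "real ^ 'd::finite"
  assumes "m \<ge> 1" "q \<ge> 1" "k \<in> torus_lattice m" "x \<in> cell m q k" "y \<in> cell m q k"
  shows "norm (x - y) \<le> CARD('d) / m" "norm (x - k) \<le> CARD('d) / m"
proof -
  have b: "k $ i \<le> x $ i \<and> x $ i < k $ i + 1 / real m" "k $ i \<le> y $ i \<and> y $ i < k $ i + 1 / real m" for i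
    using assms by (auto simp: cell_def)
  have n: "norm v \<le> CARD('d) / m" if "\<And>i. \<bar>v $ i\<bar> \<le> 1 / m" for v :: "real ^ 'd"
  proof -
    have "norm v \<le> (\<Sum>i\<in>UNIV. \<bar>v $ i\<bar>)" by (rule norm_le_l1_cart)
    also have "\<dots> \<le> (\<Sum>i\<in>(UNIV :: 'd set). 1 / m)" by (intro sum_mono that)
    finally show ?thesis by simp
  qed
  show "norm (x - y) \<le> CARD('d) / m"
    by (rule n) (use b in \<open>simp add: abs_le_iff\<close>, smt (verit))
  show "norm (x - k) \<le> CARD('d) / m"
    by (rule n) (use b in \<open>simp add: abs_le_iff\<close>, smt (verit))
qed

subsection \<open>Symmetries\<close>

lemma frac_nat_div: "n \<ge> 1 \<Longrightarrow> frac (real j / real n) = real (j mod n) / real n"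
proof -
  assume "n \<ge> 1"
  have "real j = real (j div n) * real n + real (j mod n)"
    unfolding of_nat_mult[symmetric] of_nat_add[symmetric] by simp
  then have "real j / real n = real (j div n) + real (j mod n) / real n"
    using \<open>n \<ge> 1\<close> by (simp add: add_divide_distrib)
  then show ?thesis by (simp add: frac_def floor_divide_of_nat_eq)
qed

lemma shift_coordinate:
  assumes "n \<ge> 1" "a $ i = real b / real n" "x $ i = real j / real n"
  shows "torus_shift a x $ i = real ((j + b) mod n) / real n"
proof -
  have "x $ i + a $ i = real (j + b) / real n" using assms by (simp add: add_divide_distrib)
  then show ?thesis unfolding torus_shift_def vec_lambda_beta by (simp only: frac_nat_div[OF assms(1)])
qed

lemma shift_in:
  assumes "n \<ge> 1" "a \<in> torus_lattice n" "x \<in> torus_lattice n"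
  shows "torus_shift a x \<in> torus_lattice n"
proof -
  obtain b f where "\<And>i. a $ i = real (b i) / real n" "\<And>i. x $ i = real (f i) / real n"
    using torus_latticeD[OF assms(2)] torus_latticeD[OF assms(3)] by metis
  then show ?thesis
    using shift_coordinate[OF assms(1), of a _ "b _" x "f _"] assms(1)
    by (intro torus_latticeI[of "\<lambda>i. (f i + b i) mod n"]) auto
qed

lemma shift_diff_int:
  fixes a x y :: "real ^ 'd::finite"
  shows "\<exists>z. (\<forall>i. z $ i \<in> \<int>) \<and> torus_shift a x - torus_shift a y = (x - y) + z"
proof (intro exI conjI allI)
  let ?z = "\<chi> i. of_int (\<lfloor>y $ i + a $ i\<rfloor> - \<lfloor>x $ i + a $ i\<rfloor>) :: real ^ 'd"
  show "?z $ i \<in> \<int>" for i by simp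
  show "torus_shift a x - torus_shift a y = (x - y) + ?z"
    by (simp add: vec_eq_iff torus_shift_def frac_def)
qed

lemma torus_norm_shift: "torus_norm (torus_shift a x - torus_shift a y) = torus_norm (x - y)"
  using shift_diff_int[of a x y] torus_norm_add_int by metis

lemma lattice_eq_mod_int:
  assumes "x \<in> torus_lattice n" "y \<in> torus_lattice n" "\<And>i. x $ i - y $ i \<in> \<int>"
  shows "x = y"
proof -
  have "x $ i = y $ i" for i
  proof -
    obtain z where z: "x $ i - y $ i = of_int z" using assms(3)[of i] by (auto elim: Ints_cases)
    have "\<bar>x $ i - y $ i\<bar> < 1"
      using torus_lattice_bounds[OF assms(1), of i] torus_lattice_bounds[OF assms(2), of i] by simp
    then have "z = 0" unfolding z by simp
    then show ?thesis using z by simp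
  qed
  then show ?thesis by (simp add: vec_eq_iff)
qed

lemma shift_inj: "inj_on (torus_shift a) (torus_lattice n)"
proof (rule inj_onI)
  fix x y assume xy: "x \<in> torus_lattice n" "y \<in> torus_lattice n" "torus_shift a x = torus_shift a y"
  obtain z where z: "\<forall>i. z $ i \<in> \<int>" "(x - y) + z = 0"
    using shift_diff_int[of a x y] xy(3) by auto
  have "x $ i - y $ i = - (z $ i)" for i using z(2) by (simp add: vec_eq_iff eq_neg_iff_add_eq_0)
  then show "x = y" using z(1) by (intro lattice_eq_mod_int[OF xy(1,2)]) auto
qed

lemma shift_bij:
  assumes "n \<ge> 1" "a \<in> torus_lattice n"
  shows "bij_betw (torus_shift a) (torus_lattice n) (torus_lattice n)"
  unfolding bij_betw_def using shift_inj shift_in[OF assms]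
  by (metis endo_inj_surj finite_torus_lattice image_subsetI)

lemma torus_lattice_mult:
  assumes "q \<ge> 1" "a \<in> torus_lattice m"
  shows "a \<in> torus_lattice (m * q)"
proof -
  obtain b where b: "\<And>i. b i < m" "\<And>i. a $ i = real (b i) / real m"
    using torus_latticeD[OF assms(2)] by blast
  show ?thesis by (rule torus_latticeI[of "\<lambda>i. b i * q"]) (use b assms in auto)
qed

text \<open>A coarse translation moves numerators by multiples of \<open>q\<close>. Reduction modulo
  \<open>m * q\<close> followed by division by \<open>q\<close> is then division by \<open>q\<close>
  followed by reduction modulo \<open>m\<close>, so wrapping around the torus respects the
  cells.\<close>

lemma corner_shift:
  assumes "m \<ge> 1" "q \<ge> 1" "a \<in> torus_lattice m" "x \<in> torus_lattice (m * q)"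
  shows "corner m (torus_shift a x) = torus_shift a (corner m x)"
proof -
  obtain b where b: "\<And>i. a $ i = real (b i) / real m"
    using torus_latticeD[OF assms(3)] by metis
  obtain f where f: "\<And>i. x $ i = real (f i) / real (m * q)"
    using torus_latticeD[OF assms(4)] by metis
  have a: "a $ i = real (b i * q) / real (m * q)" for i using b assms by simp
  have mq: "m * q \<ge> 1" using assms by simp
  have "corner m (torus_shift a x) $ i = torus_shift a (corner m x) $ i" for i
  proof -
    have "corner m (torus_shift a x) $ i = real ((f i + b i * q) mod (m * q) div q) / real m"
      by (rule corner_coordinate[OF assms(1,2) shift_coordinate[OF mq a f]])
    also have "(f i + b i * q) mod (m * q) div q = (f i div q + b i) mod m"
      using assms(2) by (simp add: mult.commute[of m q] mod_mult2_eq add.commute)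
    also have "real \<dots> / real m = torus_shift a (corner m x) $ i"
      by (rule shift_coordinate[OF assms(1) b corner_coordinate[OF assms(1,2) f], symmetric])
    finally show ?thesis .
  qed
  then show ?thesis by (simp add: vec_eq_iff)
qed

text \<open>The point reflection exchanging the cells \<open>k\<close> and \<open>l\<close>; unlike a translation it needs no reduction modulo
  the integers.\<close>
definition reflect :: "nat \<Rightarrow> nat \<Rightarrow> real ^ 'd::finite \<Rightarrow> real ^ 'd \<Rightarrow> real ^ 'd \<Rightarrow> real ^ 'd" where
  "reflect m q k l x = (\<chi> i. k $ i + l $ i + (real q - 1) / real (m * q) - x $ i)"

lemma reflect_in:
  assumes "m \<ge> 1" "q \<ge> 1" "k \<in> torus_lattice m" "l \<in> torus_lattice m" "x \<in> cell m q k"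
  shows "reflect m q k l x \<in> cell m q l"
proof -
  obtain s where s': "s \<in> UNIV \<rightarrow>\<^sub>E {..<q}" and s2: "x = (\<chi> i. k $ i + real (s i) / real (m * q))"
    using assms(5) unfolding cell_param[OF assms(1-3)] by (rule imageE)
  have s1: "s i < q" for i using s' by (auto simp: PiE_iff)
  \<comment> \<open>The offset \<open>s i\<close> within the cell becomes
    \<open>q - 1 - s i\<close>. The constant \<open>(q - 1) / (m q)\<close> in
    \<open>reflect\<close> is chosen so that the extreme lattice points of the half-open cells
    correspond.\<close>
  have "reflect m q k l x = (\<chi> i. l $ i + real (q - 1 - s i) / real (m * q))"
  proof -
    have "real (q - 1 - s i) = real q - 1 - real (s i)" for i
      using s1[of i] by (simp add: of_nat_diff)
    then show ?thesis unfolding reflect_def s2 by (simp add: vec_eq_iff diff_divide_distrib)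
  qed
  then show ?thesis unfolding cell_param[OF assms(1,2,4)]
    using assms(2) by (intro image_eqI[of _ _ "\<lambda>i. q - 1 - s i"]) auto
qed

lemma reflect_bij:
  assumes "m \<ge> 1" "q \<ge> 1" "k \<in> torus_lattice m" "l \<in> torus_lattice m"
  shows "bij_betw (reflect m q k l) (cell m q k) (cell m q l)"
proof (rule bij_betw_byWitness[where f' = "reflect m q l k"])
  show "reflect m q k l ` cell m q k \<subseteq> cell m q l" "reflect m q l k ` cell m q l \<subseteq> cell m q k"
    using reflect_in assms by blast+
qed (auto simp: reflect_def vec_eq_iff)

lemma reflect_diff: "reflect m q k l x - reflect m q k l y = y - x"
  by (simp add: reflect_def vec_eq_iff)

lemma reflect_commute: "reflect m q k l = reflect m q l k"
  by (simp add: reflect_def fun_eq_iff vec_eq_iff)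

subsection \<open>Counting lattice points\<close>

text \<open>The displacement from \<open>x\<close> to \<open>y\<close>, corrected by the nearby
  integer vector, is a whole number \<open>g\<close> of lattice spacings in each coordinate, and
  \<open>y\<close> is recovered from \<open>g\<close> by wrapping around. Near points are thus coded
  injectively by integer vectors in a cube, which gives the counting bound.\<close>

lemma close_lattice_points:
  assumes n: "n \<ge> 1" and xy: "x \<in> torus_lattice n" "y \<in> torus_lattice n" and r: "real n * torus_norm (x - y) < r"
  obtains g :: "'d::finite \<Rightarrow> int" where "\<And>i. \<bar>real_of_int (g i)\<bar> < r" "(y :: real ^ 'd) = (\<chi> i. frac (x $ i - real_of_int (g i) / real n))"
proof -
  have "torus_norm (x - y) < r / n" using r n by (simp add: field_simps)
  then obtain z where z: "\<And>i. z $ i \<in> \<int>" "norm (x - y - z) < r / n" using torus_norm_lt_imp by blast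
  obtain f where f: "\<And>i. x $ i = real (f i) / real n" using torus_latticeD[OF xy(1)] by metis
  obtain h where h: "\<And>i. y $ i = real (h i) / real n" using torus_latticeD[OF xy(2)] by metis
  have "\<exists>w. z $ i = real_of_int w" for i using z(1)[of i] by (auto elim: Ints_cases)
  then obtain w where w: "\<And>i. z $ i = real_of_int (w i)" by metis
  define g where "g i = int (f i) - int (h i) - int n * w i" for i
  have g: "real_of_int (g i) = real n * (x - y - z) $ i" for i
    using n by (simp add: g_def f h w field_simps)
  have "\<bar>real_of_int (g i)\<bar> < r" for i
  proof -
    have "\<bar>(x - y - z) $ i\<bar> < r / n" using component_le_norm_cart[of "x - y - z" i] z(2) by linarith
    then show ?thesis unfolding g abs_mult using n by (simp add: field_simps)
  qed
  moreover have "y = (\<chi> i. frac (x $ i - real_of_int (g i) / real n))"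
  proof -
    have "frac (x $ i - real_of_int (g i) / real n) = y $ i" for i
    proof -
      have "x $ i - real_of_int (g i) / real n = y $ i + of_int (w i)" unfolding g using n w by simp
      moreover have "frac (y $ i) = y $ i" using torus_lattice_bounds[OF xy(2), of i] by (simp add: frac_eq)
      ultimately show ?thesis by (simp add: frac_def)
    qed
    then show ?thesis by (simp add: vec_eq_iff)
  qed
  ultimately show ?thesis using that by blast
qed

lemma close_lattice_points_eq:
  assumes "n \<ge> 1" "x \<in> torus_lattice n" "y \<in> torus_lattice n" "real n * torus_norm (x - y) < 1"
  shows "y = x"
proof -
  obtain g :: "'a \<Rightarrow> int" where g: "\<And>i. \<bar>real_of_int (g i)\<bar> < 1" "y = (\<chi> i. frac (x $ i - real_of_int (g i) / real n))"
    using close_lattice_points[OF assms] by blast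
  have "g i = 0" for i using g(1)[of i] by linarith
  moreover have "frac (x $ i) = x $ i" for i using torus_lattice_bounds[OF assms(2), of i] by (simp add: frac_eq)
  ultimately show ?thesis unfolding g(2) by (simp add: vec_eq_iff)
qed

lemma card_close_lattice_points:
  fixes x :: "real ^ 'd::finite"
  assumes "n \<ge> 1" "x \<in> torus_lattice n" "r \<ge> 0"
  shows "real (card {y \<in> torus_lattice n. real n * torus_norm (x - y) < r}) \<le> (2 * r + 1) ^ CARD('d)"
proof -
  let ?G = "UNIV \<rightarrow>\<^sub>E {- \<lfloor>r\<rfloor>..\<lfloor>r\<rfloor>} :: ('d \<Rightarrow> int) set"
  have fin: "finite ?G" by (intro finite_PiE) auto
  have "{y \<in> torus_lattice n. real n * torus_norm (x - y) < r} \<subseteq> (\<lambda>g. \<chi> i. frac (x $ i - real_of_int (g i) / real n)) ` ?G"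
  proof
    fix y assume "y \<in> {y \<in> torus_lattice n. real n * torus_norm (x - y) < r}"
    then obtain g :: "'d \<Rightarrow> int" where g: "\<And>i. \<bar>real_of_int (g i)\<bar> < r" "y = (\<chi> i. frac (x $ i - real_of_int (g i) / real n))"
      using close_lattice_points[OF assms(1,2)] by blast
    have "g i \<in> {- \<lfloor>r\<rfloor>..\<lfloor>r\<rfloor>}" for i using g(1)[of i] by (simp add: le_floor_iff) linarith
    then show "y \<in> (\<lambda>g. \<chi> i. frac (x $ i - real_of_int (g i) / real n)) ` ?G" using g(2) by blast
  qed
  then have "card {y \<in> torus_lattice n. real n * torus_norm (x - y) < r} \<le> card ?G"
    using fin by (meson card_image_le card_mono finite_imageI order_trans)
  then have "real (card {y \<in> torus_lattice n. real n * torus_norm (x - y) < r}) \<le> real (card ?G)" by simp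
  also have "\<dots> = real_of_int (2 * \<lfloor>r\<rfloor> + 1) ^ CARD('d)" using assms(3) by (simp add: card_PiE)
  also have "\<dots> \<le> (2 * r + 1) ^ CARD('d)" using assms(3) by (intro power_mono) auto
  finally show ?thesis .
qed

subsection \<open>The Kac model\<close>

lemma sum_diff1_if: "finite A \<Longrightarrow> (\<Sum>y\<in>A - {x}. f y) = (\<Sum>y\<in>A. if y = x then 0 else f y :: real)"
  by (rule sum.mono_neutral_cong_left) auto

text \<open>\<open>D\<close> bounds the oscillation of the coupling over a pair of cells, and cells further apart than \<open>\<rho>\<close> do not
  interact.\<close>
locale kac_model =
  fixes m q :: nat and L :: real and V V' :: "real \<Rightarrow> real" and J :: "real ^ 'd::finite \<Rightarrow> real"
    and Q :: nat and G D \<rho> :: real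
  assumes m: "m \<ge> 1" and q: "q \<ge> 1" and L: "L > 0"
    and deriv: "\<And>t. t \<ge> 0 \<Longrightarrow> (V has_real_derivative V' t) (at t within {0..})"
    and cont: "continuous_on {0..} V'" and V_zero: "\<And>t. t \<ge> 1 \<Longrightarrow> V t = 0"
    and G_def: "G = (SUP t\<in>{0..}. \<bar>V' t\<bar>)"
    and J_def: "J = kac_potential (m * q) L V" and Q_def: "Q = q ^ CARD('d)"
    and D_def: "D = G / L ^ CARD('d) * (2 * CARD('d) * (q / L))"
    and \<rho>_def: "\<rho> = (1 + 2 * CARD('d)) * (L + q) / real (m * q)"
begin

abbreviation \<Lambda> :: "(real ^ 'd) set" where "\<Lambda> \<equiv> torus_lattice (m * q)"
abbreviation \<Lambda>' :: "(real ^ 'd) set" where "\<Lambda>' \<equiv> torus_lattice m"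

lemma mq: "m * q \<ge> 1" using m q by simp

lemma V'_zero:
  assumes "t > 1"
  shows "V' t = 0"
proof -
  have "(V has_real_derivative V' t) (at t)"
    using deriv[of t] assms by (simp add: at_within_interior[of t "{0..}"] interior_real_atLeast)
  moreover have "(V has_real_derivative 0) (at t)"
  proof (rule has_field_derivative_transform_within_open[of "\<lambda>_. 0" _ _ "{1<..}"])
    show "\<And>x. x \<in> {1<..} \<Longrightarrow> 0 = V x" using V_zero by auto
  qed (use assms in auto)
  ultimately show ?thesis by (rule DERIV_unique)
qed

text \<open>\<open>G\<close> is a supremum over an unbounded set and meaningful only once
  boundedness is known: \<open>V'\<close> is continuous on \<open>[0, 1]\<close>, and beyond 1 it
  vanishes because \<open>V\<close> does.\<close>

lemma V'_le_G:
  assumes "t \<ge> 0"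
  shows "\<bar>V' t\<bar> \<le> G"
proof -
  have "compact ((\<lambda>t. \<bar>V' t\<bar>) ` {0..1})"
    by (intro compact_continuous_image continuous_on_rabs continuous_on_subset[OF cont]) auto
  then obtain B where B: "\<And>t. t \<in> {0..1} \<Longrightarrow> \<bar>V' t\<bar> \<le> B"
    by (metis bounded_imp_bdd_above compact_imp_bounded bdd_above.E image_eqI)
  have "bdd_above ((\<lambda>t. \<bar>V' t\<bar>) ` {0..})"
  proof (rule bdd_aboveI2)
    fix t :: real assume "t \<in> {0..}"
    then show "\<bar>V' t\<bar> \<le> max B 0"
      using B[of t] V'_zero[of t] by (cases "t \<le> 1") auto
  qed
  then show ?thesis unfolding G_def using assms by (intro cSUP_upper) auto
qed

lemma G_nonneg: "G \<ge> 0" using V'_le_G[of 0] by simp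

lemma V_lipschitz:
  assumes "s \<ge> 0" "t \<ge> 0"
  shows "\<bar>V s - V t\<bar> \<le> G * \<bar>s - t\<bar>"
  using field_differentiable_bound[of "{0..}" V V' G s t] deriv V'_le_G assms by simp

text \<open>\<open>V\<close> is 0 at distance 1, hence a Lipschitz bound over an interval of length
  at most 1 bounds \<open>V\<close> itself by the supremum of its derivative.\<close>

lemma V_bound:
  assumes "t \<ge> 0"
  shows "\<bar>V t\<bar> \<le> G"
proof (cases "t \<le> 1")
  case True
  have "\<bar>V t - V 1\<bar> \<le> G * \<bar>t - 1\<bar>" using assms by (intro V_lipschitz) auto
  also have "\<dots> \<le> G * 1" using True assms G_nonneg by (intro mult_left_mono) auto
  finally show ?thesis using V_zero[of 1] by simp
qed (use V_zero[of t] G_nonneg in auto)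

lemma scaled_norm_nonneg: "real (m * q) / L * torus_norm v \<ge> 0"
  using L torus_norm_ge_0[of v] by simp

lemma J_bound: "\<bar>J v\<bar> \<le> G / L ^ CARD('d)"
  unfolding J_def kac_potential_def abs_divide
  using L V_bound[OF scaled_norm_nonneg[of v]] by (simp add: divide_right_mono)

lemma J_zero: "real (m * q) * torus_norm v \<ge> L \<Longrightarrow> J v = 0"
  unfolding J_def kac_potential_def using L by (simp add: V_zero)

lemma J_minus: "J (- v) = J v"
  by (simp add: J_def kac_potential_def torus_norm_minus)

lemma J_commute: "J (x - y) = J (y - x)"
  using J_minus[of "y - x"] by simp

lemma J_shift: "J (torus_shift a x - torus_shift a y) = J (x - y)"
  by (simp add: J_def kac_potential_def torus_norm_shift)

lemma J_lipschitz: "\<bar>J u - J v\<bar> \<le> G / L ^ CARD('d) * (real (m * q) / L) * norm (u - v)"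
proof -
  have "\<bar>J u - J v\<bar> = \<bar>V (real (m * q) / L * torus_norm u) - V (real (m * q) / L * torus_norm v)\<bar> / L ^ CARD('d)"
    using L unfolding J_def kac_potential_def by (simp add: diff_divide_distrib[symmetric] abs_divide)
  also have "\<dots> \<le> G * \<bar>real (m * q) / L * torus_norm u - real (m * q) / L * torus_norm v\<bar> / L ^ CARD('d)"
    using L by (intro divide_right_mono V_lipschitz scaled_norm_nonneg) auto
  also have "\<bar>real (m * q) / L * torus_norm u - real (m * q) / L * torus_norm v\<bar> = real (m * q) / L * \<bar>torus_norm u - torus_norm v\<bar>"
    unfolding right_diff_distrib[symmetric] abs_mult using L by simp
  also have "G * (real (m * q) / L * \<bar>torus_norm u - torus_norm v\<bar>) / L ^ CARD('d)
      \<le> G * (real (m * q) / L * norm (u - v)) / L ^ CARD('d)"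
    using torus_norm_diff[of u v] torus_norm_diff[of v u] L G_nonneg
    by (intro divide_right_mono mult_left_mono) (auto simp: norm_minus_commute)
  finally show ?thesis by (simp add: mult_ac)
qed

text \<open>For \<open>L <= 1\<close> distinct lattice points are too far apart to interact. For
  \<open>L > 1\<close> a point has at most \<open>(2 L + 1) ^ d <= (3 L) ^ d\<close> neighbours,
  each with a coupling of at most \<open>G / L ^ d\<close>.\<close>

lemma sum_J:
  assumes "x \<in> \<Lambda>"
  shows "(\<Sum>y\<in>\<Lambda> - {x}. \<bar>J (x - y)\<bar>) \<le> 3 ^ CARD('d) * G"
proof (cases "L \<le> 1")
  case True
  have "J (x - y) = 0" if "y \<in> \<Lambda> - {x}" for y
  proof (rule J_zero, rule ccontr)
    assume "\<not> L \<le> real (m * q) * torus_norm (x - y)"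
    then have "y = x" using True that by (intro close_lattice_points_eq[OF mq assms]) auto
    then show False using that by simp
  qed
  then show ?thesis using G_nonneg by simp
next
  case False
  let ?A = "{y \<in> \<Lambda>. real (m * q) * torus_norm (x - y) < L}"
  have "(\<Sum>y\<in>\<Lambda> - {x}. \<bar>J (x - y)\<bar>) \<le> (\<Sum>y\<in>\<Lambda>. \<bar>J (x - y)\<bar>)"
    by (rule sum_mono2) (auto simp: finite_torus_lattice)
  also have "\<dots> = (\<Sum>y\<in>?A. \<bar>J (x - y)\<bar>)"
    by (rule sum.mono_neutral_right) (auto simp: finite_torus_lattice intro!: J_zero)
  also have "\<dots> \<le> (\<Sum>y\<in>?A. G / L ^ CARD('d))" by (intro sum_mono J_bound)
  also have "\<dots> = real (card ?A) * (G / L ^ CARD('d))" by simp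
  also have "\<dots> \<le> (3 * L) ^ CARD('d) * (G / L ^ CARD('d))"
  proof (rule mult_right_mono)
    have "real (card ?A) \<le> (2 * L + 1) ^ CARD('d)"
      using L by (intro card_close_lattice_points[OF mq assms]) auto
    also have "\<dots> \<le> (3 * L) ^ CARD('d)" using False by (intro power_mono) auto
    finally show "real (card ?A) \<le> (3 * L) ^ CARD('d)" .
  qed (use G_nonneg L in auto)
  also have "\<dots> = 3 ^ CARD('d) * G" using L by (simp add: power_mult_distrib)
  finally show ?thesis .
qed

lemma finite_cell: "finite (cell m q k)"
  unfolding cell_def by (rule finite_subset[OF _ finite_torus_lattice[of "m * q"]]) auto

lemma cell_corner: "k \<in> \<Lambda>' \<Longrightarrow> x \<in> cell m q k \<longleftrightarrow> x \<in> \<Lambda> \<and> corner m x = k"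
  using cell_eq[OF m q, of k] by auto

lemma corner_in': "x \<in> \<Lambda> \<Longrightarrow> corner m x \<in> \<Lambda>'"
  by (rule corner_in[OF m q])

lemma card_cell': "k \<in> \<Lambda>' \<Longrightarrow> card (cell m q k) = Q"
  unfolding Q_def by (rule card_cell[OF m q])

lemma Q_pos: "Q \<ge> 1" using q by (simp add: Q_def)

lemma sum_cells: "(\<Sum>x\<in>\<Lambda>. f x) = (\<Sum>k\<in>\<Lambda>'. \<Sum>x\<in>cell m q k. f x :: real)"
proof -
  have "(\<Sum>x\<in>\<Lambda>. f x) = (\<Sum>k\<in>\<Lambda>'. \<Sum>x\<in>{x \<in> \<Lambda>. corner m x = k}. f x)"
    by (rule sum.group[symmetric]) (auto simp: finite_torus_lattice intro: corner_in')
  then show ?thesis by (simp add: cell_eq[OF m q])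
qed

definition pairs :: "real ^ 'd \<Rightarrow> real ^ 'd \<Rightarrow> ((real ^ 'd) \<times> (real ^ 'd)) set" where
  "pairs k l = {(x, y). x \<in> cell m q k \<and> y \<in> cell m q l \<and> x \<noteq> y}"

lemma finite_pairs: "finite (pairs k l)"
  by (rule finite_subset[of _ "cell m q k \<times> cell m q l"]) (auto simp: pairs_def finite_cell)

lemma sum_pairs: "(\<Sum>x\<in>cell m q k. \<Sum>y\<in>cell m q l - {x}. f x y) = (\<Sum>(x, y)\<in>pairs k l. f x y :: real)"
proof -
  have "pairs k l = (SIGMA x:cell m q k. cell m q l - {x})" by (auto simp: pairs_def)
  then show ?thesis by (simp add: sum.Sigma finite_cell)
qed

lemma cell_disjoint: "k \<in> \<Lambda>' \<Longrightarrow> l \<in> \<Lambda>' \<Longrightarrow> k \<noteq> l \<Longrightarrow> cell m q l - {x} = cell m q l" if "x \<in> cell m q k"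
  using that cell_corner by auto

lemma card_row:
  assumes "k \<in> \<Lambda>'" "l \<in> \<Lambda>'" "x \<in> cell m q k"
  shows "real (card (cell m q l - {x})) = (if k = l then real Q - 1 else real Q)"
proof (cases "k = l")
  case True
  then show ?thesis using assms card_cell'[of k] finite_cell[of k] Q_pos by (simp add: of_nat_diff)
next
  case False
  then show ?thesis using assms card_cell'[of l] cell_disjoint[OF assms(3,1,2)] by simp
qed

lemma card_pairs:
  assumes "k \<in> \<Lambda>'" "l \<in> \<Lambda>'"
  shows "real (card (pairs k l)) = real Q * (if k = l then real Q - 1 else real Q)"
proof -
  have "real (card (pairs k l)) = (\<Sum>x\<in>cell m q k. \<Sum>y\<in>cell m q l - {x}. 1)"
    unfolding sum_pairs by (simp add: case_prod_unfold)
  also have "\<dots> = (\<Sum>x\<in>cell m q k. if k = l then real Q - 1 else real Q)"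
    by (rule sum.cong[OF refl]) (use card_row[OF assms] in simp)
  finally show ?thesis using card_cell'[OF assms(1)] by simp
qed

text \<open>Both cases of \<open>J_bar\<close> are means over pairs of distinct sites. For
  \<open>Q = 1\<close> and \<open>k = l\<close> there is no such pair, and both sides are 0 as
  quotients by 0.\<close>

lemma J_bar_eq:
  assumes "k \<in> \<Lambda>'" "l \<in> \<Lambda>'"
  shows "J_bar m q J k l = (\<Sum>(x, y)\<in>pairs k l. J (x - y)) / real (card (pairs k l))"
proof (cases "k = l")
  case True
  then show ?thesis using card_pairs[OF assms] sum_pairs[where f = "\<lambda>x y. J (x - y)" and k = k and l = l]
    unfolding J_bar_def Let_def Q_def[symmetric] by simp
next
  case False
  have "(\<Sum>x\<in>cell m q k. \<Sum>y\<in>cell m q l. J (x - y)) = (\<Sum>x\<in>cell m q k. \<Sum>y\<in>cell m q l - {x}. J (x - y))"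
    by (rule sum.cong[OF refl]) (simp add: cell_disjoint[OF _ assms False])
  then show ?thesis using False card_pairs[OF assms] sum_pairs[where f = "\<lambda>x y. J (x - y)" and k = k and l = l]
    unfolding J_bar_def Let_def Q_def[symmetric] by (simp add: power2_eq_square)
qed

text \<open>The value 0 on the diagonal and off the lattice makes symmetry and vanishing diagonal
  hold for all arguments, as the ensemble locales demand.\<close>

definition fluct :: "real ^ 'd \<Rightarrow> real ^ 'd \<Rightarrow> real" where
  "fluct x y = (if x \<noteq> y \<and> x \<in> \<Lambda> \<and> y \<in> \<Lambda> then J (x - y) - J_bar m q J (corner m x) (corner m y) else 0)"

lemma fluct_diag: "fluct x x = 0" by (simp add: fluct_def)

lemma fluct_cell: "k \<in> \<Lambda>' \<Longrightarrow> l \<in> \<Lambda>' \<Longrightarrow> x \<in> cell m q k \<Longrightarrow> y \<in> cell m q l \<Longrightarrow> x \<noteq> y \<Longrightarrow> fluct x y = J (x - y) - J_bar m q J k l"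
  using cell_corner by (auto simp: fluct_def)

lemma bij_pairs:
  assumes "bij_betw f (cell m q k) (cell m q k')" "bij_betw g (cell m q l) (cell m q l')"
    and "\<And>x y. x \<in> cell m q k \<Longrightarrow> y \<in> cell m q l \<Longrightarrow> f x = g y \<longleftrightarrow> x = y"
  shows "bij_betw (map_prod f g) (pairs k l) (pairs k' l')"
proof -
  have "bij_betw (map_prod f g) (cell m q k \<times> cell m q l) (cell m q k' \<times> cell m q l')"
    by (rule bij_betw_map_prod[OF assms(1,2)])
  then show ?thesis
  proof (rule bij_betw_subset)
    show "pairs k l \<subseteq> cell m q k \<times> cell m q l" by (auto simp: pairs_def)
    show "map_prod f g ` pairs k l = pairs k' l'"
    proof (intro equalityI subsetI)
      fix p assume "p \<in> pairs k' l'"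
      then obtain x y where p: "p = (x, y)" "x \<in> cell m q k'" "y \<in> cell m q l'" "x \<noteq> y" by (auto simp: pairs_def)
      obtain x' where x': "x' \<in> cell m q k" "f x' = x" using p(2) assms(1) by (metis bij_betw_imp_surj_on imageE)
      obtain y' where y': "y' \<in> cell m q l" "g y' = y" using p(3) assms(2) by (metis bij_betw_imp_surj_on imageE)
      have "(x', y') \<in> pairs k l" using assms(3)[OF x'(1) y'(1)] x' y' p by (auto simp: pairs_def)
      then show "p \<in> map_prod f g ` pairs k l" using p x' y' by (intro image_eqI[of _ _ "(x', y')"]) auto
    next
      fix p assume "p \<in> map_prod f g ` pairs k l"
      then show "p \<in> pairs k' l'"
        using assms(3) bij_betwE[OF assms(1)] bij_betwE[OF assms(2)] by (auto simp: pairs_def)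
    qed
  qed
qed

text \<open>Block means are transported by any pair of bijections that preserve couplings and
  distinctness. Translations and the reflection of two cells are both instances.\<close>

lemma J_bar_bij:
  assumes "k \<in> \<Lambda>'" "l \<in> \<Lambda>'" "k' \<in> \<Lambda>'" "l' \<in> \<Lambda>'"
    and "bij_betw f (cell m q k) (cell m q k')" "bij_betw g (cell m q l) (cell m q l')"
    and "\<And>x y. x \<in> cell m q k \<Longrightarrow> y \<in> cell m q l \<Longrightarrow> f x = g y \<longleftrightarrow> x = y"
    and "\<And>x y. x \<in> cell m q k \<Longrightarrow> y \<in> cell m q l \<Longrightarrow> J (f x - g y) = J (x - y)"
  shows "J_bar m q J k' l' = J_bar m q J k l"
proof -
  have b: "bij_betw (map_prod f g) (pairs k l) (pairs k' l')" by (rule bij_pairs[OF assms(5-7)])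
  have "(\<Sum>p\<in>pairs k' l'. (\<lambda>(x, y). J (x - y)) p) = (\<Sum>p\<in>pairs k l. (\<lambda>(x, y). J (x - y)) (map_prod f g p))"
    by (rule sum.reindex_bij_betw[OF b, symmetric])
  also have "\<dots> = (\<Sum>p\<in>pairs k l. (\<lambda>(x, y). J (x - y)) p)"
    by (rule sum.cong[OF refl]) (use assms(8) in \<open>auto simp: pairs_def\<close>)
  finally show ?thesis using bij_betw_same_card[OF b] by (simp add: J_bar_eq assms)
qed

lemma J_bar_sym:
  assumes "k \<in> \<Lambda>'" "l \<in> \<Lambda>'"
  shows "J_bar m q J k l = J_bar m q J l k"
proof -
  have b: "bij_betw prod.swap (pairs k l) (pairs l k)"
    by (rule bij_betw_byWitness[where f' = prod.swap]) (auto simp: pairs_def)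
  have "(\<Sum>p\<in>pairs l k. (\<lambda>(x, y). J (x - y)) p) = (\<Sum>p\<in>pairs k l. (\<lambda>(x, y). J (x - y)) (prod.swap p))"
    by (rule sum.reindex_bij_betw[OF b, symmetric])
  also have "\<dots> = (\<Sum>p\<in>pairs k l. (\<lambda>(x, y). J (x - y)) p)"
    by (rule sum.cong[OF refl]) (auto simp: J_commute)
  finally show ?thesis using bij_betw_same_card[OF b] by (simp add: J_bar_eq assms)
qed

lemma fluct_sym: "fluct x y = fluct y x"
  using J_bar_sym[OF corner_in' corner_in', of x y] by (auto simp: fluct_def J_commute)

lemma fluct_sum:
  assumes "k \<in> \<Lambda>'" "l \<in> \<Lambda>'"
  shows "(\<Sum>x\<in>cell m q k. \<Sum>y\<in>cell m q l. fluct x y) = 0"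
proof -
  have "(\<Sum>x\<in>cell m q k. \<Sum>y\<in>cell m q l. fluct x y) = (\<Sum>x\<in>cell m q k. \<Sum>y\<in>cell m q l - {x}. fluct x y)"
    by (rule sum.cong[OF refl], rule sum.mono_neutral_right) (auto simp: finite_cell fluct_diag)
  also have "\<dots> = (\<Sum>(x, y)\<in>pairs k l. J (x - y) - J_bar m q J k l)"
    unfolding sum_pairs by (rule sum.cong[OF refl]) (auto simp: pairs_def fluct_cell assms)
  also have "\<dots> = 0"
    using card_gt_0_iff[of "pairs k l"] finite_pairs[of k l]
    by (cases "pairs k l = {}") (simp_all add: sum_subtractf case_prod_unfold J_bar_eq[OF assms])
  finally show ?thesis .
qed

lemma shift_cell:
  assumes "a \<in> \<Lambda>'" "k \<in> \<Lambda>'"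
  shows "bij_betw (torus_shift a) (cell m q k) (cell m q (torus_shift a k))"
proof -
  have aL: "a \<in> \<Lambda>" by (rule torus_lattice_mult[OF q assms(1)])
  have sk: "torus_shift a k \<in> \<Lambda>'" by (rule shift_in[OF m assms])
  have "torus_shift a ` cell m q k = cell m q (torus_shift a k)"
  proof (intro equalityI subsetI)
    fix y assume "y \<in> torus_shift a ` cell m q k"
    then show "y \<in> cell m q (torus_shift a k)"
      using cell_corner assms sk corner_shift[OF m q assms(1)] shift_in[OF mq aL] by auto
  next
    fix y assume y: "y \<in> cell m q (torus_shift a k)"
    then obtain x where x: "x \<in> \<Lambda>" "y = torus_shift a x"
      using shift_bij[OF mq aL] cell_corner[OF sk] by (metis bij_betw_imp_surj_on imageE)
    have "torus_shift a (corner m x) = torus_shift a k"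
      using y x cell_corner[OF sk] corner_shift[OF m q assms(1) x(1)] by simp
    then have "corner m x = k" using inj_onD[OF shift_inj, of a "corner m x" k m] corner_in'[OF x(1)] assms by blast
    then show "y \<in> torus_shift a ` cell m q k" using x cell_corner[OF assms(2)] by auto
  qed
  moreover have "inj_on (torus_shift a) (cell m q k)"
    by (rule inj_on_subset[OF shift_inj[of a "m * q"]]) (auto simp: cell_def)
  ultimately show ?thesis by (simp add: bij_betw_def)
qed

lemma shift_eq_iff: "a \<in> \<Lambda>' \<Longrightarrow> x \<in> \<Lambda> \<Longrightarrow> y \<in> \<Lambda> \<Longrightarrow> torus_shift a x = torus_shift a y \<longleftrightarrow> x = y"
  using inj_on_eq_iff[OF shift_inj] by blast

lemma cell_subset: "cell m q k \<subseteq> \<Lambda>" by (auto simp: cell_def)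

lemma J_bar_shift:
  assumes "a \<in> \<Lambda>'" "k \<in> \<Lambda>'" "l \<in> \<Lambda>'"
  shows "J_bar m q J (torus_shift a k) (torus_shift a l) = J_bar m q J k l"
  by (rule J_bar_bij[of _ _ _ _ "torus_shift a" "torus_shift a"])
     (use assms shift_in[OF m assms(1)] shift_cell[OF assms(1)] shift_eq_iff[OF assms(1)] cell_subset J_shift in \<open>auto simp: subset_iff\<close>)

lemma fluct_shift:
  assumes "a \<in> \<Lambda>'" "x \<in> \<Lambda>" "y \<in> \<Lambda>"
  shows "fluct (torus_shift a x) (torus_shift a y) = fluct x y"
proof -
  have aL: "a \<in> \<Lambda>" by (rule torus_lattice_mult[OF q assms(1)])
  show ?thesis
    unfolding fluct_def using assms shift_in[OF mq aL] shift_eq_iff[OF assms] J_shift[of a x y]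
      corner_shift[OF m q assms(1)] J_bar_shift[OF assms(1) corner_in' corner_in'] by simp
qed

lemma D_nonneg: "D \<ge> 0" using G_nonneg L by (simp add: D_def)

lemma cell_pair_dist:
  assumes "k \<in> \<Lambda>'" "l \<in> \<Lambda>'" "x \<in> cell m q k" "x' \<in> cell m q k" "y \<in> cell m q l" "y' \<in> cell m q l"
  shows "norm ((x - y) - (x' - y')) \<le> 2 * CARD('d) / m"
proof -
  have "norm ((x - y) - (x' - y')) = norm ((x - x') - (y - y'))" by (simp add: algebra_simps)
  also have "\<dots> \<le> norm (x - x') + norm (y - y')" by (rule norm_triangle_ineq4)
  also have "\<dots> \<le> CARD('d) / m + CARD('d) / m"
    by (intro add_mono corner_dist(1)[OF m q]) (use assms in auto)
  finally show ?thesis by simp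
qed

text \<open>A fluctuation is the mean of \<open>J (x - y) - J (x' - y')\<close> over the same pair
  of cells. Two such displacements differ by at most \<open>2 d / m\<close>, that is
  \<open>2 d q\<close> lattice spacings, and the Lipschitz bound of \<open>J\<close> gives
  \<open>D\<close>.\<close>

lemma fluct_bound: "\<bar>fluct x y\<bar> \<le> D"
proof (cases "x \<noteq> y \<and> x \<in> \<Lambda> \<and> y \<in> \<Lambda>")
  case False
  then show ?thesis using D_nonneg by (auto simp: fluct_def)
next
  case True
  define k l where "k = corner m x" "l = corner m y"
  have kl: "k \<in> \<Lambda>'" "l \<in> \<Lambda>'" "x \<in> cell m q k" "y \<in> cell m q l"
    using True corner_in' cell_corner by (auto simp: k_l_def)
  have "(x, y) \<in> pairs k l" using True kl by (simp add: pairs_def)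
  then have P: "card (pairs k l) > 0" using finite_pairs by (auto simp: card_gt_0_iff)
  have "fluct x y = (\<Sum>(x', y')\<in>pairs k l. J (x - y) - J (x' - y')) / card (pairs k l)"
    using fluct_cell[OF kl] True P J_bar_eq[OF kl(1,2)] by (simp add: sum_subtractf case_prod_unfold diff_divide_distrib)
  also have "\<bar>\<dots>\<bar> = \<bar>\<Sum>(x', y')\<in>pairs k l. J (x - y) - J (x' - y')\<bar> / card (pairs k l)" by simp
  also have "\<dots> \<le> (\<Sum>p\<in>pairs k l. D) / card (pairs k l)"
  proof (intro divide_right_mono order_trans[OF sum_abs] sum_mono)
    fix p assume "p \<in> pairs k l"
    then obtain x' y' where p: "p = (x', y')" "x' \<in> cell m q k" "y' \<in> cell m q l" by (auto simp: pairs_def)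
    have "\<bar>J (x - y) - J (x' - y')\<bar> \<le> G / L ^ CARD('d) * (real (m * q) / L) * norm ((x - y) - (x' - y'))"
      by (rule J_lipschitz)
    also have "\<dots> \<le> G / L ^ CARD('d) * (real (m * q) / L) * (2 * CARD('d) / m)"
      using cell_pair_dist[OF kl(1,2,3) p(2) kl(4) p(3)] G_nonneg L by (intro mult_left_mono) auto
    also have "\<dots> = D" using m by (simp add: D_def)
    finally show "\<bar>case p of (x', y') \<Rightarrow> J (x - y) - J (x' - y')\<bar> \<le> D" using p by simp
  qed auto
  also have "\<dots> = D" using P by simp
  finally show ?thesis .
qed

text \<open>Moving both points inside their cells changes the displacement by at most
  \<open>2 d q\<close> lattice spacings. Beyond the range enlarged by this amount, whole cells
  decouple, and with them the block means.\<close>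

lemma J_zero_cells:
  assumes "k \<in> \<Lambda>'" "l \<in> \<Lambda>'" "x \<in> cell m q k" "x' \<in> cell m q k" "y \<in> cell m q l" "y' \<in> cell m q l"
    and far: "real (m * q) * torus_norm (x - y) \<ge> L + 2 * CARD('d) * q"
  shows "J (x' - y') = 0"
proof (rule J_zero)
  have "torus_norm (x - y) \<le> torus_norm (x' - y') + 2 * CARD('d) / m"
    using torus_norm_diff[of "x - y" "x' - y'"] cell_pair_dist[OF assms(1-6)] by linarith
  then have "real (m * q) * torus_norm (x - y) \<le> real (m * q) * (torus_norm (x' - y') + 2 * CARD('d) / m)"
    by (intro mult_left_mono) auto
  also have "\<dots> = real (m * q) * torus_norm (x' - y') + 2 * CARD('d) * q" using m by (simp add: algebra_simps)
  finally show "L \<le> real (m * q) * torus_norm (x' - y')" using far by linarith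
qed

lemma fluct_zero:
  assumes far: "real (m * q) * torus_norm (x - y) \<ge> L + 2 * CARD('d) * q"
  shows "fluct x y = 0"
proof (cases "x \<noteq> y \<and> x \<in> \<Lambda> \<and> y \<in> \<Lambda>")
  case True
  define k l where "k = corner m x" "l = corner m y"
  have kl: "k \<in> \<Lambda>'" "l \<in> \<Lambda>'" "x \<in> cell m q k" "y \<in> cell m q l"
    using True corner_in' cell_corner by (auto simp: k_l_def)
  have "(\<Sum>(x', y')\<in>pairs k l. J (x' - y')) = 0"
    by (rule sum.neutral) (use J_zero_cells[OF kl(1,2,3) _ kl(4) _ far] in \<open>auto simp: pairs_def\<close>)
  then show ?thesis
    using fluct_cell[OF kl] True J_bar_eq[OF kl(1,2)] J_zero_cells[OF kl(1,2,3,3,4,4) far] by simp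
qed (auto simp: fluct_def)

text \<open>For \<open>q <= L\<close> the enlarged range is at most a multiple of \<open>L\<close>,
  so a site has at most \<open>((3 + 4 d) L) ^ d\<close> partners. Multiplied by \<open>D\<close>,
  the powers of \<open>L\<close> cancel and a factor \<open>q / L\<close> remains.\<close>

lemma sum_fluct_small:
  assumes "x \<in> \<Lambda>" "real q \<le> L"
  shows "(\<Sum>y\<in>\<Lambda>. \<bar>fluct x y\<bar>) \<le> (3 + 4 * CARD('d)) ^ CARD('d) * (2 * CARD('d)) * ((q / L) * G)"
proof -
  let ?r = "L + 2 * CARD('d) * q"
  let ?A = "{y \<in> \<Lambda>. real (m * q) * torus_norm (x - y) < ?r}"
  have L1: "1 \<le> L" using assms(2) q by linarith
  have "(\<Sum>y\<in>\<Lambda>. \<bar>fluct x y\<bar>) = (\<Sum>y\<in>?A. \<bar>fluct x y\<bar>)"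
    by (rule sum.mono_neutral_right) (auto simp: finite_torus_lattice intro!: fluct_zero)
  also have "\<dots> \<le> (\<Sum>y\<in>?A. D)" by (intro sum_mono fluct_bound)
  also have "\<dots> = real (card ?A) * D" by simp
  also have "\<dots> \<le> ((3 + 4 * CARD('d)) * L) ^ CARD('d) * D"
  proof (rule mult_right_mono)
    have "real (card ?A) \<le> (2 * ?r + 1) ^ CARD('d)"
      using L by (intro card_close_lattice_points[OF mq assms(1)]) auto
    also have "\<dots> \<le> ((3 + 4 * CARD('d)) * L) ^ CARD('d)"
    proof (rule power_mono)
      have "real CARD('d) * real q \<le> real CARD('d) * L" using assms(2) by (intro mult_left_mono) auto
      moreover have "2 * ?r + 1 = 2 * L + 4 * (real CARD('d) * real q) + 1" by simp
      moreover have "(3 + 4 * CARD('d)) * L = 3 * L + 4 * (real CARD('d) * L)" by (simp add: algebra_simps)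
      ultimately show "2 * ?r + 1 \<le> (3 + 4 * CARD('d)) * L" using L1 by linarith
    qed (use L in auto)
    finally show "real (card ?A) \<le> ((3 + 4 * CARD('d)) * L) ^ CARD('d)" by simp
  qed (rule D_nonneg)
  also have "\<dots> = (3 + 4 * CARD('d)) ^ CARD('d) * (2 * CARD('d)) * ((q / L) * G)"
    using L by (simp add: power_mult_distrib D_def)
  finally show ?thesis by simp
qed

text \<open>Here no cancellation between coupling and block mean is used. The row of block means is
  at most the average, over the sites of the cell, of the rows of \<open>\<bar>J\<bar>\<close>, so
  both parts are bounded by \<open>sum_J\<close>.\<close>

lemma sum_fluct_large:
  assumes "x \<in> \<Lambda>"
  shows "(\<Sum>y\<in>\<Lambda>. \<bar>fluct x y\<bar>) \<le> 2 * 3 ^ CARD('d) * G"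
proof -
  define k where "k = corner m x"
  have k: "k \<in> \<Lambda>'" "x \<in> cell m q k" using assms corner_in' cell_corner by (auto simp: k_def)
  have "(\<Sum>y\<in>\<Lambda>. \<bar>fluct x y\<bar>) \<le> (\<Sum>y\<in>\<Lambda>. (if y = x then 0 else \<bar>J (x - y)\<bar>) + (if y = x then 0 else \<bar>J_bar m q J k (corner m y)\<bar>))"
    by (intro sum_mono) (auto simp: fluct_def k_def)
  also have "\<dots> = (\<Sum>y\<in>\<Lambda> - {x}. \<bar>J (x - y)\<bar>) + (\<Sum>y\<in>\<Lambda>. if y = x then 0 else \<bar>J_bar m q J k (corner m y)\<bar>)"
    by (simp add: sum.distrib sum_diff1_if finite_torus_lattice)
  also have "(\<Sum>y\<in>\<Lambda>. if y = x then 0 else \<bar>J_bar m q J k (corner m y)\<bar>)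
      = (\<Sum>l\<in>\<Lambda>'. \<Sum>y\<in>cell m q l - {x}. \<bar>J_bar m q J k l\<bar>)"
    unfolding sum_cells
  proof (rule sum.cong[OF refl])
    fix l assume l: "l \<in> \<Lambda>'"
    show "(\<Sum>y\<in>cell m q l. if y = x then 0 else \<bar>J_bar m q J k (corner m y)\<bar>) = (\<Sum>y\<in>cell m q l - {x}. \<bar>J_bar m q J k l\<bar>)"
      unfolding sum_diff1_if[OF finite_cell] by (rule sum.cong[OF refl]) (use cell_corner[OF l] in auto)
  qed
  also have "\<dots> \<le> (\<Sum>l\<in>\<Lambda>'. (\<Sum>x'\<in>cell m q k. \<Sum>y\<in>cell m q l - {x'}. \<bar>J (x' - y)\<bar>) / Q)"
  proof (rule sum_mono)
    fix l assume l: "l \<in> \<Lambda>'"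
    let ?r = "if k = l then real Q - 1 else real Q"
    have r0: "?r \<ge> 0" using Q_pos by auto
    have "(\<Sum>y\<in>cell m q l - {x}. \<bar>J_bar m q J k l\<bar>) = ?r * \<bar>J_bar m q J k l\<bar>"
      using card_row[OF k(1) l k(2)] by simp
    also have "\<dots> = ?r * (\<bar>\<Sum>(x, y)\<in>pairs k l. J (x - y)\<bar> / (real Q * ?r))"
      unfolding J_bar_eq[OF k(1) l] card_pairs[OF k(1) l] abs_divide abs_mult using r0 by simp
    also have "\<dots> \<le> \<bar>\<Sum>(x, y)\<in>pairs k l. J (x - y)\<bar> / Q"
      using r0 by (cases "?r = 0") (simp_all del: of_nat_power)
    also have "\<dots> \<le> (\<Sum>(x, y)\<in>pairs k l. \<bar>J (x - y)\<bar>) / Q"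
      by (intro divide_right_mono order_trans[OF sum_abs]) (auto simp: case_prod_unfold)
    finally show "(\<Sum>y\<in>cell m q l - {x}. \<bar>J_bar m q J k l\<bar>) \<le> (\<Sum>x'\<in>cell m q k. \<Sum>y\<in>cell m q l - {x'}. \<bar>J (x' - y)\<bar>) / Q"
      unfolding sum_pairs .
  qed
  also have "\<dots> = (\<Sum>x'\<in>cell m q k. \<Sum>y\<in>\<Lambda> - {x'}. \<bar>J (x' - y)\<bar>) / Q"
    unfolding sum_divide_distrib[symmetric] sum_diff1_if[OF finite_cell] sum_diff1_if[OF finite_torus_lattice] sum_cells
    by (subst sum.swap) simp
  also have "\<dots> \<le> (\<Sum>x'\<in>cell m q k. 3 ^ CARD('d) * G) / Q"
    by (intro divide_right_mono sum_mono sum_J) (use cell_subset in auto)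
  also have "\<dots> = 3 ^ CARD('d) * G" using card_cell'[OF k(1)] Q_pos by simp
  finally show ?thesis using sum_J[OF assms] by linarith
qed

text \<open>For \<open>q > L\<close> the missing factor \<open>q / L\<close> exceeds 1 and can be
  inserted for free. This row sum, times \<beta>, is the small parameter \<epsilon> up to a constant
  depending on the dimension and on \<open>C\<close>.\<close>

lemma sum_fluct:
  assumes "x \<in> \<Lambda>"
  shows "(\<Sum>y\<in>\<Lambda>. \<bar>fluct x y\<bar>) \<le> (2 * 3 ^ CARD('d) + (3 + 4 * real CARD('d)) ^ CARD('d) * (2 * CARD('d))) * ((q / L) * G)"
    (is "_ \<le> (?a + ?b) * _")
proof (cases "real q \<le> L")
  case True
  have "(\<Sum>y\<in>\<Lambda>. \<bar>fluct x y\<bar>) \<le> ?b * ((q / L) * G)" using sum_fluct_small[OF assms True] by simp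
  also have "\<dots> \<le> (?a + ?b) * ((q / L) * G)" using L G_nonneg by (intro mult_right_mono) auto
  finally show ?thesis .
next
  case False
  have "(\<Sum>y\<in>\<Lambda>. \<bar>fluct x y\<bar>) \<le> ?a * (1 * G)" using sum_fluct_large[OF assms] by simp
  also have "\<dots> \<le> ?a * ((q / L) * G)" using L G_nonneg False by (intro mult_left_mono mult_right_mono) auto
  also have "\<dots> \<le> (?a + ?b) * ((q / L) * G)" using L G_nonneg by (intro mult_right_mono) auto
  finally show ?thesis .
qed

text \<open>The corners belong to their cells, so \<open>J_zero_cells\<close> applies to them:
  \<open>\<rho>\<close>, measured in lattice units, is at least the enlarged range
  \<open>L + 2 d q\<close>.\<close>

lemma far_cells:
  assumes "k \<in> \<Lambda>'" "l \<in> \<Lambda>'" "torus_norm (k - l) > \<rho>" "x \<in> cell m q k" "y \<in> cell m q l"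
  shows "J (x - y) = 0" "fluct x y = 0"
proof -
  have kc: "k \<in> cell m q k" "l \<in> cell m q l"
    using assms torus_lattice_mult[OF q] m by (auto simp: cell_def)
  have "(1 + 2 * CARD('d)) * (L + q) < real (m * q) * torus_norm (k - l)"
    using assms(3) mq by (simp add: \<rho>_def field_simps)
  moreover have "(1 + 2 * CARD('d)) * (L + q) \<ge> L + 2 * CARD('d) * q" using L by (simp add: algebra_simps)
  ultimately have far: "real (m * q) * torus_norm (k - l) \<ge> L + 2 * CARD('d) * q" by linarith
  have J0: "J (x' - y') = 0" if "x' \<in> cell m q k" "y' \<in> cell m q l" for x' y'
    by (rule J_zero_cells[OF assms(1,2) kc(1) that(1) kc(2) that(2) far])
  then show "J (x - y) = 0" using assms by blast
  have "(\<Sum>(x', y')\<in>pairs k l. J (x' - y')) = 0"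
    by (rule sum.neutral) (use J0 in \<open>auto simp: pairs_def\<close>)
  then show "fluct x y = 0"
    using fluct_cell[OF assms(1,2,4,5)] J_bar_eq[OF assms(1,2)] J0[OF assms(4,5)] by (cases "x = y") (auto simp: fluct_diag)
qed

text \<open>The reflection reverses displacements, \<open>J\<close> is even, and the two cells are
  exchanged, so block means and fluctuations are preserved for pairs across the two cells and inside
  either one.\<close>

lemma reflect_fluct:
  assumes "k \<in> \<Lambda>'" "l \<in> \<Lambda>'" "k' \<in> {k, l}" "l' \<in> {k, l}" "x \<in> cell m q k'" "y \<in> cell m q l'"
  shows "fluct (reflect m q k l x) (reflect m q k l y) = fluct x y"
proof -
  define r where "r j = (if j = k then l else k)" for j
  have bij: "bij_betw (reflect m q k l) (cell m q j) (cell m q (r j))" if "j \<in> {k, l}" for j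
    using that reflect_bij[OF m q assms(1,2)] reflect_bij[OF m q assms(2,1)] reflect_commute[of m q k l]
    by (auto simp: r_def)
  have inj: "reflect m q k l u = reflect m q k l v \<longleftrightarrow> u = v" for u v
    by (auto simp: reflect_def vec_eq_iff)
  have J: "J (reflect m q k l u - reflect m q k l v) = J (u - v)" for u v
    using J_commute reflect_diff by metis
  have r: "r j \<in> \<Lambda>'" for j using assms by (simp add: r_def)
  have L': "k' \<in> \<Lambda>'" "l' \<in> \<Lambda>'" using assms by auto
  have "J_bar m q J (r k') (r l') = J_bar m q J k' l'"
    by (rule J_bar_bij[OF L' r r bij[OF assms(3)] bij[OF assms(4)]]) (use inj J in auto)
  moreover have "reflect m q k l x \<in> cell m q (r k')" "reflect m q k l y \<in> cell m q (r l')"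
    using bij_betwE[OF bij] assms by blast+
  ultimately show ?thesis
    using fluct_cell[OF r r] fluct_cell[OF L' assms(5,6)] J inj by (cases "x = y") (auto simp: fluct_diag)
qed

end

section \<open>The conditional prior as a uniform measure on a slice\<close>

lemma cond_pmf_of_set:
  assumes "finite A" "A \<inter> B \<noteq> {}"
  shows "cond_pmf (pmf_of_set A) B = pmf_of_set (A \<inter> B)"
proof (rule pmf_eqI)
  fix x
  have A: "A \<noteq> {}" using assms by auto
  have c: "card A > 0" "card (A \<inter> B) > 0" using assms A by (auto simp: card_gt_0_iff)
  have "set_pmf (pmf_of_set A) \<inter> B \<noteq> {}" using assms A by simp
  then have "pmf (cond_pmf (pmf_of_set A) B) x = (if x \<in> B then pmf (pmf_of_set A) x / measure (pmf_of_set A) B else 0)"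
    by (rule pmf_cond)
  then show "pmf (cond_pmf (pmf_of_set A) B) x = pmf (pmf_of_set (A \<inter> B)) x"
    using assms A c by (auto simp: measure_pmf_of_set indicator_def)
qed

context kac_model
begin

abbreviation cl :: "real ^ 'd \<Rightarrow> real ^ 'd" where "cl \<equiv> corner m"

text \<open>Recovers the numbers of plus spins from the block spins. Values outside \<open>X\<close>
  are set to 0, so that a configuration known on \<open>X\<close> only determines the ensemble
  \<open>on_cells X\<close>.\<close>

definition occ :: "(real ^ 'd) set \<Rightarrow> (real ^ 'd \<Rightarrow> real) \<Rightarrow> real ^ 'd \<Rightarrow> nat" where
  "occ X \<xi> = (\<lambda>k. if k \<in> X then nat \<lfloor>(\<xi> k + real Q) / 2\<rfloor> else 0)"

lemma occ_coarse:
  assumes "\<eta> \<in> coarse_configs m q" "k \<in> \<Lambda>'"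
  shows "real (occ \<Lambda>' \<eta> k) = (\<eta> k + real Q) / 2" "occ \<Lambda>' \<eta> k \<le> Q"
proof -
  obtain j where j: "\<eta> k = 2 * real j - real Q" "j \<le> Q"
    using assms unfolding coarse_configs_def Q_def[symmetric] by (auto simp: PiE_iff)
  have "(\<eta> k + real Q) / 2 = real j" using j by simp
  then show "real (occ \<Lambda>' \<eta> k) = (\<eta> k + real Q) / 2" "occ \<Lambda>' \<eta> k \<le> Q"
    using assms(2) j by (auto simp: occ_def)
qed

lemma occ_restrict: "X \<subseteq> \<Lambda>' \<Longrightarrow> occ X (restrict \<eta> X) = on_cells X (occ \<Lambda>' \<eta>)"
  by (auto simp: occ_def on_cells_def fun_eq_iff)

lemma ensemble:
  assumes "\<eta> \<in> coarse_configs m q"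
  shows "pair_block_ensemble \<Lambda> \<Lambda>' cl Q (occ \<Lambda>' \<eta>) fluct"
proof -
  interpret block_ensemble \<Lambda> \<Lambda>' cl Q "occ \<Lambda>' \<eta>"
  proof
    show "card {x\<in>\<Lambda>. cl x = k} = Q" if "k \<in> \<Lambda>'" for k
      using card_cell'[OF that] cell_eq[OF m q that] by simp
    show "occ \<Lambda>' \<eta> k \<le> Q" if "k \<in> \<Lambda>'" for k by (rule occ_coarse[OF assms that])
  qed (auto simp: finite_torus_lattice occ_def intro: corner_in')
  show ?thesis
  proof
    have "C k = cell m q k" if "k \<in> \<Lambda>'" for k by (simp add: C_def cell_eq[OF m q that])
    then show "(\<Sum>x\<in>C k. \<Sum>y\<in>C l. fluct x y) = 0" if "k \<in> \<Lambda>'" "l \<in> \<Lambda>'" for k l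
      using fluct_sum that by simp
  qed (auto simp: fluct_diag intro: fluct_sym)
qed

definition conf :: "(real ^ 'd) set \<Rightarrow> real ^ 'd \<Rightarrow> real" where
  "conf P = restrict (spin P) \<Lambda>"

lemma block_spin_conf:
  assumes "P \<subseteq> \<Lambda>" "k \<in> \<Lambda>'"
  shows "block_spin m q (conf P) k = 2 * real (card {x\<in>P. cl x = k}) - real Q"
proof -
  have P: "{x\<in>P. cl x = k} = cell m q k \<inter> P" using assms cell_corner by auto
  have "block_spin m q (conf P) k = (\<Sum>x\<in>cell m q k. spin P x)"
    using assms by (auto simp: block_spin_def conf_def intro!: sum.cong dest: subsetD[OF cell_subset])
  also have "\<dots> = (\<Sum>x\<in>cell m q k. 2 * of_bool (x \<in> P) - 1)"
    by (rule sum.cong) (auto simp: spin_def)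
  also have "\<dots> = 2 * real (card (cell m q k \<inter> P)) - real (card (cell m q k))"
    by (simp add: sum_subtractf sum_distrib_left[symmetric] finite_cell)
  finally show ?thesis using card_cell'[OF assms(2)] P by simp
qed

lemma block_spin_conf_eq:
  assumes "\<eta> \<in> coarse_configs m q" "P \<subseteq> \<Lambda>"
  shows "block_spin m q (conf P) = \<eta> \<longleftrightarrow> P \<in> slice cl \<Lambda> (occ \<Lambda>' \<eta>)"
proof -
  have ext: "\<eta> = (\<lambda>k\<in>\<Lambda>'. \<eta> k)" using assms(1) by (auto simp: coarse_configs_def PiE_def extensional_def fun_eq_iff)
  have "block_spin m q (conf P) = \<eta> \<longleftrightarrow> (\<forall>k\<in>\<Lambda>'. block_spin m q (conf P) k = \<eta> k)"
    by (subst ext) (auto simp: block_spin_def fun_eq_iff)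
  also have "\<dots> \<longleftrightarrow> (\<forall>k\<in>\<Lambda>'. card {x\<in>P. cl x = k} = occ \<Lambda>' \<eta> k)"
  proof (rule ball_cong[OF refl])
    fix k assume k: "k \<in> \<Lambda>'"
    have "block_spin m q (conf P) k = \<eta> k \<longleftrightarrow> real (card {x\<in>P. cl x = k}) = real (occ \<Lambda>' \<eta> k)"
      unfolding block_spin_conf[OF assms(2) k] occ_coarse(1)[OF assms(1) k] by auto
    then show "block_spin m q (conf P) k = \<eta> k \<longleftrightarrow> card {x\<in>P. cl x = k} = occ \<Lambda>' \<eta> k" by simp
  qed
  also have "\<dots> \<longleftrightarrow> (\<forall>k. card {x\<in>P. cl x = k} = occ \<Lambda>' \<eta> k)"
  proof -
    have "card {x\<in>P. cl x = k} = occ \<Lambda>' \<eta> k" if "k \<notin> \<Lambda>'" for k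
    proof -
      have "{x\<in>P. cl x = k} = {}" using that assms(2) corner_in' by auto
      then show ?thesis using that by (simp only: card.empty occ_def if_False)
    qed
    then show ?thesis by auto
  qed
  finally show ?thesis using assms(2) by (simp add: slice_def)
qed

definition micro :: "(real ^ 'd \<Rightarrow> real) set" where "micro = \<Lambda> \<rightarrow>\<^sub>E {1, - 1}"

lemma finite_micro: "finite micro"
  unfolding micro_def by (intro finite_PiE) (auto simp: finite_torus_lattice)

lemma micro_ne: "micro \<noteq> {}" by (auto simp: micro_def PiE_eq_empty_iff)

lemma prior_eq: "prior (m * q) = pmf_of_set micro"
proof -
  have "PiE_dflt \<Lambda> undefined (\<lambda>_. {1, - 1}) = micro"
    by (auto simp: PiE_dflt_def micro_def PiE_def extensional_def)
  then show ?thesis unfolding prior_def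
    by (subst Pi_pmf_of_set) (auto simp: finite_torus_lattice)
qed

lemma conf_bij: "bij_betw conf (Pow \<Lambda>) micro"
proof (rule bij_betw_byWitness[where f' = "\<lambda>\<sigma>. {x\<in>\<Lambda>. \<sigma> x = 1}"])
  show "\<forall>P\<in>Pow \<Lambda>. {x\<in>\<Lambda>. conf P x = 1} = P" by (auto simp: conf_def spin_def split: if_splits)
  show "\<forall>\<sigma>\<in>micro. conf {x\<in>\<Lambda>. \<sigma> x = 1} = \<sigma>"
    by (auto simp: conf_def spin_def micro_def PiE_def extensional_def fun_eq_iff Pi_iff)
qed (auto simp: conf_def micro_def spin_def)

lemma conf_slice:
  assumes "\<eta> \<in> coarse_configs m q"
  shows "bij_betw conf (slice cl \<Lambda> (occ \<Lambda>' \<eta>)) (micro \<inter> {\<sigma>. block_spin m q \<sigma> = \<eta>})"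
proof (rule bij_betw_subset[OF conf_bij])
  show "slice cl \<Lambda> (occ \<Lambda>' \<eta>) \<subseteq> Pow \<Lambda>" by (auto simp: slice_def)
  show "conf ` slice cl \<Lambda> (occ \<Lambda>' \<eta>) = micro \<inter> {\<sigma>. block_spin m q \<sigma> = \<eta>}"
  proof (intro equalityI subsetI)
    fix \<sigma> assume "\<sigma> \<in> conf ` slice cl \<Lambda> (occ \<Lambda>' \<eta>)"
    then obtain P where P: "P \<in> slice cl \<Lambda> (occ \<Lambda>' \<eta>)" "\<sigma> = conf P" by auto
    then have PL: "P \<subseteq> \<Lambda>" by (simp add: slice_def)
    show "\<sigma> \<in> micro \<inter> {\<sigma>. block_spin m q \<sigma> = \<eta>}"
      using P block_spin_conf_eq[OF assms PL] bij_betwE[OF conf_bij] PL by auto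
  next
    fix \<sigma> assume s: "\<sigma> \<in> micro \<inter> {\<sigma>. block_spin m q \<sigma> = \<eta>}"
    then obtain P where P: "P \<subseteq> \<Lambda>" "\<sigma> = conf P"
      using bij_betw_imp_surj_on[OF conf_bij] by (metis IntD1 PowD imageE)
    then show "\<sigma> \<in> conf ` slice cl \<Lambda> (occ \<Lambda>' \<eta>)"
      using s block_spin_conf_eq[OF assms P(1)] by auto
  qed
qed

lemma cond_expect_sum:
  assumes "\<eta> \<in> coarse_configs m q"
  shows "cond_expect m q f \<eta> = (\<Sum>\<sigma>\<in>micro \<inter> {\<sigma>. block_spin m q \<sigma> = \<eta>}. f \<sigma>) / card (micro \<inter> {\<sigma>. block_spin m q \<sigma> = \<eta>})"
    and "micro \<inter> {\<sigma>. block_spin m q \<sigma> = \<eta>} \<noteq> {}"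
proof -
  interpret pair_block_ensemble \<Lambda> \<Lambda>' cl Q "occ \<Lambda>' \<eta>" fluct by (rule ensemble[OF assms])
  show ne: "micro \<inter> {\<sigma>. block_spin m q \<sigma> = \<eta>} \<noteq> {}"
    using conf_slice[OF assms] slice_ne by (auto simp: bij_betw_def)
  have "cond_pmf (pmf_of_set micro) {\<sigma>. block_spin m q \<sigma> = \<eta>} = pmf_of_set (micro \<inter> {\<sigma>. block_spin m q \<sigma> = \<eta>})"
    by (rule cond_pmf_of_set[OF finite_micro ne])
  then show "cond_expect m q f \<eta> = (\<Sum>\<sigma>\<in>micro \<inter> {\<sigma>. block_spin m q \<sigma> = \<eta>}. f \<sigma>) / card (micro \<inter> {\<sigma>. block_spin m q \<sigma> = \<eta>})"
    unfolding cond_expect_def prior_eq using ne finite_micro by (simp add: integral_pmf_of_set)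
qed

lemma cond_expect_avg:
  assumes "\<eta> \<in> coarse_configs m q"
  shows "cond_expect m q f \<eta> = avg cl \<Lambda> (occ \<Lambda>' \<eta>) (\<lambda>P. f (conf P))"
  unfolding cond_expect_sum(1)[OF assms] avg_def
  using sum.reindex_bij_betw[OF conf_slice[OF assms], of f] bij_betw_same_card[OF conf_slice[OF assms]] by simp

text \<open>The pair energy \<open>V\<close> of the ensemble locale, restated without reference to a
  coarse configuration: the interpretation depends on \<eta>, the energy does not.\<close>

definition W :: "real ^ 'd \<Rightarrow> real ^ 'd \<Rightarrow> (real ^ 'd) set \<Rightarrow> real" where
  "W k l P = (\<Sum>x\<in>cell m q k. \<Sum>y\<in>cell m q l. fluct x y * (spin P x * spin P y))"

lemma sum_W: "(\<Sum>k\<in>\<Lambda>'. \<Sum>l\<in>\<Lambda>'. W k l P) = (\<Sum>x\<in>\<Lambda>. \<Sum>y\<in>\<Lambda>. fluct x y * (spin P x * spin P y))"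
  unfolding sum_cells W_def by (subst (2) sum.swap) (rule refl)

lemma hamiltonian_conf:
  "hamiltonian (m * q) J h (conf P) = - (1/2) * (\<Sum>x\<in>\<Lambda>. \<Sum>y\<in>\<Lambda> - {x}. J (x - y) * spin P x * spin P y)
     + (\<Sum>x\<in>\<Lambda>. h x * spin P x)"
  unfolding hamiltonian_def by (simp add: conf_def)

text \<open>On a slice only the fluctuation part of the energy varies: block averages of the couplings and
  a field that is constant on cells see the block spins only.\<close>
lemma hamiltonian_slice:
  assumes \<eta>: "\<eta> \<in> coarse_configs m q" and h: "\<forall>k\<in>\<Lambda>'. \<forall>x\<in>cell m q k. \<forall>y\<in>cell m q k. h x = h y"
  obtains K where "\<And>P. P \<in> slice cl \<Lambda> (occ \<Lambda>' \<eta>) \<Longrightarrow> hamiltonian (m * q) J h (conf P) = K - pair_energy fluct \<Lambda> P"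
proof
  fix P assume P: "P \<in> slice cl \<Lambda> (occ \<Lambda>' \<eta>)"
  then have PL: "P \<subseteq> \<Lambda>" by (simp add: slice_def)
  have bs: "(\<Sum>x\<in>cell m q k. spin P x) = \<eta> k" if "k \<in> \<Lambda>'" for k
  proof -
    have "block_spin m q (conf P) k = (\<Sum>x\<in>cell m q k. spin P x)"
      using that by (auto simp: block_spin_def conf_def intro!: sum.cong dest: subsetD[OF cell_subset])
    then show ?thesis using block_spin_conf_eq[OF \<eta> PL] P by simp
  qed
  have f: "(\<Sum>x\<in>\<Lambda>. h x * spin P x) = (\<Sum>k\<in>\<Lambda>'. h k * \<eta> k)"
    unfolding sum_cells
  proof (rule sum.cong[OF refl])
    fix k assume k: "k \<in> \<Lambda>'"
    have kc: "k \<in> cell m q k" using k torus_lattice_mult[OF q k] m by (auto simp: cell_def)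
    have "(\<Sum>x\<in>cell m q k. h x * spin P x) = (\<Sum>x\<in>cell m q k. h k * spin P x)"
      by (rule sum.cong[OF refl]) (use h k kc in metis)
    then show "(\<Sum>x\<in>cell m q k. h x * spin P x) = h k * \<eta> k" using bs[OF k] by (simp add: sum_distrib_left[symmetric])
  qed
  \<comment> \<open>The double sum of block means is completed to include \<open>y = x\<close>, so
    that it factors into block spins. The added terms carry a squared spin and are the constants
    subtracted in the last line.\<close>
  have J: "(\<Sum>x\<in>\<Lambda>. \<Sum>y\<in>\<Lambda> - {x}. J (x - y) * spin P x * spin P y)
     = (\<Sum>x\<in>\<Lambda>. \<Sum>y\<in>\<Lambda>. fluct x y * spin P x * spin P y)
       + (\<Sum>x\<in>\<Lambda>. \<Sum>y\<in>\<Lambda>. (J_bar m q J (cl x) (cl y)) * (spin P x * spin P y))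
       - (\<Sum>x\<in>\<Lambda>. J_bar m q J (cl x) (cl x))"
  proof -
    have "(\<Sum>y\<in>\<Lambda> - {x}. J (x - y) * spin P x * spin P y) = (\<Sum>y\<in>\<Lambda>. fluct x y * spin P x * spin P y)
       + (\<Sum>y\<in>\<Lambda>. (J_bar m q J (cl x) (cl y)) * (spin P x * spin P y)) - J_bar m q J (cl x) (cl x)" if x: "x \<in> \<Lambda>" for x
    proof -
      have "(\<Sum>y\<in>\<Lambda> - {x}. J (x - y) * spin P x * spin P y)
         = (\<Sum>y\<in>\<Lambda> - {x}. fluct x y * spin P x * spin P y + (J_bar m q J (cl x) (cl y)) * (spin P x * spin P y))"
        by (rule sum.cong[OF refl]) (use x in \<open>auto simp: fluct_def algebra_simps\<close>)
      moreover have "(\<Sum>y\<in>\<Lambda>. fluct x y * spin P x * spin P y) = (\<Sum>y\<in>\<Lambda> - {x}. fluct x y * spin P x * spin P y)"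
        by (subst sum.remove[OF finite_torus_lattice x]) (simp add: fluct_diag)
      moreover have "(\<Sum>y\<in>\<Lambda>. (J_bar m q J (cl x) (cl y)) * (spin P x * spin P y))
         = J_bar m q J (cl x) (cl x) + (\<Sum>y\<in>\<Lambda> - {x}. (J_bar m q J (cl x) (cl y)) * (spin P x * spin P y))"
        by (subst sum.remove[OF finite_torus_lattice x]) simp
      ultimately show ?thesis by (simp add: sum.distrib)
    qed
    then show ?thesis by (simp add: sum.distrib sum_subtractf)
  qed
  have B: "(\<Sum>x\<in>\<Lambda>. \<Sum>y\<in>\<Lambda>. (J_bar m q J (cl x) (cl y)) * (spin P x * spin P y))
     = (\<Sum>k\<in>\<Lambda>'. \<Sum>l\<in>\<Lambda>'. J_bar m q J k l * (\<eta> k * \<eta> l))"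
  proof -
    have "(\<Sum>x\<in>\<Lambda>. \<Sum>y\<in>\<Lambda>. (J_bar m q J (cl x) (cl y)) * (spin P x * spin P y))
      = (\<Sum>k\<in>\<Lambda>'. \<Sum>l\<in>\<Lambda>'. \<Sum>x\<in>cell m q k. \<Sum>y\<in>cell m q l. (J_bar m q J (cl x) (cl y)) * (spin P x * spin P y))"
      unfolding sum_cells by (subst (2) sum.swap) (rule refl)
    also have "\<dots> = (\<Sum>k\<in>\<Lambda>'. \<Sum>l\<in>\<Lambda>'. J_bar m q J k l * (\<eta> k * \<eta> l))"
    proof (intro sum.cong refl)
      fix k l assume kl: "k \<in> \<Lambda>'" "l \<in> \<Lambda>'"
      have "(\<Sum>x\<in>cell m q k. \<Sum>y\<in>cell m q l. (J_bar m q J (cl x) (cl y)) * (spin P x * spin P y))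
        = (\<Sum>x\<in>cell m q k. \<Sum>y\<in>cell m q l. J_bar m q J k l * (spin P x * spin P y))"
        using cell_corner[OF kl(1)] cell_corner[OF kl(2)] by (intro sum.cong refl) auto
      also have "\<dots> = J_bar m q J k l * ((\<Sum>x\<in>cell m q k. spin P x) * (\<Sum>y\<in>cell m q l. spin P y))"
        by (subst sum_product) (simp only: sum_distrib_left)
      finally show "(\<Sum>x\<in>cell m q k. \<Sum>y\<in>cell m q l. (J_bar m q J (cl x) (cl y)) * (spin P x * spin P y))
        = J_bar m q J k l * (\<eta> k * \<eta> l)" using bs kl by simp
    qed
    finally show ?thesis .
  qed
  show "hamiltonian (m * q) J h (conf P) = (- (1/2) * ((\<Sum>k\<in>\<Lambda>'. \<Sum>l\<in>\<Lambda>'. J_bar m q J k l * (\<eta> k * \<eta> l))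
      - (\<Sum>x\<in>\<Lambda>. J_bar m q J (cl x) (cl x))) + (\<Sum>k\<in>\<Lambda>'. h k * \<eta> k)) - pair_energy fluct \<Lambda> P"
    unfolding hamiltonian_conf f J B pair_energy_def by (simp add: algebra_simps)
qed

lemma V_W:
  fixes \<eta> :: "real ^ 'd \<Rightarrow> real"
  assumes "\<eta> \<in> coarse_configs m q" "k \<in> \<Lambda>'" "l \<in> \<Lambda>'"
  shows "pair_block_ensemble.V \<Lambda> cl fluct k l = W k l"
proof -
  interpret pair_block_ensemble \<Lambda> \<Lambda>' cl Q "occ \<Lambda>' \<eta>" fluct by (rule ensemble[OF assms(1)])
  show ?thesis unfolding V_def[abs_def] W_def[abs_def] C_def
    unfolding cell_eq[OF m q assms(2)] cell_eq[OF m q assms(3)] ..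
qed

lemma avg_pair_energy:
  assumes \<eta>: "\<eta> \<in> coarse_configs m q"
  shows "avg cl \<Lambda> (occ \<Lambda>' \<eta>) (pair_energy fluct \<Lambda>) = 0"
proof -
  interpret pair_block_ensemble \<Lambda> \<Lambda>' cl Q "occ \<Lambda>' \<eta>" fluct by (rule ensemble[OF \<eta>])
  have "pair_energy fluct \<Lambda> = (\<lambda>P. (1/2) * (\<Sum>k\<in>\<Lambda>'. \<Sum>l\<in>\<Lambda>'. W k l P))"
    unfolding sum_W pair_energy_def[abs_def] by (simp add: mult.assoc)
  then have "av (pair_energy fluct \<Lambda>) = (1/2) * (\<Sum>k\<in>\<Lambda>'. \<Sum>l\<in>\<Lambda>'. av (W k l))"
    by (simp only: avg_scale avg_sum)
  also have "\<dots> = 0" using av_V V_W[OF \<eta>] by simp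
  finally show ?thesis .
qed

text \<open>On a slice the energy is a constant minus the fluctuation energy. The latter has mean
  zero, so the constant is the conditional mean, and it factors out of the exponential.\<close>

lemma coarse_energies:
  assumes \<eta>: "\<eta> \<in> coarse_configs m q" and h: "\<forall>k\<in>\<Lambda>'. \<forall>x\<in>cell m q k. \<forall>y\<in>cell m q k. h x = h y"
    and \<beta>: "\<beta> > 0"
  shows "coarse_hamiltonian m q \<beta> (hamiltonian (m * q) J h) \<eta> = cond_expect m q (hamiltonian (m * q) J h) \<eta>
     - ln (avg cl \<Lambda> (occ \<Lambda>' \<eta>) (\<lambda>P. exp (pair_energy (\<lambda>x y. \<beta> * fluct x y) \<Lambda> P))) / \<beta>"
proof -
  interpret pair_block_ensemble \<Lambda> \<Lambda>' cl Q "occ \<Lambda>' \<eta>" fluct by (rule ensemble[OF \<eta>])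
  obtain K where K: "\<And>P. P \<in> slice cl \<Lambda> (occ \<Lambda>' \<eta>) \<Longrightarrow> hamiltonian (m * q) J h (conf P) = K - pair_energy fluct \<Lambda> P"
    using hamiltonian_slice[OF \<eta> h] by blast
  have "cond_expect m q (hamiltonian (m * q) J h) \<eta> = av (\<lambda>P. K + (- 1) * pair_energy fluct \<Lambda> P)"
    unfolding cond_expect_avg[OF \<eta>] by (rule avg_cong) (simp add: K)
  also have "\<dots> = K"
    unfolding avg_add avg_scale avg_pair_energy[OF \<eta>] by (simp add: avg_const[OF finS slice_ne])
  finally have H0: "cond_expect m q (hamiltonian (m * q) J h) \<eta> = K" .
  have pe: "pair_energy (\<lambda>x y. \<beta> * fluct x y) \<Lambda> P = \<beta> * pair_energy fluct \<Lambda> P" for P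
    by (simp add: pair_energy_def sum_distrib_left mult.assoc)
  have "cond_expect m q (\<lambda>\<sigma>. exp (- \<beta> * hamiltonian (m * q) J h \<sigma>)) \<eta>
     = av (\<lambda>P. exp (- \<beta> * K) * exp (pair_energy (\<lambda>x y. \<beta> * fluct x y) \<Lambda> P))"
    unfolding cond_expect_avg[OF \<eta>] pe by (rule avg_cong) (simp add: K exp_add[symmetric] algebra_simps)
  also have "\<dots> = exp (- \<beta> * K) * av (\<lambda>P. exp (pair_energy (\<lambda>x y. \<beta> * fluct x y) \<Lambda> P))" by (rule avg_scale)
  finally have E: "cond_expect m q (\<lambda>\<sigma>. exp (- \<beta> * hamiltonian (m * q) J h \<sigma>)) \<eta>
     = exp (- \<beta> * K) * av (\<lambda>P. exp (pair_energy (\<lambda>x y. \<beta> * fluct x y) \<Lambda> P))" .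
  have pos: "av (\<lambda>P. exp (pair_energy (\<lambda>x y. \<beta> * fluct x y) \<Lambda> P)) > 0"
    unfolding avg_def using finite_slice[OF finS] slice_ne
    by (intro divide_pos_pos sum_pos) (auto simp: card_gt_0_iff)
  show ?thesis unfolding coarse_hamiltonian_def E H0 using pos \<beta> by (simp add: ln_mult field_simps)
qed

subsection \<open>Potentials of finite range\<close>

lemma shift_occ:
  assumes a: "a \<in> \<Lambda>'" and X: "X \<subseteq> \<Lambda>'" and k: "k \<in> \<Lambda>'"
  shows "occ (torus_shift a ` X) (restrict \<eta> (torus_shift a ` X)) (torus_shift a k)
    = occ X (restrict (\<eta> \<circ> torus_shift a) X) k"
proof -
  have "torus_shift a k \<in> torus_shift a ` X \<longleftrightarrow> k \<in> X"
    using inj_on_image_mem_iff[OF shift_inj k X] .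
  then show ?thesis by (simp add: occ_def)
qed

text \<open>Terms are grouped by support: the potential of \<open>Y\<close> collects the terms with
  \<open>X e = Y\<close>, which by locality see only the occupation on \<open>Y\<close>. A
  translation must permute the terms; its effect is stated for arbitrary occupation functions
  because the potential evaluates restricted configurations. The guard \<open>tr\<close> covers the
  mean energy, whose invariance depends on the field.\<close>

lemma potential_of_terms:
  fixes T :: "'e \<Rightarrow> (real ^ 'd \<Rightarrow> nat) \<Rightarrow> real" and X :: "'e \<Rightarrow> (real ^ 'd) set"
    and F :: "(real ^ 'd \<Rightarrow> real) \<Rightarrow> real"
  assumes E: "finite E" and XE: "\<And>e. e \<in> E \<Longrightarrow> X e \<subseteq> \<Lambda>'"
    and loc: "\<And>e \<eta>. e \<in> E \<Longrightarrow> \<eta> \<in> coarse_configs m q \<Longrightarrow> T e (on_cells (X e) (occ \<Lambda>' \<eta>)) = T e (occ \<Lambda>' \<eta>)"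
    and far: "\<And>e \<eta> k l. e \<in> E \<Longrightarrow> \<eta> \<in> coarse_configs m q \<Longrightarrow> k \<in> X e \<Longrightarrow> l \<in> X e \<Longrightarrow> torus_norm (k - l) > R
      \<Longrightarrow> T e (occ \<Lambda>' \<eta>) = 0"
    and F: "\<And>\<eta>. \<eta> \<in> coarse_configs m q \<Longrightarrow> F \<eta> = (\<Sum>e\<in>E. T e (occ \<Lambda>' \<eta>))"
    and shift: "\<And>a. tr \<Longrightarrow> a \<in> \<Lambda>' \<Longrightarrow> \<exists>\<pi>. bij_betw \<pi> E E \<and> (\<forall>e\<in>E. X (\<pi> e) = torus_shift a ` X e \<and>
      (\<forall>b b'. (\<forall>k. k \<notin> \<Lambda>' \<longrightarrow> b k = 0 \<and> b' k = 0) \<longrightarrow> (\<forall>k\<in>\<Lambda>'. b (torus_shift a k) = b' k) \<longrightarrow> T (\<pi> e) b = T e b'))"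
  shows "\<exists>\<Phi>. (\<forall>\<eta>\<in>coarse_configs m q. F \<eta> = potential_sum m \<Phi> \<eta>) \<and> finite_range m q R \<Phi> \<and>
    (tr \<longrightarrow> translation_invariant m q \<Phi>)"
proof -
  define \<Phi> where "\<Phi> Y \<xi> = (\<Sum>e\<in>{e\<in>E. X e = Y}. T e (occ Y \<xi>))" for Y \<xi>
  have \<Phi>: "\<Phi> Y (restrict \<eta> Y) = (\<Sum>e\<in>{e\<in>E. X e = Y}. T e (occ \<Lambda>' \<eta>))" if "\<eta> \<in> coarse_configs m q" "Y \<subseteq> \<Lambda>'" for Y \<eta>
    unfolding \<Phi>_def occ_restrict[OF that(2)] by (rule sum.cong) (use loc that in auto)
  have "F \<eta> = potential_sum m \<Phi> \<eta>" if "\<eta> \<in> coarse_configs m q" for \<eta>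
  proof -
    have "potential_sum m \<Phi> \<eta> = (\<Sum>Y\<in>Pow \<Lambda>'. \<Sum>e\<in>{e\<in>E. X e = Y}. T e (occ \<Lambda>' \<eta>))"
      unfolding potential_sum_def by (rule sum.cong) (use \<Phi> that in auto)
    also have "\<dots> = (\<Sum>e\<in>E. T e (occ \<Lambda>' \<eta>))"
      by (rule sum.group) (use E XE in \<open>auto simp: finite_torus_lattice\<close>)
    finally show ?thesis using F[OF that] by simp
  qed
  moreover have "finite_range m q R \<Phi>"
    unfolding finite_range_def
  proof (intro allI impI ballI)
    fix Y :: "(real ^ 'd) set" and \<eta> :: "real ^ 'd \<Rightarrow> real" assume Y: "Y \<subseteq> \<Lambda>'" and \<eta>: "\<eta> \<in> coarse_configs m q" and "\<exists>k\<in>Y. \<exists>l\<in>Y. torus_norm (k - l) > R"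
    then show "\<Phi> Y (restrict \<eta> Y) = 0" unfolding \<Phi>[OF \<eta> Y] using far by (intro sum.neutral) auto
  qed
  moreover have "translation_invariant m q \<Phi>" if tr
    unfolding translation_invariant_def
  proof (intro ballI allI impI)
    fix a :: "real ^ 'd" and Y :: "(real ^ 'd) set" and \<eta> :: "real ^ 'd \<Rightarrow> real" assume a: "a \<in> \<Lambda>'" and Y: "Y \<subseteq> \<Lambda>'" and \<eta>: "\<eta> \<in> coarse_configs m q"
    let ?t = "torus_shift a"
    obtain \<pi> where \<pi>: "bij_betw \<pi> E E" "\<And>e. e \<in> E \<Longrightarrow> X (\<pi> e) = ?t ` X e"
      "\<And>e b b'. e \<in> E \<Longrightarrow> (\<forall>k. k \<notin> \<Lambda>' \<longrightarrow> b k = 0 \<and> b' k = 0) \<Longrightarrow> (\<forall>k\<in>\<Lambda>'. b (?t k) = b' k) \<Longrightarrow> T (\<pi> e) b = T e b'"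
    proof -
      from shift[OF \<open>tr\<close> a] obtain \<pi> where \<pi>0: "bij_betw \<pi> E E"
        and \<pi>1: "\<forall>e\<in>E. X (\<pi> e) = ?t ` X e \<and> (\<forall>b b'. (\<forall>k. k \<notin> \<Lambda>' \<longrightarrow> b k = 0 \<and> b' k = 0) \<longrightarrow>
          (\<forall>k\<in>\<Lambda>'. b (?t k) = b' k) \<longrightarrow> T (\<pi> e) b = T e b')"
        by (elim exE conjE)
      show thesis
      proof (rule that[OF \<pi>0])
        show "X (\<pi> e) = ?t ` X e" if "e \<in> E" for e using \<pi>1 that by blast
        show "T (\<pi> e) b = T e b'" if "e \<in> E" "\<forall>k. k \<notin> \<Lambda>' \<longrightarrow> b k = 0 \<and> b' k = 0" "\<forall>k\<in>\<Lambda>'. b (?t k) = b' k" for e b b'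
          using bspec[OF \<pi>1 that(1), THEN conjunct2, rule_format, of b b'] that(2,3) by blast
      qed
    qed
    have bij: "bij_betw \<pi> {e\<in>E. X e = Y} {e\<in>E. X e = ?t ` Y}"
    proof (rule bij_betw_subset[OF \<pi>(1)])
      show "\<pi> ` {e\<in>E. X e = Y} = {e\<in>E. X e = ?t ` Y}"
      proof (intro equalityI subsetI)
        fix e assume "e \<in> {e\<in>E. X e = ?t ` Y}"
        then have e: "e \<in> \<pi> ` E" "X e = ?t ` Y" using bij_betw_imp_surj_on[OF \<pi>(1)] by auto
        then obtain e' where e': "e' \<in> E" "e = \<pi> e'" "X e = ?t ` Y" by blast
        then have "?t ` X e' = ?t ` Y" using \<pi>(2) by simp
        then have "X e' = Y" using inj_on_image_eq_iff[OF shift_inj XE[OF e'(1)] Y] by simp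
        then show "e \<in> \<pi> ` {e\<in>E. X e = Y}" using e' by auto
      qed (use \<pi>(2) bij_betwE[OF \<pi>(1)] in auto)
    qed auto
    have tY: "?t ` Y \<subseteq> \<Lambda>'" using shift_in[OF m a] Y by auto
    have "\<Phi> (?t ` Y) (restrict \<eta> (?t ` Y)) = (\<Sum>e\<in>{e\<in>E. X e = Y}. T (\<pi> e) (occ (?t ` Y) (restrict \<eta> (?t ` Y))))"
      unfolding \<Phi>_def by (rule sum.reindex_bij_betw[OF bij, symmetric])
    also have "\<dots> = (\<Sum>e\<in>{e\<in>E. X e = Y}. T e (occ Y (restrict (\<eta> \<circ> ?t) Y)))"
    proof (rule sum.cong[OF refl])
      fix e assume "e \<in> {e\<in>E. X e = Y}"
      then have e: "e \<in> E" by simp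
      show "T (\<pi> e) (occ (?t ` Y) (restrict \<eta> (?t ` Y))) = T e (occ Y (restrict (\<eta> \<circ> ?t) Y))"
      proof (rule \<pi>(3)[OF e])
        show "\<forall>k. k \<notin> \<Lambda>' \<longrightarrow> occ (?t ` Y) (restrict \<eta> (?t ` Y)) k = 0 \<and> occ Y (restrict (\<eta> \<circ> ?t) Y) k = 0"
          using tY Y by (auto simp: occ_def)
        show "\<forall>k\<in>\<Lambda>'. occ (?t ` Y) (restrict \<eta> (?t ` Y)) (?t k) = occ Y (restrict (\<eta> \<circ> ?t) Y) k"
          using shift_occ[OF a Y] by blast
      qed
    qed
    finally show "\<Phi> (?t ` Y) (restrict \<eta> (?t ` Y)) = \<Phi> Y (restrict (\<eta> \<circ> ?t) Y)" by (simp add: \<Phi>_def)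
  qed
  ultimately show ?thesis by blast
qed

lemma avg_local':
  assumes "\<eta> \<in> coarse_configs m q" "local_to cl X f"
  shows "avg cl \<Lambda> (on_cells X (occ \<Lambda>' \<eta>)) f = avg cl \<Lambda> (occ \<Lambda>' \<eta>) f"
proof -
  interpret pair_block_ensemble \<Lambda> \<Lambda>' cl Q "occ \<Lambda>' \<eta>" fluct by (rule ensemble[OF assms(1)])
  show ?thesis using avg_local[OF finS slice_ne assms(2)] by simp
qed

lemma shift_bij_\<Lambda>: "a \<in> \<Lambda>' \<Longrightarrow> bij_betw (torus_shift a) \<Lambda> \<Lambda>"
  by (rule shift_bij[OF mq torus_lattice_mult[OF q]])

text \<open>The translation carries the slice of \<open>b'\<close> onto that of \<open>b\<close>.
  Since all sites outside the support are accounted for by occupation 0, this also applies to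
  ensembles on part of the cells.\<close>

lemma avg_shift:
  assumes a: "a \<in> \<Lambda>'" and b: "\<forall>k. k \<notin> \<Lambda>' \<longrightarrow> b k = 0 \<and> b' k = 0" "\<forall>k\<in>\<Lambda>'. b (torus_shift a k) = b' k"
    and f: "\<And>P. P \<subseteq> \<Lambda> \<Longrightarrow> g (torus_shift a ` P) = f P"
  shows "avg cl \<Lambda> b g = avg cl \<Lambda> b' f"
proof -
  let ?t = "torus_shift a"
  have sl: "?t ` P \<in> slice cl \<Lambda> b \<longleftrightarrow> P \<in> slice cl \<Lambda> b'" if P: "P \<subseteq> \<Lambda>" for P
  proof -
    have tP: "?t ` P \<subseteq> \<Lambda>" using bij_betwE[OF shift_bij_\<Lambda>[OF a]] P by auto
    have c: "card {x\<in>?t ` P. cl x = ?t k} = card {x\<in>P. cl x = k}" if "k \<in> \<Lambda>'" for k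
    proof -
      have "cl (?t x) = ?t k \<longleftrightarrow> cl x = k" if "x \<in> P" for x
      proof -
        have x: "x \<in> \<Lambda>" using that P by auto
        show ?thesis unfolding corner_shift[OF m q a x]
          by (rule inj_on_eq_iff[OF shift_inj corner_in'[OF x] \<open>k \<in> \<Lambda>'\<close>])
      qed
      then have "{x\<in>?t ` P. cl x = ?t k} = ?t ` {x\<in>P. cl x = k}" by auto
      moreover have "inj_on ?t {x\<in>P. cl x = k}" by (rule inj_on_subset[OF shift_inj[of a "m * q"]]) (use P in auto)
      ultimately show ?thesis by (simp add: card_image)
    qed
    have out: "card {x\<in>P'. cl x = k} = 0" if "P' \<subseteq> \<Lambda>" "k \<notin> \<Lambda>'" for P' k
    proof -
      have "{x\<in>P'. cl x = k} = {}" using that corner_in' by auto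
      then show ?thesis by (simp only: card.empty)
    qed
    have surj: "?t ` \<Lambda>' = \<Lambda>'" using shift_bij[OF m a] by (simp add: bij_betw_def)
    have "(\<forall>k. card {x\<in>?t ` P. cl x = k} = b k) \<longleftrightarrow> (\<forall>k\<in>\<Lambda>'. card {x\<in>?t ` P. cl x = k} = b k)"
      using out[OF tP] b(1) by auto
    also have "\<dots> \<longleftrightarrow> (\<forall>k\<in>\<Lambda>'. card {x\<in>?t ` P. cl x = ?t k} = b (?t k))"
      by (subst surj[symmetric]) simp
    also have "\<dots> \<longleftrightarrow> (\<forall>k\<in>\<Lambda>'. card {x\<in>P. cl x = k} = b' k)" using c b(2) by simp
    also have "\<dots> \<longleftrightarrow> (\<forall>k. card {x\<in>P. cl x = k} = b' k)" using out[OF P] b(1) by auto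
    finally show ?thesis using P tP by (simp add: slice_def)
  qed
  have bij: "bij_betw ((`) ?t) (slice cl \<Lambda> b') (slice cl \<Lambda> b)"
  proof (rule bij_betw_subset[OF bij_betw_Pow[OF shift_bij_\<Lambda>[OF a]]])
    show "slice cl \<Lambda> b' \<subseteq> Pow \<Lambda>" by (auto simp: slice_def)
    show "(`) ?t ` slice cl \<Lambda> b' = slice cl \<Lambda> b"
    proof (intro equalityI subsetI)
      fix P assume P: "P \<in> slice cl \<Lambda> b"
      then have "P \<in> Pow \<Lambda>" by (simp add: slice_def)
      then have "P \<in> (`) ?t ` Pow \<Lambda>"
        by (simp only: bij_betw_imp_surj_on[OF bij_betw_Pow[OF shift_bij_\<Lambda>[OF a]]])
      then obtain P' where "P' \<in> Pow \<Lambda>" "P = ?t ` P'" by (rule imageE)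
      then show "P \<in> (`) ?t ` slice cl \<Lambda> b'" using sl[of P'] P by auto
    next
      fix P assume "P \<in> (`) ?t ` slice cl \<Lambda> b'"
      then obtain P' where P': "P = ?t ` P'" "P' \<in> slice cl \<Lambda> b'" by auto
      then have "P' \<subseteq> \<Lambda>" by (simp add: slice_def)
      then show "P \<in> slice cl \<Lambda> b" using sl[of P'] P' by simp
    qed
  qed
  have "sum g (slice cl \<Lambda> b) = (\<Sum>P\<in>slice cl \<Lambda> b'. g (?t ` P))"
    by (rule sum.reindex_bij_betw[OF bij, symmetric])
  also have "\<dots> = sum f (slice cl \<Lambda> b')" by (rule sum.cong) (use f in \<open>auto simp: slice_def\<close>)
  finally show ?thesis unfolding avg_def using bij_betw_same_card[OF bij] by simp
qed

lemma spin_shift: "a \<in> \<Lambda>' \<Longrightarrow> P \<subseteq> \<Lambda> \<Longrightarrow> x \<in> \<Lambda> \<Longrightarrow> spin (torus_shift a ` P) (torus_shift a x) = (spin P x :: real)"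
  using inj_on_image_mem_iff[OF shift_inj, of x "m * q" P a] by (simp add: spin_def)

lemma sum_shift_cell:
  assumes "a \<in> \<Lambda>'" "k \<in> \<Lambda>'"
  shows "(\<Sum>x\<in>cell m q (torus_shift a k). f x) = (\<Sum>x\<in>cell m q k. f (torus_shift a x) :: real)"
  by (rule sum.reindex_bij_betw[OF shift_cell[OF assms], symmetric])

lemma W_shift:
  assumes "a \<in> \<Lambda>'" "k \<in> \<Lambda>'" "l \<in> \<Lambda>'" "P \<subseteq> \<Lambda>"
  shows "W (torus_shift a k) (torus_shift a l) (torus_shift a ` P) = W k l P"
  unfolding W_def sum_shift_cell[OF assms(1,2)] sum_shift_cell[OF assms(1,3)]
  by (intro sum.cong refl) (use cell_subset fluct_shift[OF assms(1)] spin_shift[OF assms(1,4)] in \<open>auto simp: subset_iff\<close>)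

lemma W_far: "k \<in> \<Lambda>' \<Longrightarrow> l \<in> \<Lambda>' \<Longrightarrow> torus_norm (k - l) > \<rho> \<Longrightarrow> W k l P = 0"
  unfolding W_def using far_cells(2) by (intro sum.neutral ballI) simp

lemma local_spin_cell: "k \<in> \<Lambda>' \<Longrightarrow> k \<in> X \<Longrightarrow> x \<in> cell m q k \<Longrightarrow> local_to cl X (\<lambda>P. spin P x)"
  by (rule local_to_spin) (simp add: cell_corner)

lemma local_W: "k \<in> \<Lambda>' \<Longrightarrow> l \<in> \<Lambda>' \<Longrightarrow> k \<in> X \<Longrightarrow> l \<in> X \<Longrightarrow> local_to cl X (W k l)"
  unfolding W_def[abs_def]
  by (intro local_to_sum local_to_mult local_to_const) (auto intro: local_spin_cell)

lemma \<rho>_nonneg: "\<rho> \<ge> 0" using L by (simp add: \<rho>_def)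

lemma relpow_torus_norm:
  fixes R :: "((real ^ 'd) \<times> (real ^ 'd)) set"
  assumes "\<And>x y. (x, y) \<in> R \<Longrightarrow> torus_norm (x - y) \<le> \<rho>"
  shows "(k, l) \<in> R ^^ n \<Longrightarrow> torus_norm (k - l) \<le> real n * \<rho>"
proof (induction n arbitrary: l)
  case 0
  then show ?case using torus_norm_le_norm[of "0 :: real ^ 'd"] by simp
next
  case (Suc n)
  then obtain j where j: "(k, j) \<in> R ^^ n" "(j, l) \<in> R" by auto
  have "torus_norm (k - l) \<le> torus_norm (k - j) + torus_norm (j - l)"
    using torus_norm_triangle[of "k - j" "j - l"] by simp
  also have "\<dots> \<le> real n * \<rho> + \<rho>" using Suc.IH[OF j(1)] assms[OF j(2)] by linarith
  finally show ?case by (simp add: algebra_simps)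
qed

definition edge_energy :: "real \<Rightarrow> (real ^ 'd) \<times> (real ^ 'd) \<Rightarrow> (real ^ 'd) set \<Rightarrow> real" where
  "edge_energy \<beta> e P = \<beta> / 2 * W (fst e) (snd e) P"

definition edge_cells :: "nat \<Rightarrow> (nat \<Rightarrow> (real ^ 'd) \<times> (real ^ 'd)) \<Rightarrow> (real ^ 'd) set" where
  "edge_cells p e = (\<Union>i<p. {fst (e i), snd (e i)})"

definition edge_cumulant :: "real \<Rightarrow> nat \<Rightarrow> (nat \<Rightarrow> (real ^ 'd) \<times> (real ^ 'd)) \<Rightarrow> (real ^ 'd \<Rightarrow> nat) \<Rightarrow> real" where
  "edge_cumulant \<beta> p e a = joint_cumulant (\<lambda>S. avg cl \<Lambda> a (\<lambda>P. \<Prod>i\<in>S. edge_energy \<beta> (e i) P)) {..<p}"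

text \<open>The pairs of the tuple are edges of a graph on the cells. If they do not connect
  \<open>k\<close> with \<open>l\<close>, the edges in the component of \<open>k\<close> are
  independent of the others and the cumulant vanishes. If they do, a path of at most
  \<open>2 p\<close> steps joins them, and a step longer than \<open>\<rho>\<close> has energy
  zero.\<close>

lemma edge_cumulant_far:
  assumes \<eta>: "\<eta> \<in> coarse_configs m q" and e: "e \<in> {..<p} \<rightarrow>\<^sub>E \<Lambda>' \<times> \<Lambda>'"
    and kl: "k \<in> edge_cells p e" "l \<in> edge_cells p e" "torus_norm (k - l) > 2 * real p * \<rho>"
  shows "edge_cumulant \<beta> p e (occ \<Lambda>' \<eta>) = 0"
proof -
  interpret pair_block_ensemble \<Lambda> \<Lambda>' cl Q "occ \<Lambda>' \<eta>" fluct by (rule ensemble[OF \<eta>])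
  let ?m = "\<lambda>S. av (\<lambda>P. \<Prod>i\<in>S. edge_energy \<beta> (e i) P)"
  have eL: "fst (e i) \<in> \<Lambda>'" "snd (e i) \<in> \<Lambda>'" if "i < p" for i
    using e that by (auto simp: PiE_iff mem_Times_iff)
  show ?thesis
  proof (cases "\<exists>i<p. torus_norm (fst (e i) - snd (e i)) > \<rho>")
    case True
    then obtain i where i: "i < p" "torus_norm (fst (e i) - snd (e i)) > \<rho>" by auto
    have "?m S = 0" if "S \<subseteq> {..<p}" "i \<in> S" for S
    proof -
      have "finite S" using that finite_subset by auto
      moreover have "edge_energy \<beta> (e i) P = 0" for P
        using W_far[OF eL[OF i(1)] i(2)] by (simp add: edge_energy_def)
      ultimately have "(\<Prod>i\<in>S. edge_energy \<beta> (e i) P) = 0" for P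
        using that by (auto intro!: prod_zero)
      then show ?thesis by (simp add: avg_def)
    qed
    then show ?thesis unfolding edge_cumulant_def using i by (intro joint_cumulant_zero[of _ i]) auto
  next
    case False
    \<comment> \<open>Both orientations of all edges. Their number, at most \<open>2 * p\<close>,
      bounds the length of a shortest path, which is where the factor 2 in the range comes
      from.\<close>
    define R where "R = (\<lambda>i. (fst (e i), snd (e i))) ` {..<p} \<union> (\<lambda>i. (snd (e i), fst (e i))) ` {..<p}"
    define comp where "comp = R\<^sup>* `` {k}"
    have finR: "finite R" by (simp add: R_def)
    have "card R \<le> card ((\<lambda>i. (fst (e i), snd (e i))) ` {..<p}) + card ((\<lambda>i. (snd (e i), fst (e i))) ` {..<p})"
      unfolding R_def by (rule card_Un_le)
    also have "\<dots> \<le> p + p"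
      using card_image_le[of "{..<p}" "\<lambda>i. (fst (e i), snd (e i))"] card_image_le[of "{..<p}" "\<lambda>i. (snd (e i), fst (e i))"]
      by (intro add_mono) auto
    finally have cardR: "card R \<le> 2 * p" by simp
    have Rn: "torus_norm (x - y) \<le> \<rho>" if "(x, y) \<in> R" for x y
    proof -
      have "torus_norm (x - y) = torus_norm (y - x)" using torus_norm_minus[of "x - y"] by simp
      moreover from that obtain i where "i < p" "(x, y) = (fst (e i), snd (e i)) \<or> (x, y) = (snd (e i), fst (e i))"
        unfolding R_def by blast
      ultimately show ?thesis using False by (metis fst_conv snd_conv not_less)
    qed
    have l: "l \<notin> comp"
    proof
      assume "l \<in> comp"
      then have "(k, l) \<in> R\<^sup>*" by (simp add: comp_def)
      then obtain n where n: "n \<le> card R" "(k, l) \<in> R ^^ n"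
        unfolding rtrancl_finite_eq_relpow[OF finR] by auto
      have "torus_norm (k - l) \<le> real n * \<rho>" by (rule relpow_torus_norm[OF Rn n(2)])
      also have "\<dots> \<le> real (2 * p) * \<rho>" using n(1) cardR \<rho>_nonneg by (intro mult_right_mono) auto
      finally show False using kl(3) by simp
    qed
    have step: "y \<in> comp" if "x \<in> comp" "(x, y) \<in> R" for x y
      using that by (auto simp: comp_def intro: rtrancl_into_rtrancl)
    \<comment> \<open>No edge leaves the component, so the energies with index in \<open>I1\<close>
      are local to \<open>comp\<close> and those in \<open>I2\<close> to its complement.
      Nonemptiness of both parts comes from \<open>k\<close> and \<open>l\<close>.\<close>
    have iff: "fst (e i) \<in> comp \<longleftrightarrow> snd (e i) \<in> comp" if "i < p" for i
      using step[of "fst (e i)" "snd (e i)"] step[of "snd (e i)" "fst (e i)"] that by (auto simp: R_def)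
    define I1 where "I1 = {i. i < p \<and> fst (e i) \<in> comp}"
    define I2 where "I2 = {i. i < p \<and> fst (e i) \<notin> comp}"
    have I: "{..<p} = I1 \<union> I2" by (auto simp: I1_def I2_def)
    have "joint_cumulant ?m (I1 \<union> I2) = 0"
    proof (rule joint_cumulant_independent)
      show "finite (I1 \<union> I2)" unfolding I[symmetric] by simp
      have "k \<in> comp" by (simp add: comp_def)
      then show "I1 \<noteq> {}" using kl(1) iff by (auto simp: edge_cells_def I1_def)
      show "I2 \<noteq> {}" using kl(2) l iff by (auto simp: edge_cells_def I2_def)
      show "I1 \<inter> I2 = {}" by (auto simp: I1_def I2_def)
      show "?m {} = 1" using av_one by simp
      fix S assume S: "S \<subseteq> I1 \<union> I2"
      then have finS': "finite S" using finite_subset unfolding I[symmetric] by blast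
      have "?m S = av (\<lambda>P. (\<Prod>i\<in>S \<inter> I1. edge_energy \<beta> (e i) P) * (\<Prod>i\<in>S \<inter> I2. edge_energy \<beta> (e i) P))"
      proof (rule avg_cong)
        fix P
        have "S = (S \<inter> I1) \<union> (S \<inter> I2)" using S by auto
        then have "(\<Prod>i\<in>S. edge_energy \<beta> (e i) P) = (\<Prod>i\<in>(S \<inter> I1) \<union> (S \<inter> I2). edge_energy \<beta> (e i) P)" by simp
        also have "\<dots> = (\<Prod>i\<in>S \<inter> I1. edge_energy \<beta> (e i) P) * (\<Prod>i\<in>S \<inter> I2. edge_energy \<beta> (e i) P)"
          by (rule prod.union_disjoint) (use finS' in \<open>auto simp: I1_def I2_def\<close>)
        finally show "(\<Prod>i\<in>S. edge_energy \<beta> (e i) P) = (\<Prod>i\<in>S \<inter> I1. edge_energy \<beta> (e i) P) * (\<Prod>i\<in>S \<inter> I2. edge_energy \<beta> (e i) P)" .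
      qed
      also have "\<dots> = ?m (S \<inter> I1) * ?m (S \<inter> I2)"
      proof (rule indep[of comp _ "- comp"])
        show "local_to cl comp (\<lambda>P. \<Prod>i\<in>S \<inter> I1. edge_energy \<beta> (e i) P)"
          unfolding edge_energy_def by (intro local_to_prod local_to_mult local_to_const local_W) (auto simp: I1_def eL iff)
        show "local_to cl (- comp) (\<lambda>P. \<Prod>i\<in>S \<inter> I2. edge_energy \<beta> (e i) P)"
          unfolding edge_energy_def by (intro local_to_prod local_to_mult local_to_const local_W) (auto simp: I2_def eL iff)
      qed auto
      finally show "?m S = ?m (S \<inter> I1) * ?m (S \<inter> I2)" .
    qed
    then show ?thesis unfolding edge_cumulant_def I .
  qed
qed

lemma sum_edge_energy: "(\<Sum>e\<in>\<Lambda>' \<times> \<Lambda>'. edge_energy \<beta> e P) = pair_energy (\<lambda>x y. \<beta> * fluct x y) \<Lambda> P"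
proof -
  have "(\<Sum>e\<in>\<Lambda>' \<times> \<Lambda>'. edge_energy \<beta> e P) = \<beta> / 2 * (\<Sum>k\<in>\<Lambda>'. \<Sum>l\<in>\<Lambda>'. W k l P)"
    by (simp add: edge_energy_def sum.cartesian_product' sum_distrib_left)
  also have "\<dots> = pair_energy (\<lambda>x y. \<beta> * fluct x y) \<Lambda> P"
    unfolding sum_W pair_energy_def by (simp add: sum_distrib_left sum_divide_distrib mult_ac)
  finally show ?thesis .
qed

definition kappa :: "real \<Rightarrow> (real ^ 'd \<Rightarrow> real) \<Rightarrow> nat \<Rightarrow> real" where
  "kappa \<beta> \<eta> p = cumulant (\<lambda>n. avg cl \<Lambda> (occ \<Lambda>' \<eta>) (\<lambda>P. pair_energy (\<lambda>x y. \<beta> * fluct x y) \<Lambda> P ^ n)) p"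

lemma kappa_eq: "kappa \<beta> \<eta> p = (\<Sum>e\<in>{..<p} \<rightarrow>\<^sub>E \<Lambda>' \<times> \<Lambda>'. edge_cumulant \<beta> p e (occ \<Lambda>' \<eta>))"
  unfolding kappa_def edge_cumulant_def sum_edge_energy[symmetric]
  by (rule cumulant_sum) (auto simp: finite_torus_lattice avg_sum)

lemma shift_edges:
  assumes a: "a \<in> \<Lambda>'"
  shows "bij_betw (\<lambda>e. restrict (\<lambda>i. map_prod (torus_shift a) (torus_shift a) (e i)) I) (I \<rightarrow>\<^sub>E \<Lambda>' \<times> \<Lambda>') (I \<rightarrow>\<^sub>E \<Lambda>' \<times> \<Lambda>')"
proof -
  let ?f = "map_prod (torus_shift a) (torus_shift a)"
  have f: "bij_betw ?f (\<Lambda>' \<times> \<Lambda>') (\<Lambda>' \<times> \<Lambda>')" by (intro bij_betw_map_prod shift_bij[OF m a])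
  let ?g = "inv_into (\<Lambda>' \<times> \<Lambda>') ?f"
  have g: "?g u \<in> \<Lambda>' \<times> \<Lambda>'" "?f (?g u) = u" if "u \<in> \<Lambda>' \<times> \<Lambda>'" for u
    using bij_betwE[OF bij_betw_inv_into[OF f]] bij_betw_inv_into_right[OF f] that by blast+
  have f': "?f u \<in> \<Lambda>' \<times> \<Lambda>'" "?g (?f u) = u" if "u \<in> \<Lambda>' \<times> \<Lambda>'" for u
    using bij_betwE[OF f] bij_betw_inv_into_left[OF f] that by blast+
  show ?thesis
  proof (rule bij_betw_byWitness[where f' = "\<lambda>e. restrict (\<lambda>i. ?g (e i)) I"])
    show "\<forall>e\<in>I \<rightarrow>\<^sub>E \<Lambda>' \<times> \<Lambda>'. restrict (\<lambda>i. ?g (restrict (\<lambda>i. ?f (e i)) I i)) I = e"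
    proof
      fix e assume e: "e \<in> I \<rightarrow>\<^sub>E \<Lambda>' \<times> \<Lambda>'"
      show "restrict (\<lambda>i. ?g (restrict (\<lambda>i. ?f (e i)) I i)) I = e"
      proof (rule ext)
        fix i show "restrict (\<lambda>i. ?g (restrict (\<lambda>i. ?f (e i)) I i)) I i = e i"
          using f'(2)[OF PiE_mem[OF e]] PiE_arb[OF e] by (cases "i \<in> I") auto
      qed
    qed
    show "\<forall>e\<in>I \<rightarrow>\<^sub>E \<Lambda>' \<times> \<Lambda>'. restrict (\<lambda>i. ?f (restrict (\<lambda>i. ?g (e i)) I i)) I = e"
    proof
      fix e assume e: "e \<in> I \<rightarrow>\<^sub>E \<Lambda>' \<times> \<Lambda>'"
      show "restrict (\<lambda>i. ?f (restrict (\<lambda>i. ?g (e i)) I i)) I = e"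
      proof (rule ext)
        fix i show "restrict (\<lambda>i. ?f (restrict (\<lambda>i. ?g (e i)) I i)) I i = e i"
          using g(2)[OF PiE_mem[OF e]] PiE_arb[OF e] by (cases "i \<in> I") auto
      qed
    qed
    show "(\<lambda>e. restrict (\<lambda>i. ?f (e i)) I) ` (I \<rightarrow>\<^sub>E \<Lambda>' \<times> \<Lambda>') \<subseteq> I \<rightarrow>\<^sub>E \<Lambda>' \<times> \<Lambda>'"
      using f'(1) PiE_mem by (intro image_subsetI) (auto simp: PiE_iff simp del: map_prod_simp)
    show "(\<lambda>e. restrict (\<lambda>i. ?g (e i)) I) ` (I \<rightarrow>\<^sub>E \<Lambda>' \<times> \<Lambda>') \<subseteq> I \<rightarrow>\<^sub>E \<Lambda>' \<times> \<Lambda>'"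
      using g(1) by (intro image_subsetI) (auto simp: PiE_iff)
  qed
qed

text \<open>The terms are indexed by \<open>p\<close>-tuples of ordered pairs of cells, a pair of
  equal cells included, and the support of a term consists of all cells of its tuple.\<close>

theorem cumulant_potential:
  fixes F :: "(real ^ 'd \<Rightarrow> real) \<Rightarrow> real"
  assumes F: "\<And>\<eta>. \<eta> \<in> coarse_configs m q \<Longrightarrow> F \<eta> = c * kappa \<beta> \<eta> p" and R: "R \<ge> 2 * real p * \<rho>"
  shows "\<exists>\<Phi>. (\<forall>\<eta>\<in>coarse_configs m q. F \<eta> = potential_sum m \<Phi> \<eta>) \<and> finite_range m q R \<Phi> \<and>
    (tr \<longrightarrow> translation_invariant m q \<Phi>)"
proof (rule potential_of_terms[where E = "{..<p} \<rightarrow>\<^sub>E \<Lambda>' \<times> \<Lambda>'" and X = "edge_cells p" and T = "\<lambda>e a. c * edge_cumulant \<beta> p e a"])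
  show "finite ({..<p} \<rightarrow>\<^sub>E \<Lambda>' \<times> \<Lambda>')" by (intro finite_PiE) (auto simp: finite_torus_lattice)
  fix e assume e: "e \<in> {..<p} \<rightarrow>\<^sub>E \<Lambda>' \<times> \<Lambda>'"
  have eL: "fst (e i) \<in> \<Lambda>'" "snd (e i) \<in> \<Lambda>'" if "i < p" for i
    using e that by (auto simp: PiE_iff mem_Times_iff)
  then show "edge_cells p e \<subseteq> \<Lambda>'" by (auto simp: edge_cells_def)
  fix \<eta> :: "real ^ 'd \<Rightarrow> real" assume \<eta>: "\<eta> \<in> coarse_configs m q"
  show "c * edge_cumulant \<beta> p e (on_cells (edge_cells p e) (occ \<Lambda>' \<eta>)) = c * edge_cumulant \<beta> p e (occ \<Lambda>' \<eta>)"
    unfolding edge_cumulant_def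
  proof (intro arg_cong[where f = "\<lambda>x. c * x"] joint_cumulant_cong avg_local'[OF \<eta>])
    fix S assume "S \<subseteq> {..<p}"
    then show "local_to cl (edge_cells p e) (\<lambda>P. \<Prod>i\<in>S. edge_energy \<beta> (e i) P)"
      unfolding edge_energy_def
      by (intro local_to_prod local_to_mult local_to_const local_W) (use eL in \<open>auto simp: edge_cells_def\<close>)
  qed
  fix k l assume "k \<in> edge_cells p e" "l \<in> edge_cells p e" "R < torus_norm (k - l)"
  then show "c * edge_cumulant \<beta> p e (occ \<Lambda>' \<eta>) = 0"
    using edge_cumulant_far[OF \<eta> e, of k l] R by simp
next
  fix \<eta> :: "real ^ 'd \<Rightarrow> real" assume "\<eta> \<in> coarse_configs m q"
  then show "F \<eta> = (\<Sum>e\<in>{..<p} \<rightarrow>\<^sub>E \<Lambda>' \<times> \<Lambda>'. c * edge_cumulant \<beta> p e (occ \<Lambda>' \<eta>))"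
    by (simp add: F kappa_eq sum_distrib_left)
next
  fix a assume a: "a \<in> \<Lambda>'"
  let ?t = "torus_shift a"
  let ?\<pi> = "\<lambda>e. restrict (\<lambda>i. map_prod ?t ?t (e i)) {..<p}"
  have X: "edge_cells p (?\<pi> e) = ?t ` edge_cells p e" for e
    unfolding edge_cells_def image_UN by (intro SUP_cong) auto
  have T: "c * edge_cumulant \<beta> p (?\<pi> e) b = c * edge_cumulant \<beta> p e b'"
    if e: "e \<in> {..<p} \<rightarrow>\<^sub>E \<Lambda>' \<times> \<Lambda>'" and b: "\<forall>k. k \<notin> \<Lambda>' \<longrightarrow> b k = 0 \<and> b' k = 0" "\<forall>k\<in>\<Lambda>'. b (?t k) = b' k" for e b b'
    unfolding edge_cumulant_def
  proof (intro arg_cong[where f = "\<lambda>x. c * x"] joint_cumulant_cong avg_shift[OF a b])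
    fix S and P :: "(real ^ 'd) set" assume S: "S \<subseteq> {..<p}" and P: "P \<subseteq> \<Lambda>"
    show "(\<Prod>i\<in>S. edge_energy \<beta> (?\<pi> e i) (?t ` P)) = (\<Prod>i\<in>S. edge_energy \<beta> (e i) P)"
    proof (rule prod.cong[OF refl])
      fix i assume "i \<in> S"
      then have i: "i < p" using S by auto
      then have "fst (e i) \<in> \<Lambda>'" "snd (e i) \<in> \<Lambda>'" using e by (auto simp: PiE_iff mem_Times_iff)
      then show "edge_energy \<beta> (?\<pi> e i) (?t ` P) = edge_energy \<beta> (e i) P"
        using i W_shift[OF a _ _ P] by (simp add: edge_energy_def)
    qed
  qed
  show "\<exists>\<pi>. bij_betw \<pi> ({..<p} \<rightarrow>\<^sub>E \<Lambda>' \<times> \<Lambda>') ({..<p} \<rightarrow>\<^sub>E \<Lambda>' \<times> \<Lambda>') \<and>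
     (\<forall>e\<in>{..<p} \<rightarrow>\<^sub>E \<Lambda>' \<times> \<Lambda>'. edge_cells p (\<pi> e) = ?t ` edge_cells p e \<and>
      (\<forall>b b'. (\<forall>k. k \<notin> \<Lambda>' \<longrightarrow> b k = 0 \<and> b' k = 0) \<longrightarrow> (\<forall>k\<in>\<Lambda>'. b (?t k) = b' k) \<longrightarrow>
        c * edge_cumulant \<beta> p (\<pi> e) b = c * edge_cumulant \<beta> p e b'))"
    by (intro exI[of _ ?\<pi>] conjI ballI allI impI shift_edges[OF a] X T) auto
qed

lemma avg_potential:
  fixes f :: "'e \<Rightarrow> (real ^ 'd) set \<Rightarrow> real" and F :: "(real ^ 'd \<Rightarrow> real) \<Rightarrow> real"
  assumes E: "finite E" and XE: "\<And>e. e \<in> E \<Longrightarrow> X e \<subseteq> \<Lambda>'"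
    and loc: "\<And>e. e \<in> E \<Longrightarrow> local_to cl (X e) (f e)"
    and far: "\<And>e k l P. e \<in> E \<Longrightarrow> k \<in> X e \<Longrightarrow> l \<in> X e \<Longrightarrow> torus_norm (k - l) > R \<Longrightarrow> f e P = 0"
    and F: "\<And>\<eta>. \<eta> \<in> coarse_configs m q \<Longrightarrow> F \<eta> = (\<Sum>e\<in>E. avg cl \<Lambda> (occ \<Lambda>' \<eta>) (f e))"
    and shift: "\<And>a. tr \<Longrightarrow> a \<in> \<Lambda>' \<Longrightarrow> \<exists>\<pi>. bij_betw \<pi> E E \<and> (\<forall>e\<in>E. X (\<pi> e) = torus_shift a ` X e \<and>
      (\<forall>P\<subseteq>\<Lambda>. f (\<pi> e) (torus_shift a ` P) = f e P))"
  shows "\<exists>\<Phi>. (\<forall>\<eta>\<in>coarse_configs m q. F \<eta> = potential_sum m \<Phi> \<eta>) \<and> finite_range m q R \<Phi> \<and>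
    (tr \<longrightarrow> translation_invariant m q \<Phi>)"
proof (rule potential_of_terms[where E = E and X = X and T = "\<lambda>e a. avg cl \<Lambda> a (f e)"])
  show "avg cl \<Lambda> (on_cells (X e) (occ \<Lambda>' \<eta>)) (f e) = avg cl \<Lambda> (occ \<Lambda>' \<eta>) (f e)"
    if "e \<in> E" "\<eta> \<in> coarse_configs m q" for e \<eta>
    by (rule avg_local'[OF that(2) loc[OF that(1)]])
  show "avg cl \<Lambda> (occ \<Lambda>' \<eta>) (f e) = 0" if "e \<in> E" "\<eta> \<in> coarse_configs m q" "k \<in> X e" "l \<in> X e" "R < torus_norm (k - l)"
    for e \<eta> k l
    using far[OF that(1,3,4,5)] by (simp add: avg_def)
  fix a assume tr and a: "a \<in> \<Lambda>'"
  from shift[OF this] obtain \<pi> where \<pi>0: "bij_betw \<pi> E E"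
    and \<pi>1: "\<forall>e\<in>E. X (\<pi> e) = torus_shift a ` X e \<and> (\<forall>P\<subseteq>\<Lambda>. f (\<pi> e) (torus_shift a ` P) = f e P)"
    by (elim exE conjE)
  have \<pi>: "bij_betw \<pi> E E" "\<And>e. e \<in> E \<Longrightarrow> X (\<pi> e) = torus_shift a ` X e"
    "\<And>e P. e \<in> E \<Longrightarrow> P \<subseteq> \<Lambda> \<Longrightarrow> f (\<pi> e) (torus_shift a ` P) = f e P"
    using \<pi>0 \<pi>1 by simp_all
  show "\<exists>\<pi>. bij_betw \<pi> E E \<and> (\<forall>e\<in>E. X (\<pi> e) = torus_shift a ` X e \<and>
      (\<forall>b b'. (\<forall>k. k \<notin> \<Lambda>' \<longrightarrow> b k = 0 \<and> b' k = 0) \<longrightarrow> (\<forall>k\<in>\<Lambda>'. b (torus_shift a k) = b' k) \<longrightarrow>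
        avg cl \<Lambda> b (f (\<pi> e)) = avg cl \<Lambda> b' (f e)))"
    by (intro exI[of _ \<pi>] conjI ballI allI impI \<pi>(1) \<pi>(2) avg_shift[OF a]) (use \<pi>(3) in auto)
qed (use E XE F in auto)

end

section \<open>Sums over cells ordered by a linear order\<close>

lemma sum_ordered_pairs:
  fixes G :: "'c \<Rightarrow> 'c \<Rightarrow> real"
  assumes fin: "finite \<Lambda>" and r: "strict_linear_order_on \<Lambda> r"
    and G: "\<And>k l. k \<in> \<Lambda> \<Longrightarrow> l \<in> \<Lambda> \<Longrightarrow> k \<noteq> l \<Longrightarrow> G k l = G l k"
  shows "(\<Sum>k\<in>\<Lambda>. \<Sum>l\<in>\<Lambda> - {k}. G k l) = 2 * (\<Sum>k\<in>\<Lambda>. \<Sum>l\<in>{l\<in>\<Lambda>. (k, l) \<in> r}. G k l)"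
proof -
  have tri: "trans r" "irrefl r" "total_on \<Lambda> r" using r by (auto simp: strict_linear_order_on_def)
  have irr: "(k, k) \<notin> r" for k using tri(2) by (simp add: irrefl_def)
  have asym: "\<not> ((k, l) \<in> r \<and> (l, k) \<in> r)" for k l using tri(1) irr by (meson transE)
  have o: "(\<Sum>l\<in>{l\<in>\<Lambda>. (k, l) \<in> r}. G k l) = (\<Sum>l\<in>\<Lambda>. if (k, l) \<in> r then G k l else 0)" for k
    using fin by (simp add: sum.inter_filter)
  have "(\<Sum>k\<in>\<Lambda>. \<Sum>l\<in>\<Lambda> - {k}. G k l) = (\<Sum>k\<in>\<Lambda>. \<Sum>l\<in>\<Lambda>. (if (k, l) \<in> r then G k l else 0) + (if (l, k) \<in> r then G l k else 0))"
  proof (rule sum.cong[OF refl])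
    fix k assume k: "k \<in> \<Lambda>"
    show "(\<Sum>l\<in>\<Lambda> - {k}. G k l) = (\<Sum>l\<in>\<Lambda>. (if (k, l) \<in> r then G k l else 0) + (if (l, k) \<in> r then G l k else 0))"
    proof (rule sum.mono_neutral_cong_left)
      fix l assume l: "l \<in> \<Lambda> - {k}"
      then have "(k, l) \<in> r \<or> (l, k) \<in> r" using tri(3) k by (auto simp: total_on_def)
      then show "G k l = (if (k, l) \<in> r then G k l else 0) + (if (l, k) \<in> r then G l k else 0)"
        using asym[of k l] G[of k l] k l by auto
    qed (use fin irr in auto)
  qed
  also have "\<dots> = (\<Sum>k\<in>\<Lambda>. \<Sum>l\<in>\<Lambda>. if (k, l) \<in> r then G k l else 0) + (\<Sum>k\<in>\<Lambda>. \<Sum>l\<in>\<Lambda>. if (l, k) \<in> r then G l k else 0)"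
    by (simp add: sum.distrib)
  also have "(\<Sum>k\<in>\<Lambda>. \<Sum>l\<in>\<Lambda>. if (l, k) \<in> r then G l k else 0) = (\<Sum>k\<in>\<Lambda>. \<Sum>l\<in>\<Lambda>. if (k, l) \<in> r then G k l else 0)"
    by (rule sum.swap)
  finally show ?thesis unfolding o by simp
qed

text \<open>Three distinct cells have six orderings. By the symmetry of \<open>T\<close> in its
  outer arguments these pair up into three choices of the middle cell, each occurring twice.\<close>

lemma sum_ordered_triples:
  fixes T :: "'c \<Rightarrow> 'c \<Rightarrow> 'c \<Rightarrow> real"
  assumes fin: "finite \<Lambda>" and r: "strict_linear_order_on \<Lambda> r" and T: "\<And>k m l. T k m l = T l m k"
  shows "(\<Sum>m\<in>\<Lambda>. \<Sum>k\<in>\<Lambda> - {m}. \<Sum>l\<in>\<Lambda> - {m, k}. T k m l)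
    = 2 * (\<Sum>x\<in>\<Lambda>. \<Sum>y\<in>{y\<in>\<Lambda>. (x, y) \<in> r}. \<Sum>z\<in>{z\<in>\<Lambda>. (y, z) \<in> r}. T x y z + T y z x + T z x y)"
proof -
  have tri: "trans r" "irrefl r" "total_on \<Lambda> r" using r by (auto simp: strict_linear_order_on_def)
  have irr: "(k, k) \<notin> r" for k using tri(2) by (simp add: irrefl_def)
  have tr: "(k, l) \<in> r \<Longrightarrow> (l, j) \<in> r \<Longrightarrow> (k, j) \<in> r" for k l j using tri(1) by (meson transE)
  define ord3 where "ord3 x y z = (if (x, y) \<in> r \<and> (y, z) \<in> r then 1 else 0 :: real)" for x y z
  have tot: "(k, l) \<in> r \<or> (l, k) \<in> r" if "k \<in> \<Lambda>" "l \<in> \<Lambda>" "k \<noteq> l" for k l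
    using tri(3) that by (auto simp: total_on_def)
  have six: "(if k \<noteq> m \<and> l \<noteq> m \<and> l \<noteq> k then 1 else 0) = ord3 k m l + ord3 l m k + ord3 m k l + ord3 l k m + ord3 k l m + ord3 m l k"
    if "k \<in> \<Lambda>" "m \<in> \<Lambda>" "l \<in> \<Lambda>" for k m l
    using tot[of k m] tot[of k l] tot[of m l] that irr tr unfolding ord3_def
    by (smt (verit))
  have dist: "(\<Sum>m\<in>\<Lambda>. \<Sum>k\<in>\<Lambda> - {m}. \<Sum>l\<in>\<Lambda> - {m, k}. T k m l)
    = (\<Sum>m\<in>\<Lambda>. \<Sum>k\<in>\<Lambda>. \<Sum>l\<in>\<Lambda>. (if k \<noteq> m \<and> l \<noteq> m \<and> l \<noteq> k then 1 else 0) * T k m l)"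
  proof (rule sum.cong[OF refl], rule sum.mono_neutral_cong_left)
    fix m k assume "k \<in> \<Lambda> - {m}"
    then show "(\<Sum>l\<in>\<Lambda> - {m, k}. T k m l) = (\<Sum>l\<in>\<Lambda>. (if k \<noteq> m \<and> l \<noteq> m \<and> l \<noteq> k then 1 else 0) * T k m l)"
      using fin by (intro sum.mono_neutral_cong_left) auto
  qed (use fin in auto)
  have ord: "(\<Sum>x\<in>\<Lambda>. \<Sum>y\<in>{y\<in>\<Lambda>. (x, y) \<in> r}. \<Sum>z\<in>{z\<in>\<Lambda>. (y, z) \<in> r}. U x y z) = (\<Sum>x\<in>\<Lambda>. \<Sum>y\<in>\<Lambda>. \<Sum>z\<in>\<Lambda>. ord3 x y z * U x y z)" for U
  proof (rule sum.cong[OF refl], rule sum.mono_neutral_cong_left)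
    fix x y assume "y \<in> {y\<in>\<Lambda>. (x, y) \<in> r}"
    then show "(\<Sum>z\<in>{z\<in>\<Lambda>. (y, z) \<in> r}. U x y z) = (\<Sum>z\<in>\<Lambda>. ord3 x y z * U x y z)"
      using fin by (intro sum.mono_neutral_cong_left) (auto simp: ord3_def)
  qed (use fin in \<open>auto simp: ord3_def\<close>)
  have s12: "(\<Sum>x\<in>\<Lambda>. \<Sum>y\<in>\<Lambda>. \<Sum>z\<in>\<Lambda>. U x y z) = (\<Sum>x\<in>\<Lambda>. \<Sum>y\<in>\<Lambda>. \<Sum>z\<in>\<Lambda>. U y x z)" for U :: "'c \<Rightarrow> 'c \<Rightarrow> 'c \<Rightarrow> real"
    by (rule sum.swap)
  have s23: "(\<Sum>x\<in>\<Lambda>. \<Sum>y\<in>\<Lambda>. \<Sum>z\<in>\<Lambda>. U x y z) = (\<Sum>x\<in>\<Lambda>. \<Sum>y\<in>\<Lambda>. \<Sum>z\<in>\<Lambda>. U x z y)" for U :: "'c \<Rightarrow> 'c \<Rightarrow> 'c \<Rightarrow> real"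
    by (rule sum.cong[OF refl], rule sum.swap)
  let ?S = "\<lambda>U. (\<Sum>x\<in>\<Lambda>. \<Sum>y\<in>\<Lambda>. \<Sum>z\<in>\<Lambda>. U x y z)"
  have "(\<Sum>m\<in>\<Lambda>. \<Sum>k\<in>\<Lambda>. \<Sum>l\<in>\<Lambda>. (if k \<noteq> m \<and> l \<noteq> m \<and> l \<noteq> k then 1 else 0) * T k m l)
    = (\<Sum>m\<in>\<Lambda>. \<Sum>k\<in>\<Lambda>. \<Sum>l\<in>\<Lambda>. (ord3 k m l + ord3 l m k + ord3 m k l + ord3 l k m + ord3 k l m + ord3 m l k) * T k m l)"
    by (intro sum.cong refl) (simp add: six)
  also have "\<dots> = ?S (\<lambda>m k l. ord3 k m l * T k m l) + ?S (\<lambda>m k l. ord3 l m k * T k m l) + ?S (\<lambda>m k l. ord3 m k l * T k m l)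
     + ?S (\<lambda>m k l. ord3 l k m * T k m l) + ?S (\<lambda>m k l. ord3 k l m * T k m l) + ?S (\<lambda>m k l. ord3 m l k * T k m l)"
    by (simp add: ring_distribs sum.distrib)
  also have "?S (\<lambda>m k l. ord3 k m l * T k m l) = ?S (\<lambda>x y z. ord3 x y z * T x y z)" by (rule s12)
  also have "?S (\<lambda>m k l. ord3 l m k * T k m l) = ?S (\<lambda>x y z. ord3 x y z * T x y z)"
    by (subst s23, subst s12) (simp add: T)
  also have "?S (\<lambda>m k l. ord3 m k l * T k m l) = ?S (\<lambda>x y z. ord3 x y z * T z x y)"
    by (simp add: T)
  also have "?S (\<lambda>m k l. ord3 l k m * T k m l) = ?S (\<lambda>x y z. ord3 x y z * T y z x)"
    by (subst s12, subst s23, subst s12) simp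
  also have "?S (\<lambda>m k l. ord3 k l m * T k m l) = ?S (\<lambda>x y z. ord3 x y z * T y z x)"
    by (subst s12, subst s23) (simp add: T)
  also have "?S (\<lambda>m k l. ord3 m l k * T k m l) = ?S (\<lambda>x y z. ord3 x y z * T z x y)"
    by (subst s23) simp
  finally show ?thesis unfolding dist ord by (simp add: ring_distribs sum.distrib)
qed

context kac_model
begin

lemma shift_pairs: "a \<in> \<Lambda>' \<Longrightarrow> bij_betw (map_prod (torus_shift a) (torus_shift a)) (\<Lambda>' \<times> \<Lambda>') (\<Lambda>' \<times> \<Lambda>')"
  by (intro bij_betw_map_prod shift_bij[OF m])

lemma shift_eq': "a \<in> \<Lambda>' \<Longrightarrow> k \<in> \<Lambda>' \<Longrightarrow> l \<in> \<Lambda>' \<Longrightarrow> torus_shift a k = torus_shift a l \<longleftrightarrow> k = l"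
  by (rule inj_on_eq_iff[OF shift_inj])

text \<open>The Hamiltonian as one sum over ordered pairs of cells. The field is attached to the
  diagonal pairs.\<close>

definition mean_term :: "(real ^ 'd \<Rightarrow> real) \<Rightarrow> (real ^ 'd) \<times> (real ^ 'd) \<Rightarrow> (real ^ 'd) set \<Rightarrow> real" where
  "mean_term h e P = - (1/2) * (\<Sum>x\<in>cell m q (fst e). \<Sum>y\<in>cell m q (snd e). (if x = y then 0 else J (x - y)) * (spin P x * spin P y))
     + (if fst e = snd e then \<Sum>x\<in>cell m q (fst e). h x * spin P x else 0)"

lemma torus_norm_commute: "torus_norm (k - l) = torus_norm (l - k)"
  using torus_norm_minus[of "k - l"] by simp

lemma torus_norm_0: "torus_norm (0 :: real ^ 'd) = 0"
  using torus_norm_le_norm[of "0 :: real ^ 'd"] torus_norm_ge_0[of "0 :: real ^ 'd"] by simp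

lemma mean_potential:
  assumes R: "R \<ge> \<rho>"
  shows "\<exists>\<Phi>. (\<forall>\<eta>\<in>coarse_configs m q. cond_expect m q (hamiltonian (m * q) J h) \<eta> = potential_sum m \<Phi> \<eta>)
    \<and> finite_range m q R \<Phi> \<and> ((\<forall>x\<in>\<Lambda>. \<forall>y\<in>\<Lambda>. h x = h y) \<longrightarrow> translation_invariant m q \<Phi>)"
proof (rule avg_potential[where E = "\<Lambda>' \<times> \<Lambda>'" and X = "\<lambda>e. {fst e, snd e}" and f = "mean_term h"])
  show "finite (\<Lambda>' \<times> \<Lambda>')" by (simp add: finite_torus_lattice)
  fix e :: "(real ^ 'd) \<times> (real ^ 'd)" assume e: "e \<in> \<Lambda>' \<times> \<Lambda>'"
  then have eL: "fst e \<in> \<Lambda>'" "snd e \<in> \<Lambda>'" by auto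
  then show "{fst e, snd e} \<subseteq> \<Lambda>'" by simp
  show "local_to cl {fst e, snd e} (mean_term h e)"
    unfolding mean_term_def[abs_def]
  proof (intro local_to_add local_to_mult[OF local_to_const] local_to_sum local_to_mult)
    show "local_to cl {fst e, snd e} (\<lambda>P. if fst e = snd e then \<Sum>x\<in>cell m q (fst e). h x * spin P x else 0)"
      by (cases "fst e = snd e")
        (simp_all only: if_True if_False, (intro local_to_sum local_to_mult[OF local_to_const] local_to_const local_spin_cell[OF eL(2)] | simp)+)
  qed (auto intro: local_spin_cell[OF eL(1)] local_spin_cell[OF eL(2)])
  fix k l P assume kl: "k \<in> {fst e, snd e}" "l \<in> {fst e, snd e}" "R < torus_norm (k - l)"
  have "k \<noteq> l" using kl(3) R \<rho>_nonneg torus_norm_0 by auto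
  then have "fst e \<noteq> snd e" and far: "torus_norm (fst e - snd e) > \<rho>"
    using kl R torus_norm_commute[of "fst e" "snd e"] by auto
  then show "mean_term h e P = 0"
    using far_cells(1)[OF eL far] by (simp add: mean_term_def sum.neutral)
next
  fix \<eta> :: "real ^ 'd \<Rightarrow> real" assume \<eta>: "\<eta> \<in> coarse_configs m q"
  have "hamiltonian (m * q) J h (conf P) = (\<Sum>e\<in>\<Lambda>' \<times> \<Lambda>'. mean_term h e P)" for P
  proof -
    have 1: "(\<Sum>x\<in>\<Lambda>. \<Sum>y\<in>\<Lambda> - {x}. J (x - y) * spin P x * spin P y)
       = (\<Sum>k\<in>\<Lambda>'. \<Sum>l\<in>\<Lambda>'. \<Sum>x\<in>cell m q k. \<Sum>y\<in>cell m q l. (if x = y then 0 else J (x - y)) * (spin P x * spin P y))"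
    proof -
      have "(\<Sum>x\<in>\<Lambda>. \<Sum>y\<in>\<Lambda> - {x}. J (x - y) * spin P x * spin P y)
        = (\<Sum>x\<in>\<Lambda>. \<Sum>y\<in>\<Lambda>. (if x = y then 0 else J (x - y)) * (spin P x * spin P y))"
        by (rule sum.cong[OF refl], rule sum.mono_neutral_cong_left) (auto simp: finite_torus_lattice)
      also have "\<dots> = (\<Sum>k\<in>\<Lambda>'. \<Sum>l\<in>\<Lambda>'. \<Sum>x\<in>cell m q k. \<Sum>y\<in>cell m q l. (if x = y then 0 else J (x - y)) * (spin P x * spin P y))"
        unfolding sum_cells by (subst (2) sum.swap) (rule refl)
      finally show ?thesis .
    qed
    have 2: "(\<Sum>x\<in>\<Lambda>. h x * spin P x) = (\<Sum>k\<in>\<Lambda>'. \<Sum>l\<in>\<Lambda>'. if k = l then \<Sum>x\<in>cell m q k. h x * spin P x else 0)"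
      unfolding sum_cells by (simp add: finite_torus_lattice)
    show ?thesis unfolding hamiltonian_conf 1 2
      by (simp add: mean_term_def sum.cartesian_product' sum.distrib sum_distrib_left cong: if_cong)
  qed
  then show "cond_expect m q (hamiltonian (m * q) J h) \<eta> = (\<Sum>e\<in>\<Lambda>' \<times> \<Lambda>'. avg cl \<Lambda> (occ \<Lambda>' \<eta>) (mean_term h e))"
    unfolding cond_expect_avg[OF \<eta>] by (simp only: avg_sum)
next
  fix a assume h: "\<forall>x\<in>\<Lambda>. \<forall>y\<in>\<Lambda>. h x = h y" and a: "a \<in> \<Lambda>'"
  let ?t = "torus_shift a"
  show "\<exists>\<pi>. bij_betw \<pi> (\<Lambda>' \<times> \<Lambda>') (\<Lambda>' \<times> \<Lambda>') \<and> (\<forall>e\<in>\<Lambda>' \<times> \<Lambda>'. {fst (\<pi> e), snd (\<pi> e)} = ?t ` {fst e, snd e} \<and>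
      (\<forall>P\<subseteq>\<Lambda>. mean_term h (\<pi> e) (?t ` P) = mean_term h e P))"
  proof (intro exI[of _ "map_prod ?t ?t"] conjI ballI allI impI shift_pairs[OF a])
    fix e assume e: "e \<in> \<Lambda>' \<times> \<Lambda>'"
    then have eL: "fst e \<in> \<Lambda>'" "snd e \<in> \<Lambda>'" by auto
    show "{fst (map_prod ?t ?t e), snd (map_prod ?t ?t e)} = ?t ` {fst e, snd e}" by simp
    fix P assume P: "P \<subseteq> \<Lambda>"
    have 1: "(\<Sum>x\<in>cell m q (?t (fst e)). \<Sum>y\<in>cell m q (?t (snd e)). (if x = y then 0 else J (x - y)) * (spin (?t ` P) x * spin (?t ` P) y))
      = (\<Sum>x\<in>cell m q (fst e). \<Sum>y\<in>cell m q (snd e). (if x = y then 0 else J (x - y)) * (spin P x * spin P y))"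
      unfolding sum_shift_cell[OF a eL(1)] sum_shift_cell[OF a eL(2)]
    proof (intro sum.cong refl)
      fix x y assume "x \<in> cell m q (fst e)" "y \<in> cell m q (snd e)"
      then have "x \<in> \<Lambda>" "y \<in> \<Lambda>" using cell_subset by auto
      then show "(if ?t x = ?t y then 0 else J (?t x - ?t y)) * (spin (?t ` P) (?t x) * spin (?t ` P) (?t y))
         = (if x = y then 0 else J (x - y)) * (spin P x * spin P y)"
        using spin_shift[OF a P] shift_eq_iff[OF a] J_shift[of a x y] by simp
    qed
    have 2: "(\<Sum>x\<in>cell m q (?t (fst e)). h x * spin (?t ` P) x) = (\<Sum>x\<in>cell m q (fst e). h x * spin P x)"
      unfolding sum_shift_cell[OF a eL(1)]
    proof (rule sum.cong[OF refl])
      fix x assume "x \<in> cell m q (fst e)"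
      then have x: "x \<in> \<Lambda>" using cell_subset by auto
      have "?t x \<in> \<Lambda>" using bij_betwE[OF shift_bij_\<Lambda>[OF a]] x by blast
      then have "h (?t x) = h x" using h x by blast
      then show "h (?t x) * spin (?t ` P) (?t x) = h x * spin P x" using spin_shift[OF a P x] by simp
    qed
    show "mean_term h (map_prod ?t ?t e) (?t ` P) = mean_term h e P"
      unfolding mean_term_def fst_map_prod snd_map_prod 1 2 shift_eq'[OF a eL] ..
  qed
qed

text \<open>The part of the second cumulant term that involves at most two cells. It equals
  \<open>- \<beta> / 8\<close> times the mean of the squared sum of all \<open>W k l\<close>; the
  multiplicities 1, 4 and 2 of \<open>sum_interacting_pairs\<close> turn \<open>\<beta> / 8\<close>
  into \<open>\<beta> / 8\<close>, \<open>\<beta> / 2\<close> and \<open>\<beta> / 4\<close>. For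
  three cells the multiplicity is 4, hence the \<open>\<beta> / 2\<close> in
  \<open>triple_term\<close>.\<close>

definition pair_term :: "real \<Rightarrow> (real ^ 'd) \<times> (real ^ 'd) \<Rightarrow> (real ^ 'd) set \<Rightarrow> real" where
  "pair_term \<beta> e P = (if fst e = snd e then - (\<beta> / 8) * (W (fst e) (fst e) P * W (fst e) (fst e) P)
     else - (\<beta> / 2) * (W (fst e) (fst e) P * W (fst e) (snd e) P) + - (\<beta> / 4) * (W (fst e) (snd e) P * W (fst e) (snd e) P))"

lemma pair_potential:
  assumes R: "R \<ge> \<rho>"
    and F: "\<And>\<eta>. \<eta> \<in> coarse_configs m q \<Longrightarrow> F \<eta> = (\<Sum>e\<in>\<Lambda>' \<times> \<Lambda>'. avg cl \<Lambda> (occ \<Lambda>' \<eta>) (pair_term \<beta> e))"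
  shows "\<exists>\<Phi>. (\<forall>\<eta>\<in>coarse_configs m q. F \<eta> = potential_sum m \<Phi> \<eta>) \<and> finite_range m q R \<Phi> \<and> (tr \<longrightarrow> translation_invariant m q \<Phi>)"
proof (rule avg_potential[where E = "\<Lambda>' \<times> \<Lambda>'" and X = "\<lambda>e. {fst e, snd e}" and f = "pair_term \<beta>"])
  show "finite (\<Lambda>' \<times> \<Lambda>')" by (simp add: finite_torus_lattice)
  fix e :: "(real ^ 'd) \<times> (real ^ 'd)" assume e: "e \<in> \<Lambda>' \<times> \<Lambda>'"
  then have eL: "fst e \<in> \<Lambda>'" "snd e \<in> \<Lambda>'" by auto
  then show "{fst e, snd e} \<subseteq> \<Lambda>'" by simp
  show "local_to cl {fst e, snd e} (pair_term \<beta> e)"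
  proof (cases "fst e = snd e")
    case True
    show ?thesis unfolding pair_term_def[abs_def] if_P[OF True]
      by (intro local_to_mult[OF local_to_const] local_to_mult local_W eL) auto
  next
    case False
    show ?thesis unfolding pair_term_def[abs_def] if_not_P[OF False]
      by (intro local_to_add local_to_mult[OF local_to_const] local_to_mult local_W eL) auto
  qed
  fix k l P assume kl: "k \<in> {fst e, snd e}" "l \<in> {fst e, snd e}" "R < torus_norm (k - l)"
  have "k \<noteq> l" using kl(3) R \<rho>_nonneg torus_norm_0 by auto
  then have "fst e \<noteq> snd e" and far: "torus_norm (fst e - snd e) > \<rho>"
    using kl R torus_norm_commute[of "fst e" "snd e"] by auto
  then show "pair_term \<beta> e P = 0" using W_far[OF eL far] by (simp add: pair_term_def)
next
  fix a assume a: "a \<in> \<Lambda>'"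
  let ?t = "torus_shift a"
  show "\<exists>\<pi>. bij_betw \<pi> (\<Lambda>' \<times> \<Lambda>') (\<Lambda>' \<times> \<Lambda>') \<and> (\<forall>e\<in>\<Lambda>' \<times> \<Lambda>'. {fst (\<pi> e), snd (\<pi> e)} = ?t ` {fst e, snd e} \<and>
      (\<forall>P\<subseteq>\<Lambda>. pair_term \<beta> (\<pi> e) (?t ` P) = pair_term \<beta> e P))"
  proof (intro exI[of _ "map_prod ?t ?t"] conjI ballI allI impI shift_pairs[OF a])
    fix e assume e: "e \<in> \<Lambda>' \<times> \<Lambda>'"
    then have eL: "fst e \<in> \<Lambda>'" "snd e \<in> \<Lambda>'" by auto
    show "{fst (map_prod ?t ?t e), snd (map_prod ?t ?t e)} = ?t ` {fst e, snd e}" by simp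
    fix P assume P: "P \<subseteq> \<Lambda>"
    show "pair_term \<beta> (map_prod ?t ?t e) (?t ` P) = pair_term \<beta> e P"
      using shift_eq'[OF a eL] W_shift[OF a eL P] W_shift[OF a eL(1) eL(1) P] W_shift[OF a eL(2) eL(2) P] by (simp add: pair_term_def)
  qed
qed (rule F)

definition triple_term :: "real \<Rightarrow> (real ^ 'd) \<times> (real ^ 'd) \<times> (real ^ 'd) \<Rightarrow> (real ^ 'd) set \<Rightarrow> real" where
  "triple_term \<beta> e P = (case e of (j, k, l) \<Rightarrow> if k \<noteq> j \<and> l \<noteq> j \<and> l \<noteq> k then - (\<beta> / 2) * (W k j P * W j l P) else 0)"

lemma triple_potential:
  assumes R: "R \<ge> 2 * \<rho>"
    and F: "\<And>\<eta>. \<eta> \<in> coarse_configs m q \<Longrightarrow> F \<eta> = (\<Sum>e\<in>\<Lambda>' \<times> \<Lambda>' \<times> \<Lambda>'. avg cl \<Lambda> (occ \<Lambda>' \<eta>) (triple_term \<beta> e))"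
  shows "\<exists>\<Phi>. (\<forall>\<eta>\<in>coarse_configs m q. F \<eta> = potential_sum m \<Phi> \<eta>) \<and> finite_range m q R \<Phi> \<and> (tr \<longrightarrow> translation_invariant m q \<Phi>)"
proof (rule avg_potential[where E = "\<Lambda>' \<times> \<Lambda>' \<times> \<Lambda>'" and X = "\<lambda>(j, k, l). {j, k, l}" and f = "triple_term \<beta>"])
  show "finite (\<Lambda>' \<times> \<Lambda>' \<times> \<Lambda>')" by (simp add: finite_torus_lattice)
  fix e :: "(real ^ 'd) \<times> (real ^ 'd) \<times> (real ^ 'd)" assume "e \<in> \<Lambda>' \<times> \<Lambda>' \<times> \<Lambda>'"
  then obtain j k l where e: "e = (j, k, l)" "j \<in> \<Lambda>'" "k \<in> \<Lambda>'" "l \<in> \<Lambda>'" by auto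
  then show "(case e of (j, k, l) \<Rightarrow> {j, k, l}) \<subseteq> \<Lambda>'" by simp
  show "local_to cl (case e of (j, k, l) \<Rightarrow> {j, k, l}) (triple_term \<beta> e)"
  proof (cases "k \<noteq> j \<and> l \<noteq> j \<and> l \<noteq> k")
    case True
    show ?thesis unfolding triple_term_def[abs_def] e(1) prod.case if_P[OF True]
      by (intro local_to_mult[OF local_to_const] local_to_mult local_W e) auto
  next
    case False
    show ?thesis unfolding triple_term_def[abs_def] e(1) prod.case if_not_P[OF False] by (rule local_to_const)
  qed
  fix x y P assume xy: "x \<in> (case e of (j, k, l) \<Rightarrow> {j, k, l})" "y \<in> (case e of (j, k, l) \<Rightarrow> {j, k, l})" "R < torus_norm (x - y)"
  have "torus_norm (k - j) > \<rho> \<or> torus_norm (j - l) > \<rho>"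
  proof (rule ccontr)
    assume "\<not> ?thesis"
    then have le: "torus_norm (k - j) \<le> \<rho>" "torus_norm (j - l) \<le> \<rho>" by auto
    have "torus_norm (k - l) \<le> 2 * \<rho>" using torus_norm_triangle[of "k - j" "j - l"] le by simp
    then have "torus_norm (x - y) \<le> 2 * \<rho>"
      using xy(1,2) e(1) le \<rho>_nonneg torus_norm_0 torus_norm_commute[of k j] torus_norm_commute[of j l] torus_norm_commute[of k l] by auto
    then show False using xy(3) R by simp
  qed
  then show "triple_term \<beta> e P = 0" using W_far[OF e(3,2)] W_far[OF e(2,4)] by (auto simp: triple_term_def e(1))
next
  fix a assume a: "a \<in> \<Lambda>'"
  let ?t = "torus_shift a"
  let ?\<pi> = "map_prod ?t (map_prod ?t ?t)"
  show "\<exists>\<pi>. bij_betw \<pi> (\<Lambda>' \<times> \<Lambda>' \<times> \<Lambda>') (\<Lambda>' \<times> \<Lambda>' \<times> \<Lambda>') \<and>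
     (\<forall>e\<in>\<Lambda>' \<times> \<Lambda>' \<times> \<Lambda>'. (case \<pi> e of (j, k, l) \<Rightarrow> {j, k, l}) = ?t ` (case e of (j, k, l) \<Rightarrow> {j, k, l}) \<and>
      (\<forall>P\<subseteq>\<Lambda>. triple_term \<beta> (\<pi> e) (?t ` P) = triple_term \<beta> e P))"
  proof (intro exI[of _ ?\<pi>] conjI ballI allI impI)
    show "bij_betw ?\<pi> (\<Lambda>' \<times> \<Lambda>' \<times> \<Lambda>') (\<Lambda>' \<times> \<Lambda>' \<times> \<Lambda>')"
      by (intro bij_betw_map_prod shift_bij[OF m a])
    fix e assume "e \<in> \<Lambda>' \<times> \<Lambda>' \<times> \<Lambda>'"
    then obtain j k l where e: "e = (j, k, l)" "j \<in> \<Lambda>'" "k \<in> \<Lambda>'" "l \<in> \<Lambda>'" by auto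
    show "(case ?\<pi> e of (j, k, l) \<Rightarrow> {j, k, l}) = ?t ` (case e of (j, k, l) \<Rightarrow> {j, k, l})" using e by simp
    fix P assume P: "P \<subseteq> \<Lambda>"
    show "triple_term \<beta> (?\<pi> e) (?t ` P) = triple_term \<beta> e P"
      using shift_eq'[OF a] W_shift[OF a e(3,2) P] W_shift[OF a e(2,4) P] e by (simp add: triple_term_def)
  qed
qed (rule F)

subsection \<open>The explicit corrections\<close>

lemma Defs_j1:
  assumes "k \<in> \<Lambda>'" "l \<in> \<Lambda>'"
  shows "Defs.j1 m q J k l = (\<Sum>x\<in>cell m q k. \<Sum>y\<in>cell m q l. (fluct x y)\<^sup>2)"
  unfolding j1_def
proof (rule sum.cong[OF refl])
  fix x assume x: "x \<in> cell m q k"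
  show "(\<Sum>y\<in>cell m q l - {x}. (J (x - y) - J_bar m q J k l)\<^sup>2) = (\<Sum>y\<in>cell m q l. (fluct x y)\<^sup>2)"
    by (rule sum.mono_neutral_cong_left) (use x fluct_cell[OF assms x] in \<open>auto simp: finite_cell fluct_diag\<close>)
qed

lemma Defs_j2:
  assumes "k \<in> \<Lambda>'" "l \<in> \<Lambda>'"
  shows "Defs.j2 m q J k l = (\<Sum>x\<in>cell m q k. \<Sum>y\<in>cell m q l. \<Sum>w\<in>cell m q l. fluct x y * fluct x w)"
  unfolding j2_def
proof (rule sum.cong[OF refl])
  fix x assume x: "x \<in> cell m q k"
  show "(\<Sum>y\<in>cell m q l - {x}. \<Sum>w\<in>cell m q l - {x}. (J (x - y) - J_bar m q J k l) * (J (x - w) - J_bar m q J k l))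
    = (\<Sum>y\<in>cell m q l. \<Sum>w\<in>cell m q l. fluct x y * fluct x w)"
  proof (rule sum.mono_neutral_cong_left)
    fix y assume y: "y \<in> cell m q l - {x}"
    show "(\<Sum>w\<in>cell m q l - {x}. (J (x - y) - J_bar m q J k l) * (J (x - w) - J_bar m q J k l)) = (\<Sum>w\<in>cell m q l. fluct x y * fluct x w)"
      by (rule sum.mono_neutral_cong_left) (use x y fluct_cell[OF assms x] in \<open>auto simp: finite_cell fluct_diag\<close>)
  qed (auto simp: finite_cell fluct_diag)
qed

lemma Defs_j2_chain:
  assumes "k \<in> \<Lambda>'" "j \<in> \<Lambda>'" "l \<in> \<Lambda>'"
  shows "Defs.j2_chain m q J k j l = (\<Sum>x\<in>cell m q k. \<Sum>y\<in>cell m q j. \<Sum>z\<in>cell m q l. fluct x y * fluct y z)"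
  unfolding j2_chain_def
proof (rule sum.cong[OF refl])
  fix x assume x: "x \<in> cell m q k"
  show "(\<Sum>y\<in>cell m q j - {x}. \<Sum>z\<in>cell m q l - {y}. (J (x - y) - J_bar m q J k j) * (J (y - z) - J_bar m q J j l))
    = (\<Sum>y\<in>cell m q j. \<Sum>z\<in>cell m q l. fluct x y * fluct y z)"
  proof (rule sum.mono_neutral_cong_left)
    fix y assume y: "y \<in> cell m q j - {x}"
    then have y': "y \<in> cell m q j" by simp
    show "(\<Sum>z\<in>cell m q l - {y}. (J (x - y) - J_bar m q J k j) * (J (y - z) - J_bar m q J j l)) = (\<Sum>z\<in>cell m q l. fluct x y * fluct y z)"
      by (rule sum.mono_neutral_cong_left)
        (use y fluct_cell[OF assms(1,2) x y'] fluct_cell[OF assms(2,3) y'] in \<open>auto simp: finite_cell fluct_diag\<close>)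
  qed (auto simp: finite_cell fluct_diag)
qed

lemma sum_reflect:
  assumes "k \<in> \<Lambda>'" "l \<in> \<Lambda>'"
  shows "(\<Sum>x\<in>cell m q l. f x) = (\<Sum>x\<in>cell m q k. f (reflect m q k l x) :: real)"
  by (rule sum.reindex_bij_betw[OF reflect_bij[OF m q assms], symmetric])

text \<open>The second moment yields \<open>j2 k l\<close> and \<open>j2 l k\<close> with different
  coefficients, while the formula for \<open>H1\<close> uses \<open>j2 k l\<close> alone. The point
  reflection exchanging the two cells identifies them.\<close>

lemma j2_sym:
  assumes "k \<in> \<Lambda>'" "l \<in> \<Lambda>'"
  shows "Defs.j2 m q J k l = Defs.j2 m q J l k"
proof -
  let ?r = "reflect m q k l"
  have a: "(\<Sum>x\<in>cell m q k. f x) = (\<Sum>x\<in>cell m q l. f (?r x))" for f :: "real ^ 'd \<Rightarrow> real"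
    by (rule sum_reflect[OF assms(2,1), unfolded reflect_commute[of m q l k]])
  have b: "(\<Sum>x\<in>cell m q l. f x) = (\<Sum>x\<in>cell m q k. f (?r x))" for f :: "real ^ 'd \<Rightarrow> real"
    by (rule sum_reflect[OF assms])
  have "(\<Sum>x\<in>cell m q k. \<Sum>y\<in>cell m q l. \<Sum>w\<in>cell m q l. fluct x y * fluct x w)
    = (\<Sum>x\<in>cell m q l. \<Sum>y\<in>cell m q l. \<Sum>w\<in>cell m q l. fluct (?r x) y * fluct (?r x) w)" by (rule a)
  also have "\<dots> = (\<Sum>x\<in>cell m q l. \<Sum>y\<in>cell m q k. \<Sum>w\<in>cell m q l. fluct (?r x) (?r y) * fluct (?r x) w)"
    by (rule sum.cong[OF refl], rule b)
  also have "\<dots> = (\<Sum>x\<in>cell m q l. \<Sum>y\<in>cell m q k. \<Sum>w\<in>cell m q k. fluct (reflect m q k l x) (reflect m q k l y) * fluct (reflect m q k l x) (reflect m q k l w))"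
    by (rule sum.cong[OF refl], rule sum.cong[OF refl], rule b)
  also have "\<dots> = (\<Sum>x\<in>cell m q l. \<Sum>y\<in>cell m q k. \<Sum>w\<in>cell m q k. fluct x y * fluct x w)"
  proof (intro sum.cong refl)
    fix x y w assume "x \<in> cell m q l" "y \<in> cell m q k" "w \<in> cell m q k"
    then show "fluct (reflect m q k l x) (reflect m q k l y) * fluct (reflect m q k l x) (reflect m q k l w) = fluct x y * fluct x w"
      using reflect_fluct[OF assms, of l k x y] reflect_fluct[OF assms, of l k x w] by simp
  qed
  finally show ?thesis unfolding Defs_j2[OF assms] Defs_j2[OF assms(2,1)] .
qed

text \<open>The same reflection, for chains with two sites in one cell. It allows the single
  coefficient \<open>j2_chain k k l\<close> in \<open>H1\<close> to multiply terms in which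
  \<open>k\<close> and \<open>l\<close> are exchanged.\<close>

lemma j2_chain_sym:
  assumes "k \<in> \<Lambda>'" "l \<in> \<Lambda>'"
  shows "Defs.j2_chain m q J k k l = Defs.j2_chain m q J l l k"
proof -
  let ?r = "reflect m q k l"
  have a: "(\<Sum>x\<in>cell m q k. f x) = (\<Sum>x\<in>cell m q l. f (?r x))" for f :: "real ^ 'd \<Rightarrow> real"
    by (rule sum_reflect[OF assms(2,1), unfolded reflect_commute[of m q l k]])
  have b: "(\<Sum>x\<in>cell m q l. f x) = (\<Sum>x\<in>cell m q k. f (?r x))" for f :: "real ^ 'd \<Rightarrow> real"
    by (rule sum_reflect[OF assms])
  have "(\<Sum>x\<in>cell m q k. \<Sum>y\<in>cell m q k. \<Sum>w\<in>cell m q l. fluct x y * fluct y w)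
    = (\<Sum>x\<in>cell m q l. \<Sum>y\<in>cell m q k. \<Sum>w\<in>cell m q l. fluct (?r x) y * fluct y w)" by (rule a)
  also have "\<dots> = (\<Sum>x\<in>cell m q l. \<Sum>y\<in>cell m q l. \<Sum>w\<in>cell m q l. fluct (?r x) (?r y) * fluct (?r y) w)"
    by (rule sum.cong[OF refl], rule a)
  also have "\<dots> = (\<Sum>x\<in>cell m q l. \<Sum>y\<in>cell m q l. \<Sum>w\<in>cell m q k. fluct (reflect m q k l x) (reflect m q k l y) * fluct (reflect m q k l y) (reflect m q k l w))"
    by (rule sum.cong[OF refl], rule sum.cong[OF refl], rule b)
  also have "\<dots> = (\<Sum>x\<in>cell m q l. \<Sum>y\<in>cell m q l. \<Sum>w\<in>cell m q k. fluct x y * fluct y w)"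
  proof (intro sum.cong refl)
    fix x y w assume "x \<in> cell m q l" "y \<in> cell m q l" "w \<in> cell m q k"
    then show "fluct (reflect m q k l x) (reflect m q k l y) * fluct (reflect m q k l y) (reflect m q k l w) = fluct x y * fluct y w"
      using reflect_fluct[OF assms, of l l x y] reflect_fluct[OF assms, of l k y w] by simp
  qed
  finally show ?thesis unfolding Defs_j2_chain[OF assms(1,1,2)] Defs_j2_chain[OF assms(2,2,1)] .
qed

end

text \<open>The logarithm of the density is the difference of the two energies plus the logarithm of
  the ratio of partition functions. Each is at most \<open>t\<close> in modulus, the second because
  the first holds uniformly.\<close>

lemma rel_entropy_gibbs_bound:
  fixes P0 \<mu> :: "'s pmf" and A b :: "'s \<Rightarrow> real"
  assumes fin: "finite (set_pmf P0)" and Zb: "Zb > 0"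
    and \<mu>: "\<And>s. pmf \<mu> s = exp (- b s) * pmf P0 s / Zb"
    and close: "\<And>s. s \<in> set_pmf P0 \<Longrightarrow> \<bar>b s - \<beta> * A s\<bar> \<le> t"
  shows "\<bar>rel_entropy (gibbs P0 \<beta> A) \<mu>\<bar> \<le> 2 * t"
proof -
  let ?S = "set_pmf P0" and ?\<pi> = "gibbs P0 \<beta> A"
  define ZA where "ZA = (\<Sum>s\<in>?S. exp (- \<beta> * A s) * pmf P0 s)"
  have "measure_pmf.expectation P0 (\<lambda>s. exp (- \<beta> * A s)) = ZA"
    unfolding ZA_def by (rule integral_measure_pmf_real) (use fin in auto)
  then have \<pi>: "pmf ?\<pi> s = exp (- \<beta> * A s) * pmf P0 s / ZA" for s
    using pmf_gibbs[OF fin, of \<beta> A s] by simp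
  have ZA: "ZA > 0"
    unfolding ZA_def using fin set_pmf_not_empty by (intro sum_pos) (auto simp: pmf_positive)
  have sub: "set_pmf \<mu> \<subseteq> ?S" "set_pmf ?\<pi> \<subseteq> ?S"
    using \<mu> \<pi> by (auto simp: set_pmf_iff)
  have "(\<Sum>s\<in>?S. pmf \<mu> s) = 1" using fin sub(1) by (rule sum_pmf_eq_1)
  then have Zb': "Zb = (\<Sum>s\<in>?S. exp (- b s) * pmf P0 s)"
    using Zb by (simp add: \<mu> sum_divide_distrib[symmetric])
  have "Zb \<le> exp t * ZA"
    unfolding Zb' ZA_def sum_distrib_left
  proof (rule sum_mono)
    fix s assume "s \<in> ?S"
    then have "- b s \<le> t + - \<beta> * A s" using close[of s] by simp
    then have "exp (- b s) \<le> exp t * exp (- \<beta> * A s)" by (simp add: exp_add[symmetric])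
    then show "exp (- b s) * pmf P0 s \<le> exp t * (exp (- \<beta> * A s) * pmf P0 s)"
      unfolding mult.assoc[symmetric] by (rule mult_right_mono) simp
  qed
  then have "Zb / ZA \<le> exp t" using ZA by (simp add: divide_le_eq)
  then have "ln (Zb / ZA) \<le> ln (exp t)" using ZA Zb by (subst ln_le_cancel_iff) auto
  then have up: "ln (Zb / ZA) \<le> t" by simp
  have "ZA \<le> exp t * Zb"
    unfolding Zb' ZA_def sum_distrib_left
  proof (rule sum_mono)
    fix s assume "s \<in> ?S"
    then have "- \<beta> * A s \<le> t + - b s" using close[of s] by simp
    then have "exp (- \<beta> * A s) \<le> exp t * exp (- b s)" by (simp add: exp_add[symmetric])
    then show "exp (- \<beta> * A s) * pmf P0 s \<le> exp t * (exp (- b s) * pmf P0 s)"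
      unfolding mult.assoc[symmetric] by (rule mult_right_mono) simp
  qed
  then have "ZA / Zb \<le> exp t" using Zb by (simp add: divide_le_eq)
  then have "ln (ZA / Zb) \<le> ln (exp t)" using ZA Zb by (subst ln_le_cancel_iff) auto
  then have "ln (ZA / Zb) \<le> t" by simp
  then have lo: "- t \<le> ln (Zb / ZA)" using ZA Zb by (simp add: ln_div)
  have summand: "\<bar>pmf ?\<pi> s * ln (pmf ?\<pi> s / pmf \<mu> s)\<bar> \<le> pmf ?\<pi> s * (2 * t)" if "s \<in> set_pmf ?\<pi>" for s
  proof -
    have s: "s \<in> ?S" using sub that by auto
    then have p: "pmf P0 s > 0" by (simp add: pmf_positive)
    have "pmf ?\<pi> s / pmf \<mu> s = exp (b s - \<beta> * A s) * (Zb / ZA)"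
      using p ZA Zb by (simp add: \<pi> \<mu> exp_diff exp_minus field_simps)
    moreover have "ln (exp (b s - \<beta> * A s) * (Zb / ZA)) = ln (exp (b s - \<beta> * A s)) + ln (Zb / ZA)"
      using ZA Zb by (intro ln_mult_pos) auto
    ultimately have "ln (pmf ?\<pi> s / pmf \<mu> s) = (b s - \<beta> * A s) + ln (Zb / ZA)"
      by (simp only: ln_exp)
    then have "\<bar>ln (pmf ?\<pi> s / pmf \<mu> s)\<bar> \<le> 2 * t" using close[OF s] up lo by linarith
    then show ?thesis by (simp add: abs_mult mult_left_mono)
  qed
  have "\<bar>rel_entropy ?\<pi> \<mu>\<bar> \<le> (\<Sum>s\<in>set_pmf ?\<pi>. pmf ?\<pi> s * (2 * t))"
    unfolding rel_entropy_def by (rule order_trans[OF sum_abs sum_mono]) (rule summand)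
  also have "\<dots> = 2 * t"
    using sum_pmf_eq_1[of "set_pmf ?\<pi>" ?\<pi>] finite_subset[OF sub(2) fin] by (simp add: sum_distrib_right[symmetric])
  finally show ?thesis .
qed

context kac_model
begin

lemma W_sym: "W k l P = W l k P"
  unfolding W_def by (subst sum.swap) (simp add: fluct_sym mult.commute)

lemma sum_offdiag_ordered_pair:
  "(\<Sum>e\<in>\<Lambda>' \<times> \<Lambda>'. f e) = (\<Sum>k\<in>\<Lambda>'. f (k, k) + (\<Sum>l\<in>\<Lambda>' - {k}. f (k, l)) :: real)"
proof -
  have "(\<Sum>e\<in>\<Lambda>' \<times> \<Lambda>'. f e) = (\<Sum>k\<in>\<Lambda>'. \<Sum>l\<in>\<Lambda>'. f (k, l))" by (simp add: sum.cartesian_product')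
  also have "\<dots> = (\<Sum>k\<in>\<Lambda>'. f (k, k) + (\<Sum>l\<in>\<Lambda>' - {k}. f (k, l)))"
    by (rule sum.cong[OF refl], rule sum.remove[OF finite_torus_lattice])
  finally show ?thesis .
qed

lemma sum_pair_term:
  "(\<Sum>e\<in>\<Lambda>' \<times> \<Lambda>'. avg cl \<Lambda> a (pair_term \<beta> e)) =
    - (\<beta> / 8) * (\<Sum>k\<in>\<Lambda>'. avg cl \<Lambda> a (\<lambda>P. W k k P * W k k P))
    - \<beta> / 2 * (\<Sum>k\<in>\<Lambda>'. \<Sum>l\<in>\<Lambda>' - {k}. avg cl \<Lambda> a (\<lambda>P. W k k P * W k l P))
    - \<beta> / 4 * (\<Sum>k\<in>\<Lambda>'. \<Sum>l\<in>\<Lambda>' - {k}. avg cl \<Lambda> a (\<lambda>P. W k l P * W k l P))"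
proof -
  have 1: "avg cl \<Lambda> a (pair_term \<beta> (k, k)) = - (\<beta> / 8) * avg cl \<Lambda> a (\<lambda>P. W k k P * W k k P)" for k
    unfolding pair_term_def[abs_def] fst_conv snd_conv if_P[OF refl] by (rule avg_scale)
  have 2: "avg cl \<Lambda> a (pair_term \<beta> (k, l)) = - (\<beta> / 2) * avg cl \<Lambda> a (\<lambda>P. W k k P * W k l P)
     + - (\<beta> / 4) * avg cl \<Lambda> a (\<lambda>P. W k l P * W k l P)" if "k \<noteq> l" for k l
    unfolding pair_term_def[abs_def] fst_conv snd_conv if_not_P[OF that] avg_add avg_scale ..
  have "(\<Sum>k\<in>\<Lambda>'. avg cl \<Lambda> a (pair_term \<beta> (k, k)) + (\<Sum>l\<in>\<Lambda>' - {k}. avg cl \<Lambda> a (pair_term \<beta> (k, l))))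
    = (\<Sum>k\<in>\<Lambda>'. - (\<beta> / 8) * avg cl \<Lambda> a (\<lambda>P. W k k P * W k k P)
       + (\<Sum>l\<in>\<Lambda>' - {k}. - (\<beta> / 2) * avg cl \<Lambda> a (\<lambda>P. W k k P * W k l P) + - (\<beta> / 4) * avg cl \<Lambda> a (\<lambda>P. W k l P * W k l P)))"
    by (intro sum.cong refl arg_cong2[where f = "(+)"] 1 2) auto
  then show ?thesis unfolding sum_offdiag_ordered_pair
    by (simp add: sum.distrib sum_negf sum_subtractf sum_distrib_left sum_divide_distrib)
qed

lemma sum_triple_term:
  "(\<Sum>e\<in>\<Lambda>' \<times> \<Lambda>' \<times> \<Lambda>'. avg cl \<Lambda> a (triple_term \<beta> e)) =
    - (\<beta> / 2) * (\<Sum>j\<in>\<Lambda>'. \<Sum>k\<in>\<Lambda>' - {j}. \<Sum>l\<in>\<Lambda>' - {j, k}. avg cl \<Lambda> a (\<lambda>P. W k j P * W j l P))"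
proof -
  let ?T = "\<lambda>k j l. avg cl \<Lambda> a (\<lambda>P. W k j P * W j l P)"
  have 1: "avg cl \<Lambda> a (triple_term \<beta> (j, k, l)) = - (\<beta> / 2) * ?T k j l" if "k \<noteq> j \<and> l \<noteq> j \<and> l \<noteq> k" for j k l
    unfolding triple_term_def[abs_def] prod.case if_P[OF that] by (rule avg_scale)
  have 2: "avg cl \<Lambda> a (triple_term \<beta> (j, k, l)) = 0" if "\<not> (k \<noteq> j \<and> l \<noteq> j \<and> l \<noteq> k)" for j k l
    unfolding triple_term_def[abs_def] prod.case if_not_P[OF that] by (simp add: avg_def)
  have "(\<Sum>e\<in>\<Lambda>' \<times> \<Lambda>' \<times> \<Lambda>'. avg cl \<Lambda> a (triple_term \<beta> e)) = (\<Sum>j\<in>\<Lambda>'. \<Sum>k\<in>\<Lambda>'. \<Sum>l\<in>\<Lambda>'. avg cl \<Lambda> a (triple_term \<beta> (j, k, l)))"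
    by (simp add: sum.cartesian_product')
  also have "\<dots> = (\<Sum>j\<in>\<Lambda>'. \<Sum>k\<in>\<Lambda>' - {j}. \<Sum>l\<in>\<Lambda>' - {j, k}. - (\<beta> / 2) * ?T k j l)"
  proof (rule sum.cong[OF refl], rule sum.mono_neutral_cong_right)
    fix j k assume k: "k \<in> \<Lambda>' - {j}"
    show "(\<Sum>l\<in>\<Lambda>'. avg cl \<Lambda> a (triple_term \<beta> (j, k, l))) = (\<Sum>l\<in>\<Lambda>' - {j, k}. - (\<beta> / 2) * ?T k j l)"
      by (rule sum.mono_neutral_cong_right) (use k 1 2 in \<open>auto simp: finite_torus_lattice\<close>)
  qed (use 2 in \<open>auto simp: finite_torus_lattice\<close>)
  finally show ?thesis by (simp only: sum_distrib_left)
qed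

lemma H1_eq:
  assumes \<eta>: "\<eta> \<in> coarse_configs m q" and r: "strict_linear_order_on \<Lambda>' r"
  shows "H1 m q r J \<beta> \<eta> = (\<Sum>e\<in>\<Lambda>' \<times> \<Lambda>'. avg cl \<Lambda> (occ \<Lambda>' \<eta>) (pair_term \<beta> e))"
proof -
  interpret pair_block_ensemble \<Lambda> \<Lambda>' cl Q "occ \<Lambda>' \<eta>" fluct by (rule ensemble[OF \<eta>])
  have Cc: "C k = cell m q k" if "k \<in> \<Lambda>'" for k by (simp add: C_def cell_eq[OF m q that])
  have irr: "(k, k) \<notin> r" for k using r by (simp add: strict_linear_order_on_def irrefl_def)
  have J1: "Defs.j1 m q J k l = j1 k l" if "k \<in> \<Lambda>'" "l \<in> \<Lambda>'" for k l
    unfolding Defs_j1[OF that] local.j1_def Cc[OF that(1)] Cc[OF that(2)] ..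
  have J2: "Defs.j2 m q J k l = j2 k l" if "k \<in> \<Lambda>'" "l \<in> \<Lambda>'" for k l
    unfolding Defs_j2[OF that] local.j2_def Cc[OF that(1)] Cc[OF that(2)] ..
  have J3: "Defs.j2_chain m q J k j l = j2_chain k j l" if "k \<in> \<Lambda>'" "j \<in> \<Lambda>'" "l \<in> \<Lambda>'" for k j l
    unfolding Defs_j2_chain[OF that] local.j2_chain_def Cc[OF that(1)] Cc[OF that(2)] Cc[OF that(3)] ..
  have VW: "local.V k l = W k l" if "k \<in> \<Lambda>'" "l \<in> \<Lambda>'" for k l by (rule V_W[OF \<eta> that])
  have ee: "E1 (real Q) ((\<eta> k + real Q) / 2) = e1 k" "E2 (real Q) ((\<eta> k + real Q) / 2) = e2 k"
    "E3 (real Q) ((\<eta> k + real Q) / 2) = e3 k" "E4 (real Q) ((\<eta> k + real Q) / 2) = e4 k" if "k \<in> \<Lambda>'" for k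
    by (simp_all only: e1_def e2_def e3_def e4_def occ_coarse(1)[OF \<eta> that])
  have R1: "(\<Sum>k\<in>\<Lambda>'. 4 * Defs.j2 m q J k k * (- E4 (real Q) ((\<eta> k + real Q) / 2) + E2 (real Q) ((\<eta> k + real Q) / 2))
      + 2 * Defs.j1 m q J k k * (E4 (real Q) ((\<eta> k + real Q) / 2) + 1 - 2 * E2 (real Q) ((\<eta> k + real Q) / 2)))
     = (\<Sum>k\<in>\<Lambda>'. av (\<lambda>P. W k k P * W k k P))"
  proof (rule sum.cong[OF refl])
    fix k assume k: "k \<in> \<Lambda>'"
    show "4 * Defs.j2 m q J k k * (- E4 (real Q) ((\<eta> k + real Q) / 2) + E2 (real Q) ((\<eta> k + real Q) / 2))
      + 2 * Defs.j1 m q J k k * (E4 (real Q) ((\<eta> k + real Q) / 2) + 1 - 2 * E2 (real Q) ((\<eta> k + real Q) / 2)) = av (\<lambda>P. W k k P * W k k P)"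
      using av_diag_square[OF k] unfolding VW[OF k k] J1[OF k k] J2[OF k k] ee[OF k] by (simp add: algebra_simps)
  qed
  have G: "av (\<lambda>P. W k l P * W k l P) = Defs.j1 m q J k l * (e2 k * e2 l - e2 l - e2 k + 1) + Defs.j2 m q J k l * (- 2 * e2 k * e2 l + e2 k + e2 l)"
    if kl: "k \<in> \<Lambda>'" "l \<in> \<Lambda>'" "k \<noteq> l" for k l
    using av_edge_square[OF kl] j2_sym[OF kl(1,2)] J2[OF kl(1,2)] J2[OF kl(2,1)]
    unfolding VW[OF kl(1,2)] J1[OF kl(1,2)] by (simp add: algebra_simps)
  have R2: "(\<Sum>k\<in>\<Lambda>'. \<Sum>l\<in>{l\<in>\<Lambda>'. (k, l) \<in> r}.
      Defs.j1 m q J k l * (E2 (real Q) ((\<eta> k + real Q) / 2) * E2 (real Q) ((\<eta> l + real Q) / 2) - E2 (real Q) ((\<eta> l + real Q) / 2) - E2 (real Q) ((\<eta> k + real Q) / 2) + 1)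
       + Defs.j2 m q J k l * (- 2 * E2 (real Q) ((\<eta> k + real Q) / 2) * E2 (real Q) ((\<eta> l + real Q) / 2) + E2 (real Q) ((\<eta> k + real Q) / 2) + E2 (real Q) ((\<eta> l + real Q) / 2)))
     = (\<Sum>k\<in>\<Lambda>'. \<Sum>l\<in>\<Lambda>' - {k}. av (\<lambda>P. W k l P * W k l P)) / 2"
  proof -
    have "(\<Sum>k\<in>\<Lambda>'. \<Sum>l\<in>\<Lambda>' - {k}. av (\<lambda>P. W k l P * W k l P)) = 2 * (\<Sum>k\<in>\<Lambda>'. \<Sum>l\<in>{l\<in>\<Lambda>'. (k, l) \<in> r}. av (\<lambda>P. W k l P * W k l P))"
      by (rule sum_ordered_pairs[OF finite_torus_lattice r]) (simp add: W_sym)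
    moreover have "(\<Sum>k\<in>\<Lambda>'. \<Sum>l\<in>{l\<in>\<Lambda>'. (k, l) \<in> r}.
      Defs.j1 m q J k l * (E2 (real Q) ((\<eta> k + real Q) / 2) * E2 (real Q) ((\<eta> l + real Q) / 2) - E2 (real Q) ((\<eta> l + real Q) / 2) - E2 (real Q) ((\<eta> k + real Q) / 2) + 1)
       + Defs.j2 m q J k l * (- 2 * E2 (real Q) ((\<eta> k + real Q) / 2) * E2 (real Q) ((\<eta> l + real Q) / 2) + E2 (real Q) ((\<eta> k + real Q) / 2) + E2 (real Q) ((\<eta> l + real Q) / 2)))
      = (\<Sum>k\<in>\<Lambda>'. \<Sum>l\<in>{l\<in>\<Lambda>'. (k, l) \<in> r}. av (\<lambda>P. W k l P * W k l P))"
    proof (rule sum.cong[OF refl], rule sum.cong[OF refl])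
      fix k l assume k: "k \<in> \<Lambda>'" and "l \<in> {l\<in>\<Lambda>'. (k, l) \<in> r}"
      then have l: "l \<in> \<Lambda>'" "k \<noteq> l" using irr by auto
      show "Defs.j1 m q J k l * (E2 (real Q) ((\<eta> k + real Q) / 2) * E2 (real Q) ((\<eta> l + real Q) / 2) - E2 (real Q) ((\<eta> l + real Q) / 2) - E2 (real Q) ((\<eta> k + real Q) / 2) + 1)
       + Defs.j2 m q J k l * (- 2 * E2 (real Q) ((\<eta> k + real Q) / 2) * E2 (real Q) ((\<eta> l + real Q) / 2) + E2 (real Q) ((\<eta> k + real Q) / 2) + E2 (real Q) ((\<eta> l + real Q) / 2))
        = av (\<lambda>P. W k l P * W k l P)"
        unfolding ee[OF k] ee[OF l(1)] G[OF k l] ..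
    qed
    ultimately show ?thesis by simp
  qed
  have R3: "(\<Sum>k\<in>\<Lambda>'. \<Sum>l\<in>\<Lambda>' - {k}. Defs.j2_chain m q J k k l *
      (- E3 (real Q) ((\<eta> k + real Q) / 2) * E1 (real Q) ((\<eta> l + real Q) / 2) + 2 * E1 (real Q) ((\<eta> k + real Q) / 2) * E1 (real Q) ((\<eta> l + real Q) / 2)
        - E3 (real Q) ((\<eta> l + real Q) / 2) * E1 (real Q) ((\<eta> k + real Q) / 2)))
     = (\<Sum>k\<in>\<Lambda>'. \<Sum>l\<in>\<Lambda>' - {k}. av (\<lambda>P. W k k P * W k l P))"
  proof -
    \<comment> \<open>The bracket in \<open>H1\<close> is symmetric in \<open>k\<close> and
      \<open>l\<close>. By \<open>j2_chain_sym\<close> it splits into \<open>K k l + K l k\<close>,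
      and the two halves have equal sums over ordered pairs.\<close>
    define K where "K k l = (e1 k - e3 k) * e1 l * Defs.j2_chain m q J k k l" for k l
    have "(\<Sum>k\<in>\<Lambda>'. \<Sum>l\<in>\<Lambda>' - {k}. Defs.j2_chain m q J k k l *
      (- E3 (real Q) ((\<eta> k + real Q) / 2) * E1 (real Q) ((\<eta> l + real Q) / 2) + 2 * E1 (real Q) ((\<eta> k + real Q) / 2) * E1 (real Q) ((\<eta> l + real Q) / 2)
        - E3 (real Q) ((\<eta> l + real Q) / 2) * E1 (real Q) ((\<eta> k + real Q) / 2)))
      = (\<Sum>k\<in>\<Lambda>'. \<Sum>l\<in>\<Lambda>' - {k}. K k l + K l k)"
    proof (rule sum.cong[OF refl], rule sum.cong[OF refl])
      fix k l assume k: "k \<in> \<Lambda>'" and "l \<in> \<Lambda>' - {k}"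
      then have l: "l \<in> \<Lambda>'" by simp
      show "Defs.j2_chain m q J k k l *
      (- E3 (real Q) ((\<eta> k + real Q) / 2) * E1 (real Q) ((\<eta> l + real Q) / 2) + 2 * E1 (real Q) ((\<eta> k + real Q) / 2) * E1 (real Q) ((\<eta> l + real Q) / 2)
        - E3 (real Q) ((\<eta> l + real Q) / 2) * E1 (real Q) ((\<eta> k + real Q) / 2)) = K k l + K l k"
        unfolding K_def ee[OF k] ee[OF l] j2_chain_sym[OF l k] by (simp add: algebra_simps)
    qed
    also have "\<dots> = (\<Sum>k\<in>\<Lambda>'. \<Sum>l\<in>\<Lambda>' - {k}. K k l) + (\<Sum>k\<in>\<Lambda>'. \<Sum>l\<in>\<Lambda>' - {k}. K l k)" by (simp add: sum.distrib)
    also have "(\<Sum>k\<in>\<Lambda>'. \<Sum>l\<in>\<Lambda>' - {k}. K l k) = (\<Sum>k\<in>\<Lambda>'. \<Sum>l\<in>\<Lambda>' - {k}. K k l)"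
      by (rule sum_offdiag_swap[OF finite_torus_lattice])
    also have "(\<Sum>k\<in>\<Lambda>'. \<Sum>l\<in>\<Lambda>' - {k}. K k l) + (\<Sum>k\<in>\<Lambda>'. \<Sum>l\<in>\<Lambda>' - {k}. K k l) = (\<Sum>k\<in>\<Lambda>'. \<Sum>l\<in>\<Lambda>' - {k}. 2 * K k l)"
      by (simp add: sum_distrib_left[symmetric])
    also have "\<dots> = (\<Sum>k\<in>\<Lambda>'. \<Sum>l\<in>\<Lambda>' - {k}. av (\<lambda>P. W k k P * W k l P))"
    proof (rule sum.cong[OF refl], rule sum.cong[OF refl])
      fix k l assume k: "k \<in> \<Lambda>'" and "l \<in> \<Lambda>' - {k}"
      then have l: "l \<in> \<Lambda>'" "k \<noteq> l" by auto
      show "2 * K k l = av (\<lambda>P. W k k P * W k l P)"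
        using av_diag_edge[OF k l] unfolding VW[OF k k] VW[OF k l(1)] K_def J3[OF k k l(1)] by simp
    qed
    finally show ?thesis .
  qed
  show ?thesis
    unfolding H1_def Let_def Q_def[symmetric] R1 R2 R3 sum_pair_term by simp
qed

lemma H2_eq:
  assumes \<eta>: "\<eta> \<in> coarse_configs m q" and r: "strict_linear_order_on \<Lambda>' r"
  shows "H2 m q r J \<beta> \<eta> = (\<Sum>e\<in>\<Lambda>' \<times> \<Lambda>' \<times> \<Lambda>'. avg cl \<Lambda> (occ \<Lambda>' \<eta>) (triple_term \<beta> e))"
proof -
  interpret pair_block_ensemble \<Lambda> \<Lambda>' cl Q "occ \<Lambda>' \<eta>" fluct by (rule ensemble[OF \<eta>])
  have Cc: "C k = cell m q k" if "k \<in> \<Lambda>'" for k by (simp add: C_def cell_eq[OF m q that])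
  have irr: "(k, k) \<notin> r" for k using r by (simp add: strict_linear_order_on_def irrefl_def)
  have tr: "(k, l) \<in> r \<Longrightarrow> (l, j) \<in> r \<Longrightarrow> (k, j) \<in> r" for k l j
    using r unfolding strict_linear_order_on_def by (meson transE)
  have J3: "Defs.j2_chain m q J k j l = j2_chain k j l" if "k \<in> \<Lambda>'" "j \<in> \<Lambda>'" "l \<in> \<Lambda>'" for k j l
    unfolding Defs_j2_chain[OF that] local.j2_chain_def Cc[OF that(1)] Cc[OF that(2)] Cc[OF that(3)] ..
  have VW: "local.V k l = W k l" if "k \<in> \<Lambda>'" "l \<in> \<Lambda>'" for k l by (rule V_W[OF \<eta> that])
  have ee: "E1 (real Q) ((\<eta> k + real Q) / 2) = e1 k" "E2 (real Q) ((\<eta> k + real Q) / 2) = e2 k" if "k \<in> \<Lambda>'" for k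
    by (simp_all only: e1_def e2_def occ_coarse(1)[OF \<eta> that])
  define T where "T k j l = av (\<lambda>P. W k j P * W j l P)" for k j l
  have Tsym: "T k j l = T l j k" for k j l by (simp add: T_def W_sym[of k j] W_sym[of j l] mult.commute)
  have T: "Defs.j2_chain m q J k j l * (- E1 (real Q) ((\<eta> k + real Q) / 2) * E2 (real Q) ((\<eta> j + real Q) / 2) * E1 (real Q) ((\<eta> l + real Q) / 2)
      + E1 (real Q) ((\<eta> k + real Q) / 2) * E1 (real Q) ((\<eta> l + real Q) / 2)) = T k j l"
    if "k \<in> \<Lambda>'" "j \<in> \<Lambda>'" "l \<in> \<Lambda>'" "k \<noteq> j" "l \<noteq> j" "k \<noteq> l" for k j l
    using av_chain[OF that] unfolding VW[OF that(1,2)] VW[OF that(2,3)] T_def J3[OF that(1-3)] ee[OF that(1)] ee[OF that(2)] ee[OF that(3)]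
    by (simp add: algebra_simps)
  have "(\<Sum>k1\<in>\<Lambda>'. \<Sum>k2\<in>{k\<in>\<Lambda>'. (k1, k) \<in> r}. \<Sum>k3\<in>{k\<in>\<Lambda>'. (k2, k) \<in> r}.
     Defs.j2_chain m q J k1 k2 k3 * (- E1 (real Q) ((\<eta> k1 + real Q) / 2) * E2 (real Q) ((\<eta> k2 + real Q) / 2) * E1 (real Q) ((\<eta> k3 + real Q) / 2) + E1 (real Q) ((\<eta> k1 + real Q) / 2) * E1 (real Q) ((\<eta> k3 + real Q) / 2))
     + Defs.j2_chain m q J k2 k3 k1 * (- E1 (real Q) ((\<eta> k2 + real Q) / 2) * E2 (real Q) ((\<eta> k3 + real Q) / 2) * E1 (real Q) ((\<eta> k1 + real Q) / 2) + E1 (real Q) ((\<eta> k2 + real Q) / 2) * E1 (real Q) ((\<eta> k1 + real Q) / 2))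
     + Defs.j2_chain m q J k3 k1 k2 * (- E1 (real Q) ((\<eta> k3 + real Q) / 2) * E2 (real Q) ((\<eta> k1 + real Q) / 2) * E1 (real Q) ((\<eta> k2 + real Q) / 2) + E1 (real Q) ((\<eta> k3 + real Q) / 2) * E1 (real Q) ((\<eta> k2 + real Q) / 2)))
     = (\<Sum>x\<in>\<Lambda>'. \<Sum>y\<in>{k\<in>\<Lambda>'. (x, k) \<in> r}. \<Sum>z\<in>{k\<in>\<Lambda>'. (y, k) \<in> r}. T x y z + T y z x + T z x y)"
  proof (rule sum.cong[OF refl], rule sum.cong[OF refl], rule sum.cong[OF refl])
    fix x y z assume x: "x \<in> \<Lambda>'" and "y \<in> {k\<in>\<Lambda>'. (x, k) \<in> r}" "z \<in> {k\<in>\<Lambda>'. (y, k) \<in> r}"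
    then have yz: "y \<in> \<Lambda>'" "z \<in> \<Lambda>'" "(x, y) \<in> r" "(y, z) \<in> r" by auto
    have ne: "x \<noteq> y" "y \<noteq> z" "x \<noteq> z" using yz irr tr by blast+
    show "Defs.j2_chain m q J x y z * (- E1 (real Q) ((\<eta> x + real Q) / 2) * E2 (real Q) ((\<eta> y + real Q) / 2) * E1 (real Q) ((\<eta> z + real Q) / 2) + E1 (real Q) ((\<eta> x + real Q) / 2) * E1 (real Q) ((\<eta> z + real Q) / 2))
     + Defs.j2_chain m q J y z x * (- E1 (real Q) ((\<eta> y + real Q) / 2) * E2 (real Q) ((\<eta> z + real Q) / 2) * E1 (real Q) ((\<eta> x + real Q) / 2) + E1 (real Q) ((\<eta> y + real Q) / 2) * E1 (real Q) ((\<eta> x + real Q) / 2))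
     + Defs.j2_chain m q J z x y * (- E1 (real Q) ((\<eta> z + real Q) / 2) * E2 (real Q) ((\<eta> x + real Q) / 2) * E1 (real Q) ((\<eta> y + real Q) / 2) + E1 (real Q) ((\<eta> z + real Q) / 2) * E1 (real Q) ((\<eta> y + real Q) / 2))
      = T x y z + T y z x + T z x y"
      by (intro arg_cong2[where f = "(+)"] T x yz ne ne[symmetric])
  qed
  moreover have "(\<Sum>j\<in>\<Lambda>'. \<Sum>k\<in>\<Lambda>' - {j}. \<Sum>l\<in>\<Lambda>' - {j, k}. T k j l)
    = 2 * (\<Sum>x\<in>\<Lambda>'. \<Sum>y\<in>{k\<in>\<Lambda>'. (x, k) \<in> r}. \<Sum>z\<in>{k\<in>\<Lambda>'. (y, k) \<in> r}. T x y z + T y z x + T z x y)"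
    by (rule sum_ordered_triples[OF finite_torus_lattice r Tsym])
  ultimately show ?thesis
    unfolding H2_def Let_def Q_def[symmetric] sum_triple_term T_def[symmetric] by simp
qed

lemma avg_abs_le:
  assumes "\<And>P. P \<in> slice cl \<Lambda> a \<Longrightarrow> \<bar>f P\<bar> \<le> 1"
  shows "\<bar>avg cl \<Lambda> a f\<bar> \<le> 1"
proof -
  have "\<bar>sum f (slice cl \<Lambda> a)\<bar> \<le> (\<Sum>P\<in>slice cl \<Lambda> a. 1)" by (rule order_trans[OF sum_abs sum_mono]) (rule assms)
  then show ?thesis unfolding avg_def by (auto simp: divide_le_eq_1)
qed

text \<open>Needed for \<open>p = 1\<close>, where the truncation leaves out \<open>H2\<close>. The
  averages of one and two spins are at most 1 in modulus, so a chain centred at \<open>y\<close>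
  costs at most two row sums of \<open>y\<close>; the factor 2 bounding \<open>1 - e2\<close>
  cancels the 1/2 in front.\<close>

lemma H2_bound:
  fixes e :: real
  assumes \<eta>: "\<eta> \<in> coarse_configs m q" and r: "strict_linear_order_on \<Lambda>' r" and \<beta>: "\<beta> > 0"
    and e: "\<And>x. x \<in> \<Lambda> \<Longrightarrow> (\<Sum>y\<in>\<Lambda>. \<bar>\<beta> * fluct x y\<bar>) \<le> e"
  shows "\<bar>\<beta> * H2 m q r J \<beta> \<eta>\<bar> \<le> card \<Lambda> * e\<^sup>2"
proof -
  interpret pair_block_ensemble \<Lambda> \<Lambda>' cl Q "occ \<Lambda>' \<eta>" fluct by (rule ensemble[OF \<eta>])
  have Cc: "C k = cell m q k" if "k \<in> \<Lambda>'" for k by (simp add: C_def cell_eq[OF m q that])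
  have VW: "local.V k l = W k l" if "k \<in> \<Lambda>'" "l \<in> \<Lambda>'" for k l by (rule V_W[OF \<eta> that])
  have sp: "\<bar>spin P x :: real\<bar> = 1" for P and x :: "real ^ 'd" by (simp add: spin_def)
  have b1: "\<bar>e1 k\<bar> \<le> 1" if kL: "k \<in> \<Lambda>'" for k
  proof -
    have "C k \<noteq> {}" using card_C[OF kL] Q_pos by (metis card.empty not_one_le_zero)
    then obtain x where "x \<in> C k" by blast
    then show ?thesis using av1[OF kL, of x] avg_abs_le[of "occ \<Lambda>' \<eta>" "\<lambda>P. spin P x"] sp by simp
  qed
  \<comment> \<open>For \<open>Q = 1\<close> there are no two distinct sites to average over, and
    \<open>E2\<close> is the quotient by 0, that is 0.\<close>
  have b2: "\<bar>e2 k\<bar> \<le> 1" if kL: "k \<in> \<Lambda>'" for k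
  proof (cases "Q = 1")
    case True
    then have "real Q * (real Q - 1) = 0" by simp
    then have "e2 k = 0" unfolding e2_def E2_def Let_def by (simp only: div_by_0)
    then show ?thesis by simp
  next
    case False
    then have "card (C k) \<ge> 2" using card_C[OF kL] Q_pos by simp
    then obtain x y where xy: "x \<in> C k" "y \<in> C k" "x \<noteq> y" by (auto simp: card_le_Suc_iff numeral_2_eq_2)
    then show ?thesis using av2[OF kL xy] avg_abs_le[of "occ \<Lambda>' \<eta>" "\<lambda>P. spin P x * spin P y"] sp by (simp add: abs_mult)
  qed
  define N3 where "N3 k j l = (\<Sum>x\<in>cell m q k. \<Sum>y\<in>cell m q j. \<Sum>z\<in>cell m q l. \<bar>fluct x y\<bar> * \<bar>fluct y z\<bar>)" for k j l
  have N30: "N3 k j l \<ge> 0" for k j l unfolding N3_def by (intro sum_nonneg) auto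
  have T: "\<bar>av (\<lambda>P. W k j P * W j l P)\<bar> \<le> 2 * N3 k j l" if kl: "k \<in> \<Lambda>'" "j \<in> \<Lambda>'" "l \<in> \<Lambda>'" "k \<noteq> j" "l \<noteq> j" "k \<noteq> l" for k j l
  proof -
    have "\<bar>j2_chain k j l\<bar> \<le> N3 k j l"
      unfolding local.j2_chain_def N3_def Cc[OF kl(1)] Cc[OF kl(2)] Cc[OF kl(3)] abs_mult[symmetric]
      by (intro order_trans[OF sum_abs sum_mono] order_refl)
    moreover have "\<bar>e1 k * e1 l * (1 - e2 j)\<bar> \<le> 1 * 1 * 2"
      unfolding abs_mult using b1[OF kl(1)] b1[OF kl(3)] b2[OF kl(2)] by (intro mult_mono) auto
    ultimately have "\<bar>e1 k * e1 l * (1 - e2 j)\<bar> * \<bar>j2_chain k j l\<bar> \<le> 2 * N3 k j l"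
      by (intro mult_mono) auto
    then show ?thesis using av_chain[OF kl] unfolding VW[OF kl(1,2)] VW[OF kl(2,3)] by (simp add: abs_mult)
  qed
  have "\<bar>\<Sum>j\<in>\<Lambda>'. \<Sum>k\<in>\<Lambda>' - {j}. \<Sum>l\<in>\<Lambda>' - {j, k}. av (\<lambda>P. W k j P * W j l P)\<bar>
    \<le> (\<Sum>j\<in>\<Lambda>'. \<Sum>k\<in>\<Lambda>' - {j}. \<Sum>l\<in>\<Lambda>' - {j, k}. 2 * N3 k j l)"
    by (intro order_trans[OF sum_abs sum_mono] T) auto
  also have "\<dots> \<le> (\<Sum>j\<in>\<Lambda>'. \<Sum>k\<in>\<Lambda>'. \<Sum>l\<in>\<Lambda>'. 2 * N3 k j l)"
  proof (rule sum_mono)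
    fix j
    have "(\<Sum>k\<in>\<Lambda>' - {j}. \<Sum>l\<in>\<Lambda>' - {j, k}. 2 * N3 k j l) \<le> (\<Sum>k\<in>\<Lambda>' - {j}. \<Sum>l\<in>\<Lambda>'. 2 * N3 k j l)"
      by (intro sum_mono sum_mono2) (auto simp: finite_torus_lattice N30)
    also have "\<dots> \<le> (\<Sum>k\<in>\<Lambda>'. \<Sum>l\<in>\<Lambda>'. 2 * N3 k j l)"
      by (intro sum_mono2) (auto simp: finite_torus_lattice N30 intro!: sum_nonneg)
    finally show "(\<Sum>k\<in>\<Lambda>' - {j}. \<Sum>l\<in>\<Lambda>' - {j, k}. 2 * N3 k j l) \<le> (\<Sum>k\<in>\<Lambda>'. \<Sum>l\<in>\<Lambda>'. 2 * N3 k j l)" .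
  qed
  also have "\<dots> = 2 * (\<Sum>j\<in>\<Lambda>'. \<Sum>k\<in>\<Lambda>'. \<Sum>l\<in>\<Lambda>'. N3 k j l)" by (simp only: sum_distrib_left)
  also have "(\<Sum>j\<in>\<Lambda>'. \<Sum>k\<in>\<Lambda>'. \<Sum>l\<in>\<Lambda>'. N3 k j l) = (\<Sum>y\<in>\<Lambda>. (\<Sum>x\<in>\<Lambda>. \<bar>fluct y x\<bar>) * (\<Sum>z\<in>\<Lambda>. \<bar>fluct y z\<bar>))"
  proof -
    have "(\<Sum>k\<in>\<Lambda>'. \<Sum>l\<in>\<Lambda>'. N3 k j l) = (\<Sum>y\<in>cell m q j. (\<Sum>x\<in>\<Lambda>. \<bar>fluct y x\<bar>) * (\<Sum>z\<in>\<Lambda>. \<bar>fluct y z\<bar>))" for j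
    proof -
      have "(\<Sum>k\<in>\<Lambda>'. \<Sum>l\<in>\<Lambda>'. N3 k j l) = (\<Sum>k\<in>\<Lambda>'. \<Sum>x\<in>cell m q k. \<Sum>y\<in>cell m q j. \<Sum>l\<in>\<Lambda>'. \<Sum>z\<in>cell m q l. \<bar>fluct x y\<bar> * \<bar>fluct y z\<bar>)"
        unfolding N3_def by (rule sum.cong[OF refl], subst sum.swap, rule sum.cong[OF refl], rule sum.swap)
      also have "\<dots> = (\<Sum>x\<in>\<Lambda>. \<Sum>y\<in>cell m q j. \<Sum>z\<in>\<Lambda>. \<bar>fluct x y\<bar> * \<bar>fluct y z\<bar>)" by (simp only: sum_cells)
      also have "\<dots> = (\<Sum>y\<in>cell m q j. \<Sum>x\<in>\<Lambda>. \<Sum>z\<in>\<Lambda>. \<bar>fluct x y\<bar> * \<bar>fluct y z\<bar>)" by (rule sum.swap)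
      also have "\<dots> = (\<Sum>y\<in>cell m q j. (\<Sum>x\<in>\<Lambda>. \<bar>fluct y x\<bar>) * (\<Sum>z\<in>\<Lambda>. \<bar>fluct y z\<bar>))"
        unfolding sum_product by (intro sum.cong refl) (simp add: fluct_sym)
      finally show ?thesis .
    qed
    then show ?thesis by (simp add: sum_cells[of "\<lambda>y. (\<Sum>x\<in>\<Lambda>. \<bar>fluct y x\<bar>) * (\<Sum>z\<in>\<Lambda>. \<bar>fluct y z\<bar>)"])
  qed
  finally have A: "\<bar>\<Sum>j\<in>\<Lambda>'. \<Sum>k\<in>\<Lambda>' - {j}. \<Sum>l\<in>\<Lambda>' - {j, k}. av (\<lambda>P. W k j P * W j l P)\<bar>
    \<le> 2 * (\<Sum>y\<in>\<Lambda>. (\<Sum>x\<in>\<Lambda>. \<bar>fluct y x\<bar>) * (\<Sum>z\<in>\<Lambda>. \<bar>fluct y z\<bar>))" .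
  have "\<bar>\<beta> * H2 m q r J \<beta> \<eta>\<bar> = \<beta>\<^sup>2 / 2 * \<bar>\<Sum>j\<in>\<Lambda>'. \<Sum>k\<in>\<Lambda>' - {j}. \<Sum>l\<in>\<Lambda>' - {j, k}. av (\<lambda>P. W k j P * W j l P)\<bar>"
    unfolding H2_eq[OF \<eta> r] sum_triple_term using \<beta> by (simp add: abs_mult power2_eq_square)
  also have "\<dots> \<le> \<beta>\<^sup>2 / 2 * (2 * (\<Sum>y\<in>\<Lambda>. (\<Sum>x\<in>\<Lambda>. \<bar>fluct y x\<bar>) * (\<Sum>z\<in>\<Lambda>. \<bar>fluct y z\<bar>)))"
    by (intro mult_left_mono A) simp
  also have "\<dots> = (\<Sum>y\<in>\<Lambda>. (\<Sum>x\<in>\<Lambda>. \<bar>\<beta> * fluct y x\<bar>) * (\<Sum>z\<in>\<Lambda>. \<bar>\<beta> * fluct y z\<bar>))"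
  proof -
    have "(\<Sum>x\<in>\<Lambda>. \<bar>\<beta> * fluct y x\<bar>) = \<beta> * (\<Sum>x\<in>\<Lambda>. \<bar>fluct y x\<bar>)" for y
      using \<beta> by (simp add: abs_mult sum_distrib_left)
    then show ?thesis by (simp add: sum_distrib_left power2_eq_square mult_ac)
  qed
  also have "\<dots> \<le> (\<Sum>y\<in>\<Lambda>. e * e)"
  proof (rule sum_mono)
    fix y assume y: "y \<in> \<Lambda>"
    have 0: "0 \<le> (\<Sum>x\<in>\<Lambda>. \<bar>\<beta> * fluct y x\<bar>)" by (intro sum_nonneg) auto
    then show "(\<Sum>x\<in>\<Lambda>. \<bar>\<beta> * fluct y x\<bar>) * (\<Sum>z\<in>\<Lambda>. \<bar>\<beta> * fluct y z\<bar>) \<le> e * e"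
      using e[OF y] order_trans[OF 0 e[OF y]] by (intro mult_mono)
  qed
  also have "\<dots> = card \<Lambda> * e\<^sup>2" by (simp add: power2_eq_square)
  finally show ?thesis .
qed

subsection \<open>Error bounds and relative entropy\<close>

lemma block_spin_micro:
  assumes "\<sigma> \<in> micro"
  shows "block_spin m q \<sigma> \<in> coarse_configs m q"
proof -
  obtain P where P: "P \<subseteq> \<Lambda>" "\<sigma> = conf P"
    using assms bij_betw_imp_surj_on[OF conf_bij] by (metis PowD imageE)
  have "block_spin m q \<sigma> k \<in> {2 * real j - real Q | j. j \<le> Q}" if k: "k \<in> \<Lambda>'" for k
  proof -
    have "{x\<in>P. cl x = k} \<subseteq> cell m q k" using P(1) cell_corner[OF k] by auto
    then have "card {x\<in>P. cl x = k} \<le> Q" using card_mono[OF finite_cell] card_cell'[OF k] by metis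
    then show ?thesis using block_spin_conf[OF P(1) k] P(2) by blast
  qed
  moreover have "block_spin m q \<sigma> k = undefined" if "k \<notin> \<Lambda>'" for k using that by (simp add: block_spin_def)
  ultimately show ?thesis unfolding coarse_configs_def Q_def[symmetric] by (auto simp: PiE_iff extensional_def)
qed

lemma set_coarse_prior: "set_pmf (coarse_prior m q :: (real ^ 'd \<Rightarrow> real) pmf) \<subseteq> coarse_configs m q" "finite (set_pmf (coarse_prior m q :: (real ^ 'd \<Rightarrow> real) pmf))"
proof -
  have "set_pmf (coarse_prior m q :: (real ^ 'd \<Rightarrow> real) pmf) = block_spin m q ` micro"
    unfolding coarse_prior_def prior_eq using micro_ne finite_micro by simp
  then show "set_pmf (coarse_prior m q :: (real ^ 'd \<Rightarrow> real) pmf) \<subseteq> coarse_configs m q" "finite (set_pmf (coarse_prior m q :: (real ^ 'd \<Rightarrow> real) pmf))"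
    using block_spin_micro finite_micro by auto
qed

lemma pmf_block_spin:
  assumes "set_pmf p \<subseteq> micro"
  shows "pmf (map_pmf (block_spin m q) p) \<eta> = (\<Sum>\<sigma>\<in>micro \<inter> {\<sigma>. block_spin m q \<sigma> = \<eta>}. pmf p \<sigma>)"
proof -
  have "pmf (map_pmf (block_spin m q) p) \<eta> = measure p (block_spin m q -` {\<eta>})" by (rule pmf_map)
  also have "\<dots> = measure p (block_spin m q -` {\<eta>} \<inter> set_pmf p)" by (simp add: measure_Int_set_pmf)
  also have "block_spin m q -` {\<eta>} \<inter> set_pmf p = (micro \<inter> {\<sigma>. block_spin m q \<sigma> = \<eta>}) \<inter> set_pmf p"
    using assms by auto
  also have "measure p \<dots> = measure p (micro \<inter> {\<sigma>. block_spin m q \<sigma> = \<eta>})" by (simp add: measure_Int_set_pmf)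
  also have "\<dots> = (\<Sum>\<sigma>\<in>micro \<inter> {\<sigma>. block_spin m q \<sigma> = \<eta>}. pmf p \<sigma>)"
    by (rule measure_measure_pmf_finite) (simp add: finite_micro)
  finally show ?thesis .
qed

text \<open>Summing the microscopic weights over a fibre of the block spin map gives its prior mass
  times the conditional expectation of the Boltzmann factor, which is the exponential of the exact
  coarse energy. Off the image of the lattice configurations both sides are 0.\<close>

lemma pmf_coarse_gibbs:
  fixes H :: "(real ^ 'd \<Rightarrow> real) \<Rightarrow> real"
  assumes \<beta>: "\<beta> > 0"
  obtains Z where "Z > 0" and "\<And>\<eta>. pmf (map_pmf (block_spin m q) (gibbs (prior (m * q)) \<beta> H)) \<eta>
     = exp (- (\<beta> * coarse_hamiltonian m q \<beta> H \<eta>)) * pmf (coarse_prior m q) \<eta> / Z"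
proof -
  define Z where "Z = measure_pmf.expectation (prior (m * q)) (\<lambda>\<sigma>. exp (- \<beta> * H \<sigma>))"
  have fin: "finite (set_pmf (prior (m * q) :: (real ^ 'd \<Rightarrow> real) pmf))"
    unfolding prior_eq using micro_ne finite_micro by simp
  have c: "card micro > 0" using micro_ne finite_micro by (simp add: card_gt_0_iff)
  have Z: "Z > 0"
    unfolding Z_def prior_eq using micro_ne finite_micro c
    by (simp add: integral_pmf_of_set) (intro divide_pos_pos sum_pos; simp)
  have pg: "pmf (gibbs (prior (m * q)) \<beta> H) \<sigma> = exp (- \<beta> * H \<sigma>) * pmf (prior (m * q)) \<sigma> / Z" for \<sigma>
    unfolding Z_def by (rule pmf_gibbs[OF fin])
  have sub: "set_pmf (gibbs (prior (m * q)) \<beta> H) \<subseteq> micro"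
    using pg micro_ne finite_micro by (auto simp: set_pmf_iff prior_eq indicator_def split: if_splits)
  have sub': "set_pmf (prior (m * q) :: (real ^ 'd \<Rightarrow> real) pmf) \<subseteq> micro"
    unfolding prior_eq using micro_ne finite_micro by simp
  have "pmf (map_pmf (block_spin m q) (gibbs (prior (m * q)) \<beta> H)) \<eta>
     = exp (- (\<beta> * coarse_hamiltonian m q \<beta> H \<eta>)) * pmf (coarse_prior m q) \<eta> / Z" for \<eta>
  proof -
    let ?A = "micro \<inter> {\<sigma>. block_spin m q \<sigma> = \<eta>}"
    have pr: "pmf (prior (m * q)) \<sigma> = 1 / card micro" if "\<sigma> \<in> ?A" for \<sigma>
      using that micro_ne finite_micro by (simp add: prior_eq)
    have P0: "pmf (coarse_prior m q) \<eta> = card ?A / card micro"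
      unfolding coarse_prior_def pmf_block_spin[OF sub'] by (simp add: pr)
    have L: "pmf (map_pmf (block_spin m q) (gibbs (prior (m * q)) \<beta> H)) \<eta> = (\<Sum>\<sigma>\<in>?A. exp (- \<beta> * H \<sigma>)) / card micro / Z"
      unfolding pmf_block_spin[OF sub] by (simp add: pg pr sum_divide_distrib)
    show ?thesis
    proof (cases "?A = {}")
      case True
      then show ?thesis unfolding L P0 by simp
    next
      case False
      then have \<eta>: "\<eta> \<in> coarse_configs m q" using block_spin_micro by auto
      have cA: "card ?A > 0" using False finite_micro by (simp add: card_gt_0_iff)
      have "cond_expect m q (\<lambda>\<sigma>. exp (- \<beta> * H \<sigma>)) \<eta> = (\<Sum>\<sigma>\<in>?A. exp (- \<beta> * H \<sigma>)) / card ?A"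
        by (rule cond_expect_sum(1)[OF \<eta>])
      moreover from this have "cond_expect m q (\<lambda>\<sigma>. exp (- \<beta> * H \<sigma>)) \<eta> > 0"
        using False cA finite_micro by (auto intro!: divide_pos_pos sum_pos)
      ultimately have "exp (- (\<beta> * coarse_hamiltonian m q \<beta> H \<eta>)) = (\<Sum>\<sigma>\<in>?A. exp (- \<beta> * H \<sigma>)) / card ?A"
        unfolding coarse_hamiltonian_def using \<beta> by simp
      then show ?thesis unfolding L P0 using cA by simp
    qed
  qed
  then show ?thesis using that Z by blast
qed

definition mu :: "real \<Rightarrow> (real ^ 'd \<Rightarrow> real) \<Rightarrow> nat \<Rightarrow> real" where
  "mu \<beta> \<eta> n = avg cl \<Lambda> (occ \<Lambda>' \<eta>) (\<lambda>P. pair_energy (\<lambda>x y. \<beta> * fluct x y) \<Lambda> P ^ n)"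

lemma kappa_rec:
  assumes "\<eta> \<in> coarse_configs m q"
  shows "mu \<beta> \<eta> (Suc n) = (\<Sum>i\<le>n. of_nat (n choose i) * kappa \<beta> \<eta> (Suc i) * mu \<beta> \<eta> (n - i))" "mu \<beta> \<eta> 0 = 1"
proof -
  interpret pair_block_ensemble \<Lambda> \<Lambda>' cl Q "occ \<Lambda>' \<eta>" fluct by (rule ensemble[OF assms])
  show 0: "mu \<beta> \<eta> 0 = 1" using av_one by (simp add: mu_def)
  show "mu \<beta> \<eta> (Suc n) = (\<Sum>i\<le>n. of_nat (n choose i) * kappa \<beta> \<eta> (Suc i) * mu \<beta> \<eta> (n - i))"
    using cumulant_recursion[where \<mu> = "mu \<beta> \<eta>" and n = n, OF 0] unfolding kappa_def mu_def[abs_def] .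
qed

lemma kappa_1:
  assumes "\<eta> \<in> coarse_configs m q"
  shows "kappa \<beta> \<eta> 1 = 0"
proof -
  have "pair_energy (\<lambda>x y. \<beta> * fluct x y) \<Lambda> P = \<beta> * pair_energy fluct \<Lambda> P" for P
    by (simp add: pair_energy_def sum_distrib_left mult.assoc)
  then have "mu \<beta> \<eta> 1 = \<beta> * avg cl \<Lambda> (occ \<Lambda>' \<eta>) (pair_energy fluct \<Lambda>)"
    by (simp add: mu_def avg_scale)
  then show ?thesis
    using kappa_rec(1)[OF assms, of \<beta> 0] kappa_rec(2)[OF assms, of \<beta>] avg_pair_energy[OF assms] by simp
qed

text \<open>Since \<open>kappa 1 = 0\<close>, the second cumulant is the second moment; its terms
  with at most two cells form \<open>H1\<close> and those with three distinct cells form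
  \<open>H2\<close>.\<close>

lemma kappa_2:
  assumes \<eta>: "\<eta> \<in> coarse_configs m q" and r: "strict_linear_order_on \<Lambda>' r" and \<beta>: "\<beta> > 0"
  shows "H1 m q r J \<beta> \<eta> + H2 m q r J \<beta> \<eta> = - kappa \<beta> \<eta> 2 / (2 * \<beta>)"
proof -
  interpret pair_block_ensemble \<Lambda> \<Lambda>' cl Q "occ \<Lambda>' \<eta>" fluct by (rule ensemble[OF \<eta>])
  have VW: "local.V k l = W k l" if "k \<in> \<Lambda>'" "l \<in> \<Lambda>'" for k l by (rule V_W[OF \<eta> that])
  have "kappa \<beta> \<eta> 2 = mu \<beta> \<eta> 2"
    using kappa_rec(1)[OF \<eta>, of \<beta> 1] kappa_rec(2)[OF \<eta>, of \<beta>] kappa_1[OF \<eta>, of \<beta>] by (simp add: numeral_2_eq_2)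
  also have "\<dots> = av (\<lambda>P. (\<beta>\<^sup>2 / 4) * (\<Sum>k\<in>\<Lambda>'. \<Sum>l\<in>\<Lambda>'. W k l P)\<^sup>2)"
  proof -
    have "pair_energy (\<lambda>x y. \<beta> * fluct x y) \<Lambda> P = \<beta> / 2 * (\<Sum>k\<in>\<Lambda>'. \<Sum>l\<in>\<Lambda>'. W k l P)" for P
      unfolding sum_W pair_energy_def by (simp add: sum_distrib_left sum_divide_distrib mult_ac)
    then show ?thesis unfolding mu_def by (simp only: power_mult_distrib) (simp add: power_divide)
  qed
  also have "\<dots> = \<beta>\<^sup>2 / 4 * av (\<lambda>P. (\<Sum>k\<in>\<Lambda>'. \<Sum>l\<in>\<Lambda>'. local.V k l P)\<^sup>2)"
    unfolding avg_scale by (simp add: VW)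
  also have "av (\<lambda>P. (\<Sum>k\<in>\<Lambda>'. \<Sum>l\<in>\<Lambda>'. local.V k l P)\<^sup>2)
     = (\<Sum>k\<in>\<Lambda>'. av (\<lambda>P. W k k P * W k k P)) + 4 * (\<Sum>k\<in>\<Lambda>'. \<Sum>l\<in>\<Lambda>' - {k}. av (\<lambda>P. W k k P * W k l P))
      + 2 * (\<Sum>k\<in>\<Lambda>'. \<Sum>l\<in>\<Lambda>' - {k}. av (\<lambda>P. W k l P * W k l P))
      + 4 * (\<Sum>j\<in>\<Lambda>'. \<Sum>k\<in>\<Lambda>' - {j}. \<Sum>l\<in>\<Lambda>' - {j, k}. av (\<lambda>P. W k j P * W j l P))"
    unfolding second_moment by (simp add: VW)
  finally show ?thesis unfolding H1_eq[OF \<eta> r] H2_eq[OF \<eta> r] sum_pair_term sum_triple_term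
    using \<beta> by (simp add: field_simps power2_eq_square)
qed

definition logZ :: "real \<Rightarrow> (real ^ 'd \<Rightarrow> real) \<Rightarrow> real" where
  "logZ \<beta> \<eta> = ln (avg cl \<Lambda> (occ \<Lambda>' \<eta>) (\<lambda>P. exp (pair_energy (\<lambda>x y. \<beta> * fluct x y) \<Lambda> P)))"

lemma logZ_expansion:
  fixes e :: real
  assumes \<eta>: "\<eta> \<in> coarse_configs m q" and e: "\<And>x. x \<in> \<Lambda> \<Longrightarrow> (\<Sum>y\<in>\<Lambda>. \<bar>\<beta> * fluct x y\<bar>) \<le> e" "0 \<le> e" "e < 1 / 200"
  shows "(\<lambda>j. kappa \<beta> \<eta> (Suc j) / fact (Suc j)) sums logZ \<beta> \<eta>"
    and "\<bar>logZ \<beta> \<eta> - (\<Sum>j<p. kappa \<beta> \<eta> (Suc j) / fact (Suc j))\<bar> \<le> card \<Lambda> * (4 * 100 ^ p * e ^ (p + 1))"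
proof -
  interpret pair_block_ensemble \<Lambda> \<Lambda>' cl Q "occ \<Lambda>' \<eta>" fluct by (rule ensemble[OF \<eta>])
  have exp': "(\<lambda>j. kappa \<beta> \<eta> (Suc j) / fact (Suc j)) sums logZ \<beta> \<eta>"
    "\<bar>logZ \<beta> \<eta> - (\<Sum>j<p. kappa \<beta> \<eta> (Suc j) / fact (Suc j))\<bar> \<le> 4 * card \<Lambda> * e' * (100 * e') ^ p"
    if e': "0 < e'" "e' \<le> 1 / 200" "e \<le> e'" for e' :: real
  proof -
    have le: "(\<Sum>y\<in>\<Lambda>. \<bar>\<beta> * fluct x y\<bar>) \<le> e'" if "x \<in> \<Lambda>" for x using e(1)[OF that] e'(3) by linarith
    have sym: "\<beta> * fluct x y = \<beta> * fluct y x" for x y by (simp add: fluct_sym)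
    have diag: "\<beta> * fluct x x = 0" for x by (simp add: fluct_diag)
    note * = canonical_cumulant_expansion[where \<kappa> = "kappa \<beta> \<eta>", OF finS slice_ne sym diag le e'(1,2) kappa_rec(1)[OF \<eta>, unfolded mu_def]]
    show "(\<lambda>j. kappa \<beta> \<eta> (Suc j) / fact (Suc j)) sums logZ \<beta> \<eta>" unfolding logZ_def by (rule *(1))
    show "\<bar>logZ \<beta> \<eta> - (\<Sum>j<p. kappa \<beta> \<eta> (Suc j) / fact (Suc j))\<bar> \<le> 4 * card \<Lambda> * e' * (100 * e') ^ p"
      unfolding logZ_def by (rule *(2))
  qed
  show "(\<lambda>j. kappa \<beta> \<eta> (Suc j) / fact (Suc j)) sums logZ \<beta> \<eta>" by (rule exp'(1)[of "1 / 200"]) (use e in auto)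
  \<comment> \<open>The expansion was proved for positive row bounds, but \<open>e\<close> is 0 when
    the potential vanishes. The bound for \<open>e\<close> follows by letting \<open>e'\<close>
    decrease to \<open>e\<close>, which also explains the strict inequality
    \<open>e < 1 / 200\<close>.\<close>
  let ?f = "\<lambda>e' :: real. 4 * card \<Lambda> * e' * (100 * e') ^ p"
  have "\<bar>logZ \<beta> \<eta> - (\<Sum>j<p. kappa \<beta> \<eta> (Suc j) / fact (Suc j))\<bar> \<le> ?f e"
  proof (rule tendsto_lowerbound)
    show "(?f \<longlongrightarrow> ?f e) (at_right e)" by (intro tendsto_intros)
    show "\<forall>\<^sub>F e' in at_right e. \<bar>logZ \<beta> \<eta> - (\<Sum>j<p. kappa \<beta> \<eta> (Suc j) / fact (Suc j))\<bar> \<le> ?f e'"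
      unfolding eventually_at_right_field
      by (rule exI[of _ "1 / 200"]) (use e exp'(2) in \<open>auto simp del: fact_Suc\<close>)
  qed simp
  then show "\<bar>logZ \<beta> \<eta> - (\<Sum>j<p. kappa \<beta> \<eta> (Suc j) / fact (Suc j))\<bar> \<le> card \<Lambda> * (4 * 100 ^ p * e ^ (p + 1))"
    by (simp add: power_mult_distrib mult_ac del: fact_Suc)
qed

text \<open>The cumulant series, except that the second cumulant is spread over the indices 1 and 2.
  Index 1 is free for this because the first cumulant vanishes; from \<open>p = 3\<close> on, the
  index is the order of the cumulant.\<close>

definition Hterm :: "(real ^ 'd \<Rightarrow> real) \<Rightarrow> real \<Rightarrow> (real ^ 'd) rel \<Rightarrow> nat \<Rightarrow> (real ^ 'd \<Rightarrow> real) \<Rightarrow> real" where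
  "Hterm h \<beta> r p \<eta> = (if p = 0 then cond_expect m q (hamiltonian (m * q) J h) \<eta>
     else if p = 1 then H1 m q r J \<beta> \<eta> else if p = 2 then H2 m q r J \<beta> \<eta>
     else - kappa \<beta> \<eta> p / (\<beta> * fact p))"

text \<open>The factor \<open>2 p + 3\<close> covers all cases at once: \<open>\<rho>\<close> for
  orders 0 and 1, \<open>2 \<rho>\<close> for the chains in \<open>H2\<close>, and
  \<open>2 p \<rho>\<close> for a connected cluster of \<open>p\<close> edges.\<close>

lemma Hterm_potential:
  assumes r: "strict_linear_order_on \<Lambda>' r" and R: "R = (2 * real p + 3) * \<rho>"
  shows "\<exists>\<Phi>. (\<forall>\<eta>\<in>coarse_configs m q. Hterm h \<beta> r p \<eta> = potential_sum m \<Phi> \<eta>) \<and> finite_range m q R \<Phi> \<and>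
    (p \<ge> 1 \<or> (\<forall>x\<in>\<Lambda>. \<forall>y\<in>\<Lambda>. h x = h y) \<longrightarrow> translation_invariant m q \<Phi>)"
proof -
  have R2: "R \<ge> 2 * real p * \<rho>" "R \<ge> \<rho>" "R \<ge> 2 * \<rho>"
    unfolding R using \<rho>_nonneg mult_nonneg_nonneg[of "real p" \<rho>] by (auto simp: algebra_simps)
  consider "p = 0" | "p = 1" | "p = 2" | "p \<ge> 3" by linarith
  then show ?thesis
  proof cases
    case 1
    then show ?thesis using mean_potential[OF R2(2), of h] by (simp add: Hterm_def)
  next
    case 2
    have "\<exists>\<Phi>. (\<forall>\<eta>\<in>coarse_configs m q. H1 m q r J \<beta> \<eta> = potential_sum m \<Phi> \<eta>) \<and> finite_range m q R \<Phi> \<and> (True \<longrightarrow> translation_invariant m q \<Phi>)"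
      by (rule pair_potential[OF R2(2) H1_eq[OF _ r]])
    then show ?thesis using 2 by (simp add: Hterm_def)
  next
    case 3
    have "\<exists>\<Phi>. (\<forall>\<eta>\<in>coarse_configs m q. H2 m q r J \<beta> \<eta> = potential_sum m \<Phi> \<eta>) \<and> finite_range m q R \<Phi> \<and> (True \<longrightarrow> translation_invariant m q \<Phi>)"
      by (rule triple_potential[OF R2(3) H2_eq[OF _ r]])
    then show ?thesis using 3 by (simp add: Hterm_def)
  next
    case 4
    have "\<exists>\<Phi>. (\<forall>\<eta>\<in>coarse_configs m q. Hterm h \<beta> r p \<eta> = potential_sum m \<Phi> \<eta>) \<and> finite_range m q R \<Phi> \<and> (True \<longrightarrow> translation_invariant m q \<Phi>)"
      by (rule cumulant_potential[where c = "- 1 / (\<beta> * fact p)" and \<beta> = \<beta> and p = p, OF _ R2(1)]) (use 4 in \<open>simp add: Hterm_def\<close>)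
    then show ?thesis by auto
  qed
qed

lemma Hterm_expansion:
  fixes e :: real
  assumes \<eta>: "\<eta> \<in> coarse_configs m q" and h: "\<forall>k\<in>\<Lambda>'. \<forall>x\<in>cell m q k. \<forall>y\<in>cell m q k. h x = h y"
    and r: "strict_linear_order_on \<Lambda>' r" and \<beta>: "\<beta> > 0"
    and e: "\<And>x. x \<in> \<Lambda> \<Longrightarrow> (\<Sum>y\<in>\<Lambda>. \<bar>\<beta> * fluct x y\<bar>) \<le> e" "0 \<le> e" "e < 1 / 200"
  defines "Hbar \<equiv> coarse_hamiltonian m q \<beta> (hamiltonian (m * q) J h) \<eta>"
  shows "(\<lambda>p. Hterm h \<beta> r p \<eta>) sums Hbar"
    and "\<bar>\<beta> * (Hbar - Hterm h \<beta> r 0 \<eta>)\<bar> \<le> card \<Lambda> * (400 * e\<^sup>2)"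
    and "\<bar>\<beta> * (Hbar - (Hterm h \<beta> r 0 \<eta> + Hterm h \<beta> r 1 \<eta>))\<bar> \<le> card \<Lambda> * (40001 * e\<^sup>2)"
    and "p \<ge> 2 \<Longrightarrow> \<bar>\<beta> * (Hbar - (\<Sum>i\<le>p. Hterm h \<beta> r i \<eta>))\<bar> \<le> card \<Lambda> * (4 * 100 ^ p * e ^ (p + 1))"
proof -
  define K where "K = cond_expect m q (hamiltonian (m * q) J h) \<eta>"
  \<comment> \<open>The unmodified cumulant series. It differs from \<open>Hterm\<close> at the
    indices 1 and 2 only, where the sums of two terms agree, so partial sums coincide for
    \<open>p = 0\<close> and from \<open>p = 2\<close> on.\<close>
  define g where "g p = (if p = 0 then K else - kappa \<beta> \<eta> p / (\<beta> * fact p))" for p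
  have Hbar: "Hbar = K - logZ \<beta> \<eta> / \<beta>"
    unfolding Hbar_def K_def logZ_def by (rule coarse_energies[OF \<eta> h \<beta>])
  have H12: "Hterm h \<beta> r 1 \<eta> + Hterm h \<beta> r 2 \<eta> = g 1 + g 2"
    using kappa_2[OF \<eta> r \<beta>] kappa_1[OF \<eta>, of \<beta>] by (simp add: Hterm_def g_def mult.commute)
  have eq: "Hterm h \<beta> r p \<eta> = g p" if "p \<noteq> 1" "p \<noteq> 2" for p
    using that by (simp add: Hterm_def g_def K_def)
  have "(\<lambda>j. kappa \<beta> \<eta> (Suc j) / fact (Suc j) * (- 1 / \<beta>)) sums (logZ \<beta> \<eta> * (- 1 / \<beta>))"
    by (rule sums_mult2[OF logZ_expansion(1)[OF \<eta> e]])
  then have "(\<lambda>j. g (Suc j)) sums (- logZ \<beta> \<eta> / \<beta>)"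
    by (simp add: g_def mult.commute del: fact_Suc)
  then have "g sums Hbar" using sums_Suc_iff[of g "- logZ \<beta> \<eta> / \<beta>"] sums_Suc[of g "- logZ \<beta> \<eta> / \<beta>"] by (simp add: Hbar g_def)
  moreover have "(\<lambda>p. Hterm h \<beta> r p \<eta> - g p) sums (\<Sum>p\<in>{1, 2}. Hterm h \<beta> r p \<eta> - g p)"
    by (rule sums_finite) (use eq in auto)
  ultimately have "(\<lambda>p. g p + (Hterm h \<beta> r p \<eta> - g p)) sums (Hbar + (\<Sum>p\<in>{1, 2}. Hterm h \<beta> r p \<eta> - g p))"
    by (rule sums_add)
  then show "(\<lambda>p. Hterm h \<beta> r p \<eta>) sums Hbar" using H12 by (simp add: algebra_simps)
  have gsum: "(\<Sum>i\<le>p. g i) = K - (\<Sum>j<p. kappa \<beta> \<eta> (Suc j) / fact (Suc j)) / \<beta>" for p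
    by (induction p) (simp_all add: g_def diff_divide_distrib add_divide_distrib del: fact_Suc)
  have rem: "\<bar>\<beta> * (Hbar - (\<Sum>i\<le>p. g i))\<bar> \<le> card \<Lambda> * (4 * 100 ^ p * e ^ (p + 1))" for p
  proof -
    have "\<beta> * (Hbar - (\<Sum>i\<le>p. g i)) = - (logZ \<beta> \<eta> - (\<Sum>j<p. kappa \<beta> \<eta> (Suc j) / fact (Suc j)))"
      unfolding gsum Hbar using \<beta> by (simp add: field_simps del: fact_Suc)
    then show ?thesis using logZ_expansion(2)[OF \<eta> e, of p] by simp
  qed
  have g1: "g 1 = 0" using kappa_1[OF \<eta>, of \<beta>] by (simp add: g_def)
  show 0: "\<bar>\<beta> * (Hbar - Hterm h \<beta> r 0 \<eta>)\<bar> \<le> card \<Lambda> * (400 * e\<^sup>2)"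
    using rem[of 1] g1 eq[of 0] by (simp add: power2_eq_square)
  show *: "\<bar>\<beta> * (Hbar - (\<Sum>i\<le>p. Hterm h \<beta> r i \<eta>))\<bar> \<le> card \<Lambda> * (4 * 100 ^ p * e ^ (p + 1))" if p: "p \<ge> 2" for p
  proof -
    have "(\<Sum>i\<le>p. Hterm h \<beta> r i \<eta> - g i) = (\<Sum>i\<in>{1, 2}. Hterm h \<beta> r i \<eta> - g i)"
      by (rule sum.mono_neutral_right) (use p eq in auto)
    also have "\<dots> = 0" using H12 by simp
    finally have "(\<Sum>i\<le>p. Hterm h \<beta> r i \<eta>) = (\<Sum>i\<le>p. g i)" by (simp add: sum_subtractf)
    then show ?thesis using rem[of p] by simp
  qed
  \<comment> \<open>The truncation at 1 is the truncation at 2 with \<open>H2\<close> restored: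
    40000 is the constant of the latter, with one of its three powers of \<open>e\<close> given
    away, and 1 is the constant of \<open>H2_bound\<close>.\<close>
  show "\<bar>\<beta> * (Hbar - (Hterm h \<beta> r 0 \<eta> + Hterm h \<beta> r 1 \<eta>))\<bar> \<le> card \<Lambda> * (40001 * e\<^sup>2)"
  proof -
    have "\<bar>\<beta> * (Hbar - (\<Sum>i\<le>2. Hterm h \<beta> r i \<eta>))\<bar> \<le> card \<Lambda> * (40000 * e\<^sup>2)"
    proof (rule order_trans[OF *])
      have "e ^ 3 \<le> e\<^sup>2" using e(2,3) by (intro power_decreasing) auto
      then show "real (card \<Lambda>) * (4 * 100 ^ 2 * e ^ (2 + 1)) \<le> card \<Lambda> * (40000 * e\<^sup>2)"
        by (intro mult_left_mono) (auto simp: numeral_3_eq_3)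
    qed simp
    moreover have "\<bar>\<beta> * Hterm h \<beta> r 2 \<eta>\<bar> \<le> card \<Lambda> * e\<^sup>2"
      using H2_bound[OF \<eta> r \<beta> e(1)] by (simp add: Hterm_def)
    moreover have "\<beta> * (Hbar - (Hterm h \<beta> r 0 \<eta> + Hterm h \<beta> r 1 \<eta>))
      = \<beta> * (Hbar - (\<Sum>i\<le>2. Hterm h \<beta> r i \<eta>)) + \<beta> * Hterm h \<beta> r 2 \<eta>"
      by (simp add: numeral_2_eq_2 algebra_simps)
    ultimately show ?thesis by (simp add: algebra_simps)
  qed
qed

lemma entropy_bound:
  fixes H A :: "(real ^ 'd \<Rightarrow> real) \<Rightarrow> real" and t :: real
  assumes \<beta>: "\<beta> > 0" and b: "\<And>\<eta>. \<eta> \<in> coarse_configs m q \<Longrightarrow> \<bar>\<beta> * (coarse_hamiltonian m q \<beta> H \<eta> - A \<eta>)\<bar> \<le> card \<Lambda> * t"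
  shows "\<bar>1 / card \<Lambda> * rel_entropy (gibbs (coarse_prior m q) \<beta> A) (map_pmf (block_spin m q) (gibbs (prior (m * q)) \<beta> H))\<bar> \<le> 2 * t"
proof -
  obtain Z where Z: "Z > 0" "\<And>\<eta>. pmf (map_pmf (block_spin m q) (gibbs (prior (m * q)) \<beta> H)) \<eta>
     = exp (- (\<beta> * coarse_hamiltonian m q \<beta> H \<eta>)) * pmf (coarse_prior m q) \<eta> / Z"
    using pmf_coarse_gibbs[OF \<beta>] by blast
  have N: "card \<Lambda> > 0" using card_torus_lattice[OF mq, where ?'d = 'd] mq by simp
  have "\<bar>rel_entropy (gibbs (coarse_prior m q) \<beta> A) (map_pmf (block_spin m q) (gibbs (prior (m * q)) \<beta> H))\<bar> \<le> 2 * (card \<Lambda> * t)"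
  proof (rule rel_entropy_gibbs_bound[OF set_coarse_prior(2) Z])
    show "\<bar>\<beta> * coarse_hamiltonian m q \<beta> H \<eta> - \<beta> * A \<eta>\<bar> \<le> card \<Lambda> * t" if "\<eta> \<in> set_pmf (coarse_prior m q)" for \<eta>
      using b[of \<eta>] set_coarse_prior(1) that by (auto simp: right_diff_distrib)
  qed
  then show ?thesis using N by (simp add: abs_mult field_simps)
qed

end

section \<open>Error and entropy bounds with constants uniform in all model parameters\<close>

theorem theorem2p4:
  fixes C :: real
  assumes "C > 0"
  shows "\<exists>\<delta>0 > 0. \<exists>K R :: nat \<Rightarrow> real.
    \<forall>(m::nat) (q::nat) (L::real) (\<beta>::real) (V::real \<Rightarrow> real) (V'::real \<Rightarrow> real)
      (h :: real ^ 'd::finite \<Rightarrow> real) (r :: (real ^ 'd) rel).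
    let n = m * q; N = real (n ^ CARD('d)); Q = real (q ^ CARD('d));
        J = kac_potential n L V;
        \<epsilon> = C * \<beta> * (real q / L) * (SUP t\<in>{0..}. \<bar>V' t\<bar>);
        Hn = hamiltonian n J h;
        Hbar = coarse_hamiltonian m q \<beta> Hn;
        \<mu>F = map_pmf (block_spin m q) (gibbs (prior n) \<beta> Hn)
    in
      m \<ge> 1 \<longrightarrow> q \<ge> 1 \<longrightarrow> L > 0 \<longrightarrow> \<beta> > 0 \<longrightarrow>
      (\<forall>t\<ge>0. (V has_real_derivative V' t) (at t within {0..})) \<longrightarrow>
      continuous_on {0..} V' \<longrightarrow> (\<forall>t\<ge>1. V t = 0) \<longrightarrow>
      (\<forall>k\<in>torus_lattice m. \<forall>x\<in>cell m q k. \<forall>y\<in>cell m q k. h x = h y) \<longrightarrow>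
      strict_linear_order_on (torus_lattice m) r \<longrightarrow>
      Q * \<epsilon> < \<delta>0 \<longrightarrow>
      (\<exists>H :: nat \<Rightarrow> (real ^ 'd \<Rightarrow> real) \<Rightarrow> real.
        (\<forall>\<eta>\<in>coarse_configs m q.
           H 0 \<eta> = cond_expect m q Hn \<eta> \<and>
           H 1 \<eta> = H1 m q r J \<beta> \<eta> \<and>
           H 2 \<eta> = H2 m q r J \<beta> \<eta> \<and>
           (\<lambda>p. H p \<eta>) sums Hbar \<eta>) \<and>
        (\<forall>p. \<exists>\<Phi>. (\<forall>\<eta>\<in>coarse_configs m q. H p \<eta> = potential_sum m \<Phi> \<eta>) \<and>
                  finite_range m q (R p * (L + real q) / real n) \<Phi> \<and>
                  (p \<ge> 1 \<or> (\<forall>x\<in>torus_lattice n. \<forall>y\<in>torus_lattice n. h x = h y)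
                    \<longrightarrow> translation_invariant m q \<Phi>)) \<and>
        (\<forall>p. \<forall>\<eta>\<in>coarse_configs m q.
           \<bar>\<beta> / N * (Hbar \<eta> - (\<Sum>i\<le>p. H i \<eta>))\<bar> \<le> K p * \<epsilon> ^ (p + 1)) \<and>
        \<bar>1 / N * rel_entropy (gibbs (coarse_prior m q) \<beta> (H 0)) \<mu>F\<bar> \<le> K 0 * \<epsilon> ^ 2 \<and>
        (\<forall>p\<ge>2. \<bar>1 / N * rel_entropy (gibbs (coarse_prior m q) \<beta> (\<lambda>\<eta>. \<Sum>i\<le>p. H i \<eta>)) \<mu>F\<bar>
                  \<le> K p * \<epsilon> ^ (p + 1)))"
proof -
  \<comment> \<open>\<open>C1\<close> is the geometric constant of \<open>sum_fluct\<close>, and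
    \<open>c\<close> converts the given \<epsilon> into the bound \<open>e = c \<epsilon>\<close> on
    the row sums of \<open>\<beta> * fluct\<close>. With this \<open>\<delta>0\<close>,
    \<open>c * \<delta>0 = 1 / 200\<close>, the threshold of \<open>logZ_expansion\<close>.\<close>
  define C1 where "C1 = 2 * 3 ^ CARD('d) + (3 + 4 * real CARD('d)) ^ CARD('d) * (2 * CARD('d))"
  define c where "c = C1 / C"
  define \<delta>0 where "\<delta>0 = C / (200 * C1)"
  \<comment> \<open>\<open>K 0\<close> must serve the energy error, linear in \<epsilon>, and the
    entropy, quadratic in \<epsilon>; \<open>2 c\<close> is for the first and
    \<open>800 c ^ 2\<close> for the second. For \<open>p >= 2\<close> the energy constant
    \<open>4 * 100 ^ p\<close> is doubled, as the entropy requires.\<close>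
  define K where "K p = (if p = 0 then 2 * c + 800 * c\<^sup>2 else if p = 1 then 40001 * c\<^sup>2 else 8 * 100 ^ p * c ^ (p + 1))" for p :: nat
  define R where "R p = (2 * real p + 3) * (1 + 2 * real CARD('d))" for p :: nat
  have C1: "C1 > 0" unfolding C1_def by (intro add_pos_nonneg) auto
  have c: "c > 0" using C1 assms by (simp add: c_def)
  have \<delta>0: "\<delta>0 > 0" using C1 assms by (simp add: \<delta>0_def)
  show ?thesis
  proof (rule exI[of _ \<delta>0], rule conjI[OF \<delta>0], rule exI[of _ K], rule exI[of _ R], intro allI, unfold Let_def, intro impI)
    fix m q :: nat and L \<beta> :: real and V V' :: "real \<Rightarrow> real" and h :: "real ^ 'd \<Rightarrow> real" and r :: "(real ^ 'd) rel"
    let ?J = "kac_potential (m * q) L V :: real ^ 'd \<Rightarrow> real"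
    let ?G = "SUP t\<in>{0..}. \<bar>V' t\<bar>"
    let ?\<epsilon> = "C * \<beta> * (real q / L) * ?G"
    let ?N = "real ((m * q) ^ CARD('d))"
    assume mqL: "1 \<le> m" "1 \<le> q" "0 < L" and \<beta>: "0 < \<beta>"
      and V: "\<forall>t\<ge>0. (V has_real_derivative V' t) (at t within {0..})" "continuous_on {0..} V'" "\<forall>t\<ge>1. V t = 0"
      and h: "\<forall>k\<in>torus_lattice m. \<forall>x\<in>cell m q k. \<forall>y\<in>cell m q k. h x = h y"
      and r: "strict_linear_order_on (torus_lattice m) r"
      and small: "real (q ^ CARD('d)) * ?\<epsilon> < \<delta>0"
    interpret kac_model m q L V V' ?J "q ^ CARD('d)" ?G "?G / L ^ CARD('d) * (2 * CARD('d) * (q / L))"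
      "(1 + 2 * CARD('d)) * (L + q) / real (m * q)"
      by unfold_locales (use mqL V in auto)
    have \<epsilon>0: "?\<epsilon> \<ge> 0" using assms \<beta> mqL G_nonneg by simp
    \<comment> \<open>A cell has at least one site, so the smallness of \<open>Q \<epsilon>\<close>
      passes on to \<epsilon>, the quantity that measures row sums.\<close>
    have "?\<epsilon> \<le> real (q ^ CARD('d)) * ?\<epsilon>"
    proof -
      have "1 \<le> real (q ^ CARD('d))" using Q_pos by linarith
      then show ?thesis using mult_right_mono[OF _ \<epsilon>0] by fastforce
    qed
    then have \<epsilon>s: "?\<epsilon> < \<delta>0" using small by linarith
    define e where "e = c * ?\<epsilon>"
    have e0: "0 \<le> e" unfolding e_def by (rule mult_nonneg_nonneg[OF less_imp_le[OF c] \<epsilon>0])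
    have e1: "e < 1 / 200"
    proof -
      have "e < c * \<delta>0" unfolding e_def using c \<epsilon>s by (intro mult_strict_left_mono) auto
      also have "c * \<delta>0 = 1 / 200" using C1 assms by (simp add: c_def \<delta>0_def)
      finally show ?thesis .
    qed
    have e: "(\<Sum>y\<in>\<Lambda>. \<bar>\<beta> * fluct x y\<bar>) \<le> e" if "x \<in> \<Lambda>" for x
    proof -
      have "(\<Sum>y\<in>\<Lambda>. \<bar>\<beta> * fluct x y\<bar>) = \<beta> * (\<Sum>y\<in>\<Lambda>. \<bar>fluct x y\<bar>)" using \<beta> by (simp add: abs_mult sum_distrib_left)
      also have "\<dots> \<le> \<beta> * (C1 * ((q / L) * ?G))"
        unfolding C1_def using \<beta> sum_fluct[OF that] by (intro mult_left_mono) auto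
      also have "\<dots> = e" using assms by (simp add: e_def c_def)
      finally show ?thesis .
    qed
    have N: "real (card \<Lambda>) = ?N" using card_torus_lattice[OF mq, where ?'d = 'd] by simp
    have Npos: "?N > 0" using mq by simp
    define H where "H = Hterm h \<beta> r"
    let ?Hn = "hamiltonian (m * q) ?J h"
    let ?Hbar = "coarse_hamiltonian m q \<beta> ?Hn"
    have ep: "e ^ p = c ^ p * ?\<epsilon> ^ p" for p unfolding e_def by (rule power_mult_distrib)
    have err: "\<bar>\<beta> / ?N * (?Hbar \<eta> - F)\<bar> \<le> t" if "\<bar>\<beta> * (?Hbar \<eta> - F)\<bar> \<le> card \<Lambda> * t" for \<eta> F and t :: real
    proof -
      have "\<bar>\<beta> / ?N * (?Hbar \<eta> - F)\<bar> = \<bar>\<beta> * (?Hbar \<eta> - F)\<bar> / ?N" using Npos by (simp add: abs_mult)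
      then show ?thesis using that Npos unfolding N by (simp add: divide_le_eq mult.commute)
    qed
    note X = Hterm_expansion[OF _ h r \<beta> e e0 e1]
    have err0: "\<bar>\<beta> * (?Hbar \<eta> - H 0 \<eta>)\<bar> \<le> card \<Lambda> * (400 * e\<^sup>2)" if "\<eta> \<in> coarse_configs m q" for \<eta>
      unfolding H_def by (rule X(2)[OF that])
    have errp: "\<bar>\<beta> * (?Hbar \<eta> - (\<Sum>i\<le>p. H i \<eta>))\<bar> \<le> card \<Lambda> * (4 * 100 ^ p * e ^ (p + 1))"
      if "\<eta> \<in> coarse_configs m q" "p \<ge> 2" for \<eta> p
      unfolding H_def by (rule X(4)[OF that(1) _ that(2)])
    have Kp: "2 * (4 * 100 ^ p * e ^ (p + 1)) = K p * ?\<epsilon> ^ (p + 1)" if "p \<ge> 2" for p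
      using that unfolding ep K_def by simp
    show "\<exists>H :: nat \<Rightarrow> (real ^ 'd \<Rightarrow> real) \<Rightarrow> real.
        (\<forall>\<eta>\<in>coarse_configs m q.
           H 0 \<eta> = cond_expect m q ?Hn \<eta> \<and>
           H 1 \<eta> = H1 m q r ?J \<beta> \<eta> \<and>
           H 2 \<eta> = H2 m q r ?J \<beta> \<eta> \<and>
           (\<lambda>p. H p \<eta>) sums ?Hbar \<eta>) \<and>
        (\<forall>p. \<exists>\<Phi>. (\<forall>\<eta>\<in>coarse_configs m q. H p \<eta> = potential_sum m \<Phi> \<eta>) \<and>
                  finite_range m q (R p * (L + real q) / real (m * q)) \<Phi> \<and>
                  (p \<ge> 1 \<or> (\<forall>x\<in>torus_lattice (m * q). \<forall>y\<in>torus_lattice (m * q). h x = h y)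
                    \<longrightarrow> translation_invariant m q \<Phi>)) \<and>
        (\<forall>p. \<forall>\<eta>\<in>coarse_configs m q.
           \<bar>\<beta> / ?N * (?Hbar \<eta> - (\<Sum>i\<le>p. H i \<eta>))\<bar> \<le> K p * ?\<epsilon> ^ (p + 1)) \<and>
        \<bar>1 / ?N * rel_entropy (gibbs (coarse_prior m q) \<beta> (H 0)) (map_pmf (block_spin m q) (gibbs (prior (m * q)) \<beta> ?Hn))\<bar> \<le> K 0 * ?\<epsilon> ^ 2 \<and>
        (\<forall>p\<ge>2. \<bar>1 / ?N * rel_entropy (gibbs (coarse_prior m q) \<beta> (\<lambda>\<eta>. \<Sum>i\<le>p. H i \<eta>)) (map_pmf (block_spin m q) (gibbs (prior (m * q)) \<beta> ?Hn))\<bar>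
                  \<le> K p * ?\<epsilon> ^ (p + 1))"
    proof (rule exI[of _ H], intro conjI allI ballI impI)
      fix \<eta> :: "real ^ 'd \<Rightarrow> real" assume \<eta>: "\<eta> \<in> coarse_configs m q"
      show "H 0 \<eta> = cond_expect m q ?Hn \<eta>" "H 1 \<eta> = H1 m q r ?J \<beta> \<eta>" "H 2 \<eta> = H2 m q r ?J \<beta> \<eta>"
        by (simp_all add: H_def Hterm_def)
      show "(\<lambda>p. H p \<eta>) sums ?Hbar \<eta>" unfolding H_def by (rule X(1)[OF \<eta>])
      fix p
      show "\<bar>\<beta> / ?N * (?Hbar \<eta> - (\<Sum>i\<le>p. H i \<eta>))\<bar> \<le> K p * ?\<epsilon> ^ (p + 1)"
      proof -
        consider "p = 0" | "p = 1" | "p \<ge> 2" by linarith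
        then show ?thesis
        proof cases
          case 1
          \<comment> \<open>The remainder after \<open>H 0\<close> is of second order because the
            first cumulant vanishes. Since \<open>e < 1 / 200\<close>, one power of \<open>e\<close>
            is exchanged for the constant 2 to obtain the first-order bound.\<close>
          have "400 * e\<^sup>2 \<le> 2 * e"
            unfolding power2_eq_square using mult_right_mono[of "400 * e" 2 e] e0 e1 by simp
          also have "\<dots> \<le> K 0 * ?\<epsilon>"
          proof -
            have "2 * c * ?\<epsilon> \<le> (2 * c + 800 * c\<^sup>2) * ?\<epsilon>" by (intro mult_right_mono \<epsilon>0) simp
            then show ?thesis unfolding e_def K_def if_P[OF refl] by (simp only: mult.assoc)
          qed
          finally show ?thesis using err[OF err0[OF \<eta>]] 1 by simp
        next
          case 2
          have "\<bar>\<beta> / ?N * (?Hbar \<eta> - (H 0 \<eta> + H 1 \<eta>))\<bar> \<le> 40001 * e\<^sup>2"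
            unfolding H_def by (rule err[OF X(3)[OF \<eta>]])
          then show ?thesis using 2 unfolding ep K_def by (simp add: power2_eq_square)
        next
          case 3
          have "4 * 100 ^ p * e ^ (p + 1) \<le> 2 * (4 * 100 ^ p * e ^ (p + 1))" using e0 by simp
          then show ?thesis using err[OF errp[OF \<eta> 3]] Kp[OF 3] by linarith
        qed
      qed
    next
      fix p
      have "R p * (L + real q) / real (m * q) = (2 * real p + 3) * ((1 + 2 * CARD('d)) * (L + q) / real (m * q))"
        by (simp add: R_def)
      then show "\<exists>\<Phi>. (\<forall>\<eta>\<in>coarse_configs m q. H p \<eta> = potential_sum m \<Phi> \<eta>) \<and>
                  finite_range m q (R p * (L + real q) / real (m * q)) \<Phi> \<and>
                  (p \<ge> 1 \<or> (\<forall>x\<in>torus_lattice (m * q). \<forall>y\<in>torus_lattice (m * q). h x = h y)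
                    \<longrightarrow> translation_invariant m q \<Phi>)"
        unfolding H_def by (rule Hterm_potential[OF r])
    next
      have "\<bar>1 / ?N * rel_entropy (gibbs (coarse_prior m q) \<beta> (H 0)) (map_pmf (block_spin m q) (gibbs (prior (m * q)) \<beta> ?Hn))\<bar> \<le> 2 * (400 * e\<^sup>2)"
        unfolding N[symmetric] by (rule entropy_bound[OF \<beta> err0])
      also have "\<dots> \<le> K 0 * ?\<epsilon> ^ 2"
      proof -
        have "800 * c\<^sup>2 * ?\<epsilon>\<^sup>2 \<le> (2 * c + 800 * c\<^sup>2) * ?\<epsilon>\<^sup>2" using c by (intro mult_right_mono) auto
        then show ?thesis unfolding ep K_def if_P[OF refl] by (simp only: mult.assoc mult_numeral_left(1)) simp
      qed
      finally show "\<bar>1 / ?N * rel_entropy (gibbs (coarse_prior m q) \<beta> (H 0)) (map_pmf (block_spin m q) (gibbs (prior (m * q)) \<beta> ?Hn))\<bar> \<le> K 0 * ?\<epsilon> ^ 2" .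
    next
      fix p :: nat assume p: "2 \<le> p"
      show "\<bar>1 / ?N * rel_entropy (gibbs (coarse_prior m q) \<beta> (\<lambda>\<eta>. \<Sum>i\<le>p. H i \<eta>)) (map_pmf (block_spin m q) (gibbs (prior (m * q)) \<beta> ?Hn))\<bar>
                  \<le> K p * ?\<epsilon> ^ (p + 1)"
        unfolding N[symmetric] Kp[OF p, symmetric] by (rule entropy_bound[OF \<beta> errp[OF _ p]])
    qed
  qed
qed

end
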